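(* Let $\mathfrak{g}=\mathfrak{sl}_2(\mathbb{C})$ and let $\mathfrak{s}=\mathfrak{g}\ltimes\mathfrak{H}$ be the Schrödinger Lie algebra. Let $V$ be a simple $\mathfrak{g}$-Harish-Chandra module for $\mathfrak{s}$. Denote by $\lambda_2$ its central charge, and suppose that $L(n)$, $n\in\mathbb{Z}_{\ge 0}$, is the minimal $\mathfrak{g}$-type of $V$. (i) If $\lambda_2\neq 0$, then $V\cong V(n,\lambda_2)\cong V(-n,\lambda_2)$. (ii) If $\lambda_2=0$, then $V\cong L(n)$ with the trivial $\mathfrak{H}$-action. In other words, the modules $V(n,\lambda_2)$, $n\in\mathbb{Z}_{\ge 0}$, $\lambda_2\in\mathbb{C}\setminus\{0\}$, together with the finite-dimensional simple $\mathfrak{g}$-modules (with trivial $\mathfrak{H}$-action), constitute a complete list of pairwise non-isomorphic simple $\mathfrak{g}$-Harish-Chandra modules for $\mathfrak{s}$.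
   Context: Everything is over $\mathbb{C}$. The Schrödinger Lie algebra $\mathfrak{s}$ has basis $\{e,h,f,p,q,z\}$, where $e,h,f$ satisfy the usual relations of $\mathfrak{g}=\mathfrak{sl}_2$, $z$ is central, and $[e,p]=0$, $[h,p]=p$, $[f,p]=q$, $[e,q]=p$, $[h,q]=-q$, $[f,q]=0$, $[p,q]=z$. $\mathfrak{H}=\mathrm{span}\{p,q,z\}$ is an ideal and $\mathfrak{s}=\mathfrak{g}\ltimes\mathfrak{H}$. $L(n)$ is the simple $\mathfrak{g}$-module of dimension $n+1$. An $\mathfrak{s}$-module is a $\mathfrak{g}$-Harish-Chandra module if its restriction to $\mathfrak{g}$ is a direct sum of simple finite-dimensional $\mathfrak{g}$-modules, each isomorphism class occurring with finite multiplicity. The simple $\mathfrak{g}$-submodules are its $\mathfrak{g}$-types; the minimal $\mathfrak{g}$-type is the $L(n)$ occurring with the smallest $n$. The central charge of a module is the scalar by which $z$ acts. Verma modules: for $(\lambda_1,\lambda_2)\in\mathbb{C}^2$, $\Delta(\lambda_1,\lambda_2)=U(\mathfrak{s})\otimes_{U(\tilde{\mathfrak{b}})}\mathbb{C}_\lambda$, where $\tilde{\mathfrak{b}}=\mathrm{span}\{h,z,e,p\}$ and on the one-dimensional module $\mathbb{C}_\lambda$ the elements $e,p$ act by $0$, $h$ by $\lambda_1$, $z$ by $\lambda_2$. Completion functor: let $U=U(\mathfrak{s})$, let $U_{(f)}$ be the Ore localization of $U$ at the powers of $f$, and $S_f:=U_{(f)}/U$, a $U$-$U$-bimodule. For an $\mathfrak{s}$-module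 $M$, $\mathbf{EA}(M)$ is the submodule of $S_f\otimes_U M$ consisting of all $m$ with $\dim\mathbb{C}[e]m<\infty$. For $n\in\mathbb{Z}$ and $\lambda_2\neq 0$: $V(n,\lambda_2):=\mathbf{EA}(\Delta(n-1,\lambda_2))$ if $n\ge 0$ and $V(n,\lambda_2):=\mathbf{EA}(\Delta(n-2,\lambda_2))$ if $n\le 0$; for $n=0$ the two definitions agree up to isomorphism. *)

theory Defs
  imports
    Complex_Main
    "HOL-Library.Poly_Mapping"
    "HOL-Library.Set_Algebras"
    "HOL-Computational_Algebra.Group_Closure"
    "HOL-Algebra.Module"
    "HOL-Algebra.Algebraic_Closure_Type"
begin

section \<open>Complex Lie algebras\<close>

class lie_algebra = ab_group_add +
  fixes lscale :: "complex \<Rightarrow> 'a \<Rightarrow> 'a"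
    and bracket :: "'a \<Rightarrow> 'a \<Rightarrow> 'a"
  assumes lscale_add_right: "lscale c (x + y) = lscale c x + lscale c y"
    and lscale_add_left: "lscale (c + d) x = lscale c x + lscale d x"
    and lscale_lscale: "lscale c (lscale d x) = lscale (c * d) x"
    and lscale_one: "lscale 1 x = x"
    and bracket_add_left: "bracket (x + y) w = bracket x w + bracket y w"
    and bracket_add_right: "bracket w (x + y) = bracket w x + bracket w y"
    and bracket_scale_left: "bracket (lscale c x) y = lscale c (bracket x y)"
    and bracket_scale_right: "bracket x (lscale c y) = lscale c (bracket x y)"
    and bracket_self: "bracket x x = 0"
    and jacobi: "bracket x (bracket y w) + bracket y (bracket w x) + bracket w (bracket x y) = 0"

lemma vector_space_lscale: "vector_space (lscale :: complex \<Rightarrow> 'a::lie_algebra \<Rightarrow> 'a)"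
  by unfold_locales (simp_all add: lscale_add_right lscale_add_left lscale_lscale lscale_one)

text \<open>The Schroedinger algebra, in coordinates with respect to the basis \<open>e, h, f, p, q, z\<close>.\<close>

datatype schr =
  Schr (ce: complex) (ch: complex) (cf: complex) (cp: complex) (cq: complex) (cz: complex)

instantiation schr :: lie_algebra
begin

definition "0 = Schr 0 0 0 0 0 0"
definition "x + y = Schr (ce x + ce y) (ch x + ch y) (cf x + cf y)
                         (cp x + cp y) (cq x + cq y) (cz x + cz y)" for x y :: schr
definition "- x = Schr (- ce x) (- ch x) (- cf x) (- cp x) (- cq x) (- cz x)" for x :: schr
definition "x - y = Schr (ce x - ce y) (ch x - ch y) (cf x - cf y)
                         (cp x - cp y) (cq x - cq y) (cz x - cz y)" for x y :: schr
definition "lscale c x = Schr (c * ce x) (c * ch x) (c * cf x) (c * cp x) (c * cq x) (c * cz x)"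
  for x :: schr
definition "bracket x y = Schr
    (2 * (ch x * ce y - ce x * ch y))
    (ce x * cf y - cf x * ce y)
    (- 2 * (ch x * cf y - cf x * ch y))
    ((ch x * cp y - cp x * ch y) + (ce x * cq y - cq x * ce y))
    ((cf x * cp y - cp x * cf y) - (ch x * cq y - cq x * ch y))
    (cp x * cq y - cq x * cp y)" for x y :: schr

instance
  by standard
    (simp_all add: zero_schr_def plus_schr_def uminus_schr_def minus_schr_def lscale_schr_def
       bracket_schr_def algebra_simps)

end

definition \<ee> :: schr where "\<ee> = Schr 1 0 0 0 0 0"
definition \<hh> :: schr where "\<hh> = Schr 0 1 0 0 0 0"
definition \<ff> :: schr where "\<ff> = Schr 0 0 1 0 0 0"
definition \<pp> :: schr where "\<pp> = Schr 0 0 0 1 0 0"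
definition \<qq> :: schr where "\<qq> = Schr 0 0 0 0 1 0"
definition \<zz> :: schr where "\<zz> = Schr 0 0 0 0 0 1"

lemma schr_basis:
  "x = lscale (ce x) \<ee> + lscale (ch x) \<hh> + lscale (cf x) \<ff>
     + lscale (cp x) \<pp> + lscale (cq x) \<qq> + lscale (cz x) \<zz>"
  by (cases x) (simp add: plus_schr_def lscale_schr_def \<ee>_def \<hh>_def \<ff>_def \<pp>_def \<qq>_def \<zz>_def)

lemma schr_relations:
  "bracket \<ee> \<ff> = \<hh>" "bracket \<hh> \<ee> = lscale 2 \<ee>" "bracket \<hh> \<ff> = lscale (- 2) \<ff>"
  "bracket \<ee> \<pp> = 0" "bracket \<hh> \<pp> = \<pp>" "bracket \<ff> \<pp> = \<qq>"
  "bracket \<ee> \<qq> = \<pp>" "bracket \<hh> \<qq> = - \<qq>" "bracket \<ff> \<qq> = 0"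
  "bracket \<pp> \<qq> = \<zz>" "bracket \<zz> x = 0"
  by (simp_all add: zero_schr_def plus_schr_def uminus_schr_def lscale_schr_def bracket_schr_def
       \<ee>_def \<hh>_def \<ff>_def \<pp>_def \<qq>_def \<zz>_def)

definition sl2 :: "schr set"
  where "sl2 = {x. cp x = 0 \<and> cq x = 0 \<and> cz x = 0}"

text \<open>The subalgebra spanned by \<open>h, z, e, p\<close>.\<close>

typedef borel = "{x :: schr. cf x = 0 \<and> cq x = 0}"
  by (rule exI[of _ 0]) (simp add: zero_schr_def)

setup_lifting type_definition_borel

instantiation borel :: lie_algebra
begin

lift_definition zero_borel :: borel is 0 by (simp add: zero_schr_def)
lift_definition plus_borel :: "borel \<Rightarrow> borel \<Rightarrow> borel" is "(+)" by (simp add: plus_schr_def)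
lift_definition minus_borel :: "borel \<Rightarrow> borel \<Rightarrow> borel" is "(-)" by (simp add: minus_schr_def)
lift_definition uminus_borel :: "borel \<Rightarrow> borel" is uminus by (simp add: uminus_schr_def)
lift_definition lscale_borel :: "complex \<Rightarrow> borel \<Rightarrow> borel" is lscale
  by (simp add: lscale_schr_def)
lift_definition bracket_borel :: "borel \<Rightarrow> borel \<Rightarrow> borel" is bracket
  by (simp add: bracket_schr_def)

instance
  by standard
    (transfer; rule add.assoc add.commute add_0_left left_minus diff_conv_add_uminus
      lscale_add_right lscale_add_left lscale_lscale lscale_one
      bracket_add_left bracket_add_right bracket_scale_left bracket_scale_right bracket_self
      jacobi)+

end


section \<open>Universal enveloping algebras\<close>

datatype 'g word = Word (letters: "'g list")

instantiation word :: (type) monoid_add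
begin

definition "0 = Word []"
definition "v + w = Word (letters v @ letters w)"

instance
  by standard (simp_all add: zero_word_def plus_word_def)

end

text \<open>
  The type \<open>'g word \<Rightarrow>\<^sub>0 complex\<close>, with convolution, is the free associative unital algebra on
  the set \<open>'g\<close>. The linearity relators turn it into the tensor algebra of the vector space \<open>'g\<close>.
\<close>

abbreviation letter :: "'g \<Rightarrow> ('g word \<Rightarrow>\<^sub>0 complex)"
  where "letter x \<equiv> Poly_Mapping.single (Word [x]) 1"

abbreviation const :: "complex \<Rightarrow> ('g word \<Rightarrow>\<^sub>0 complex)"
  where "const c \<equiv> Poly_Mapping.single 0 c"

definition uea_relators :: "('g::lie_algebra word \<Rightarrow>\<^sub>0 complex) set"
  where "uea_relators =
      {letter (x + y) - letter x - letter y | x y. True}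
    \<union> {letter (lscale c x) - const c * letter x | c x. True}
    \<union> {letter x * letter y - letter y * letter x - letter (bracket x y) | x y. True}"

definition uea_ideal :: "('g::lie_algebra word \<Rightarrow>\<^sub>0 complex) set"
  where "uea_ideal = group_closure {a * r * b | a r b. r \<in> uea_relators}"

lemma uea_ideal_0: "0 \<in> uea_ideal"
  by (simp add: uea_ideal_def)

lemma uea_ideal_add: "a \<in> uea_ideal \<Longrightarrow> b \<in> uea_ideal \<Longrightarrow> a + b \<in> uea_ideal"
  unfolding uea_ideal_def by (rule group_closure_add)

lemma uea_ideal_diff: "a \<in> uea_ideal \<Longrightarrow> b \<in> uea_ideal \<Longrightarrow> a - b \<in> uea_ideal"
  unfolding uea_ideal_def by (rule group_closure.diff)

lemma uea_ideal_uminus: "a \<in> uea_ideal \<Longrightarrow> - a \<in> uea_ideal"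
  by (simp add: uea_ideal_def)

lemma uea_ideal_mult_left: "x \<in> uea_ideal \<Longrightarrow> c * x \<in> uea_ideal"
  unfolding uea_ideal_def
proof (induction rule: group_closure.induct)
  case (base s)
  show ?case
  proof (cases "s = 0")
    case False
    with base obtain a r b where "s = a * r * b" "r \<in> uea_relators" by auto
    then have "c * s = (c * a) * r * b" "r \<in> uea_relators" by (simp_all add: mult.assoc)
    then show ?thesis by (intro group_closure.base) blast
  qed simp
next
  case (diff s t)
  then show ?case by (simp add: right_diff_distrib group_closure.diff)
qed

lemma uea_ideal_mult_right: "x \<in> uea_ideal \<Longrightarrow> x * c \<in> uea_ideal"
  unfolding uea_ideal_def
proof (induction rule: group_closure.induct)
  case (base s)
  show ?case
  proof (cases "s = 0")
    case False
    with base obtain a r b where "s = a * r * b" "r \<in> uea_relators" by auto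
    then have "s * c = a * r * (b * c)" "r \<in> uea_relators" by (simp_all add: mult.assoc)
    then show ?thesis by (intro group_closure.base) blast
  qed simp
next
  case (diff s t)
  then show ?case by (simp add: left_diff_distrib group_closure.diff)
qed

definition uea_rel :: "('g::lie_algebra word \<Rightarrow>\<^sub>0 complex) \<Rightarrow> ('g word \<Rightarrow>\<^sub>0 complex) \<Rightarrow> bool"
  where "uea_rel a b \<longleftrightarrow> a - b \<in> uea_ideal"

lemma uea_rel_equivp: "equivp (uea_rel :: ('a::lie_algebra word \<Rightarrow>\<^sub>0 complex) \<Rightarrow> _)"
proof (rule equivpI)
  show "reflp (uea_rel :: ('a word \<Rightarrow>\<^sub>0 complex) \<Rightarrow> _)"
    by (simp add: reflp_def uea_rel_def uea_ideal_0)
  show "symp (uea_rel :: ('a word \<Rightarrow>\<^sub>0 complex) \<Rightarrow> _)"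
    unfolding symp_def uea_rel_def using uea_ideal_uminus by fastforce
  show "transp (uea_rel :: ('a word \<Rightarrow>\<^sub>0 complex) \<Rightarrow> _)"
    unfolding transp_def uea_rel_def
  proof (intro allI impI)
    fix a b c :: "'a::lie_algebra word \<Rightarrow>\<^sub>0 complex"
    assume "a - b \<in> uea_ideal" "b - c \<in> uea_ideal"
    then have "(a - b) + (b - c) \<in> uea_ideal" by (rule uea_ideal_add)
    then show "a - c \<in> uea_ideal" by simp
  qed
qed

quotient_type (overloaded) 'g uea = "('g::lie_algebra word \<Rightarrow>\<^sub>0 complex)" / uea_rel
  by (rule uea_rel_equivp)

lemma lookup_mult_0:
  fixes a b :: "'g word \<Rightarrow>\<^sub>0 complex"
  shows "Poly_Mapping.lookup (a * b) 0 = Poly_Mapping.lookup a 0 * Poly_Mapping.lookup b 0"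
proof -
  have *: "(0 = k + l) \<longleftrightarrow> k = 0 \<and> l = 0" for k l :: "'g word"
    by (cases k; cases l) (auto simp: zero_word_def plus_word_def)
  have "Poly_Mapping.lookup (a * b) 0 = Sum_any (\<lambda>k. Poly_Mapping.lookup a k *
      Sum_any (\<lambda>l. Poly_Mapping.lookup b l when 0 = k + l))"
    by (simp add: lookup_mult)
  also have "\<dots> = Sum_any (\<lambda>k. Poly_Mapping.lookup a k *
      Sum_any (\<lambda>l. (Poly_Mapping.lookup b l when l = 0) when k = 0))"
    by (simp add: * when_when conj_commute)
  also have "\<dots> = Sum_any (\<lambda>k. (Poly_Mapping.lookup a k * Poly_Mapping.lookup b 0) when k = 0)"
    by (rule Sum_any.cong) (auto simp: when_def)
  also have "\<dots> = Poly_Mapping.lookup a 0 * Poly_Mapping.lookup b 0"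
    by simp
  finally show ?thesis .
qed

lemma uea_ideal_lookup_0: "x \<in> uea_ideal \<Longrightarrow> Poly_Mapping.lookup x 0 = 0"
  unfolding uea_ideal_def
proof (induction rule: group_closure.induct)
  case (base s)
  have *: "Word [x] \<noteq> 0" "0 \<noteq> Word [x]" for x :: 'a by (simp_all add: zero_word_def)
  have "Poly_Mapping.lookup r 0 = 0" if "r \<in> uea_relators" for r :: "'a word \<Rightarrow>\<^sub>0 complex"
    using that
    unfolding uea_relators_def
    by (elim UnE CollectE exE) (simp_all only: lookup_minus lookup_mult_0 lookup_single * when_def if_False, simp_all)
  with base show ?case by (auto simp: lookup_mult_0)
next
  case (diff s t)
  then show ?case by (simp add: lookup_minus)
qed

instantiation uea :: (lie_algebra) ring_1
begin

lift_definition zero_uea :: "'a uea" is 0 .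
lift_definition one_uea :: "'a uea" is 1 .
lift_definition plus_uea :: "'a uea \<Rightarrow> 'a uea \<Rightarrow> 'a uea" is "(+)"
  unfolding uea_rel_def by (simp only: add_diff_add uea_ideal_add)
lift_definition uminus_uea :: "'a uea \<Rightarrow> 'a uea" is uminus
  unfolding uea_rel_def by (simp only: minus_diff_minus uea_ideal_uminus)
lift_definition minus_uea :: "'a uea \<Rightarrow> 'a uea \<Rightarrow> 'a uea" is "(-)"
proof -
  fix a b c d :: "'a word \<Rightarrow>\<^sub>0 complex"
  assume "uea_rel a b" "uea_rel c d"
  then have "(a - b) - (c - d) \<in> uea_ideal"
    unfolding uea_rel_def by (rule uea_ideal_diff)
  moreover have "(a - b) - (c - d) = (a - c) - (b - d)" by simp
  ultimately show "uea_rel (a - c) (b - d)" by (simp add: uea_rel_def)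
qed
lift_definition times_uea :: "'a uea \<Rightarrow> 'a uea \<Rightarrow> 'a uea" is "(*)"
proof -
  fix a b c d :: "'a word \<Rightarrow>\<^sub>0 complex"
  assume "uea_rel a b" "uea_rel c d"
  then have "(a - b) * c + b * (c - d) \<in> uea_ideal"
    unfolding uea_rel_def by (intro uea_ideal_add uea_ideal_mult_left uea_ideal_mult_right)
  moreover have "(a - b) * c + b * (c - d) = a * c - b * d" by (simp add: algebra_simps)
  ultimately show "uea_rel (a * c) (b * d)" by (simp add: uea_rel_def)
qed

instance
proof
  show "(0 :: 'a uea) \<noteq> 1"
  proof transfer
    show "\<not> uea_rel 0 (1 :: 'a word \<Rightarrow>\<^sub>0 complex)"
    proof
      assume "uea_rel 0 (1 :: 'a word \<Rightarrow>\<^sub>0 complex)"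
      then have "Poly_Mapping.lookup (0 - 1 :: 'a word \<Rightarrow>\<^sub>0 complex) 0 = 0"
        unfolding uea_rel_def by (rule uea_ideal_lookup_0)
      then show False by (simp only: lookup_minus lookup_one lookup_zero when_def) simp
    qed
  qed
qed (transfer; simp only: uea_rel_def; simp add: algebra_simps uea_ideal_0)+

end

lift_definition uea_of :: "'g::lie_algebra \<Rightarrow> 'g uea" is letter .

lift_definition uea_const :: "complex \<Rightarrow> 'g::lie_algebra uea" is const .


text \<open>
  The algebra homomorphism \<open>U \<phi>\<close> induced by a homomorphism \<open>\<phi>\<close> of Lie algebras. The value does
  not depend on the representative picked by \<open>rep_uea\<close>.
\<close>

definition uea_map :: "('g::lie_algebra \<Rightarrow> 'h::lie_algebra) \<Rightarrow> 'g uea \<Rightarrow> 'h uea"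
  where "uea_map \<phi> u = (\<Sum>w\<in>Poly_Mapping.keys (rep_uea u).
    uea_const (Poly_Mapping.lookup (rep_uea u) w) * prod_list (map (uea_of \<circ> \<phi>) (letters w)))"

lemma poly_mapping_sum_induct [case_names zero single add]:
  assumes "S 0" "\<And>k v. S (Poly_Mapping.single k v)" "\<And>a b. S a \<Longrightarrow> S b \<Longrightarrow> S (a + b)"
  shows "S (a :: 'k \<Rightarrow>\<^sub>0 'v::comm_monoid_add)"
proof (induction a rule: Poly_Mapping.update_induct)
  case const
  show ?case by (rule assms(1))
next
  case (update g k v)
  have "Poly_Mapping.update k v g = g + Poly_Mapping.single k v"
    using update(1)
    by (intro poly_mapping_eqI)
      (auto simp: lookup_update lookup_add lookup_single when_def in_keys_iff)
  with update assms show ?case by simp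
qed

lemma uea_const_1: "uea_const 1 = 1"
  by (simp add: uea_const_def one_uea_def single_one)

lemma uea_const_mult: "uea_const (c * d) = uea_const c * uea_const d"
  by transfer (simp add: mult_single equivp_reflp[OF uea_rel_equivp])

lemma uea_const_commute: "uea_const c * u = u * uea_const c"
proof (transfer fixing: c, goal_cases)
  case (1 u)
  have "const c * u = u * const c"
  proof (induction u rule: poly_mapping_sum_induct)
    case (single k v)
    then show ?case by (simp add: mult_single mult.commute)
  next
    case (add a b)
    then show ?case by (simp add: distrib_left distrib_right)
  qed simp
  then show ?case by (simp add: equivp_reflp[OF uea_rel_equivp])
qed

lemma uea_rel_relator: "a - b \<in> uea_relators \<Longrightarrow> uea_rel a b"
  unfolding uea_rel_def uea_ideal_def
  by (rule group_closure.base) (metis (mono_tags, lifting) insertI2 mem_Collect_eq mult_1 mult_1_right)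

lemma uea_of_add: "uea_of (x + y) = uea_of x + uea_of y"
proof transfer
  fix x y :: 'a
  have "letter (x + y) - (letter x + letter y) \<in> uea_relators"
    unfolding uea_relators_def by (auto simp: algebra_simps)
  then show "uea_rel (letter (x + y)) (letter x + letter y)" by (rule uea_rel_relator)
qed

lemma uea_of_lscale: "uea_of (lscale c x) = uea_const c * uea_of x"
proof transfer
  fix x :: 'a and c
  have "letter (lscale c x) - const c * letter x \<in> uea_relators"
    unfolding uea_relators_def by blast
  then show "uea_rel (letter (lscale c x)) (const c * letter x)" by (rule uea_rel_relator)
qed

lemma uea_of_bracket: "uea_of (bracket x y) = uea_of x * uea_of y - uea_of y * uea_of x"
proof transfer
  fix x y :: 'a
  have "letter x * letter y - letter y * letter x - letter (bracket x y) \<in> uea_relators"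
    unfolding uea_relators_def by blast
  then have "uea_rel (letter x * letter y - letter y * letter x) (letter (bracket x y))"
    by (rule uea_rel_relator)
  then show "uea_rel (letter (bracket x y)) (letter x * letter y - letter y * letter x)"
    by (rule equivp_symp[OF uea_rel_equivp])
qed

lemma uea_induct [case_names const of add mult]:
  fixes u :: "'g::lie_algebra uea"
  assumes "\<And>c. S (uea_const c)" "\<And>x. S (uea_of x)"
    and add: "\<And>u v. S u \<Longrightarrow> S v \<Longrightarrow> S (u + v)" and mult: "\<And>u v. S u \<Longrightarrow> S v \<Longrightarrow> S (u * v)"
  shows "S u"
proof -
  have words: "S (abs_uea (Poly_Mapping.single (Word xs) c))" for xs :: "'g list" and c
  proof (induction xs arbitrary: c)
    case Nil
    then show ?case using assms(1)[of c] by (simp add: uea_const_def zero_word_def)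
  next
    case (Cons x xs)
    have "Poly_Mapping.single (Word (x # xs)) c = letter x * Poly_Mapping.single (Word xs) c"
      by (simp add: mult_single plus_word_def)
    then have "abs_uea (Poly_Mapping.single (Word (x # xs)) c)
      = uea_of x * abs_uea (Poly_Mapping.single (Word xs) c)"
      by (simp add: uea_of.abs_eq times_uea.abs_eq)
    then show ?case using Cons assms(2) mult by simp
  qed
  have "S (abs_uea a)" for a :: "'g word \<Rightarrow>\<^sub>0 complex"
  proof (induction a rule: poly_mapping_sum_induct)
    case zero
    show ?case using assms(1)[of 0] by (simp add: uea_const_def)
  next
    case (single k v)
    show ?case using words[of "letters k" v] by simp
  next
    case (add a b)
    then show ?case using assms(3) by (simp add: plus_uea.abs_eq[symmetric])
  qed
  from this[of "rep_uea u"] show ?thesis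
    by (simp add: Quotient3_abs_rep[OF Quotient3_uea])
qed


lifting_forget uea.lifting


section \<open>Ore localization at the powers of f\<close>

text \<open>
  For a ring \<open>R\<close> and a left Ore set of the form \<open>{f ^ n}\<close>, the ring of fractions consists of the
  classes of pairs \<open>(k, u)\<close>, read as \<open>f\<^sup>-\<^sup>k u\<close>. Products are computed with the Ore condition:
  \<open>f\<^sup>-\<^sup>k u \<cdot> f\<^sup>-\<^sup>l v = f\<^sup>-\<^sup>(\<^sup>k\<^sup>+\<^sup>j\<^sup>) u' v\<close> whenever \<open>f ^ j * u = u' * f ^ l\<close>.
\<close>

definition frac_rel :: "'a::ring_1 \<Rightarrow> nat \<times> 'a \<Rightarrow> nat \<times> 'a \<Rightarrow> bool"
  where "frac_rel f x y \<longleftrightarrow> (\<exists>m. f ^ (m + fst y) * snd x = f ^ (m + fst x) * snd y)"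

definition frac_mult :: "'a::ring_1 \<Rightarrow> nat \<times> 'a \<Rightarrow> nat \<times> 'a \<Rightarrow> nat \<times> 'a"
  where "frac_mult f x y =
    (let (j, u) = (SOME (j, u). f ^ j * snd x = u * f ^ fst y) in (fst x + j, u * snd y))"

definition frac_add :: "'a::ring_1 \<Rightarrow> nat \<times> 'a \<Rightarrow> nat \<times> 'a \<Rightarrow> nat \<times> 'a"
  where "frac_add f x y = (fst x + fst y, f ^ fst y * snd x + f ^ fst x * snd y)"

locale ad_nilpotent =
  fixes f :: "'a::ring_1"
  assumes ad_nilpotent: "\<exists>n. ((\<lambda>u. f * u - u * f) ^^ n) u = 0"
begin

abbreviation (input) "ad \<equiv> \<lambda>u. f * u - u * f"

lemma pow_pow: "f ^ a * (f ^ b * u) = f ^ (a + b) * u"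
  by (simp add: power_add mult.assoc)

lemma pow_comm: "f ^ n * u = u * f ^ n + (\<Sum>i<n. f ^ i * ad u * f ^ (n - 1 - i))"
proof (induction n)
  case (Suc n)
  have "f ^ Suc n * u = f * (f ^ n * u)" by (simp add: mult.assoc)
  also have "\<dots> = f * u * f ^ n + (\<Sum>i<n. f ^ Suc i * ad u * f ^ (n - 1 - i))"
    by (simp add: Suc distrib_left sum_distrib_left mult.assoc)
  also have "f * u * f ^ n = u * f ^ Suc n + f ^ 0 * ad u * f ^ n"
    by (simp add: algebra_simps)
  also have "u * f ^ Suc n + f ^ 0 * ad u * f ^ n + (\<Sum>i<n. f ^ Suc i * ad u * f ^ (n - 1 - i))
    = u * f ^ Suc n + (\<Sum>i<Suc n. f ^ i * ad u * f ^ (Suc n - 1 - i))"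
    by (subst sum.lessThan_Suc_shift) (simp add: add.assoc)
  finally show ?case .
qed simp

lemma ore: "\<exists>k v. f ^ k * u = v * f ^ l"
proof -
  obtain n where "(ad ^^ n) u = 0" using ad_nilpotent by blast
  then show ?thesis
  proof (induction n arbitrary: u)
    case 0
    then show ?case by (intro exI[of _ 0]) simp
  next
    case (Suc n)
    have "(ad ^^ n) (ad u) = 0" using Suc.prems by (simp only: funpow_Suc_right comp_def)
    then obtain K w where w: "f ^ K * ad u = w * f ^ l" using Suc.IH by blast
    have "\<exists>v. f ^ i * ad u * f ^ (K + l - 1 - i) = v * f ^ l" for i
    proof (cases "i \<ge> K")
      case True
      then have "f ^ i * ad u * f ^ (K + l - 1 - i)
        = f ^ (i - K) * (f ^ K * ad u) * f ^ (K + l - 1 - i)"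
        by (simp add: mult.assoc[symmetric] power_add[symmetric])
      also have "\<dots> = f ^ (i - K) * w * f ^ (K + l - 1 - i) * f ^ l"
        by (simp add: w mult.assoc power_add[symmetric] add.commute)
      finally show ?thesis by blast
    next
      case False
      then have "f ^ (K + l - 1 - i) = f ^ (K - 1 - i) * f ^ l"
        by (simp add: power_add[symmetric])
      then show ?thesis by (metis mult.assoc)
    qed
    then obtain v where v: "\<And>i. f ^ i * ad u * f ^ (K + l - 1 - i) = v i * f ^ l" by metis
    have "f ^ (K + l) * u = (u * f ^ K + (\<Sum>i<K + l. v i)) * f ^ l"
      by (subst pow_comm)
        (simp only: v, simp add: distrib_right sum_distrib_right power_add mult.assoc)
    then show ?case by blast
  qed
qed

lemma reversible: "u * f ^ l = 0 \<Longrightarrow> \<exists>m. f ^ m * u = 0"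
proof -
  assume u: "u * f ^ l = 0"
  obtain n where "(ad ^^ n) u = 0" using ad_nilpotent by blast
  then show ?thesis using u
  proof (induction n arbitrary: u)
    case 0
    then show ?case by (intro exI[of _ 0]) simp
  next
    case (Suc n)
    have al: "ad u * f ^ l = 0"
      using Suc.prems(2) by (simp add: left_diff_distrib mult.assoc power_commutes[symmetric])
        (simp add: mult.assoc[symmetric])
    have "(ad ^^ n) (ad u) = 0" using Suc.prems(1) by (simp only: funpow_Suc_right comp_def)
    then obtain m where m: "f ^ m * ad u = 0" using Suc.IH al by blast
    have z: "f ^ i * ad u * f ^ (m + l - 1 - i) = 0" for i
    proof (cases "i \<ge> m")
      case True
      then have "f ^ i * ad u = f ^ (i - m) * (f ^ m * ad u)"
        by (simp add: mult.assoc[symmetric] power_add[symmetric])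
      then show ?thesis by (simp add: m)
    next
      case False
      then have "f ^ (m + l - 1 - i) = f ^ l * f ^ (m - 1 - i)"
        by (simp add: power_add[symmetric] add.commute)
      then show ?thesis using al by (metis mult.assoc mult_zero_left mult_zero_right)
    qed
    have "f ^ (l + m) * u = u * f ^ (l + m) + 0"
      using z by (subst pow_comm) (simp add: add.commute[of l m])
    then have "f ^ (l + m) * u = 0"
      using Suc.prems(2) by (simp add: power_add mult.assoc[symmetric])
    then show ?case by blast
  qed
qed

lemma frac_rel_equivp: "equivp (frac_rel f)"
proof (rule equivpI)
  show "reflp (frac_rel f)" by (auto simp: reflp_def frac_rel_def)
  show "symp (frac_rel f)" by (auto simp: symp_def frac_rel_def dest: sym)
  show "transp (frac_rel f)"
    unfolding transp_def
  proof (intro allI impI)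
    fix x y w :: "nat \<times> 'a"
    assume "frac_rel f x y" "frac_rel f y w"
    then obtain m n where m: "f ^ (m + fst y) * snd x = f ^ (m + fst x) * snd y"
      and n: "f ^ (n + fst w) * snd y = f ^ (n + fst y) * snd w"
      by (auto simp: frac_rel_def)
    have "f ^ ((m + n + fst y) + fst w) * snd x = f ^ (n + fst w) * (f ^ (m + fst y) * snd x)"
      by (simp add: pow_pow add_ac)
    also have "\<dots> = f ^ (m + fst x) * (f ^ (n + fst w) * snd y)"
      unfolding m by (simp add: pow_pow add_ac)
    also have "\<dots> = f ^ ((m + n + fst y) + fst x) * snd w"
      unfolding n by (simp add: pow_pow add_ac)
    finally show "frac_rel f x w" unfolding frac_rel_def by blast
  qed
qed

lemmas frac_refl = equivp_reflp[OF frac_rel_equivp]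
lemmas frac_sym = equivp_symp[OF frac_rel_equivp]
lemmas frac_trans = equivp_transp[OF frac_rel_equivp]

lemma frac_expand: "frac_rel f (k, u) (k + a, f ^ a * u)"
  unfolding frac_rel_def
  by (rule exI[of _ 0]) (simp add: pow_pow add_ac)

lemma frac_mult_rel:
  assumes "f ^ j * u = u' * f ^ l"
  shows "frac_rel f (frac_mult f (k, u) (l, v)) (k + j, u' * v)"
proof -
  obtain i w where iw: "(i, w) = (SOME (j, w). f ^ j * u = w * f ^ l)" by (metis surj_pair)
  have "case (i, w) of (j, w) \<Rightarrow> f ^ j * u = w * f ^ l"
    unfolding iw by (rule someI[of _ "(j, u')"]) (simp add: assms)
  then have w: "f ^ i * u = w * f ^ l" by simp
  have "(f ^ j * w - f ^ i * u') * f ^ l = f ^ j * (w * f ^ l) - f ^ i * (u' * f ^ l)"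
    by (simp add: left_diff_distrib mult.assoc)
  also have "\<dots> = 0"
    unfolding assms[symmetric] w[symmetric] by (simp add: pow_pow add_ac)
  finally obtain m where "f ^ m * (f ^ j * w - f ^ i * u') = 0" using reversible by blast
  then have m: "f ^ (m + j) * w = f ^ (m + i) * u'"
    by (simp add: right_diff_distrib pow_pow)
  have "f ^ (m + (k + j)) * (w * v) = f ^ k * (f ^ (m + j) * w) * v"
    by (simp add: mult.assoc pow_pow add_ac)
  also have "\<dots> = f ^ (m + (k + i)) * (u' * v)"
    unfolding m by (simp add: mult.assoc pow_pow add_ac)
  finally have "frac_rel f (k + i, w * v) (k + j, u' * v)"
    unfolding frac_rel_def by auto
  moreover have "frac_mult f (k, u) (l, v) = (k + i, w * v)"
    unfolding frac_mult_def by (simp add: iw[symmetric])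
  ultimately show ?thesis by simp
qed

lemma frac_mult_expand_left:
  "frac_rel f (frac_mult f (k, u) y) (frac_mult f (k + a, f ^ a * u) y)"
proof -
  obtain l v where y: "y = (l, v)" by (cases y)
  obtain j w where w: "f ^ j * u = w * f ^ l" using ore by blast
  have "f ^ j * (f ^ a * u) = f ^ a * (f ^ j * u)"
    by (simp add: pow_pow add_ac)
  then have w': "f ^ j * (f ^ a * u) = (f ^ a * w) * f ^ l" by (simp add: w mult.assoc)
  have "frac_rel f (k + j, w * v) (k + a + j, f ^ a * w * v)"
    using frac_expand[of "k + j" "w * v" a] by (simp add: mult.assoc add_ac)
  then show ?thesis
    unfolding y using frac_mult_rel[OF w, of k v] frac_mult_rel[OF w', of "k + a" v]
    by (meson frac_sym frac_trans)
qed

lemma frac_mult_expand_right: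
  "frac_rel f (frac_mult f x (l, v)) (frac_mult f x (l + a, f ^ a * v))"
proof -
  obtain k u where x: "x = (k, u)" by (cases x)
  obtain j w where w: "f ^ j * u = w * f ^ (l + a)" using ore by blast
  then have w': "f ^ j * u = (w * f ^ a) * f ^ l"
    by (simp add: mult.assoc power_add[symmetric] add.commute)
  show ?thesis
    unfolding x using frac_mult_rel[OF w, of k "f ^ a * v"] frac_mult_rel[OF w', of k v]
    by (metis mult.assoc frac_sym frac_trans)
qed

lemma frac_mult_cong:
  assumes "frac_rel f x x'" "frac_rel f y y'"
  shows "frac_rel f (frac_mult f x y) (frac_mult f x' y')"
proof -
  obtain k u k' u' l v l' v' where xy: "x = (k, u)" "x' = (k', u')" "y = (l, v)" "y' = (l', v')"
    by (cases x; cases x'; cases y; cases y')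
  from assms obtain m n where m: "f ^ (m + k') * u = f ^ (m + k) * u'"
    and n: "f ^ (n + l') * v = f ^ (n + l) * v'"
    by (auto simp: frac_rel_def xy)
  have e1: "(k' + (m + k), f ^ (m + k) * u') = (k + (m + k'), f ^ (m + k') * u)"
    and e2: "(l' + (n + l), f ^ (n + l) * v') = (l + (n + l'), f ^ (n + l') * v)"
    by (simp_all add: m n)
  have 1: "frac_rel f (frac_mult f x y) (frac_mult f x' y)"
    unfolding xy(1,2)
    by (rule frac_trans[OF frac_mult_expand_left[of k u y "m + k'"]
          frac_sym[OF frac_mult_expand_left[of k' u' y "m + k", unfolded e1]]])
  have 2: "frac_rel f (frac_mult f x' y) (frac_mult f x' y')"
    unfolding xy(3,4)
    by (rule frac_trans[OF frac_mult_expand_right[of x' l v "n + l'"]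
          frac_sym[OF frac_mult_expand_right[of x' l' v' "n + l", unfolded e2]]])
  from 1 2 show ?thesis by (rule frac_trans)
qed

lemma frac_add_commute: "frac_add f x y = frac_add f y x"
  by (simp add: frac_add_def add.commute)

lemma frac_add_assoc: "frac_add f (frac_add f x y) w = frac_add f x (frac_add f y w)"
  by (simp add: frac_add_def distrib_left pow_pow add_ac)

lemma frac_add_cong:
  assumes "frac_rel f x x'" "frac_rel f y y'"
  shows "frac_rel f (frac_add f x y) (frac_add f x' y')"
proof -
  have *: "frac_rel f (frac_add f x y) (frac_add f x' y)" if "frac_rel f x x'" for x x' y
  proof -
    obtain k u k' u' l v where xy: "x = (k, u)" "x' = (k', u')" "y = (l, v)"
      by (cases x; cases x'; cases y)
    have ex: "frac_rel f (frac_add f (k, u) y) (frac_add f (k + a, f ^ a * u) y)" for k u a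
      using frac_expand[of "k + l" "f ^ l * u + f ^ k * v" a]
      by (simp add: xy frac_add_def distrib_left pow_pow add_ac)
    from that obtain m where m: "f ^ (m + k') * u = f ^ (m + k) * u'"
      by (auto simp: frac_rel_def xy)
    have e: "(k' + (m + k), f ^ (m + k) * u') = (k + (m + k'), f ^ (m + k') * u)"
      by (simp add: m)
    show ?thesis
      unfolding xy(1,2)
      by (rule frac_trans[OF ex[of k u "m + k'"] frac_sym[OF ex[of k' u' "m + k", unfolded e]]])
  qed
  from *[OF assms(1), of y] *[OF assms(2), of x'] show ?thesis
    by (simp add: frac_add_commute[of x']) (rule frac_trans)
qed

lemma frac_add_same: "frac_rel f (frac_add f (k, u) (k, v)) (k, u + v)"
  using frac_sym[OF frac_expand[of k "u + v" k]] by (simp add: frac_add_def distrib_left)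

lemma frac_mult_assoc:
  "frac_rel f (frac_mult f (frac_mult f x y) w) (frac_mult f x (frac_mult f y w))"
proof -
  obtain k a l b m c where xyw: "x = (k, a)" "y = (l, b)" "w = (m, c)"
    by (cases x; cases y; cases w)
  obtain i b' where b': "f ^ i * b = b' * f ^ m" using ore by blast
  obtain j a' where a': "f ^ j * a = a' * f ^ (l + i)" using ore by blast
  have a'': "f ^ j * a = (a' * f ^ i) * f ^ l"
    by (simp add: a' mult.assoc power_add[symmetric] add.commute)
  have "frac_rel f (frac_mult f x y) (k + j, a' * b' * f ^ m)"
    using frac_mult_rel[OF a'', of k b] by (simp add: xyw mult.assoc b')
  from frac_mult_cong[OF this frac_refl, of w]
  have "frac_rel f (frac_mult f (frac_mult f x y) w) (frac_mult f (k + j, a' * b' * f ^ m) (m, c))"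
    by (simp add: xyw)
  moreover have "frac_rel f (frac_mult f (k + j, a' * b' * f ^ m) (m, c)) (k + j, a' * b' * c)"
    using frac_mult_rel[of 0 "a' * b' * f ^ m" "a' * b'" m "k + j" c] by simp
  moreover have "frac_rel f (frac_mult f x (frac_mult f y w)) (k + j, a' * b' * c)"
    using frac_trans[OF frac_mult_cong[OF frac_refl frac_mult_rel[OF b', of l c]]
        frac_mult_rel[OF a', of k "b' * c"]]
    by (simp add: xyw mult.assoc)
  ultimately show ?thesis by (meson frac_sym frac_trans)
qed

lemma frac_common_denominator:
  obtains k u v where "frac_rel f x (k, u)" "frac_rel f y (k, v)"
proof -
  obtain k u l v where "x = (k, u)" "y = (l, v)" by (cases x; cases y)
  then show ?thesis
    using that[of "k + l" "f ^ l * u" "f ^ k * v"] frac_expand[of k u l] frac_expand[of l v k]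
    by (simp add: add.commute)
qed

lemma frac_distrib_left:
  "frac_rel f (frac_mult f x (frac_add f y w)) (frac_add f (frac_mult f x y) (frac_mult f x w))"
proof -
  obtain k u where x: "x = (k, u)" by (cases x)
  obtain l a b where y: "frac_rel f y (l, a)" and w: "frac_rel f w (l, b)"
    by (rule frac_common_denominator)
  obtain j u' where u': "f ^ j * u = u' * f ^ l" using ore by blast
  note m = frac_mult_rel[OF u', of k, folded x]
  have "frac_rel f (frac_mult f x (frac_add f y w)) (k + j, u' * (a + b))"
    by (rule frac_trans[OF frac_mult_cong[OF frac_refl
            frac_trans[OF frac_add_cong[OF y w] frac_add_same]] m])
  moreover have "frac_rel f (frac_add f (frac_mult f x y) (frac_mult f x w)) (k + j, u' * a + u' * b)"
    by (rule frac_trans[OF frac_add_cong[OF frac_trans[OF frac_mult_cong[OF frac_refl y] m]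
            frac_trans[OF frac_mult_cong[OF frac_refl w] m]] frac_add_same])
  ultimately show ?thesis by (simp add: distrib_left) (meson frac_sym frac_trans)
qed

lemma frac_distrib_right:
  "frac_rel f (frac_mult f (frac_add f y w) x) (frac_add f (frac_mult f y x) (frac_mult f w x))"
proof -
  obtain l v where x: "x = (l, v)" by (cases x)
  obtain k a b where y: "frac_rel f y (k, a)" and w: "frac_rel f w (k, b)"
    by (rule frac_common_denominator)
  obtain i a1 where a1: "f ^ i * a = a1 * f ^ l" using ore by blast
  obtain j b1 where b1: "f ^ j * b = b1 * f ^ l" using ore by blast
  have a2: "f ^ (i + j) * a = (f ^ j * a1) * f ^ l"
    by (simp add: mult.assoc a1[symmetric] pow_pow add.commute)
  have b2: "f ^ (i + j) * b = (f ^ i * b1) * f ^ l"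
    by (simp add: mult.assoc b1[symmetric] pow_pow)
  have ab: "f ^ (i + j) * (a + b) = (f ^ j * a1 + f ^ i * b1) * f ^ l"
    by (simp add: distrib_left distrib_right a2 b2)
  have "frac_rel f (frac_mult f (frac_add f y w) x) (k + (i + j), (f ^ j * a1 + f ^ i * b1) * v)"
    unfolding x
    by (rule frac_trans[OF frac_mult_cong[OF frac_trans[OF frac_add_cong[OF y w] frac_add_same]
            frac_refl] frac_mult_rel[OF ab]])
  moreover have "frac_rel f (frac_add f (frac_mult f y x) (frac_mult f w x))
      (k + (i + j), f ^ j * a1 * v + f ^ i * b1 * v)"
    unfolding x
    by (rule frac_trans[OF frac_add_cong[OF
            frac_trans[OF frac_mult_cong[OF y frac_refl] frac_mult_rel[OF a2]]
            frac_trans[OF frac_mult_cong[OF w frac_refl] frac_mult_rel[OF b2]]] frac_add_same])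
  ultimately show ?thesis by (simp add: distrib_right) (meson frac_sym frac_trans)
qed

lemma frac_mult_one_left: "frac_rel f (frac_mult f (0, 1) x) x"
  using frac_mult_rel[of "fst x" 1 1 "fst x" 0 "snd x"] by simp

lemma frac_mult_one_right: "frac_rel f (frac_mult f x (0, 1)) x"
  using frac_mult_rel[of 0 "snd x" "snd x" 0 "fst x" 1] by simp

lemma frac_uminus_cong: "frac_rel f x y \<Longrightarrow> frac_rel f (fst x, - snd x) (fst y, - snd y)"
  by (auto simp: frac_rel_def)

lemma frac_add_uminus: "frac_rel f (frac_add f (fst x, - snd x) x) (0, 0)"
  by (simp add: frac_rel_def frac_add_def)

end


lemma
  fixes f :: "'a::ring_1"
  defines "ad \<equiv> \<lambda>u. f * u - u * f"
  shows ad_funpow_zero: "(ad ^^ n) 0 = 0"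
    and ad_funpow_add: "(ad ^^ n) (u + v) = (ad ^^ n) u + (ad ^^ n) v"
  by (induction n) (simp_all add: ad_def algebra_simps)

lemma ad_funpow_mult:
  fixes f :: "'a::ring_1"
  defines "ad \<equiv> \<lambda>u. f * u - u * f"
  assumes "(ad ^^ a) u = 0" "(ad ^^ b) v = 0"
  shows "(ad ^^ (a + b)) (u * v) = 0"
  using assms(2,3)
proof (induction "a + b" arbitrary: a b u v)
  case 0
  then show ?case by simp
next
  case (Suc n)
  show ?case
  proof (cases "a = 0 \<or> b = 0")
    case True
    then have "u * v = 0" using Suc.prems by auto
    then show ?thesis using ad_funpow_zero[where f = f, folded ad_def] by simp
  next
    case False
    then obtain a' b' where ab: "a = Suc a'" "b = Suc b'" by (auto simp: gr0_conv_Suc)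
    have "(ad ^^ a') (ad u) = 0" "(ad ^^ b') (ad v) = 0"
      using Suc.prems unfolding ab by (simp_all only: funpow_Suc_right comp_def)
    then have "(ad ^^ (a' + b)) (ad u * v) = 0" "(ad ^^ (a + b')) (u * ad v) = 0"
      using Suc.hyps(1)[of a' b "ad u" v] Suc.hyps(1)[of a b' u "ad v"] Suc.hyps(2) Suc.prems ab
      by auto
    moreover have "ad (u * v) = ad u * v + u * ad v" by (simp add: ad_def algebra_simps)
    moreover have "a + b = Suc (a' + b)" "a' + b = a + b'" using ab by auto
    ultimately show ?thesis
      using ad_funpow_add[where f = f, folded ad_def] by (simp only: funpow_Suc_right comp_def) simp
  qed
qed

lemma ad_funpow_mono:
  fixes f :: "'a::ring_1"
  defines "ad \<equiv> \<lambda>u. f * u - u * f"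
  assumes "(ad ^^ a) u = 0"
  shows "(ad ^^ (b + a)) u = 0"
  using assms(2) ad_funpow_zero[where f = f, folded ad_def] by (simp only: funpow_add comp_def)

interpretation uea_F: ad_nilpotent "uea_of \<ff>"
proof
  fix u
  let ?ad = "\<lambda>u. uea_of \<ff> * u - u * uea_of \<ff>"
  show "\<exists>n. (?ad ^^ n) u = 0"
  proof (induction u rule: uea_induct)
    case (const c)
    show ?case by (rule exI[of _ 1]) (simp add: uea_const_commute)
  next
    case (of x)
    have "bracket \<ff> (bracket \<ff> (bracket \<ff> x)) = 0"
      by (simp add: bracket_schr_def \<ff>_def zero_schr_def)
    moreover have "uea_of (0 :: schr) = 0"
      using uea_of_add[of "0 :: schr" 0] by simp
    ultimately show ?case
      by (intro exI[of _ 3]) (simp add: eval_nat_numeral uea_of_bracket[symmetric])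
  next
    case (add u v)
    then obtain a b where "(?ad ^^ a) u = 0" "(?ad ^^ b) v = 0" by blast
    then have "(?ad ^^ (a + b)) (u + v) = 0"
      using ad_funpow_mono[where f = "uea_of \<ff>" and a = a and u = u and b = b]
        ad_funpow_mono[where f = "uea_of \<ff>" and a = b and u = v and b = a]
      by (simp add: ad_funpow_add add.commute)
    then show ?case by blast
  next
    case (mult u v)
    then show ?case using ad_funpow_mult by blast
  qed
qed

quotient_type uloc = "nat \<times> schr uea" / "frac_rel (uea_of \<ff>)"
  by (rule uea_F.frac_rel_equivp)

instantiation uloc :: "{ring, monoid_mult}"
begin

lift_definition zero_uloc :: uloc is "(0, 0)" .
lift_definition one_uloc :: uloc is "(0, 1)" .
lift_definition plus_uloc :: "uloc \<Rightarrow> uloc \<Rightarrow> uloc" is "frac_add (uea_of \<ff>)"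
  by (rule uea_F.frac_add_cong)
lift_definition uminus_uloc :: "uloc \<Rightarrow> uloc" is "\<lambda>x. (fst x, - snd x)"
  by (rule uea_F.frac_uminus_cong)
definition minus_uloc :: "uloc \<Rightarrow> uloc \<Rightarrow> uloc" where "x - y = x + - y" for x y :: uloc
lift_definition times_uloc :: "uloc \<Rightarrow> uloc \<Rightarrow> uloc" is "frac_mult (uea_of \<ff>)"
  by (rule uea_F.frac_mult_cong)

instance
proof
  fix a b c :: uloc
  show "a + b + c = a + (b + c)"
    by transfer (simp add: uea_F.frac_add_assoc uea_F.frac_refl)
  show "a + b = b + a"
    by transfer (metis uea_F.frac_add_commute uea_F.frac_refl)
  show "0 + a = a"
    by transfer (simp add: frac_add_def uea_F.frac_refl)
  show "- a + a = 0" by transfer (rule uea_F.frac_add_uminus)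
  show "a - b = a + - b" by (rule minus_uloc_def)
  show "a * b * c = a * (b * c)" by transfer (rule uea_F.frac_mult_assoc)
  show "(a + b) * c = a * c + b * c" by transfer (rule uea_F.frac_distrib_right)
  show "a * (b + c) = a * b + a * c" by transfer (rule uea_F.frac_distrib_left)
  show "1 * a = a" by transfer (rule uea_F.frac_mult_one_left)
  show "a * 1 = a" by transfer (rule uea_F.frac_mult_one_right)
qed

end

lift_definition uloc_of :: "schr uea \<Rightarrow> uloc" is "\<lambda>u. (0, u)" .

lemma uloc_of_hom:
  "uloc_of 1 = 1" "uloc_of (u + v) = uloc_of u + uloc_of v" "uloc_of (u * v) = uloc_of u * uloc_of v"
proof -
  show "uloc_of 1 = 1" by transfer (rule uea_F.frac_refl)
  show "uloc_of (u + v) = uloc_of u + uloc_of v"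
    by transfer (simp add: frac_add_def uea_F.frac_refl)
  show "uloc_of (u * v) = uloc_of u * uloc_of v"
    by transfer (rule uea_F.frac_sym, use uea_F.frac_mult_rel[of 0 _ _ 0 0] in simp)
qed

text \<open>\<open>f\<close> becomes invertible, and \<open>(k, u)\<close> represents \<open>f\<^sup>-\<^sup>k u\<close>.\<close>

lemma uloc_F_invertible:
  "\<exists>g. g * uloc_of (uea_of \<ff>) = 1 \<and> uloc_of (uea_of \<ff>) * g = 1"
proof (intro exI conjI)
  show "abs_uloc (1, 1) * uloc_of (uea_of \<ff>) = 1"
    by (transfer, rule uea_F.frac_trans[OF uea_F.frac_mult_rel[of 0 _ 1 0]]) 
      (auto simp: frac_rel_def power_commutes)
  show "uloc_of (uea_of \<ff>) * abs_uloc (1, 1) = 1"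
    by (transfer, use uea_F.frac_mult_rel[of 0 "uea_of \<ff>" 1 1 0 1] in simp)
qed

lemma uloc_fraction: "uloc_of (uea_of \<ff>) ^ k * abs_uloc (k, u) = uloc_of u"
proof -
  have pow: "uloc_of (uea_of \<ff>) ^ k = uloc_of (uea_of \<ff> ^ k)"
    by (induction k) (simp_all add: uloc_of_hom)
  show ?thesis
    unfolding pow
    by (transfer, use uea_F.frac_mult_rel[of 0 "uea_of \<ff> ^ _" 1 _ 0] in simp)
qed

text \<open>The bimodule \<open>S\<^sub>f = U\<^sub>(\<^sub>f\<^sub>)/U\<close>.\<close>

definition uloc_mod :: "uloc \<Rightarrow> uloc \<Rightarrow> bool"
  where "uloc_mod x y \<longleftrightarrow> x - y \<in> range uloc_of"

lemma range_uloc_of: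
  "0 \<in> range uloc_of"
  "x \<in> range uloc_of \<Longrightarrow> y \<in> range uloc_of \<Longrightarrow> x + y \<in> range uloc_of"
  "x \<in> range uloc_of \<Longrightarrow> - x \<in> range uloc_of"
proof -
  have z: "uloc_of 0 = 0" using uloc_of_hom(2)[of 0 0] by simp
  then show "0 \<in> range uloc_of" by (metis rangeI)
  show "x \<in> range uloc_of \<Longrightarrow> y \<in> range uloc_of \<Longrightarrow> x + y \<in> range uloc_of"
    by (auto simp: uloc_of_hom(2)[symmetric])
  have "uloc_of (- u) = - uloc_of u" for u
    using uloc_of_hom(2)[of "- u" u] z by (simp add: eq_neg_iff_add_eq_0)
  then show "x \<in> range uloc_of \<Longrightarrow> - x \<in> range uloc_of" by (metis rangeE rangeI)
qed

quotient_type sf = uloc / uloc_mod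
proof (rule equivpI)
  show "reflp uloc_mod" by (simp add: reflp_def uloc_mod_def range_uloc_of)
  show "symp uloc_mod"
    unfolding symp_def uloc_mod_def by (metis minus_diff_eq range_uloc_of(3))
  show "transp uloc_mod"
    unfolding transp_def uloc_mod_def
  proof (intro allI impI)
    fix x y w :: uloc
    assume "x - y \<in> range uloc_of" "y - w \<in> range uloc_of"
    from range_uloc_of(2)[OF this] show "x - w \<in> range uloc_of" by simp
  qed
qed

instantiation sf :: ab_group_add
begin

lift_definition zero_sf :: sf is 0 .
lift_definition plus_sf :: "sf \<Rightarrow> sf \<Rightarrow> sf" is "(+)"
  unfolding uloc_mod_def by (simp only: add_diff_add range_uloc_of)
lift_definition uminus_sf :: "sf \<Rightarrow> sf" is uminus
  unfolding uloc_mod_def by (simp only: minus_diff_minus range_uloc_of)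
definition minus_sf :: "sf \<Rightarrow> sf \<Rightarrow> sf" where "x - y = x + - y" for x y :: sf

instance
  by standard
    (simp only: minus_sf_def |
      transfer; simp only: uloc_mod_def; simp add: algebra_simps range_uloc_of)+

end

lift_definition sf_left :: "schr uea \<Rightarrow> sf \<Rightarrow> sf" is "\<lambda>u x. uloc_of u * x"
  unfolding uloc_mod_def by (auto simp: right_diff_distrib[symmetric] uloc_of_hom(3)[symmetric])

lift_definition sf_right :: "sf \<Rightarrow> schr uea \<Rightarrow> sf" is "\<lambda>x u. x * uloc_of u"
  unfolding uloc_mod_def by (auto simp: left_diff_distrib[symmetric] uloc_of_hom(3)[symmetric])


section \<open>Modules\<close>

abbreviation complex_field :: "complex ring"
  where "complex_field \<equiv> ring_of_type_algebra"

record ('g, 'm) rep = "(complex, 'm) module" +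
  act :: "'g \<Rightarrow> 'm \<Rightarrow> 'm"

locale lie_module = module complex_field M for M :: "('g::lie_algebra, 'm) rep" (structure) +
  assumes act_closed: "v \<in> carrier M \<Longrightarrow> act M x v \<in> carrier M"
    and act_add_right:
      "v \<in> carrier M \<Longrightarrow> w \<in> carrier M \<Longrightarrow> act M x (v \<oplus> w) = act M x v \<oplus> act M x w"
    and act_smult_right: "v \<in> carrier M \<Longrightarrow> act M x (c \<odot> v) = c \<odot> act M x v"
    and act_add_left: "v \<in> carrier M \<Longrightarrow> act M (x + y) v = act M x v \<oplus> act M y v"
    and act_lscale: "v \<in> carrier M \<Longrightarrow> act M (lscale c x) v = c \<odot> act M x v"
    and act_bracket:
      "v \<in> carrier M \<Longrightarrow> act M (bracket x y) v = act M x (act M y v) \<ominus> act M y (act M x v)"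

text \<open>
  Below, \<open>A\<close> is the set of elements whose action is taken into account: \<open>UNIV\<close> for modules over
  the Schroedinger algebra, \<open>sl2\<close> for their restrictions to \<open>sl\<^sub>2\<close>.
\<close>

definition submod :: "'g set \<Rightarrow> 'm set \<Rightarrow> ('g, 'm) rep \<Rightarrow> bool"
  where "submod A W M \<longleftrightarrow> submodule W complex_field M \<and> (\<forall>x\<in>A. \<forall>w\<in>W. act M x w \<in> W)"

definition simple_mod :: "'g set \<Rightarrow> ('g, 'm) rep \<Rightarrow> bool"
  where "simple_mod A M \<longleftrightarrow> carrier M \<noteq> {\<zero>\<^bsub>M\<^esub>} \<and>
    (\<forall>W. submod A W M \<longrightarrow> W = {\<zero>\<^bsub>M\<^esub>} \<or> W = carrier M)"

definition iso_mod :: "'g set \<Rightarrow> ('g, 'm) rep \<Rightarrow> ('g, 'n) rep \<Rightarrow> bool"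
  where "iso_mod A M N \<longleftrightarrow> (\<exists>\<phi>. bij_betw \<phi> (carrier M) (carrier N) \<and>
    (\<forall>v\<in>carrier M. \<forall>w\<in>carrier M. \<phi> (v \<oplus>\<^bsub>M\<^esub> w) = \<phi> v \<oplus>\<^bsub>N\<^esub> \<phi> w) \<and>
    (\<forall>c. \<forall>v\<in>carrier M. \<phi> (c \<odot>\<^bsub>M\<^esub> v) = c \<odot>\<^bsub>N\<^esub> \<phi> v) \<and>
    (\<forall>x\<in>A. \<forall>v\<in>carrier M. \<phi> (act M x v) = act N x (\<phi> v)))"

definition restr :: "('g, 'm) rep \<Rightarrow> 'm set \<Rightarrow> ('g, 'm) rep"
  where "restr M W = M\<lparr>carrier := W\<rparr>"

definition lspan :: "('g, 'm) rep \<Rightarrow> 'm set \<Rightarrow> 'm set"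
  where "lspan M B = (\<lambda>W. submodule W complex_field M) hull B"

definition fin_dim :: "('g, 'm) rep \<Rightarrow> 'm set \<Rightarrow> bool"
  where "fin_dim M W \<longleftrightarrow> (\<exists>B. finite B \<and> B \<subseteq> carrier M \<and> W = lspan M B)"

definition direct_sum :: "('g, 'm) rep \<Rightarrow> 'm set set \<Rightarrow> bool"
  where "direct_sum M \<W> \<longleftrightarrow> (\<forall>v\<in>carrier M. \<exists>!w.
    (\<forall>W\<in>\<W>. w W \<in> W) \<and> (\<forall>W. W \<notin> \<W> \<longrightarrow> w W = \<zero>\<^bsub>M\<^esub>) \<and>
    finite {W. w W \<noteq> \<zero>\<^bsub>M\<^esub>} \<and> v = finsum M w {W. w W \<noteq> \<zero>\<^bsub>M\<^esub>})"

definition harish_chandra :: "(schr, 'm) rep \<Rightarrow> bool"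
  where "harish_chandra M \<longleftrightarrow> (\<exists>\<W>.
    (\<forall>W\<in>\<W>. submod sl2 W M \<and> simple_mod sl2 (restr M W) \<and> fin_dim M W) \<and>
    direct_sum M \<W> \<and>
    (\<forall>W\<in>\<W>. finite {W'\<in>\<W>. iso_mod sl2 (restr M W') (restr M W)}))"

definition simple_hc_module :: "(schr, 'm) rep \<Rightarrow> bool"
  where "simple_hc_module M \<longleftrightarrow> lie_module M \<and> simple_mod UNIV M \<and> harish_chandra M"

definition central_charge :: "(schr, 'm) rep \<Rightarrow> complex \<Rightarrow> bool"
  where "central_charge M c \<longleftrightarrow> (\<forall>v\<in>carrier M. act M \<zz> v = c \<odot>\<^bsub>M\<^esub> v)"

text \<open>
  \<open>L(n)\<close> with trivial action of \<open>p, q, z\<close>. In the standard basis \<open>v\<^sub>0, \<dots>, v\<^sub>n\<close> one has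
  \<open>h v\<^sub>i = (n - 2i) v\<^sub>i\<close>, \<open>f v\<^sub>i = v\<^sub>i\<^sub>+\<^sub>1\<close> with \<open>v\<^sub>n\<^sub>+\<^sub>1 = 0\<close>, and \<open>e v\<^sub>i = i (n - i + 1) v\<^sub>i\<^sub>-\<^sub>1\<close>; a vector is
  given by its coefficients.
\<close>

definition Lmod :: "nat \<Rightarrow> (schr, nat \<Rightarrow> complex) rep"
  where "Lmod n = \<lparr>carrier = {v. \<forall>i>n. v i = 0}, monoid.mult = undefined, one = undefined,
    zero = (\<lambda>i. 0), add = (\<lambda>v w i. v i + w i), module.smult = (\<lambda>c v i. c * v i),
    act = (\<lambda>x v i. if i \<le> n then
        ce x * (of_nat (i + 1) * (of_nat n - of_nat i) * v (i + 1))
      + ch x * ((of_nat n - 2 * of_nat i) * v i)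
      + cf x * (if i = 0 then 0 else v (i - 1)) else 0)\<rparr>"

lemma lie_module_Lmod: "lie_module (Lmod n)"
proof (intro lie_module.intro moduleI lie_module_axioms.intro)
  show "cring complex_field" by (rule cring_from_type_algebra)
  show "abelian_group (Lmod n)"
  proof (rule abelian_groupI)
    fix v assume "v \<in> carrier (Lmod n)"
    then show "\<exists>w\<in>carrier (Lmod n). w \<oplus>\<^bsub>Lmod n\<^esub> v = \<zero>\<^bsub>Lmod n\<^esub>"
      by (intro bexI[of _ "\<lambda>i. - v i"]) (auto simp: Lmod_def)
  qed (auto simp: Lmod_def algebra_simps)
  then interpret abelian_group "Lmod n" .
  have minus: "v \<ominus>\<^bsub>Lmod n\<^esub> w = (\<lambda>i. v i - w i)"
    if "v \<in> carrier (Lmod n)" "w \<in> carrier (Lmod n)" for v w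
  proof -
    have "\<ominus>\<^bsub>Lmod n\<^esub> w = (\<lambda>i. - w i)"
      by (rule minus_equality) (use that in \<open>auto simp: Lmod_def\<close>)
    then show ?thesis by (simp add: a_minus_def) (simp add: Lmod_def)
  qed
  show "act (Lmod n) (bracket x y) v
      = act (Lmod n) x (act (Lmod n) y v) \<ominus>\<^bsub>Lmod n\<^esub> act (Lmod n) y (act (Lmod n) x v)"
    if "v \<in> carrier (Lmod n)" for v x y
  proof (subst minus)
    show "act (Lmod n) (bracket x y) v = (\<lambda>i. act (Lmod n) x (act (Lmod n) y v) i
        - act (Lmod n) y (act (Lmod n) x v) i)"
    proof
      fix i
      consider "i < n" | "i = n" | "n < i" by linarith
      then show "act (Lmod n) (bracket x y) v i = act (Lmod n) x (act (Lmod n) y v) i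
          - act (Lmod n) y (act (Lmod n) x v) i"
        by cases (cases i; simp add: Lmod_def bracket_schr_def algebra_simps)+
    qed
  qed (simp_all add: Lmod_def)
qed (auto simp: Lmod_def ring_of_type_algebra_def plus_schr_def lscale_schr_def algebra_simps)

definition has_type :: "(schr, 'm) rep \<Rightarrow> nat \<Rightarrow> bool"
  where "has_type M n \<longleftrightarrow> (\<exists>W. submod sl2 W M \<and> iso_mod sl2 (restr M W) (Lmod n))"

definition minimal_type :: "(schr, 'm) rep \<Rightarrow> nat \<Rightarrow> bool"
  where "minimal_type M n \<longleftrightarrow> has_type M n \<and> (\<forall>m. has_type M m \<longrightarrow> n \<le> m)"

text \<open>
  Passage between modules over a Lie algebra and left modules over its enveloping algebra. In
  \<open>uea_module\<close>, a word acts by the composition of the actions of its letters; for a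
  \<open>lie_module\<close> the choice of representative is irrelevant.
\<close>

definition uea_module :: "('g::lie_algebra, 'm) rep \<Rightarrow> ('g uea, 'm) module"
  where "uea_module M = \<lparr>carrier = carrier M, monoid.mult = undefined, one = undefined,
    zero = \<zero>\<^bsub>M\<^esub>, add = add M,
    module.smult = (\<lambda>u v. \<Oplus>\<^bsub>M\<^esub>w\<in>Poly_Mapping.keys (rep_uea u).
      Poly_Mapping.lookup (rep_uea u) w \<odot>\<^bsub>M\<^esub> foldr (act M) (letters w) v)\<rparr>"

definition rep_of_uea_module :: "('g::lie_algebra uea, 'm) module \<Rightarrow> ('g, 'm) rep"
  where "rep_of_uea_module N = \<lparr>carrier = carrier N, monoid.mult = undefined, one = undefined,
    zero = \<zero>\<^bsub>N\<^esub>, add = add N,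
    module.smult = (\<lambda>c v. uea_const c \<odot>\<^bsub>N\<^esub> v), act = (\<lambda>x v. uea_of x \<odot>\<^bsub>N\<^esub> v)\<rparr>"

text \<open>
  The tensor product \<open>N \<otimes>\<^sub>R M\<close> of an \<open>S\<close>-\<open>R\<close>-bimodule \<open>N\<close>, given by its two actions on the type
  \<open>'n\<close>, and a left \<open>R\<close>-module \<open>M\<close>: cosets in the free abelian group on \<open>N \<times> M\<close>, as a left
  \<open>S\<close>-module.
\<close>

definition tensor_relators ::
    "('n::ab_group_add \<Rightarrow> 'r \<Rightarrow> 'n) \<Rightarrow> ('r, 'm) module \<Rightarrow> ('n \<times> 'm \<Rightarrow>\<^sub>0 int) set"
  where "tensor_relators nr M =
      {frag_of (x + y, v) - frag_of (x, v) - frag_of (y, v) | x y v. v \<in> carrier M}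
    \<union> {frag_of (x, v \<oplus>\<^bsub>M\<^esub> w) - frag_of (x, v) - frag_of (x, w) | x v w.
         v \<in> carrier M \<and> w \<in> carrier M}
    \<union> {frag_of (nr x r, v) - frag_of (x, r \<odot>\<^bsub>M\<^esub> v) | x r v. v \<in> carrier M}"

definition tensor ::
    "('s \<Rightarrow> 'n \<Rightarrow> 'n) \<Rightarrow> ('n::ab_group_add \<Rightarrow> 'r \<Rightarrow> 'n) \<Rightarrow> ('r, 'm) module
      \<Rightarrow> ('s, ('n \<times> 'm \<Rightarrow>\<^sub>0 int) set) module"
  where "tensor nl nr M = (let K = group_closure (tensor_relators nr M) in
    \<lparr>carrier = {t +o K | t. Poly_Mapping.keys t \<subseteq> UNIV \<times> carrier M},
     monoid.mult = undefined, one = undefined, zero = K, add = (+),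
     module.smult = (\<lambda>s T. frag_extend (\<lambda>(x, v). frag_of (nl s x, v)) ` T + K)\<rparr>)"


section \<open>Verma modules and the completion functor\<close>

definition borel_character :: "complex \<Rightarrow> complex \<Rightarrow> (borel, complex) rep"
  where "borel_character \<mu> c = \<lparr>carrier = UNIV, monoid.mult = undefined, one = undefined,
    zero = 0, add = (+), module.smult = (*),
    act = (\<lambda>x v. (ch (Rep_borel x) * \<mu> + cz (Rep_borel x) * c) * v)\<rparr>"

lemma lie_module_borel_character: "lie_module (borel_character \<mu> c)"
proof (intro lie_module.intro moduleI lie_module_axioms.intro)
  show "cring complex_field" by (rule cring_from_type_algebra)
  show "abelian_group (borel_character \<mu> c)"
  proof (rule abelian_groupI)
    fix v
    show "\<exists>w\<in>carrier (borel_character \<mu> c).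
        w \<oplus>\<^bsub>borel_character \<mu> c\<^esub> v = \<zero>\<^bsub>borel_character \<mu> c\<^esub>"
      by (intro bexI[of _ "- v"]) (auto simp: borel_character_def)
  qed (auto simp: borel_character_def)
  then interpret abelian_group "borel_character \<mu> c" .
  have "\<ominus>\<^bsub>borel_character \<mu> c\<^esub> w = - w" for w
    by (rule minus_equality) (auto simp: borel_character_def)
  then have minus: "v \<ominus>\<^bsub>borel_character \<mu> c\<^esub> w = v - w" for v w
    by (simp add: a_minus_def) (simp add: borel_character_def)
  show "act (borel_character \<mu> c) (bracket x y) v
      = act (borel_character \<mu> c) x (act (borel_character \<mu> c) y v)
        \<ominus>\<^bsub>borel_character \<mu> c\<^esub> act (borel_character \<mu> c) y (act (borel_character \<mu> c) x v)"
    for v x y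
    using Rep_borel[of x] Rep_borel[of y] unfolding minus
    by (simp add: borel_character_def bracket_borel.rep_eq bracket_schr_def algebra_simps)
qed (auto simp: borel_character_def ring_of_type_algebra_def plus_borel.rep_eq lscale_borel.rep_eq
    plus_schr_def lscale_schr_def algebra_simps)

definition verma :: "complex \<Rightarrow> complex \<Rightarrow> (schr, (schr uea \<times> complex \<Rightarrow>\<^sub>0 int) set) rep"
  where "verma \<mu> c = rep_of_uea_module
    (tensor (*) (\<lambda>u b. u * uea_map Rep_borel b) (uea_module (borel_character \<mu> c)))"

definition EA :: "(schr, 'm) rep \<Rightarrow> (schr, (sf \<times> 'm \<Rightarrow>\<^sub>0 int) set) rep"
  where "EA M = (let T = rep_of_uea_module (tensor sf_left sf_right (uea_module M)) in
    restr T {m \<in> carrier T. fin_dim T (lspan T (range (\<lambda>k. (act T \<ee> ^^ k) m)))})"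

text \<open>
  \<open>V(n, c)\<close> is \<open>V_nonneg n c\<close> for \<open>n \<ge> 0\<close> and \<open>V_nonpos n c\<close> for \<open>n \<le> 0\<close>; for \<open>n = 0\<close> both
  apply, and give isomorphic but not equal modules.
\<close>

definition V_nonneg ::
    "int \<Rightarrow> complex \<Rightarrow> (schr, (sf \<times> (schr uea \<times> complex \<Rightarrow>\<^sub>0 int) set \<Rightarrow>\<^sub>0 int) set) rep"
  where "V_nonneg n c = EA (verma (of_int n - 1) c)"

definition V_nonpos ::
    "int \<Rightarrow> complex \<Rightarrow> (schr, (sf \<times> (schr uea \<times> complex \<Rightarrow>\<^sub>0 int) set \<Rightarrow>\<^sub>0 int) set) rep"
  where "V_nonpos n c = EA (verma (of_int n - 2) c)"

end

theory Submission
  imports Defs "HOL-Library.Function_Algebras"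
begin

text \<open>Let \<open>v\<close> be a highest weight vector of the minimal type \<open>L(n)\<close>. The component of \<open>q v\<close> of type
  \<open>L(n - 1)\<close> vanishes by minimality, that is, \<open>(n + 1) q v = f p v\<close>. The vectors \<open>p\<^sup>k v\<close> are killed by
  \<open>e\<close>, and this relation determines the action of the whole algebra on all \<open>f\<^sup>i p\<^sup>k v\<close> with
  \<open>i \<le> n + k\<close> in terms of \<open>n\<close> and the central charge \<open>c\<close> alone. Hence the module is a quotient of one
  explicit model with types \<open>L(n), L(n + 1), \<dots>\<close>, each occurring once. For \<open>c \<noteq> 0\<close> the model is simple.
  For \<open>c = 0\<close> the types above \<open>L(n)\<close> form a submodule, which has to be mapped to zero.

  The module \<open>S\<^sub>f \<otimes> \<Delta>(l, c)\<close> has the basis \<open>f\<^sup>-\<^sup>k\<^sup>-\<^sup>1 \<otimes> q\<^sup>b v\<close>. For \<open>l = n - 1\<close> and \<open>l = - n - 2\<close> it contains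
  a vector of weight \<open>n\<close> killed by \<open>e\<close> and satisfying the relation above, hence a copy of the model. This copy
  contains the kernel of \<open>e\<close> and every vector that \<open>e\<close> maps into the copy, so it is the whole
  \<open>e\<close>-finite part. Thus \<open>V(n, c)\<close> and \<open>V(-n, c)\<close> are both isomorphic to the model.\<close>

section \<open>Linear algebra in modules over a Lie algebra\<close>

text \<open>No PBW theorem is used. The tensor product of S_f with a Verma module gets a spanning
  set by closure under generators, and independence comes from a homomorphism into functions on an
  explicit index set that sends the spanning vectors to the unit functions \<open>delta\<close>. In
  the model, [p, q] = z forces the coefficient y_k of p^(k-1) v in (n+k+1) q p^k v to satisfy
  y_(k+1) = y_k - c (n+k+1) with y_0 = 0; for c nonzero all later y_k are nonzero, which is the
  source of simplicity. The parameters n - 1 and - n - 2 are exchanged by l -> - l - 3: for c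
  nonzero the Verma module with parameter l is an sl2 Verma module of highest weight l + 1/2
  tensored with an oscillator module, and the exchange is the dot reflection of l + 1/2. The main
  obstacle is to show that the e-finite part is nowhere larger than the copy of the model; it is
  overcome by the local nilpotency of f on negative weights. In the completeness claim no central
  charge is given: finite multiplicities supply an eigenvector of z, in place of an appeal to
  Schur's lemma.\<close>

definition finsupp :: "('i \<Rightarrow> complex) \<Rightarrow> bool"
  where "finsupp a \<longleftrightarrow> finite {i. a i \<noteq> 0}"

definition delta :: "'i \<Rightarrow> 'i \<Rightarrow> complex"
  where "delta i = (\<lambda>j. if j = i then 1 else 0)"

lemma finsupp_zero [simp]: "finsupp (\<lambda>i. 0)"
  and finsupp_delta [simp]: "finsupp (delta i)"
  by (simp_all add: finsupp_def delta_def)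

lemma finsupp_add [simp, intro]: "finsupp a \<Longrightarrow> finsupp b \<Longrightarrow> finsupp (\<lambda>i. a i + b i)"
  unfolding finsupp_def by (rule finite_subset[of _ "{i. a i \<noteq> 0} \<union> {i. b i \<noteq> 0}"]) auto

lemma finsupp_mult [simp, intro]: "finsupp a \<Longrightarrow> finsupp (\<lambda>i. c i * a i)"
  unfolding finsupp_def by (rule finite_subset[of _ "{i. a i \<noteq> 0}"]) auto

text \<open>The coordinate added in a step is new and its coefficient is nonzero, so the support of
  each partial function lies inside the final one. Hypotheses restricted to the support of
  \<open>a\<close> therefore survive the induction.\<close>

lemma finsupp_induct [consumes 1, case_names zero add]:
  assumes "finsupp a" "P (\<lambda>i. 0)"
    and add: "\<And>a c i. finsupp a \<Longrightarrow> P a \<Longrightarrow> a i = 0 \<Longrightarrow> c \<noteq> 0 \<Longrightarrow> P (\<lambda>j. a j + c * delta i j)"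
  shows "P a"
proof -
  have "finite {i. a i \<noteq> 0}" using assms(1) by (simp add: finsupp_def)
  then show ?thesis
  proof (induction "{i. a i \<noteq> 0}" arbitrary: a rule: finite_induct)
    case empty
    then have "a = (\<lambda>i. 0)" by auto
    then show ?case using assms(2) by simp
  next
    case (insert i F)
    let ?b = "a(i := 0)"
    have F: "F = {j. ?b j \<noteq> 0}" using insert(2,4) by auto
    have "a i \<noteq> 0" using insert(4) by auto
    then have "P (\<lambda>j. ?b j + a i * delta i j)"
      using insert(1) by (intro add insert(3) F) (auto simp: F finsupp_def)
    moreover have "(\<lambda>j. ?b j + a i * delta i j) = a" by (auto simp: delta_def)
    ultimately show ?case by simp
  qed
qed

text \<open>The sum runs over the support of \<open>a\<close>. For infinite support it has the
  default value zero of \<open>finsum\<close>, so the closure lemmas for \<open>lc\<close> carry no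
  finiteness hypothesis.\<close>

definition lc :: "('g, 'm) rep \<Rightarrow> ('i \<Rightarrow> 'm) \<Rightarrow> ('i \<Rightarrow> complex) \<Rightarrow> 'm"
  where "lc M w a = (\<Oplus>\<^bsub>M\<^esub>i\<in>{i. a i \<noteq> 0}. a i \<odot>\<^bsub>M\<^esub> w i)"

definition mod_hom :: "'g set \<Rightarrow> ('g, 'm) rep \<Rightarrow> ('g, 'n) rep \<Rightarrow> ('m \<Rightarrow> 'n) \<Rightarrow> bool"
  where "mod_hom A M N \<phi> \<longleftrightarrow> \<phi> \<in> carrier M \<rightarrow> carrier N \<and>
    (\<forall>v\<in>carrier M. \<forall>w\<in>carrier M. \<phi> (v \<oplus>\<^bsub>M\<^esub> w) = \<phi> v \<oplus>\<^bsub>N\<^esub> \<phi> w) \<and>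
    (\<forall>c. \<forall>v\<in>carrier M. \<phi> (c \<odot>\<^bsub>M\<^esub> v) = c \<odot>\<^bsub>N\<^esub> \<phi> v) \<and>
    (\<forall>x\<in>A. \<forall>v\<in>carrier M. \<phi> (act M x v) = act N x (\<phi> v))"

lemma iso_mod_hom: "iso_mod A M N \<longleftrightarrow> (\<exists>\<phi>. bij_betw \<phi> (carrier M) (carrier N) \<and> mod_hom A M N \<phi>)"
  unfolding iso_mod_def mod_hom_def using bij_betw_imp_funcset by blast

lemma complex_field_simps [simp]:
  "carrier complex_field = UNIV" "x \<oplus>\<^bsub>complex_field\<^esub> y = x + y"
  "x \<otimes>\<^bsub>complex_field\<^esub> y = x * y" "\<one>\<^bsub>complex_field\<^esub> = 1" "\<zero>\<^bsub>complex_field\<^esub> = 0"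
  by (simp_all add: ring_of_type_algebra_def)

lemma restr_simps [simp]:
  "carrier (restr M W) = W" "add (restr M W) = add M" "zero (restr M W) = zero M"
  "module.smult (restr M W) = module.smult M" "act (restr M W) = act M"
  by (simp_all add: restr_def)

locale cmodule = module complex_field M for M :: "('g, 'm) rep" (structure)
begin

lemma smult_closed_c [simp, intro]: "x \<in> carrier M \<Longrightarrow> c \<odot> x \<in> carrier M"
  by (rule smult_closed) auto

lemma smult_add_left: "x \<in> carrier M \<Longrightarrow> (a + b) \<odot> x = a \<odot> x \<oplus> b \<odot> x"
  using smult_l_distr[of a b x] by simp

lemma smult_add_right: "x \<in> carrier M \<Longrightarrow> y \<in> carrier M \<Longrightarrow> a \<odot> (x \<oplus> y) = a \<odot> x \<oplus> a \<odot> y"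
  using smult_r_distr[of a x y] by simp

lemma smult_smult: "x \<in> carrier M \<Longrightarrow> a \<odot> (b \<odot> x) = (a * b) \<odot> x"
  using smult_assoc1[of a b x] by simp

lemma smult_1 [simp]: "x \<in> carrier M \<Longrightarrow> 1 \<odot> x = x"
  using smult_one[of x] by simp

lemma smult_0 [simp]: "x \<in> carrier M \<Longrightarrow> 0 \<odot> x = \<zero>"
  using smult_l_null[of x] by simp

lemma smult_zero [simp]: "a \<odot> \<zero> = \<zero>"
  using smult_r_null[of a] by simp

lemma uminus_smult: "x \<in> carrier M \<Longrightarrow> \<ominus> x = (- 1) \<odot> x"
proof -
  assume x: "x \<in> carrier M"
  have "(- 1) \<odot> x \<oplus> x = (- 1 + 1) \<odot> x" using x by (subst smult_add_left) auto
  then have "(- 1) \<odot> x \<oplus> x = \<zero>" using x by simp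
  then show ?thesis using x by (metis minus_equality smult_closed_c)
qed

lemma minus_smult: "x \<in> carrier M \<Longrightarrow> y \<in> carrier M \<Longrightarrow> x \<ominus> y = x \<oplus> (- 1) \<odot> y"
  by (simp add: a_minus_def uminus_smult)

lemma smult_collect: "x \<in> carrier M \<Longrightarrow> a \<odot> x \<oplus> b \<odot> x = (a + b) \<odot> x"
  by (simp add: smult_add_left)

lemma smult_collect1: "x \<in> carrier M \<Longrightarrow> x \<oplus> b \<odot> x = (1 + b) \<odot> x"
  by (simp add: smult_add_left)

lemma smult_cancel:
  assumes "a \<noteq> 0" "x \<in> carrier M" "y \<in> carrier M" "a \<odot> x = a \<odot> y" shows "x = y"
proof -
  have "x = inverse a \<odot> (a \<odot> x)" using assms(1,2) by (simp add: smult_smult)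
  also have "\<dots> = y" using assms(1,3) by (simp add: assms(4) smult_smult)
  finally show ?thesis .
qed

lemma smult_eq_0: "a \<odot> x = \<zero> \<Longrightarrow> x \<in> carrier M \<Longrightarrow> a = 0 \<or> x = \<zero>"
  using smult_cancel[of a x \<zero>] by auto

lemma submodule_iff: "submodule H complex_field M \<longleftrightarrow> H \<subseteq> carrier M \<and> \<zero> \<in> H \<and>
   (\<forall>a\<in>H. \<forall>b\<in>H. a \<oplus> b \<in> H) \<and> (\<forall>c. \<forall>a\<in>H. c \<odot> a \<in> H)"
proof
  assume s: "submodule H complex_field M"
  from submoduleE[OF s] show "H \<subseteq> carrier M \<and> \<zero> \<in> H \<and>
   (\<forall>a\<in>H. \<forall>b\<in>H. a \<oplus> b \<in> H) \<and> (\<forall>c. \<forall>a\<in>H. c \<odot> a \<in> H)"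
    by (metis (no_types, lifting) UNIV_I all_not_in_conv complex_field_simps(1) smult_0 subsetD)
next
  assume "H \<subseteq> carrier M \<and> \<zero> \<in> H \<and> (\<forall>a\<in>H. \<forall>b\<in>H. a \<oplus> b \<in> H) \<and> (\<forall>c. \<forall>a\<in>H. c \<odot> a \<in> H)"
  then show "submodule H complex_field M"
    by (intro submoduleI) (auto simp: uminus_smult subset_iff)
qed

lemma submoduleD:
  assumes "submodule H complex_field M"
  shows "H \<subseteq> carrier M" "\<zero> \<in> H" "a \<in> H \<Longrightarrow> b \<in> H \<Longrightarrow> a \<oplus> b \<in> H" "a \<in> H \<Longrightarrow> c \<odot> a \<in> H"
    "a \<in> H \<Longrightarrow> a \<in> carrier M" "a \<in> H \<Longrightarrow> b \<in> H \<Longrightarrow> a \<ominus> b \<in> H"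
  using assms unfolding submodule_iff by (auto simp: minus_smult subset_iff)

lemma submodule_finsum:
  assumes "submodule H complex_field M" "\<And>i. i \<in> A \<Longrightarrow> g i \<in> H"
  shows "finsum M g A \<in> H"
proof (cases "finite A")
  case True
  then show ?thesis using assms(2)
  proof (induction A rule: finite_induct)
    case empty
    then show ?case using submoduleD(2)[OF assms(1)] by simp
  next
    case (insert a F)
    then show ?case using submoduleD[OF assms(1)] by (subst finsum_insert) auto
  qed
next
  case False
  then show ?thesis using submoduleD(2)[OF assms(1)] by (simp add: finsum_infinite)
qed

lemma lspan_submodule:
  assumes "B \<subseteq> carrier M" shows "submodule (lspan M B) complex_field M"
proof -
  have "submodule (carrier M) complex_field M" by (rule carrier_is_submodule)
  then show ?thesis
    using assms unfolding lspan_def hull_def submodule_iff by blast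
qed

lemma lspan_incl: "B \<subseteq> lspan M B"
  by (simp add: lspan_def hull_subset)

lemma lspan_least: "submodule H complex_field M \<Longrightarrow> B \<subseteq> H \<Longrightarrow> lspan M B \<subseteq> H"
  by (simp add: lspan_def hull_minimal)

lemma lspan_mono: "B \<subseteq> C \<Longrightarrow> lspan M B \<subseteq> lspan M C"
  by (simp add: lspan_def hull_mono)

lemma finsum_superset:
  assumes "finite B" "A \<subseteq> B" "\<And>i. i \<in> B - A \<Longrightarrow> g i = \<zero>" "\<And>i. i \<in> A \<Longrightarrow> g i \<in> carrier M"
  shows "finsum M g A = finsum M g B"
proof -
  have "finsum M g B = finsum M g (A \<union> (B - A))" using assms(2) by (simp add: Un_absorb1)
  also have "\<dots> = finsum M g A \<oplus> finsum M g (B - A)"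
    using assms by (intro M.finsum_Un_disjoint) (auto intro: finite_subset)
  also have "finsum M g (B - A) = \<zero>"
    using M.finsum_cong'[of "B - A" "B - A" "\<lambda>_. \<zero>" g] assms by (simp add: finsum_zero)
  finally show ?thesis using assms by (simp add: Pi_def)
qed

lemma finsum_hom:
  assumes "finite A" "\<And>i. i \<in> A \<Longrightarrow> g i \<in> carrier M"
    and "\<And>u v. u \<in> carrier M \<Longrightarrow> v \<in> carrier M \<Longrightarrow> \<phi> (u \<oplus> v) = \<phi> u \<oplus> \<phi> v" "\<phi> \<zero> = \<zero>"
      "\<And>u. u \<in> carrier M \<Longrightarrow> \<phi> u \<in> carrier M"
  shows "\<phi> (finsum M g A) = finsum M (\<lambda>i. \<phi> (g i)) A"
  using assms(1,2)
proof (induction A rule: finite_induct)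
  case (insert a F)
  then show ?case using assms(3-5) by (simp add: finsum_insert Pi_def)
qed (simp add: assms(4))

lemma finsum_smult:
  "finite A \<Longrightarrow> (\<And>i. i \<in> A \<Longrightarrow> g i \<in> carrier M) \<Longrightarrow>
    c \<odot> (finsum M g A) = finsum M (\<lambda>i. c \<odot> (g i)) A"
  by (rule finsum_hom) (auto simp: smult_add_right)

lemma lc_eq:
  assumes "finite A" "\<And>i. a i \<noteq> 0 \<Longrightarrow> i \<in> A" "\<And>i. w i \<in> carrier M"
  shows "lc M w a = (\<Oplus>i\<in>A. a i \<odot> w i)"
  unfolding lc_def using assms by (intro finsum_superset) auto

lemma lc_closed [simp, intro]: "(\<And>i. w i \<in> carrier M) \<Longrightarrow> lc M w a \<in> carrier M"
  unfolding lc_def by (rule finsum_closed) auto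

lemma lc_zero [simp]: "lc M w (\<lambda>i. 0) = \<zero>"
  by (simp add: lc_def)

lemma lc_add:
  assumes "finsupp a" "finsupp b" "\<And>i. w i \<in> carrier M"
  shows "lc M w (\<lambda>i. a i + b i) = lc M w a \<oplus> lc M w b"
proof -
  let ?A = "{i. a i \<noteq> 0} \<union> {i. b i \<noteq> 0}"
  have f: "finite ?A" using assms by (simp add: finsupp_def)
  have "lc M w (\<lambda>i. a i + b i) = (\<Oplus>i\<in>?A. (a i + b i) \<odot> w i)"
    by (rule lc_eq[OF f]) (use assms in auto)
  also have "\<dots> = (\<Oplus>i\<in>?A. a i \<odot> w i \<oplus> b i \<odot> w i)"
    using assms by (simp add: smult_add_left)
  also have "\<dots> = (\<Oplus>i\<in>?A. a i \<odot> w i) \<oplus> (\<Oplus>i\<in>?A. b i \<odot> w i)"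
    using assms by (intro finsum_addf) auto
  also have "(\<Oplus>i\<in>?A. a i \<odot> w i) = lc M w a" by (rule lc_eq[symmetric, OF f]) (use assms in auto)
  also have "(\<Oplus>i\<in>?A. b i \<odot> w i) = lc M w b" by (rule lc_eq[symmetric, OF f]) (use assms in auto)
  finally show ?thesis .
qed

lemma lc_smult:
  assumes "finsupp a" "\<And>i. w i \<in> carrier M"
  shows "lc M w (\<lambda>i. c * a i) = c \<odot> lc M w a"
proof -
  have f: "finite {i. a i \<noteq> 0}" using assms by (simp add: finsupp_def)
  have "lc M w (\<lambda>i. c * a i) = (\<Oplus>i\<in>{i. a i \<noteq> 0}. (c * a i) \<odot> w i)"
    by (rule lc_eq[OF f]) (use assms in auto)
  also have "\<dots> = (\<Oplus>i\<in>{i. a i \<noteq> 0}. c \<odot> (a i \<odot> w i))"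
    using assms by (simp add: smult_smult)
  also have "\<dots> = c \<odot> lc M w a"
    unfolding lc_def using assms f by (intro finsum_smult[symmetric]) auto
  finally show ?thesis .
qed

lemma lc_delta [simp]: "(\<And>i. w i \<in> carrier M) \<Longrightarrow> lc M w (delta i) = w i"
  by (subst lc_eq[of "{i}"]) (auto simp: delta_def finsum_insert split: if_splits)

lemma lc_submodule:
  assumes "submodule H complex_field M" "\<And>i. a i \<noteq> 0 \<Longrightarrow> w i \<in> H"
  shows "lc M w a \<in> H"
  unfolding lc_def using assms by (intro submodule_finsum) (auto simp: submodule_iff)

lemma lspan_lc:
  assumes w: "\<And>i. w i \<in> carrier M" and "v \<in> lspan M (range w)"
  obtains a where "finsupp a" "v = lc M w a"
proof -
  have "lspan M (range w) \<subseteq> {lc M w a | a. finsupp a}"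
  proof (rule lspan_least)
    show "submodule {lc M w a | a. finsupp a} complex_field M"
      unfolding submodule_iff
    proof (intro conjI ballI allI subsetI)
      show "\<zero> \<in> {lc M w a | a. finsupp a}" by (intro CollectI exI[of _ "\<lambda>i. 0"]) (simp only: lc_zero finsupp_zero simp_thms)
      show "x \<oplus> y \<in> {lc M w a | a. finsupp a}"
        if "x \<in> {lc M w a | a. finsupp a}" "y \<in> {lc M w a | a. finsupp a}" for x y
      proof -
        from that obtain a b where ab: "finsupp a" "finsupp b" "x = lc M w a" "y = lc M w b" by auto
        show ?thesis using lc_add[OF ab(1,2) w] ab by (intro CollectI exI[of _ "\<lambda>i. a i + b i"]) auto
      qed
      show "c \<odot> x \<in> {lc M w a | a. finsupp a}" if "x \<in> {lc M w a | a. finsupp a}" for x c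
      proof -
        from that obtain a where ab: "finsupp a" "x = lc M w a" by auto
        show ?thesis using lc_smult[where c = c, OF ab(1) w] ab
          by (intro CollectI exI[of _ "\<lambda>i. c * a i"]) auto
      qed
    qed (use w in auto)
    show "range w \<subseteq> {lc M w a | a. finsupp a}"
    proof
      fix x assume "x \<in> range w"
      then obtain i where "x = w i" by auto
      then show "x \<in> {lc M w a | a. finsupp a}"
        using lc_delta[of w i] w by (intro CollectI exI[of _ "delta i"]) auto
    qed
  qed
  then show ?thesis using assms(2) that by auto
qed

end

text \<open>A vector space on which a set \<open>A\<close> acts by linear maps; no Lie algebra relations are imposed,
  so that \<open>sl2\<close>-submodules of modules over the whole algebra are covered.\<close>

locale amodule = cmodule M for M :: "('g, 'm) rep" (structure) +
  fixes A :: "'g set"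
  assumes act_cl [simp, intro]: "x \<in> A \<Longrightarrow> v \<in> carrier M \<Longrightarrow> act M x v \<in> carrier M"
    and act_add: "x \<in> A \<Longrightarrow> v \<in> carrier M \<Longrightarrow> w \<in> carrier M \<Longrightarrow> act M x (v \<oplus> w) = act M x v \<oplus> act M x w"
    and act_smult: "x \<in> A \<Longrightarrow> v \<in> carrier M \<Longrightarrow> act M x (c \<odot> v) = c \<odot> act M x v"
begin

lemma submod_carrier: "submod A (carrier M) M"
  by (auto simp: submod_def carrier_is_submodule)

lemma submod_zero: "submod A {\<zero>} M"
  using act_smult[of _ \<zero> 0] by (auto simp: submod_def submodule_iff)

end

context lie_module
begin

sublocale cmodule by unfold_locales

sublocale amodule M UNIV
  by unfold_locales (auto simp: act_closed act_add_right act_smult_right)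

lemma act_closed' [simp, intro]: "v \<in> carrier M \<Longrightarrow> act M x v \<in> carrier M"
  by (rule act_closed)

lemma act_zero [simp]: "act M x \<zero> = \<zero>"
  using act_smult_right[of \<zero> x 0] by simp

lemma act_pow_closed [simp, intro]: "v \<in> carrier M \<Longrightarrow> (act M x ^^ k) v \<in> carrier M"
  by (induction k) auto

lemma act_pow_zero [simp]: "(act M x ^^ k) \<zero> = \<zero>"
  by (induction k) auto

lemma act_pow_add:
  "v \<in> carrier M \<Longrightarrow> w \<in> carrier M \<Longrightarrow> (act M x ^^ k) (v \<oplus> w) = (act M x ^^ k) v \<oplus> (act M x ^^ k) w"
  by (induction k) (auto simp: act_add_right)

lemma act_pow_smult: "v \<in> carrier M \<Longrightarrow> (act M x ^^ k) (c \<odot> v) = c \<odot> (act M x ^^ k) v"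
  by (induction k) (auto simp: act_smult_right)

lemma act_swap:
  assumes "v \<in> carrier M" "bracket x y = w"
  shows "act M x (act M y v) = act M y (act M x v) \<oplus> act M w v"
proof -
  have "act M w v = act M x (act M y v) \<oplus> \<ominus> act M y (act M x v)"
    using act_bracket[OF assms(1), of x y] assms(2) by (simp add: a_minus_def)
  then show ?thesis
    using assms(1) by (simp add: a_comm[of "act M y (act M x v)"] a_assoc l_neg)
qed

lemma act_preimage_submodule:
  assumes "submodule H complex_field M"
  shows "submodule {v \<in> carrier M. act M x v \<in> H} complex_field M"
  using assms unfolding submodule_iff by (auto simp: act_add_right act_smult_right)

lemma lspan_act_closed:
  assumes "B \<subseteq> carrier M" "\<And>b. b \<in> B \<Longrightarrow> act M x b \<in> lspan M B" "v \<in> lspan M B"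
  shows "act M x v \<in> lspan M B"
proof -
  have "lspan M B \<subseteq> {v \<in> carrier M. act M x v \<in> lspan M B}"
    using assms by (intro lspan_least act_preimage_submodule lspan_submodule) auto
  then show ?thesis using assms(3) by auto
qed

text \<open>Compares the action of \<open>x\<close> on combinations with an operator
  \<open>A\<close> on coefficients. The comparison is demanded only for \<open>w i\<close> with
  \<open>i\<close> in the support of \<open>a\<close>, since in the model the coordinate formula for
  q is valid only at indices inside the carrier.\<close>

lemma lc_hom:
  assumes w: "\<And>i. w i \<in> carrier M"
    and A_add: "\<And>a b. A (\<lambda>i. a i + b i) = (\<lambda>i. A a i + A b i)"
    and A_smult: "\<And>c a. A (\<lambda>i. c * a i) = (\<lambda>i. c * A a i)"
    and A_fin: "\<And>i. finsupp (A (delta i))"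
    and base: "\<And>i. a i \<noteq> 0 \<Longrightarrow> act M x (w i) = lc M w (A (delta i))"
    and a: "finsupp a"
  shows "act M x (lc M w a) = lc M w (A a)" "finsupp (A a)"
proof -
  have A0: "A (\<lambda>i. 0) = (\<lambda>i. 0)" using A_smult[of 0 "\<lambda>i. 0"] by simp
  have fin: "finsupp (A b)" if "finsupp b" for b using that
    by (induction b rule: finsupp_induct) (auto simp: A0 A_add A_smult A_fin)
  then show "finsupp (A a)" using a .
  from a base show "act M x (lc M w a) = lc M w (A a)"
  proof (induction a rule: finsupp_induct)
    case zero
    then show ?case by (simp add: A0)
  next
    case (add b c i)
    have b: "act M x (w j) = lc M w (A (delta j))" if "b j \<noteq> 0" for j
      using that add.hyps by (intro add.prems) (auto simp: delta_def)
    have i: "act M x (w i) = lc M w (A (delta i))"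
      using add.hyps by (intro add.prems) (auto simp: delta_def)
    show ?case
      using add.hyps add.IH b w
      by (simp add: lc_add lc_smult act_add_right act_smult_right A_add A_smult fin A_fin i)
  qed
qed

end

section \<open>Homomorphisms and transport of structure\<close>

lemma (in lie_module) amodule_restr:
  assumes "submod A W M" shows "amodule (restr M W) A"
proof -
  have W: "submodule W complex_field M" using assms by (simp add: submod_def)
  interpret s: module complex_field "restr M W"
    using submodule.submodule_is_module[OF W module_axioms] by (simp add: restr_def)
  show ?thesis
    by unfold_locales
      (use assms submoduleD(1)[OF W] in \<open>auto simp: submod_def act_add_right act_smult_right subset_iff\<close>)
qed

lemma (in lie_module) amodule_any: "amodule M A"
  by unfold_locales (auto simp: act_add_right act_smult_right)

lemma (in lie_module) submodule_restr:
  assumes "submodule W complex_field M"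
  shows "submodule U complex_field (restr M W) \<longleftrightarrow> submodule U complex_field M \<and> U \<subseteq> W"
proof -
  have W: "submod {} W M" using assms by (simp add: submod_def)
  interpret s: amodule "restr M W" "{}" by (rule amodule_restr[OF W])
  show ?thesis unfolding s.submodule_iff submodule_iff
    using assms submoduleD(1) by auto
qed

lemma (in lie_module) submod_restr:
  assumes "submod A W M"
  shows "submod A U (restr M W) \<longleftrightarrow> submod A U M \<and> U \<subseteq> W"
  using submodule_restr[of W U] assms by (auto simp: submod_def)

lemma (in lie_module) lie_module_restr:
  assumes "submod UNIV W M" shows "lie_module (restr M W)"
proof -
  have W: "submodule W complex_field M" using assms by (simp add: submod_def)
  interpret s: amodule "restr M W" UNIV by (rule amodule_restr[OF assms])
  have W': "v \<in> W \<Longrightarrow> v \<in> carrier M" for v using submoduleD(1)[OF W] by auto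
  have a: "v \<in> W \<Longrightarrow> act M x v \<in> W" for v x using assms by (auto simp: submod_def)
  show ?thesis
  proof (unfold_locales, goal_cases)
    case (6 v x y)
    then have v: "v \<in> W" by simp
    have "act M x (act M y v) \<ominus>\<^bsub>restr M W\<^esub> act M y (act M x v)
      = act M x (act M y v) \<ominus>\<^bsub>M\<^esub> act M y (act M x v)"
      using s.minus_smult[of "act M x (act M y v)" "act M y (act M x v)"] v a W'
      by (simp add: minus_smult)
    then show ?case using act_bracket[OF W'[OF v]] by simp
  qed (use W' a in \<open>auto simp: act_add_left act_lscale act_add_right act_smult_right\<close>)
qed

locale mod_hom_loc = M: amodule M A + N: amodule N A
  for M :: "('g, 'm) rep" and N :: "('g, 'n) rep" and A +
  fixes \<phi>
  assumes hom: "mod_hom A M N \<phi>"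
begin

lemma hom_closed [simp, intro]: "v \<in> carrier M \<Longrightarrow> \<phi> v \<in> carrier N"
  and hom_add: "v \<in> carrier M \<Longrightarrow> w \<in> carrier M \<Longrightarrow> \<phi> (v \<oplus>\<^bsub>M\<^esub> w) = \<phi> v \<oplus>\<^bsub>N\<^esub> \<phi> w"
  and hom_smult: "v \<in> carrier M \<Longrightarrow> \<phi> (c \<odot>\<^bsub>M\<^esub> v) = c \<odot>\<^bsub>N\<^esub> \<phi> v"
  and hom_act: "x \<in> A \<Longrightarrow> v \<in> carrier M \<Longrightarrow> \<phi> (act M x v) = act N x (\<phi> v)"
  using hom by (auto simp: mod_hom_def)

lemma hom_zero [simp]: "\<phi> \<zero>\<^bsub>M\<^esub> = \<zero>\<^bsub>N\<^esub>"
  using hom_smult[of "\<zero>\<^bsub>M\<^esub>" 0] by simp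

lemma hom_minus: "v \<in> carrier M \<Longrightarrow> w \<in> carrier M \<Longrightarrow> \<phi> (v \<ominus>\<^bsub>M\<^esub> w) = \<phi> v \<ominus>\<^bsub>N\<^esub> \<phi> w"
  by (simp add: M.minus_smult N.minus_smult hom_add hom_smult)

lemma hom_pow: "x \<in> A \<Longrightarrow> v \<in> carrier M \<Longrightarrow> \<phi> ((act M x ^^ k) v) = (act N x ^^ k) (\<phi> v)
    \<and> (act M x ^^ k) v \<in> carrier M"
  by (induction k) (auto simp: hom_act)

lemma hom_finsum:
  "finite I \<Longrightarrow> (\<And>i. i \<in> I \<Longrightarrow> g i \<in> carrier M) \<Longrightarrow> \<phi> (finsum M g I) = finsum N (\<lambda>i. \<phi> (g i)) I"
proof (induction I rule: finite_induct)
  case (insert a F)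
  then show ?case by (simp add: M.finsum_insert N.finsum_insert Pi_def hom_add)
qed simp

lemma image_submodule:
  assumes "submodule W complex_field M" shows "submodule (\<phi> ` W) complex_field N"
proof -
  note W = M.submoduleD[OF assms]
  show ?thesis
    unfolding N.submodule_iff
  proof (intro conjI ballI allI)
    show "\<zero>\<^bsub>N\<^esub> \<in> \<phi> ` W" using W(2) by (metis hom_zero imageI)
    show "a \<oplus>\<^bsub>N\<^esub> b \<in> \<phi> ` W" if "a \<in> \<phi> ` W" "b \<in> \<phi> ` W" for a b
      using that W(3,5) by (auto simp: hom_add[symmetric])
    show "c \<odot>\<^bsub>N\<^esub> a \<in> \<phi> ` W" if "a \<in> \<phi> ` W" for a c
      using that W(4,5) by (auto simp: hom_smult[symmetric])
  qed (use W in auto)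
qed

lemma image_submod: "submod A W M \<Longrightarrow> submod A (\<phi> ` W) N"
  using image_submodule[of W] M.submoduleD(5)[of W] unfolding submod_def
  by (auto simp: hom_act[symmetric])

lemma vimage_submodule:
  assumes "submodule W complex_field N" shows "submodule {v \<in> carrier M. \<phi> v \<in> W} complex_field M"
  using N.submoduleD[OF assms] unfolding M.submodule_iff by (auto simp: hom_add hom_smult)

lemma vimage_submod: "submod A W N \<Longrightarrow> submod A {v \<in> carrier M. \<phi> v \<in> W} M"
  using vimage_submodule[of W] unfolding submod_def by (auto simp: hom_act)

lemma kernel_submod: "submod A {v \<in> carrier M. \<phi> v = \<zero>\<^bsub>N\<^esub>} M"
  using vimage_submod[OF N.submod_zero] by simp

lemma inj_onI_kernel:
  assumes "\<And>v. v \<in> carrier M \<Longrightarrow> \<phi> v = \<zero>\<^bsub>N\<^esub> \<Longrightarrow> v = \<zero>\<^bsub>M\<^esub>"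
  shows "inj_on \<phi> (carrier M)"
proof (rule inj_onI)
  fix v w assume vw: "v \<in> carrier M" "w \<in> carrier M" "\<phi> v = \<phi> w"
  then have "\<phi> (v \<ominus>\<^bsub>M\<^esub> w) = \<zero>\<^bsub>N\<^esub>" by (simp add: hom_minus N.minus_smult N.smult_collect1)
  then have "v \<ominus>\<^bsub>M\<^esub> w = \<zero>\<^bsub>M\<^esub>" using vw by (intro assms) auto
  then show "v = w" using vw M.minus_equality[of v "\<ominus>\<^bsub>M\<^esub> w"] by (simp add: a_minus_def)
qed

lemma simple_inj:
  assumes "simple_mod A M" "v \<in> carrier M" "\<phi> v \<noteq> \<zero>\<^bsub>N\<^esub>"
  shows "inj_on \<phi> (carrier M)"
proof -
  have "{v \<in> carrier M. \<phi> v = \<zero>\<^bsub>N\<^esub>} = {\<zero>\<^bsub>M\<^esub>}"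
    using assms kernel_submod unfolding simple_mod_def by blast
  then show ?thesis by (intro inj_onI_kernel) blast
qed

lemma simple_surj:
  assumes "simple_mod A N" "v \<in> carrier M" "\<phi> v \<noteq> \<zero>\<^bsub>N\<^esub>"
  shows "\<phi> ` carrier M = carrier N"
  using image_submod[OF M.submod_carrier] assms unfolding simple_mod_def by blast

lemma lspan_image:
  assumes "B \<subseteq> carrier M" shows "\<phi> ` lspan M B = lspan N (\<phi> ` B)"
proof
  have B: "\<phi> ` B \<subseteq> carrier N" using assms by auto
  show "lspan N (\<phi> ` B) \<subseteq> \<phi> ` lspan M B"
    using assms M.lspan_incl by (intro N.lspan_least image_submodule M.lspan_submodule) auto
  have "lspan M B \<subseteq> {v \<in> carrier M. \<phi> v \<in> lspan N (\<phi> ` B)}"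
    using assms N.lspan_incl[of "\<phi> ` B"] by (intro M.lspan_least vimage_submodule N.lspan_submodule B) auto
  then show "\<phi> ` lspan M B \<subseteq> lspan N (\<phi> ` B)" by auto
qed

lemma fin_dim_image: "fin_dim M W \<Longrightarrow> fin_dim N (\<phi> ` W)"
proof -
  assume "fin_dim M W"
  then obtain B where "finite B" "B \<subseteq> carrier M" "W = lspan M B" by (auto simp: fin_dim_def)
  then show "fin_dim N (\<phi> ` W)"
    unfolding fin_dim_def by (intro exI[of _ "\<phi> ` B"]) (auto simp: lspan_image)
qed

lemma inv_hom:
  assumes "bij_betw \<phi> (carrier M) (carrier N)"
  shows "mod_hom A N M (inv_into (carrier M) \<phi>)" (is "mod_hom _ _ _ ?\<psi>")
    and "bij_betw (inv_into (carrier M) \<phi>) (carrier N) (carrier M)"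
proof -
  show b: "bij_betw ?\<psi> (carrier N) (carrier M)" by (rule bij_betw_inv_into[OF assms])
  have c: "?\<psi> v \<in> carrier M" if "v \<in> carrier N" for v using b that by (auto simp: bij_betw_def)
  have l: "\<phi> (?\<psi> v) = v" if "v \<in> carrier N" for v
    using assms that by (simp add: bij_betw_def f_inv_into_f)
  have r: "?\<psi> (\<phi> v) = v" if "v \<in> carrier M" for v
    using assms that by (simp add: bij_betw_def)
  show "mod_hom A N M ?\<psi>"
    unfolding mod_hom_def
  proof (intro conjI ballI allI)
    fix v w assume vw: "v \<in> carrier N" "w \<in> carrier N"
    have "\<phi> (?\<psi> v \<oplus>\<^bsub>M\<^esub> ?\<psi> w) = v \<oplus>\<^bsub>N\<^esub> w" using vw c by (simp add: hom_add l)
    then show "?\<psi> (v \<oplus>\<^bsub>N\<^esub> w) = ?\<psi> v \<oplus>\<^bsub>M\<^esub> ?\<psi> w" using r vw c by (metis M.a_closed)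
  next
    fix k v assume v: "v \<in> carrier N"
    have "\<phi> (k \<odot>\<^bsub>M\<^esub> ?\<psi> v) = k \<odot>\<^bsub>N\<^esub> v" using v c by (simp add: hom_smult l)
    then show "?\<psi> (k \<odot>\<^bsub>N\<^esub> v) = k \<odot>\<^bsub>M\<^esub> ?\<psi> v" using r v c by (metis M.smult_closed_c)
  next
    fix x v assume v: "x \<in> A" "v \<in> carrier N"
    have "\<phi> (act M x (?\<psi> v)) = act N x v" using v c by (simp add: hom_act l)
    then show "?\<psi> (act N x v) = act M x (?\<psi> v)" using r v c by (metis M.act_cl)
  qed (use c in auto)
qed

lemma simple_transport:
  assumes "bij_betw \<phi> (carrier M) (carrier N)" "simple_mod A M"
  shows "simple_mod A N"
  unfolding simple_mod_def
proof (intro conjI allI impI)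
  have surj: "\<phi> ` carrier M = carrier N" using assms by (simp add: bij_betw_def)
  obtain v where v: "v \<in> carrier M" "v \<noteq> \<zero>\<^bsub>M\<^esub>"
    using assms(2) M.zero_closed unfolding simple_mod_def by blast
  have "\<phi> v \<noteq> \<zero>\<^bsub>N\<^esub>"
    using v assms(1) hom_zero by (metis M.zero_closed bij_betw_def inj_onD)
  with v show "carrier N \<noteq> {\<zero>\<^bsub>N\<^esub>}" by (metis hom_closed singletonD)
  fix W assume W: "submod A W N"
  then have "W \<subseteq> carrier N" by (simp add: submod_def N.submodule_iff)
  then have "W = \<phi> ` {v \<in> carrier M. \<phi> v \<in> W}" using surj by auto
  moreover have "{v \<in> carrier M. \<phi> v \<in> W} = {\<zero>\<^bsub>M\<^esub>} \<or> {v \<in> carrier M. \<phi> v \<in> W} = carrier M"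
    using vimage_submod[OF W] assms(2) unfolding simple_mod_def by blast
  ultimately show "W = {\<zero>\<^bsub>N\<^esub>} \<or> W = carrier N" using surj by fastforce
qed

end

lemma iso_mod_sym:
  assumes "amodule M A" "amodule N A" "iso_mod A M N" shows "iso_mod A N M"
proof -
  obtain \<phi> where \<phi>: "bij_betw \<phi> (carrier M) (carrier N)" "mod_hom A M N \<phi>"
    using assms(3) by (auto simp: iso_mod_hom)
  then interpret mod_hom_loc M N A \<phi> using assms by (simp add: mod_hom_loc_def mod_hom_loc_axioms_def)
  show ?thesis using inv_hom[OF \<phi>(1)] by (auto simp: iso_mod_hom)
qed

lemma iso_mod_trans:
  assumes "iso_mod A M N" "iso_mod A N P" shows "iso_mod A M P"
proof -
  from assms obtain \<phi> \<psi> where "bij_betw \<phi> (carrier M) (carrier N)" "mod_hom A M N \<phi>"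
    "bij_betw \<psi> (carrier N) (carrier P)" "mod_hom A N P \<psi>"
    by (auto simp: iso_mod_hom)
  then have "bij_betw (\<psi> \<circ> \<phi>) (carrier M) (carrier P) \<and> mod_hom A M P (\<psi> \<circ> \<phi>)"
    by (auto simp: mod_hom_def Pi_def intro: bij_betw_trans)
  then show ?thesis by (auto simp: iso_mod_hom)
qed

lemma mod_hom_subset: "mod_hom A M N \<phi> \<Longrightarrow> B \<subseteq> A \<Longrightarrow> mod_hom B M N \<phi>"
  by (auto simp: mod_hom_def)

text \<open>Since \<open>h = [e, f]\<close>, \<open>p = [e, q]\<close> and \<open>z = [p, q]\<close>, it suffices to look at \<open>e\<close>, \<open>f\<close>, \<open>q\<close>.\<close>

lemma submod_generators:
  fixes N :: "(schr, 'm) rep" (structure)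
  assumes "lie_module N" "submodule W complex_field N"
    and efq: "\<And>x w. x \<in> {\<ee>, \<ff>, \<qq>} \<Longrightarrow> w \<in> W \<Longrightarrow> act N x w \<in> W"
  shows "submod UNIV W N"
proof -
  interpret N: lie_module N by fact
  note W = N.submoduleD[OF assms(2)]
  have br: "act N (bracket x y) w \<in> W"
    if "\<And>w. w \<in> W \<Longrightarrow> act N x w \<in> W" "\<And>w. w \<in> W \<Longrightarrow> act N y w \<in> W" "w \<in> W" for x y w
    using that W by (simp add: N.act_bracket)
  have e: "act N \<ee> w \<in> W" and f: "act N \<ff> w \<in> W" and q: "act N \<qq> w \<in> W" if "w \<in> W" for w
    using efq that by auto
  have h: "act N \<hh> w \<in> W" if "w \<in> W" for w
    using br[of \<ee> \<ff> w] e f that by (simp add: schr_relations)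
  have p: "act N \<pp> w \<in> W" if "w \<in> W" for w
    using br[of \<ee> \<qq> w] e q that by (simp add: schr_relations)
  have z: "act N \<zz> w \<in> W" if "w \<in> W" for w
    using br[of \<pp> \<qq> w] p q that by (simp add: schr_relations)
  have "act N x w \<in> W" if "w \<in> W" for x w
    by (subst schr_basis[of x]) (use that W e f h p q z in \<open>simp add: N.act_add_left N.act_lscale\<close>)
  then show ?thesis using assms(2) by (auto simp: submod_def)
qed

lemma mod_hom_bracket:
  assumes "lie_module M" "lie_module N" "mod_hom {x, y} M N \<phi>"
  shows "mod_hom {bracket x y} M N \<phi>"
proof -
  interpret M: lie_module M by fact
  interpret N: lie_module N by fact
  interpret mod_hom_loc M N "{x, y}" \<phi>
    using assms by (simp add: mod_hom_loc_def mod_hom_loc_axioms_def M.amodule_any N.amodule_any)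
  show ?thesis using hom
    by (simp add: mod_hom_def M.act_bracket N.act_bracket hom_minus hom_act)
qed

lemma mod_hom_generators:
  fixes M :: "(schr, 'm) rep" and N :: "(schr, 'n) rep"
  assumes "lie_module M" "lie_module N" "mod_hom {\<ee>, \<ff>, \<qq>} M N \<phi>"
  shows "mod_hom UNIV M N \<phi>"
proof -
  interpret M: lie_module M by fact
  interpret N: lie_module N by fact
  have un: "mod_hom {x, y} M N \<phi>" if "mod_hom {x} M N \<phi>" "mod_hom {y} M N \<phi>" for x y
    using that by (auto simp: mod_hom_def)
  have e: "mod_hom {\<ee>} M N \<phi>" and f: "mod_hom {\<ff>} M N \<phi>" and q: "mod_hom {\<qq>} M N \<phi>"
    using assms(3) by (auto simp: mod_hom_def)
  have h: "mod_hom {\<hh>} M N \<phi>" and p: "mod_hom {\<pp>} M N \<phi>"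
    using mod_hom_bracket[OF assms(1,2) un[OF e f]] mod_hom_bracket[OF assms(1,2) un[OF e q]]
    by (simp_all add: schr_relations)
  have z: "mod_hom {\<zz>} M N \<phi>"
    using mod_hom_bracket[OF assms(1,2) un[OF p q]] by (simp add: schr_relations)
  have "\<phi> (act M x v) = act N x (\<phi> v)" if v: "v \<in> carrier M" for x v
  proof -
    have nv: "\<phi> v \<in> carrier N" using e v by (auto simp: mod_hom_def)
    show ?thesis
      by (subst (1 2) schr_basis[of x])
        (use e f q h p z v nv in \<open>simp add: M.act_add_left M.act_lscale N.act_add_left N.act_lscale mod_hom_def\<close>)
  qed
  then show ?thesis using e by (simp add: mod_hom_def)
qed

lemma mod_hom_sl2_generators:
  fixes M :: "(schr, 'm) rep" and N :: "(schr, 'n) rep"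
  assumes "lie_module M" "lie_module N" "mod_hom {\<ee>, \<ff>} M N \<phi>"
  shows "mod_hom sl2 M N \<phi>"
proof -
  interpret M: lie_module M by fact
  interpret N: lie_module N by fact
  have h: "mod_hom {\<hh>} M N \<phi>"
    using mod_hom_bracket[OF assms] by (simp add: schr_relations)
  have b: "x = lscale (ce x) \<ee> + lscale (ch x) \<hh> + lscale (cf x) \<ff>" if "x \<in> sl2" for x
    using that by (cases x) (simp add: sl2_def plus_schr_def lscale_schr_def \<ee>_def \<hh>_def \<ff>_def)
  have "\<phi> (act M x v) = act N x (\<phi> v)" if v: "v \<in> carrier M" and x: "x \<in> sl2" for x v
  proof -
    have nv: "\<phi> v \<in> carrier N" using h v by (auto simp: mod_hom_def)
    show ?thesis
      by (subst (1 2) b[OF x])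
        (use assms(3) h v nv in \<open>simp add: M.act_add_left M.act_lscale N.act_add_left N.act_lscale mod_hom_def\<close>)
  qed
  then show ?thesis using h by (simp add: mod_hom_def)
qed

definition fun_rep :: "('i \<Rightarrow> complex) set \<Rightarrow> ('g \<Rightarrow> ('i \<Rightarrow> complex) \<Rightarrow> 'i \<Rightarrow> complex)
    \<Rightarrow> ('g, 'i \<Rightarrow> complex) rep"
  where "fun_rep C B = \<lparr>carrier = C, monoid.mult = undefined, one = undefined,
    zero = (\<lambda>i. 0), add = (\<lambda>v w i. v i + w i), module.smult = (\<lambda>c v i. c * v i), act = B\<rparr>"

lemma fun_rep_simps [simp]:
  "carrier (fun_rep C B) = C" "zero (fun_rep C B) = (\<lambda>i. 0)"
  "v \<oplus>\<^bsub>fun_rep C B\<^esub> w = (\<lambda>i. v i + w i)" "c \<odot>\<^bsub>fun_rep C B\<^esub> v = (\<lambda>i. c * v i)"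
  "act (fun_rep C B) = B"
  by (simp_all add: fun_rep_def)

lemma lie_module_fun_rep:
  assumes C: "(\<lambda>i. 0) \<in> C" "\<And>v w. v \<in> C \<Longrightarrow> w \<in> C \<Longrightarrow> (\<lambda>i. v i + w i) \<in> C"
      "\<And>c v. v \<in> C \<Longrightarrow> (\<lambda>i. c * v i) \<in> C"
    and B: "\<And>x v. v \<in> C \<Longrightarrow> B x v \<in> C"
      "\<And>x v w. v \<in> C \<Longrightarrow> w \<in> C \<Longrightarrow> B x (\<lambda>i. v i + w i) = (\<lambda>i. B x v i + B x w i)"
      "\<And>x c v. v \<in> C \<Longrightarrow> B x (\<lambda>i. c * v i) = (\<lambda>i. c * B x v i)"
      "\<And>x y v. v \<in> C \<Longrightarrow> B (x + y) v = (\<lambda>i. B x v i + B y v i)"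
      "\<And>c x v. v \<in> C \<Longrightarrow> B (lscale c x) v = (\<lambda>i. c * B x v i)"
      "\<And>x y v. v \<in> C \<Longrightarrow> B (bracket x y) v = (\<lambda>i. B x (B y v) i - B y (B x v) i)"
  shows "lie_module (fun_rep C B)"
proof (intro lie_module.intro moduleI lie_module_axioms.intro)
  show "cring complex_field" by (rule cring_from_type_algebra)
  show "abelian_group (fun_rep C B)"
  proof (rule abelian_groupI)
    fix v assume "v \<in> carrier (fun_rep C B)"
    then show "\<exists>w\<in>carrier (fun_rep C B). w \<oplus>\<^bsub>fun_rep C B\<^esub> v = \<zero>\<^bsub>fun_rep C B\<^esub>"
      using C(3)[of v "- 1"] by (intro bexI[of _ "\<lambda>i. - 1 * v i"]) auto
  qed (use C in \<open>auto simp: algebra_simps\<close>)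
  then interpret abelian_group "fun_rep C B" .
  have minus: "v \<ominus>\<^bsub>fun_rep C B\<^esub> w = (\<lambda>i. v i - w i)" if "v \<in> C" "w \<in> C" for v w
  proof -
    have "\<ominus>\<^bsub>fun_rep C B\<^esub> w = (\<lambda>i. - 1 * w i)"
      by (rule minus_equality) (use that C(3)[of w "- 1"] in auto)
    then show ?thesis by (simp add: a_minus_def)
  qed
  show "act (fun_rep C B) (bracket x y) v = act (fun_rep C B) x (act (fun_rep C B) y v)
      \<ominus>\<^bsub>fun_rep C B\<^esub> act (fun_rep C B) y (act (fun_rep C B) x v)"
    if "v \<in> carrier (fun_rep C B)" for v x y
    using that B by (simp add: minus)
qed (use B C in \<open>auto simp: algebra_simps\<close>)

lemma fun_rep_minus:
  assumes "lie_module (fun_rep C B)" "v \<in> C" "w \<in> C"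
  shows "v \<ominus>\<^bsub>fun_rep C B\<^esub> w = (\<lambda>i. v i - w i)"
proof -
  interpret lie_module "fun_rep C B" by fact
  show ?thesis using minus_smult[of v w] assms by simp
qed

section \<open>Direct sums\<close>

text \<open>\<open>direct_sum\<close> speaks of a set of subspaces and not of a family, hence the
  injectivity of \<open>W\<close>. Projections \<open>\<pi> i\<close> give existence by
  \<open>sum\<close> and uniqueness by applying them to an arbitrary decomposition.\<close>

lemma (in cmodule) direct_sum_range:
  assumes inj: "inj W" and W: "\<And>i. W i \<subseteq> carrier M" "\<And>i. \<zero> \<in> W i"
    and \<pi>: "\<And>i v. v \<in> carrier M \<Longrightarrow> \<pi> i v \<in> W i"
    and \<pi>_add: "\<And>i v w. v \<in> carrier M \<Longrightarrow> w \<in> carrier M \<Longrightarrow> \<pi> i (v \<oplus> w) = \<pi> i v \<oplus> \<pi> i w"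
    and \<pi>_same: "\<And>i v. v \<in> W i \<Longrightarrow> \<pi> i v = v"
    and \<pi>_other: "\<And>i j v. v \<in> W j \<Longrightarrow> i \<noteq> j \<Longrightarrow> \<pi> i v = \<zero>"
    and fin: "\<And>v. v \<in> carrier M \<Longrightarrow> finite {i. \<pi> i v \<noteq> \<zero>}"
    and sum: "\<And>v. v \<in> carrier M \<Longrightarrow> v = (\<Oplus>i\<in>{i. \<pi> i v \<noteq> \<zero>}. \<pi> i v)"
  shows "direct_sum M (range W)"
  unfolding direct_sum_def
proof
  fix v assume v: "v \<in> carrier M"
  let ?Q = "\<lambda>w. (\<forall>U\<in>range W. w U \<in> U) \<and> (\<forall>U. U \<notin> range W \<longrightarrow> w U = \<zero>) \<and>
    finite {U. w U \<noteq> \<zero>} \<and> v = finsum M w {U. w U \<noteq> \<zero>}"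
  let ?w = "\<lambda>U. if U \<in> range W then \<pi> (inv_into UNIV W U) v else \<zero>"
  have wW: "?w (W i) = \<pi> i v" for i using inj by (simp add: inv_f_f)
  have pc: "\<pi> i u \<in> carrier M" if "u \<in> carrier M" for i u using \<pi>[OF that] W by blast
  have wc: "?w U \<in> carrier M" for U using pc[OF v] by simp
  show "\<exists>!w. ?Q w"
  proof (rule ex1I[of _ ?w])
    have S: "{U. ?w U \<noteq> \<zero>} = W ` {i. \<pi> i v \<noteq> \<zero>}"
      using inj by (auto simp: inv_f_f split: if_splits)
    have "finsum M ?w (W ` {i. \<pi> i v \<noteq> \<zero>}) = (\<Oplus>i\<in>{i. \<pi> i v \<noteq> \<zero>}. ?w (W i))"
      by (intro finsum_reindex funcsetI wc inj_on_subset[OF inj subset_UNIV])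
    also have "\<dots> = v" unfolding wW using sum[OF v] by simp
    finally show "?Q ?w"
      unfolding S using fin[OF v] \<pi>[OF v] inj by (auto simp: inv_f_f)
  next
    fix w assume Q: "?Q w"
    define S where "S = {U. w U \<noteq> \<zero>}"
    have Q1: "w U \<in> U" if "U \<in> range W" for U using Q that by blast
    have Q2: "w U = \<zero>" if "U \<notin> range W" for U using Q that by blast
    have Q3: "finite S" and Q4: "v = finsum M w S" using Q unfolding S_def by blast+
    have c: "w U \<in> carrier M" for U
    proof (cases "U \<in> range W")
      case True
      then show ?thesis using Q1[OF True] W(1) by blast
    qed (simp add: Q2)
    have w0: "w U = \<zero>" if "U \<notin> S" for U using that by (simp add: S_def)
    have "w (W i) = \<pi> i v" for i
    proof -
      have p0: "\<pi> i \<zero> = \<zero>" using \<pi>_same[of \<zero> i] W by simp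
      \<comment> \<open>The projection kills every summand except the one in \<open>W i\<close>.
        That index is inserted into the range of summation because its component may be
        zero.\<close>
      have "\<pi> i v = finsum M (\<lambda>U. \<pi> i (w U)) S"
        unfolding Q4 by (rule finsum_hom[OF Q3 c \<pi>_add p0 pc])
      also have "\<dots> = finsum M (\<lambda>U. \<pi> i (w U)) (insert (W i) S)"
        by (rule finsum_superset) (use Q3 in \<open>auto simp: w0 p0 intro: pc c\<close>)
      also have "\<dots> = finsum M (\<lambda>U. \<pi> i (w U)) {W i}"
      proof (rule finsum_superset[symmetric])
        fix U assume U: "U \<in> insert (W i) S - {W i}"
        then have "w U \<noteq> \<zero>" by (auto simp: S_def)
        then obtain j where j: "U = W j" using Q2 by blast
        then have "i \<noteq> j" using U by auto
        then show "\<pi> i (w U) = \<zero>" using \<pi>_other[of "w U" j i] Q1[of U] j by simp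
      qed (use Q3 in \<open>auto intro: pc c\<close>)
      also have "\<dots> = \<pi> i (w (W i))" by (simp add: finsum_insert pc c)
      also have "\<dots> = w (W i)" by (rule \<pi>_same) (rule Q1, simp)
      finally show ?thesis by simp
    qed
    then have "w U = ?w U" for U using Q2[of U] wW by (cases "U \<in> range W") auto
    then show "w = ?w" by (rule ext)
  qed
qed

section \<open>Modules given by operators on coordinate functions\<close>

definition lin_op :: "(('i \<Rightarrow> complex) \<Rightarrow> 'i \<Rightarrow> complex) \<Rightarrow> bool"
  where "lin_op T \<longleftrightarrow> (\<forall>v w. T (\<lambda>i. v i + w i) = (\<lambda>i. T v i + T w i)) \<and>
    (\<forall>c v. T (\<lambda>i. c * v i) = (\<lambda>i. c * T v i))"

lemma lin_opD:
  assumes "lin_op T"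
  shows "T (\<lambda>i. v i + w i) = (\<lambda>i. T v i + T w i)" "T (\<lambda>i. c * v i) = (\<lambda>i. c * T v i)"
  using assms by (auto simp: lin_op_def)

definition schr_act where
  "schr_act E H F P Q c x v = (\<lambda>i. ce x * E v i + (ch x * H v i + (cf x * F v i
     + (cp x * P v i + (cq x * Q v i + cz x * (c * v i))))))" for c :: complex

lemma schr_act_basis [simp]:
  "schr_act E H F P Q c \<ee> = E" "schr_act E H F P Q c \<hh> = H" "schr_act E H F P Q c \<ff> = F"
  "schr_act E H F P Q c \<pp> = P" "schr_act E H F P Q c \<qq> = Q" "schr_act E H F P Q c \<zz> = (\<lambda>v i. c * v i)"
  by (auto simp: schr_act_def \<ee>_def \<hh>_def \<ff>_def \<pp>_def \<qq>_def \<zz>_def)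

lemma lin_op_schr_act:
  assumes "lin_op E" "lin_op H" "lin_op F" "lin_op P" "lin_op Q"
  shows "lin_op (schr_act E H F P Q c x)"
  unfolding lin_op_def schr_act_def
  unfolding lin_opD[OF assms(1)] lin_opD[OF assms(2)] lin_opD[OF assms(3)]
      lin_opD[OF assms(4)] lin_opD[OF assms(5)]
  apply (intro conjI allI ext)
  apply (simp_all only: distrib_left)
  apply (simp_all only: add_ac)
  apply (simp_all only: mult_ac)
  done

text \<open>As z acts by a scalar, all brackets with z hold by linearity. The ten remaining
  relations are requested coordinate by coordinate, the form in which the concrete operators can
  simply be computed.\<close>

lemma lie_module_operators:
  assumes C: "(\<lambda>i. 0) \<in> C" "\<And>v w. v \<in> C \<Longrightarrow> w \<in> C \<Longrightarrow> (\<lambda>i. v i + w i) \<in> C"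
      "\<And>c v. v \<in> C \<Longrightarrow> (\<lambda>i. c * v i) \<in> C"
    and lin: "lin_op E" "lin_op H" "lin_op F" "lin_op P" "lin_op Q"
    and cl: "\<And>v T. T \<in> {E, H, F, P, Q} \<Longrightarrow> v \<in> C \<Longrightarrow> T v \<in> C"
    and comm: "\<And>v i. v \<in> C \<Longrightarrow> E (F v) i - F (E v) i = H v i"
      "\<And>v i. v \<in> C \<Longrightarrow> H (E v) i - E (H v) i = 2 * E v i"
      "\<And>v i. v \<in> C \<Longrightarrow> H (F v) i - F (H v) i = - 2 * F v i"
      "\<And>v i. v \<in> C \<Longrightarrow> E (P v) i - P (E v) i = 0"
      "\<And>v i. v \<in> C \<Longrightarrow> H (P v) i - P (H v) i = P v i"
      "\<And>v i. v \<in> C \<Longrightarrow> F (P v) i - P (F v) i = Q v i"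
      "\<And>v i. v \<in> C \<Longrightarrow> E (Q v) i - Q (E v) i = P v i"
      "\<And>v i. v \<in> C \<Longrightarrow> H (Q v) i - Q (H v) i = - Q v i"
      "\<And>v i. v \<in> C \<Longrightarrow> F (Q v) i - Q (F v) i = 0"
      "\<And>v i. v \<in> C \<Longrightarrow> P (Q v) i - Q (P v) i = c * v i"
  shows "lie_module (fun_rep C (schr_act E H F P Q c))"
proof (rule lie_module_fun_rep)
  note l = lin_opD[OF lin(1)] lin_opD[OF lin(2)] lin_opD[OF lin(3)] lin_opD[OF lin(4)]
    lin_opD[OF lin(5)]
  show "schr_act E H F P Q c x v \<in> C" if "v \<in> C" for x v
  proof -
    have "E v \<in> C" "H v \<in> C" "F v \<in> C" "P v \<in> C" "Q v \<in> C" using cl that by auto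
    then show ?thesis unfolding schr_act_def using that by (intro C) assumption+
  qed
  show "schr_act E H F P Q c (bracket x y) v = (\<lambda>i. schr_act E H F P Q c x (schr_act E H F P Q c y v) i
      - schr_act E H F P Q c y (schr_act E H F P Q c x v) i)" if v: "v \<in> C" for x y v
  proof
    fix i
    have r: "E (F v) i = F (E v) i + H v i" "H (E v) i = E (H v) i + 2 * E v i"
      "H (F v) i = F (H v) i - 2 * F v i" "E (P v) i = P (E v) i" "H (P v) i = P (H v) i + P v i"
      "F (P v) i = P (F v) i + Q v i" "E (Q v) i = Q (E v) i + P v i" "H (Q v) i = Q (H v) i - Q v i"
      "F (Q v) i = Q (F v) i" "P (Q v) i = Q (P v) i + c * v i"
      using comm[OF v, of i] by (simp_all add: algebra_simps)
    show "schr_act E H F P Q c (bracket x y) v i = schr_act E H F P Q c x (schr_act E H F P Q c y v) i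
      - schr_act E H F P Q c y (schr_act E H F P Q c x v) i"
      unfolding schr_act_def l by (simp add: r bracket_schr_def algebra_simps)
  qed
  fix x y v w k
  show "schr_act E H F P Q c x (\<lambda>i. v i + w i) = (\<lambda>i. schr_act E H F P Q c x v i + schr_act E H F P Q c x w i)"
    and "schr_act E H F P Q c x (\<lambda>i. k * v i) = (\<lambda>i. k * schr_act E H F P Q c x v i)"
    using lin_opD[OF lin_op_schr_act[OF lin]] by blast+
  show "schr_act E H F P Q c (x + y) v = (\<lambda>i. schr_act E H F P Q c x v i + schr_act E H F P Q c y v i)"
    "schr_act E H F P Q c (lscale k x) v = (\<lambda>i. k * schr_act E H F P Q c x v i)"
    by (simp_all add: schr_act_def plus_schr_def lscale_schr_def algebra_simps)
qed (use C in auto)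

section \<open>The model with highest weight vectors \<open>p\<^sup>k v\<close>\<close>

text \<open>The coordinate \<open>(k, i)\<close> belongs to \<open>u\<^sub>k\<^sub>i = f\<^sup>i p\<^sup>k v\<close>, where \<open>v\<close> has weight \<open>n\<close> and \<open>e v = 0\<close>. With
  \<open>m = n + k\<close> and \<open>y\<^sub>k = ydown n c k\<close> one has
  \<open>(m + 1) q u\<^sub>k\<^sub>i = y\<^sub>k u\<^sub>k\<^sub>-\<^sub>1\<^sub>,\<^sub>i + u\<^sub>k\<^sub>+\<^sub>1\<^sub>,\<^sub>i\<^sub>+\<^sub>1\<close> and
  \<open>(m + 1) p u\<^sub>k\<^sub>i = (m + 1 - i) u\<^sub>k\<^sub>+\<^sub>1\<^sub>,\<^sub>i - i y\<^sub>k u\<^sub>k\<^sub>-\<^sub>1\<^sub>,\<^sub>i\<^sub>-\<^sub>1\<close>.\<close>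

definition ydown :: "nat \<Rightarrow> complex \<Rightarrow> nat \<Rightarrow> complex"
  where "ydown n c k = - c * of_nat k * (2 * of_nat n + of_nat k + 1) / 2"

text \<open>The operators act on coefficients, so each formula collects at \<open>(k, i)\<close>
  what arrives there from neighbouring basis vectors. This shifts the denominators: m + 1 is n + k
  for a contribution from level k - 1 and n + k + 2 for one from level k + 1.\<close>

definition K_e :: "nat \<Rightarrow> (nat \<times> nat \<Rightarrow> complex) \<Rightarrow> nat \<times> nat \<Rightarrow> complex" where
  "K_e n a = (\<lambda>(k, i). of_nat (i + 1) * (of_nat n + of_nat k - of_nat i) * a (k, i + 1))"
definition K_h :: "nat \<Rightarrow> (nat \<times> nat \<Rightarrow> complex) \<Rightarrow> nat \<times> nat \<Rightarrow> complex" where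
  "K_h n a = (\<lambda>(k, i). (of_nat n + of_nat k - 2 * of_nat i) * a (k, i))"
definition K_f :: "nat \<Rightarrow> (nat \<times> nat \<Rightarrow> complex) \<Rightarrow> nat \<times> nat \<Rightarrow> complex" where
  "K_f n a = (\<lambda>(k, i). if i \<le> n + k \<and> i \<noteq> 0 then a (k, i - 1) else 0)"
definition K_p :: "nat \<Rightarrow> complex \<Rightarrow> (nat \<times> nat \<Rightarrow> complex) \<Rightarrow> nat \<times> nat \<Rightarrow> complex" where
  "K_p n c a = (\<lambda>(k, i).
     (if k = 0 then 0 else (of_nat n + of_nat k - of_nat i) / (of_nat n + of_nat k) * a (k - 1, i))
     - of_nat (i + 1) * ydown n c (k + 1) / (of_nat n + of_nat k + 2) * a (k + 1, i + 1))"
text \<open>The guard concerns the term from level k + 1: there i = n + k + 1 is still a legal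
  index, whereas f^(n+k+1) p^k v is zero. For \<open>K_p\<close> the values beyond n + k vanish by
  themselves on \<open>K_carrier n\<close>.\<close>

definition K_q :: "nat \<Rightarrow> complex \<Rightarrow> (nat \<times> nat \<Rightarrow> complex) \<Rightarrow> nat \<times> nat \<Rightarrow> complex" where
  "K_q n c a = (\<lambda>(k, i). if i \<le> n + k then
     (if k = 0 \<or> i = 0 then 0 else a (k - 1, i - 1) / (of_nat n + of_nat k))
     + ydown n c (k + 1) / (of_nat n + of_nat k + 2) * a (k + 1, i) else 0)"

definition K_carrier :: "nat \<Rightarrow> (nat \<times> nat \<Rightarrow> complex) set"
  where "K_carrier n = {a. finsupp a \<and> (\<forall>k i. n + k < i \<longrightarrow> a (k, i) = 0)}"

definition Kmod :: "nat \<Rightarrow> complex \<Rightarrow> (schr, nat \<times> nat \<Rightarrow> complex) rep"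
  where "Kmod n c = fun_rep (K_carrier n) (schr_act (K_e n) (K_h n) (K_f n) (K_p n c) (K_q n c) c)"

section \<open>The relations of the Schroedinger algebra in the model\<close>

lemma K_lin: "lin_op (K_e n)" "lin_op (K_h n)" "lin_op (K_f n)" "lin_op (K_p n c)" "lin_op (K_q n c)"
  by (auto simp: lin_op_def K_e_def K_h_def K_f_def K_p_def K_q_def fun_eq_iff algebra_simps add_divide_distrib)

text \<open>With \<open>ydown n c 0 = 0\<close> this recursion determines \<open>ydown\<close>; it
  is the relation [p, q] = z read on highest weight vectors.\<close>

lemma ydown_diff: "ydown n c k - ydown n c (k + 1) = c * (of_nat n + of_nat k + 1)"
  by (simp add: ydown_def field_simps)

text \<open>The diagonal coefficient of pq - qp at level k, with m = n + k, j = i, and y, y' the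
  values of \<open>ydown\<close> at k and k + 1. The paths through level k - 1 add up to y / (m + 1)
  and those through level k + 1 to y' / (m + 1), both independent of j; their difference is
  c.\<close>

lemma pq_identity:
  fixes m j :: complex
  assumes "k \<noteq> 0 \<longrightarrow> m \<noteq> 0" "m + 1 \<noteq> 0" "m + 2 \<noteq> 0" "y - y' = c * (m + 1)" "k = 0 \<longrightarrow> y = 0"
  shows "(if k = (0::nat) then 0 else (m - j) / m * (y / (m + 1) * v))
    - (j + 1) * y' / (m + 2) * (v / (m + 1))
    - (- (if k = 0 then 0 else j * y / (m + 1) * v / m)
    + y' / (m + 2) * ((m + 1 - j) / (m + 1) * v)) = c * v"
proof -
  have "(if k = (0::nat) then 0 else (m - j) / m * (y / (m + 1) * v)) + (if k = 0 then 0 else j * y / (m + 1) * v / m)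
    = y * v / (m + 1)"
    using assms by (cases "k = 0") (auto simp: divide_simps, auto simp: algebra_simps)
  moreover have "(j + 1) * y' / (m + 2) * (v / (m + 1)) + y' / (m + 2) * ((m + 1 - j) / (m + 1) * v) = y' * v / (m + 1)"
    using assms by (auto simp: divide_simps) (auto simp: algebra_simps)
  moreover have "y * v / (m + 1) - y' * v / (m + 1) = c * v"
    using assms by (simp add: divide_simps) (simp add: algebra_simps)
  moreover have "x1 + x2 = a \<Longrightarrow> y1 + y2 = b \<Longrightarrow> a - b = r \<Longrightarrow> x1 - y1 - (- x2 + y2) = r"
    for x1 x2 a y1 y2 b r :: complex by (auto simp: algebra_simps)
  ultimately show ?thesis by blast
qed

lemma K_pq:
  assumes "v \<in> K_carrier n"
  shows "K_p n c (K_q n c v) (k, i) - K_q n c (K_p n c v) (k, i) = c * v (k, i)"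
proof -
  have z: "v (k, i) = 0" if "n + k < i" for k i using that assms by (simp add: K_carrier_def)
  define m :: complex where "m = of_nat n + of_nat k"
  define j :: complex where "j = of_nat i"
  have m: "m = of_nat (n + k)" by (simp add: m_def)
  have m1: "m + 1 = of_nat (n + k + 1)" "m + 2 = of_nat (n + k + 2)" by (simp_all add: m_def)
  have nz: "k \<noteq> 0 \<longrightarrow> m \<noteq> 0" "m + 1 \<noteq> 0" "m + 2 \<noteq> 0"
    unfolding m1 unfolding m by (simp_all del: of_nat_add of_nat_Suc)
  \<comment> \<open>\<open>?T1\<close> and \<open>?T2\<close> carry the contributions from levels k
    - 2 and k + 2. They enter pq and qp with the same coefficients and cancel, so that only the
    diagonal part is left for \<open>pq_identity\<close>.\<close>
  let ?T1 = "if k - 1 = 0 \<or> i = 0 then 0 else v (k - 2, i - 1) / (m - 1)"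
  let ?T2 = "ydown n c (k + 2) / (m + 3) * v (k + 2, i + 1)"
  show ?thesis
  proof (cases "i \<le> n + k")
    case False
    then show ?thesis by (cases k; cases i) (simp_all add: K_p_def K_q_def z)
  next
    case True
    have edge: "m - j = 0" if "i = n + k" using that by (simp add: m_def j_def)
    have 1: "K_p n c (K_q n c v) (k, i) = (if k = 0 then 0 else (m - j) / m * (?T1 + ydown n c k / (m + 1) * v (k, i)))
       - (j + 1) * ydown n c (k + 1) / (m + 2) * (v (k, i) / (m + 1) + ?T2)"
    proof (cases k)
      case 0
      then show ?thesis using True by (simp add: K_p_def K_q_def m_def j_def add_ac)
    next
      case (Suc k')
      have "(m - j) / m * K_q n c v (k - 1, i) = (m - j) / m * (?T1 + ydown n c k / (m + 1) * v (k, i))"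
      proof (cases "i = n + k")
        case True
        then show ?thesis using edge by simp
      next
        case False
        have k2: "k - Suc (Suc 0) = k' - 1" using Suc by simp
        show ?thesis using False True Suc by (simp add: K_q_def m_def k2 add_ac)
      qed
      moreover have "K_q n c v (k + 1, i + 1) = v (k, i) / (m + 1) + ?T2"
        using True by (simp add: K_q_def m_def add_ac)
      moreover have "K_p n c V (k, i) = (if k = 0 then 0 else (m - j) / m * V (k - 1, i))
          - (j + 1) * ydown n c (k + 1) / (m + 2) * V (k + 1, i + 1)" for V
        by (simp add: K_p_def m_def j_def add_ac)
      ultimately show ?thesis using Suc by (simp only: Suc_not_Zero if_False)
    qed
    have 2: "K_q n c (K_p n c v) (k, i) = (if k = 0 then 0 else (m - j) / m * ?T1 - j * ydown n c k / (m + 1) * v (k, i) / m)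
       + ydown n c (k + 1) / (m + 2) * ((m + 1 - j) / (m + 1) * v (k, i) - (j + 1) * ?T2)"
    proof -
      have "K_p n c v (k + 1, i) = (m + 1 - j) / (m + 1) * v (k, i) - (j + 1) * ?T2"
        by (simp add: K_p_def m_def j_def add_ac)
      moreover have "(if k = 0 \<or> i = 0 then 0 else K_p n c v (k - 1, i - 1) / m)
        = (if k = 0 then 0 else (m - j) / m * ?T1 - j * ydown n c k / (m + 1) * v (k, i) / m)"
      proof (cases "k = 0 \<or> i = 0")
        case True
        then show ?thesis by (auto simp: j_def)
      next
        case False
        then obtain k' i' where ki: "k = Suc k'" "i = Suc i'" by (metis not0_implies_Suc)
        have P: "K_p n c v (k - 1, i - 1) = (if k' = 0 then 0 else (m - j) / (m - 1) * v (k - 2, i - 1))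
            - j * ydown n c k / (m + 1) * v (k, i)"
          unfolding ki by (simp add: K_p_def m_def j_def ki add_ac)
        show ?thesis unfolding P using ki by (simp add: divide_inverse algebra_simps)
      qed
      moreover have "K_q n c V (k, i) = (if k = 0 \<or> i = 0 then 0 else V (k - 1, i - 1) / m)
          + ydown n c (k + 1) / (m + 2) * V (k + 1, i)" for V
        using True by (simp add: K_q_def m_def)
      ultimately show ?thesis by (simp only:)
    qed
    have y: "ydown n c k - ydown n c (k + 1) = c * (m + 1)" using ydown_diff by (simp add: m_def)
    have y0: "k = 0 \<longrightarrow> ydown n c k = 0" by (simp add: ydown_def)
    have "K_p n c (K_q n c v) (k, i) - K_q n c (K_p n c v) (k, i) =
      (if k = (0::nat) then 0 else (m - j) / m * (ydown n c k / (m + 1) * v (k, i)))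
    - (j + 1) * ydown n c (k + 1) / (m + 2) * (v (k, i) / (m + 1))
    - (- (if k = 0 then 0 else j * ydown n c k / (m + 1) * v (k, i) / m)
    + ydown n c (k + 1) / (m + 2) * ((m + 1 - j) / (m + 1) * v (k, i)))"
      unfolding 1 2 by (simp only: divide_inverse algebra_simps split: if_split) auto
    then show ?thesis unfolding pq_identity[OF nz y y0] .
  qed
qed

lemma finsupp_images:
  assumes "finsupp a" "finite G" "\<And>x. b x \<noteq> 0 \<Longrightarrow> \<exists>g\<in>G. \<exists>y. a y \<noteq> 0 \<and> x = g y"
  shows "finsupp b"
proof -
  have "{x. b x \<noteq> 0} \<subseteq> (\<Union>g\<in>G. g ` {y. a y \<noteq> 0})" using assms(3) by blast
  then show ?thesis unfolding finsupp_def
    by (rule finite_subset) (use assms(1,2) in \<open>auto simp: finsupp_def\<close>)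
qed

lemma K_finsupp:
  assumes "finsupp v" "T \<in> {K_e n, K_h n, K_f n, K_p n c, K_q n c}"
  shows "finsupp (T v)"
proof (rule finsupp_images[OF assms(1)])
  let ?G = "{\<lambda>(k, i). (k, i - 1), id, \<lambda>(k, i). (k, i + 1), \<lambda>(k, i). (k + 1, i),
    \<lambda>(k, i). (k - 1, i - 1), \<lambda>(k, i). (k + 1, i + 1), \<lambda>(k, i). (k - 1, i)} :: (nat \<times> nat \<Rightarrow> nat \<times> nat) set"
  show "finite ?G" by simp
  fix x assume x: "T v x \<noteq> 0"
  obtain k i where ki: "x = (k, i)" by (cases x)
  have "v (k, i + 1) \<noteq> 0 \<or> v (k, i) \<noteq> 0 \<or> i \<noteq> 0 \<and> v (k, i - 1) \<noteq> 0 \<or> k \<noteq> 0 \<and> v (k - 1, i) \<noteq> 0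
    \<or> v (k + 1, i + 1) \<noteq> 0 \<or> k \<noteq> 0 \<and> i \<noteq> 0 \<and> v (k - 1, i - 1) \<noteq> 0 \<or> v (k + 1, i) \<noteq> 0"
  proof (rule ccontr)
    assume "\<not> ?thesis"
    then have z: "v (k, i + 1) = 0" "v (k, i) = 0" "i \<noteq> 0 \<Longrightarrow> v (k, i - 1) = 0"
      "k \<noteq> 0 \<Longrightarrow> v (k - 1, i) = 0" "v (k + 1, i + 1) = 0"
      "k \<noteq> 0 \<Longrightarrow> i \<noteq> 0 \<Longrightarrow> v (k - 1, i - 1) = 0" "v (k + 1, i) = 0"
      by blast+
    have "K_e n v (k, i) = 0" "K_h n v (k, i) = 0" "K_f n v (k, i) = 0" "K_p n c v (k, i) = 0"
      "K_q n c v (k, i) = 0"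
      using z by (simp_all add: K_e_def K_h_def K_f_def K_p_def K_q_def)
    then have "T v (k, i) = 0" using assms(2) by auto
    then show False using x ki by simp
  qed
  then show "\<exists>g\<in>?G. \<exists>y. v y \<noteq> 0 \<and> x = g y"
    unfolding ki
    apply (elim disjE)
    subgoal by (rule bexI[of _ "\<lambda>(k, i). (k, i - 1)"], rule exI[of _ "(k, i + 1)"]) auto
    subgoal by (rule bexI[of _ id], rule exI[of _ "(k, i)"]) auto
    subgoal by (rule bexI[of _ "\<lambda>(k, i). (k, i + 1)"], rule exI[of _ "(k, i - 1)"]) auto
    subgoal by (rule bexI[of _ "\<lambda>(k, i). (k + 1, i)"], rule exI[of _ "(k - 1, i)"]) auto
    subgoal by (rule bexI[of _ "\<lambda>(k, i). (k - 1, i - 1)"], rule exI[of _ "(k + 1, i + 1)"]) auto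
    subgoal by (rule bexI[of _ "\<lambda>(k, i). (k + 1, i + 1)"], rule exI[of _ "(k - 1, i - 1)"]) auto
    subgoal by (rule bexI[of _ "\<lambda>(k, i). (k - 1, i)"], rule exI[of _ "(k + 1, i)"]) auto
    done
qed

lemma lie_module_Kmod: "lie_module (Kmod n c)"
  unfolding Kmod_def
proof (rule lie_module_operators[OF _ _ _ K_lin])
  fix v and i :: "nat \<times> nat" assume v: "v \<in> K_carrier n"
  obtain k j where i: "i = (k, j)" by (cases i)
  have z: "v (k, i) = 0" if "n + k < i" for k i using that v by (simp add: K_carrier_def)
  have ne: "1 + (of_nat a + of_nat b) \<noteq> (0::complex)" for a b
    using of_nat_neq_0[of "a + b", where 'a = complex] by (simp add: add_ac)
  \<comment> \<open>Normalization multiplies out the denominator against its own inverse; this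
    equation puts the pieces together again.\<close>
  have ne2: "x * inverse (1 + (of_nat a + of_nat b)) + (of_nat a * (x * inverse (1 + (of_nat a + of_nat b)))
      + of_nat b * (x * inverse (1 + (of_nat a + of_nat b)))) = (x::complex)" for x a b
  proof -
    have "(1 + (of_nat a + of_nat b)) * (x * inverse (1 + (of_nat a + of_nat b))) = x"
      using ne[of a b] by simp
    then show ?thesis by (simp only: distrib_right mult_1)
  qed
  note d = K_e_def K_f_def K_h_def K_p_def K_q_def
  \<comment> \<open>The guards of \<open>K_f\<close> and \<open>K_q\<close> change their truth value
    at i = n + k, so the relations involving them are computed beyond, on and inside that
    boundary.\<close>
  consider (a) "n + k < j" | (b) "j = n + k" | (c) "j < n + k" by linarith
  note cs = this
  have "K_e n (K_f n v) (k, j) - K_f n (K_e n v) (k, j) = K_h n v (k, j)"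
    using cs
  proof cases
    case a
    then show ?thesis
      by (cases j)
      ((simp_all add: d z Suc_le_eq)?, (simp_all add: divide_inverse algebra_simps)?)
  next
    case b
    then show ?thesis
      by (cases j)
      ((simp_all add: d z Suc_le_eq)?, (simp_all add: divide_inverse algebra_simps)?)
  next
    case c
    then show ?thesis
      by (cases j)
      ((simp_all add: d z Suc_le_eq)?, (simp_all add: divide_inverse algebra_simps)?)
  qed
  then show "K_e n (K_f n v) i - K_f n (K_e n v) i = K_h n v i" by (simp only: i)
  show "K_h n (K_e n v) i - K_e n (K_h n v) i = 2 * K_e n v i"
    unfolding i
    by ((simp add: d z)?, (simp add: divide_inverse algebra_simps)?)
  show "K_h n (K_f n v) i - K_f n (K_h n v) i = - 2 * K_f n v i"
    unfolding i
    by (cases j)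
      ((simp_all add: d z Suc_le_eq)?, (simp_all add: divide_inverse algebra_simps)?)
  show "K_e n (K_p n c v) i - K_p n c (K_e n v) i = 0"
    unfolding i
    by (cases k)
      ((simp_all add: d z Suc_le_eq)?, (simp_all add: divide_inverse algebra_simps)?)
  show "K_h n (K_p n c v) i - K_p n c (K_h n v) i = K_p n c v i"
    unfolding i
    by (cases k)
      ((simp_all add: d z Suc_le_eq)?, (simp_all add: divide_inverse algebra_simps)?)
  have "K_f n (K_p n c v) (k, j) - K_p n c (K_f n v) (k, j) = K_q n c v (k, j)"
    using cs
  proof cases
    case a
    then show ?thesis
      by (cases k; cases j)
      ((simp_all add: d z Suc_le_eq)?, (simp_all add: divide_inverse algebra_simps)?)
  next
    case b
    then show ?thesis
      by (cases k; cases j)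
      ((simp_all add: d z Suc_le_eq)?, (simp_all add: divide_inverse algebra_simps)?)
  next
    case c
    then show ?thesis
      by (cases k; cases j)
      ((simp_all add: d z Suc_le_eq)?, (simp_all add: divide_inverse algebra_simps)?)
  qed
  then show "K_f n (K_p n c v) i - K_p n c (K_f n v) i = K_q n c v i" by (simp only: i)
  have "K_e n (K_q n c v) (k, j) - K_q n c (K_e n v) (k, j) = K_p n c v (k, j)"
    using cs
  proof cases
    case a
    then show ?thesis
      by (cases k; cases j)
      ((simp_all add: d z Suc_le_eq)?, (simp_all add: divide_inverse algebra_simps)?, (simp_all only: ne2 simp_thms)?)
  next
    case b
    then show ?thesis
      by (cases k; cases j)
      ((simp_all add: d z Suc_le_eq)?, (simp_all add: divide_inverse algebra_simps)?, (simp_all only: ne2 simp_thms)?)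
  next
    case c
    then show ?thesis
      by (cases k; cases j)
      ((simp_all add: d z Suc_le_eq)?, (simp_all add: divide_inverse algebra_simps)?, (simp_all only: ne2 simp_thms)?)
  qed
  then show "K_e n (K_q n c v) i - K_q n c (K_e n v) i = K_p n c v i" by (simp only: i)
  show "K_h n (K_q n c v) i - K_q n c (K_h n v) i = - K_q n c v i"
    unfolding i
    by (cases k; cases j)
      ((simp_all add: d z Suc_le_eq)?, (simp_all add: divide_inverse algebra_simps)?)
  have "K_f n (K_q n c v) (k, j) - K_q n c (K_f n v) (k, j) = 0"
    using cs
  proof cases
    case a
    then show ?thesis
      by (cases k; cases j)
      ((simp_all add: d z Suc_le_eq)?, (simp_all add: divide_inverse algebra_simps)?)
  next
    case b
    then show ?thesis
      by (cases k; cases j)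
      ((simp_all add: d z Suc_le_eq)?, (simp_all add: divide_inverse algebra_simps)?)
  next
    case c
    then show ?thesis
      by (cases k; cases j)
      ((simp_all add: d z Suc_le_eq)?, (simp_all add: divide_inverse algebra_simps)?)
  qed
  then show "K_f n (K_q n c v) i - K_q n c (K_f n v) i = 0" by (simp only: i)
  show "K_p n c (K_q n c v) i - K_q n c (K_p n c v) i = c * v i"
    unfolding i by (rule K_pq[OF v])
  fix T assume "T \<in> {K_e n, K_h n, K_f n, K_p n c, K_q n c}"
  moreover have "T v (k, i) = 0" if "n + k < i" for k i
    using that \<open>T \<in> _\<close> by (auto simp: K_e_def K_h_def K_f_def K_p_def K_q_def z)
  ultimately show "T v \<in> K_carrier n"
    using K_finsupp[of v T n c] v by (simp add: K_carrier_def)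
qed (auto simp: K_carrier_def)

section \<open>Highest weight vectors\<close>

context lie_module
begin

lemma act_0_left [simp]: "v \<in> carrier M \<Longrightarrow> act M 0 v = \<zero>"
  using act_bracket[of v 0 0] by (simp add: bracket_self minus_smult smult_collect1)

lemma act_uminus_left: "v \<in> carrier M \<Longrightarrow> act M (- x) v = (- 1) \<odot> act M x v"
  using act_add_left[of v "- x" x] by (simp add: uminus_smult[symmetric] minus_equality)

lemma act_pow_commute:
  assumes "bracket x y = 0" "v \<in> carrier M"
  shows "act M x ((act M y ^^ i) v) = (act M y ^^ i) (act M x v)"
proof (induction i)
  case (Suc i)
  then show ?case using act_swap[of "(act M y ^^ i) v" x y 0] assms by simp
qed simp

end

lemma
  fixes M :: "(schr, 'm) rep" (structure)
  assumes "lie_module M" "x \<in> carrier M" "act M \<hh> x = \<mu> \<odot> x"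
  shows weight_f: "act M \<hh> ((act M \<ff> ^^ i) x) = (\<mu> - 2 * of_nat i) \<odot> (act M \<ff> ^^ i) x"
    and weight_e: "act M \<hh> ((act M \<ee> ^^ i) x) = (\<mu> + 2 * of_nat i) \<odot> (act M \<ee> ^^ i) x"
    and weight_p: "act M \<hh> ((act M \<pp> ^^ i) x) = (\<mu> + of_nat i) \<odot> (act M \<pp> ^^ i) x"
proof -
  interpret lie_module M by fact
  note x = assms(2)
  show "act M \<hh> ((act M \<ff> ^^ i) x) = (\<mu> - 2 * of_nat i) \<odot> (act M \<ff> ^^ i) x"
  proof (induction i)
    case (Suc i)
    let ?y = "(act M \<ff> ^^ i) x"
    have "act M \<hh> (act M \<ff> ?y) = act M \<ff> (act M \<hh> ?y) \<oplus> (- 2) \<odot> act M \<ff> ?y"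
      using act_swap[of ?y \<hh> \<ff>] x by (simp add: schr_relations act_lscale)
    then show ?case using x by (simp add: Suc act_smult_right smult_collect algebra_simps)
  qed (simp add: assms)
  show "act M \<hh> ((act M \<ee> ^^ i) x) = (\<mu> + 2 * of_nat i) \<odot> (act M \<ee> ^^ i) x"
  proof (induction i)
    case (Suc i)
    let ?y = "(act M \<ee> ^^ i) x"
    have "act M \<hh> (act M \<ee> ?y) = act M \<ee> (act M \<hh> ?y) \<oplus> 2 \<odot> act M \<ee> ?y"
      using act_swap[of ?y \<hh> \<ee>] x by (simp add: schr_relations act_lscale)
    then show ?case using x by (simp add: Suc act_smult_right smult_collect algebra_simps)
  qed (simp add: assms)
  show "act M \<hh> ((act M \<pp> ^^ i) x) = (\<mu> + of_nat i) \<odot> (act M \<pp> ^^ i) x"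
  proof (induction i)
    case (Suc i)
    let ?y = "(act M \<pp> ^^ i) x"
    have "act M \<hh> (act M \<pp> ?y) = act M \<pp> (act M \<hh> ?y) \<oplus> 1 \<odot> act M \<pp> ?y"
      using act_swap[of ?y \<hh> \<pp>] x by (simp add: schr_relations)
    then have "act M \<hh> (act M \<pp> ?y) = (\<mu> + of_nat i + 1) \<odot> act M \<pp> ?y"
      using x unfolding Suc by (simp only: act_smult_right smult_collect act_pow_closed act_closed' UNIV_I)
    then show ?case by (simp add: add_ac)
  qed (simp add: assms)
qed

lemma e_f_pow:
  fixes M :: "(schr, 'm) rep" (structure)
  assumes "lie_module M" "x \<in> carrier M" "act M \<hh> x = \<mu> \<odot> x" "act M \<ee> x = \<zero>"
  shows "act M \<ee> ((act M \<ff> ^^ Suc i) x) = (of_nat (Suc i) * (\<mu> - of_nat i)) \<odot> (act M \<ff> ^^ i) x"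
proof -
  interpret lie_module M by fact
  note x = assms(2)
  have e: "act M \<ee> (act M \<ff> y) = act M \<ff> (act M \<ee> y) \<oplus> act M \<hh> y" if "y \<in> carrier M" for y
    using act_swap[OF that, of \<ee> \<ff>] by (simp add: schr_relations)
  show ?thesis
  proof (induction i)
    case 0
    then show ?case using x e[OF x] assms(3,4) by simp
  next
    case (Suc i)
    let ?y = "(act M \<ff> ^^ Suc i) x"
    have "act M \<ee> (act M \<ff> ?y) = act M \<ff> (act M \<ee> ?y) \<oplus> act M \<hh> ?y"
      using x by (intro e act_pow_closed)
    also have "act M \<hh> ?y = (\<mu> - 2 * of_nat (Suc i)) \<odot> ?y" by (rule weight_f[OF assms(1-3)])
    also have "act M \<ff> (act M \<ee> ?y) = (of_nat (Suc i) * (\<mu> - of_nat i)) \<odot> ?y"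
      unfolding Suc using x by (simp add: act_smult_right)
    also have "\<dots> \<oplus> (\<mu> - 2 * of_nat (Suc i)) \<odot> ?y
        = (of_nat (Suc i) * (\<mu> - of_nat i) + (\<mu> - 2 * of_nat (Suc i))) \<odot> ?y"
      using x by (simp only: smult_collect act_pow_closed)
    also have "of_nat (Suc i) * (\<mu> - of_nat i) + (\<mu> - 2 * of_nat (Suc i))
        = of_nat (Suc (Suc i)) * (\<mu> - of_nat (Suc i))"
      by (simp add: algebra_simps)
    finally show ?case by simp
  qed
qed

text \<open>Let f^(m+1) x be the first vanishing power. Applying e to it gives (m + 1) (\<mu> - m)
  f^m x = 0 with f^m x nonzero.\<close>

lemma highest_weight_nat:
  fixes M :: "(schr, 'm) rep" (structure)
  assumes "lie_module M" "x \<in> carrier M" "act M \<hh> x = \<mu> \<odot> x" "act M \<ee> x = \<zero>"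
    and "(act M \<ff> ^^ j) x = \<zero>" "x \<noteq> \<zero>"
  obtains m where "\<mu> = of_nat m" "(act M \<ff> ^^ Suc m) x = \<zero>"
proof -
  interpret lie_module M by fact
  define l where "l = (LEAST j. (act M \<ff> ^^ j) x = \<zero>)"
  have l: "(act M \<ff> ^^ l) x = \<zero>" unfolding l_def using assms(5) by (rule LeastI)
  then obtain m where m: "l = Suc m" using assms(6) by (cases l) auto
  have "(act M \<ff> ^^ m) x \<noteq> \<zero>" using not_less_Least[of m "\<lambda>j. (act M \<ff> ^^ j) x = \<zero>"] m l_def by simp
  moreover have "(of_nat (Suc m) * (\<mu> - of_nat m)) \<odot> (act M \<ff> ^^ m) x = \<zero>"
    using e_f_pow[OF assms(1-4), of m] l m by simp
  ultimately have "of_nat (Suc m) * (\<mu> - of_nat m) = 0" using smult_eq_0 assms(2) by blast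
  then have "\<mu> = of_nat m" by (simp del: of_nat_Suc)
  then show ?thesis using that l m by simp
qed

text \<open>The condition \<open>(n + 1) q v = f (p v)\<close> says that the \<open>L(n - 1)\<close>-component of \<open>q v\<close> vanishes; it holds
  when \<open>L(n)\<close> is the minimal type.\<close>

locale hw_module = lie_module M for M :: "(schr, 'm) rep" (structure) +
  fixes v n c
  assumes v [simp, intro]: "v \<in> carrier M"
    and e_v: "act M \<ee> v = \<zero>"
    and h_v: "act M \<hh> v = of_nat n \<odot> v"
    and q_v: "(of_nat n + 1) \<odot> act M \<qq> v = act M \<ff> (act M \<pp> v)"
    and z: "\<And>w. w \<in> carrier M \<Longrightarrow> act M \<zz> w = c \<odot> w"
    and nil: "\<And>k. (act M \<ff> ^^ Suc (n + k)) ((act M \<pp> ^^ k) v) = \<zero>"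
begin

definition vk :: "nat \<Rightarrow> 'm" where "vk k = (act M \<pp> ^^ k) v"

definition u :: "nat \<times> nat \<Rightarrow> 'm" where "u = (\<lambda>(k, i). (act M \<ff> ^^ i) (vk k))"

lemma vk_closed [simp, intro]: "vk k \<in> carrier M" by (simp add: vk_def)

lemma u_closed [simp, intro]: "u x \<in> carrier M" by (cases x) (simp add: u_def)

lemma e_vk: "act M \<ee> (vk k) = \<zero>"
  using act_pow_commute[of \<ee> \<pp> v k] by (simp add: schr_relations vk_def e_v)

lemma h_vk: "act M \<hh> (vk k) = of_nat (n + k) \<odot> vk k"
  using weight_p[OF lie_module_axioms v h_v, of k] by (simp add: vk_def)

text \<open>Apply p to the relation for k. Moving p past q produces c p^k v; moving it past f
  produces one more q p^(k+1) v, which raises the factor from n + k + 1 to n + k + 2. The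
  coefficient of p^k v then changes by \<open>ydown_diff\<close>.\<close>

lemma q_vk: "of_nat (n + k + 1) \<odot> act M \<qq> (vk k) = ydown n c k \<odot> vk (k - 1) \<oplus> act M \<ff> (vk (k + 1))"
proof (induction k)
  case 0
  then show ?case using q_v by (simp add: vk_def ydown_def add.commute)
next
  case (Suc k)
  have pq: "act M \<pp> (act M \<qq> (vk k)) = act M \<qq> (vk (Suc k)) \<oplus> c \<odot> vk k"
    using act_swap[of "vk k" \<pp> \<qq>] by (simp add: schr_relations z vk_def)
  have "act M \<ff> (act M \<pp> (vk (Suc k))) = act M \<pp> (act M \<ff> (vk (Suc k))) \<oplus> act M \<qq> (vk (Suc k))"
    using act_swap[of "vk (Suc k)" \<ff> \<pp>] by (simp add: schr_relations)
  then have fp: "act M \<ff> (vk (Suc (Suc k))) = act M \<pp> (act M \<ff> (vk (Suc k))) \<oplus> act M \<qq> (vk (Suc k))"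
    by (simp add: vk_def)
  \<comment> \<open>For k = 0 the truncated index k - 1 names v itself, which is harmless because
    the coefficient \<open>ydown n c 0\<close> vanishes.\<close>
  have pv: "act M \<pp> (ydown n c k \<odot> vk (k - 1)) = ydown n c k \<odot> vk k"
  proof (cases k)
    case 0
    then show ?thesis by (simp add: ydown_def)
  next
    case (Suc j)
    then show ?thesis by (simp add: act_smult_right) (simp add: vk_def)
  qed
  have "act M \<pp> (of_nat (n + k + 1) \<odot> act M \<qq> (vk k))
      = of_nat (n + k + 1) \<odot> (act M \<qq> (vk (Suc k)) \<oplus> c \<odot> vk k)"
    by (simp only: act_smult_right act_closed vk_closed pq)
  also have "\<dots> = of_nat (n + k + 1) \<odot> act M \<qq> (vk (Suc k)) \<oplus> (of_nat (n + k + 1) * c) \<odot> vk k"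
    by (simp only: smult_add_right act_closed vk_closed smult_closed_c smult_smult)
  finally have 1: "of_nat (n + k + 1) \<odot> act M \<qq> (vk (Suc k)) \<oplus> (of_nat (n + k + 1) * c) \<odot> vk k
     = ydown n c k \<odot> vk k \<oplus> act M \<pp> (act M \<ff> (vk (Suc k)))"
    unfolding Suc using pv by (simp add: act_add_right)
  let ?Q = "act M \<qq> (vk (Suc k))" and ?C = "of_nat (n + k + 1) * c" and ?N = "of_nat (n + k + 1) :: complex"
  have "of_nat (n + Suc k + 1) \<odot> ?Q = ?N \<odot> ?Q \<oplus> ?Q"
    using smult_add_left[of ?Q ?N 1] by (simp add: add_ac)
  also have "?N \<odot> ?Q = (?N \<odot> ?Q \<oplus> ?C \<odot> vk k) \<oplus> (- ?C) \<odot> vk k"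
    using smult_collect[of "vk k" ?C "- ?C"] by (simp add: a_assoc)
  also have "\<dots> = ydown n c k \<odot> vk k \<oplus> (- ?C) \<odot> vk k \<oplus> act M \<pp> (act M \<ff> (vk (Suc k)))"
    unfolding 1 by (simp add: a_ac)
  also have "ydown n c k \<odot> vk k \<oplus> (- ?C) \<odot> vk k = (ydown n c k - ?C) \<odot> vk k"
    by (simp add: smult_collect)
  also have "ydown n c k - ?C = ydown n c (Suc k)"
    using ydown_diff[of n c k] by (simp add: algebra_simps)
  finally show ?case using fp by (simp add: a_assoc)
qed

lemma u_0: "n + k < i \<Longrightarrow> u (k, i) = \<zero>"
proof -
  assume "n + k < i"
  then obtain d where i: "i = d + Suc (n + k)" by (metis add.commute less_iff_Suc_add add_Suc_right)
  have "u (k, i) = (act M \<ff> ^^ d) ((act M \<ff> ^^ Suc (n + k)) (vk k))"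
    by (simp only: u_def prod.case i funpow_add comp_apply)
  then show ?thesis using nil[of k] by (simp only: vk_def act_pow_zero)
qed

lemma q_u: "act M \<qq> (u (k, i)) = (ydown n c k / of_nat (n + k + 1)) \<odot> u (k - 1, i)
    \<oplus> (1 / of_nat (n + k + 1)) \<odot> u (k + 1, i + 1)"
proof -
  let ?N = "of_nat (n + k + 1) :: complex"
  have N: "?N \<noteq> 0" by (simp only: of_nat_eq_0_iff)
  have qf: "bracket \<qq> \<ff> = 0"
    by (simp add: bracket_schr_def \<qq>_def \<ff>_def zero_schr_def)
  have "act M \<qq> (vk k) = (1 / ?N) \<odot> (?N \<odot> act M \<qq> (vk k))"
    using N by (simp add: smult_smult del: of_nat_add of_nat_Suc)
  also have "\<dots> = (ydown n c k / ?N) \<odot> vk (k - 1) \<oplus> (1 / ?N) \<odot> act M \<ff> (vk (k + 1))"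
    unfolding q_vk by (simp only: smult_add_right smult_closed_c act_closed vk_closed smult_smult) (simp add: algebra_simps)?
  finally have "(act M \<ff> ^^ i) (act M \<qq> (vk k)) = (ydown n c k / ?N) \<odot> (act M \<ff> ^^ i) (vk (k - 1))
     \<oplus> (1 / ?N) \<odot> (act M \<ff> ^^ i) (act M \<ff> (vk (k + 1)))"
    by (simp only: act_pow_add act_pow_smult smult_closed_c act_closed vk_closed)
  then show ?thesis
    using act_pow_commute[OF qf, of "vk k" i] by (simp add: u_def funpow_swap1)
qed

definition \<Psi> :: "(nat \<times> nat \<Rightarrow> complex) \<Rightarrow> 'm" where "\<Psi> = lc M u"

lemma \<Psi>_delta [simp]: "\<Psi> (delta x) = u x" by (simp add: \<Psi>_def)

text \<open>The vectors \<open>u (k, i)\<close> are only known to satisfy the relations of the model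
  and may be dependent or zero; the map from the model is a homomorphism nevertheless, and its
  injectivity is a separate matter of simplicity.\<close>

lemma \<Psi>_hom: "mod_hom UNIV (Kmod n c) M \<Psi>"
proof (rule mod_hom_generators[OF lie_module_Kmod lie_module_axioms])
  have fs: "finsupp (K_e n (delta x))" "finsupp (K_f n (delta x))" "finsupp (K_q n c (delta x))" for x
    by (rule K_finsupp[OF finsupp_delta, of _ n c]; simp)+
  note add = lin_opD(1)[OF K_lin(1)] lin_opD(1)[OF K_lin(3)] lin_opD(1)[OF K_lin(5)]
  note smu = lin_opD(2)[OF K_lin(1)] lin_opD(2)[OF K_lin(3)] lin_opD(2)[OF K_lin(5)]
  have e: "act M \<ee> (u (k, i)) = lc M u (K_e n (delta (k, i)))" for k i
  proof (cases i)
    case 0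
    have "K_e n (delta (k, i)) = (\<lambda>x. 0)" using 0 by (auto simp: K_e_def delta_def)
    then show ?thesis using 0 e_vk[of k] by (simp add: u_def)
  next
    case (Suc j)
    have "K_e n (delta (k, i)) = (\<lambda>x. (of_nat (Suc j) * (of_nat (n + k) - of_nat j)) * delta (k, j) x)"
      using Suc by (auto simp: K_e_def delta_def)
    then show ?thesis
      using Suc e_f_pow[OF lie_module_axioms vk_closed h_vk[of k] e_vk, of j]
      by (simp only: lc_smult[OF finsupp_delta u_closed] lc_delta[OF u_closed]) (simp add: u_def)
  qed
  have f: "act M \<ff> (u (k, i)) = lc M u (K_f n (delta (k, i)))" for k i
  proof (cases "Suc i \<le> n + k")
    case True
    have "K_f n (delta (k, i)) = delta (k, Suc i)" using True by (auto simp: K_f_def delta_def fun_eq_iff)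
    then show ?thesis by (simp only: lc_delta[OF u_closed]) (simp add: u_def)
  next
    case False
    have "K_f n (delta (k, i)) = (\<lambda>x. 0)" using False by (auto simp: K_f_def delta_def fun_eq_iff)
    then show ?thesis using u_0[of k "Suc i"] False by (simp add: u_def)
  qed
  have q: "act M \<qq> (u (k, i)) = lc M u (K_q n c (delta (k, i)))" if "i \<le> n + k" for k i
  proof -
    \<comment> \<open>For i = n + k the guard of \<open>K_q\<close> removes the term on level k - 1.
      In the module the corresponding vector \<open>u (k - 1, i)\<close> is zero, so the two
      coefficients give the same vector.\<close>
    let ?y = "if k \<noteq> 0 \<and> Suc i \<le> n + k then ydown n c k / of_nat (n + k + 1) else 0"
    have "K_q n c (delta (k, i)) = (\<lambda>x. ?y * delta (k - 1, i) x + (1 / of_nat (n + k + 1)) * delta (k + 1, i + 1) x)"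
    proof
      fix x :: "nat \<times> nat"
      obtain l j where x: "x = (l, j)" by (cases x)
      show "K_q n c (delta (k, i)) x = ?y * delta (k - 1, i) x + (1 / of_nat (n + k + 1)) * delta (k + 1, i + 1) x"
      proof (cases "k = l + 1 \<and> j = i")
        case True
        then have k: "k = Suc l" "j = i" by auto
        show ?thesis unfolding x k by (auto simp add: K_q_def delta_def add_ac)
      next
        case F: False
        show ?thesis
        proof (cases "l = k + 1 \<and> j = i + 1")
          case True
          then show ?thesis using that by (simp add: x K_q_def delta_def add_ac)
        next
          case False
          have "K_q n c (delta (k, i)) (l, j) = 0" using F False by (auto simp: K_q_def delta_def)
          moreover have "?y * delta (k - 1, i) (l, j) = 0" using F by (auto simp: delta_def)
          moreover have "delta (k + 1, i + 1) (l, j) = 0" using False by (auto simp: delta_def)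
          ultimately show ?thesis by (simp add: x)
        qed
      qed
    qed
    moreover have "lc M u (\<lambda>x. ?y * delta (k - 1, i) x + (1 / of_nat (n + k + 1)) * delta (k + 1, i + 1) x)
      = ?y \<odot> u (k - 1, i) \<oplus> (1 / of_nat (n + k + 1)) \<odot> u (k + 1, i + 1)"
      by (subst lc_add) (auto simp only: finsupp_mult finsupp_delta u_closed lc_smult lc_delta)
    moreover have "?y \<odot> u (k - 1, i) = (ydown n c k / of_nat (n + k + 1)) \<odot> u (k - 1, i)"
      using u_0[of "k - 1" i] by (cases k) (auto simp: ydown_def)
    ultimately show ?thesis using q_u[of k i] by simp
  qed
  have "\<Psi> (act (Kmod n c) x a) = act M x (\<Psi> a)" if x: "x \<in> {\<ee>, \<ff>, \<qq>}" and a: "a \<in> K_carrier n" for x a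
  proof -
    have fa: "finsupp a" and za: "\<And>k i. a (k, i) \<noteq> 0 \<Longrightarrow> i \<le> n + k"
      using a by (auto simp: K_carrier_def not_less[symmetric])
    have be: "act M \<ee> (u i) = lc M u (K_e n (delta i))" for i using e by (cases i) simp
    have bf: "act M \<ff> (u i) = lc M u (K_f n (delta i))" for i using f by (cases i) simp
    have bq: "act M \<qq> (u i) = lc M u (K_q n c (delta i))" if "a i \<noteq> 0" for i
      using q za that by (cases i) simp
    have "act M \<ee> (lc M u a) = lc M u (K_e n a)"
      by (rule lc_hom(1)[where A = "K_e n" and w = u]) (use u_closed add(1) smu(1) fs be fa in auto)
    moreover have "act M \<ff> (lc M u a) = lc M u (K_f n a)"
      by (rule lc_hom(1)[where A = "K_f n" and w = u]) (use u_closed add(2) smu(2) fs bf fa in auto)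
    moreover have "act M \<qq> (lc M u a) = lc M u (K_q n c a)"
      by (rule lc_hom(1)[where A = "K_q n c" and w = u]) (use u_closed add(3) smu(3) fs bq fa in auto)
    ultimately show ?thesis using x by (auto simp: \<Psi>_def Kmod_def)
  qed
  then show "mod_hom {\<ee>, \<ff>, \<qq>} (Kmod n c) M \<Psi>"
    by (auto simp: mod_hom_def Kmod_def \<Psi>_def K_carrier_def lc_add lc_smult)
qed

lemma u_00: "u (0, 0) = v" by (simp add: u_def vk_def)

lemma \<Psi>_loc: "mod_hom_loc (Kmod n c) M UNIV \<Psi>"
proof -
  interpret K: lie_module "Kmod n c" by (rule lie_module_Kmod)
  show ?thesis by unfold_locales (rule \<Psi>_hom)
qed

lemma q_v_zero:
  assumes "act M \<pp> v = \<zero>"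
  shows "act M \<qq> v = \<zero>"
proof -
  have "of_nat (Suc n) \<odot> act M \<qq> v = \<zero>" using q_v assms by (simp add: add.commute)
  then show ?thesis using smult_eq_0[of "of_nat (Suc n)" "act M \<qq> v"] by (simp del: of_nat_Suc)
qed

end

section \<open>Simplicity and isotypic components of the model\<close>

lemma delta_apply: "delta i j = (if j = i then 1 else 0)" by (simp add: delta_def)

lemma delta_K_carrier: "i \<le> n + k \<Longrightarrow> delta (k, i) \<in> K_carrier n"
  by (auto simp: K_carrier_def delta_apply)

lemma delta_nonzero: "delta i \<noteq> (\<lambda>j. 0)"
  by (metis delta_apply zero_neq_one)

definition comp :: "nat \<Rightarrow> (nat \<times> nat \<Rightarrow> complex) \<Rightarrow> nat \<times> nat \<Rightarrow> complex"
  where "comp k0 a = (\<lambda>(k, i). if k = k0 then a (k, i) else 0)"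

lemma Kmod_simps [simp]:
  "carrier (Kmod n c) = K_carrier n" "zero (Kmod n c) = (\<lambda>i. 0)"
  "v \<oplus>\<^bsub>Kmod n c\<^esub> w = (\<lambda>i. v i + w i)" "r \<odot>\<^bsub>Kmod n c\<^esub> v = (\<lambda>i. r * v i)"
  "act (Kmod n c) \<ee> = K_e n" "act (Kmod n c) \<hh> = K_h n" "act (Kmod n c) \<ff> = K_f n"
  "act (Kmod n c) \<pp> = K_p n c" "act (Kmod n c) \<qq> = K_q n c" "act (Kmod n c) \<zz> = (\<lambda>v i. c * v i)"
  by (simp_all add: Kmod_def)

lemma K_minus:
  assumes "v \<in> K_carrier n" "w \<in> K_carrier n"
  shows "v \<ominus>\<^bsub>Kmod n c\<^esub> w = (\<lambda>i. v i - w i)"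
  unfolding Kmod_def using lie_module_Kmod[of n c, unfolded Kmod_def] assms by (rule fun_rep_minus)

lemma submod_KmodD:
  assumes "submod A W (Kmod n c)"
  shows "W \<subseteq> K_carrier n" "(\<lambda>i. 0) \<in> W" "a \<in> W \<Longrightarrow> b \<in> W \<Longrightarrow> (\<lambda>i. a i + b i) \<in> W"
    "a \<in> W \<Longrightarrow> (\<lambda>i. r * a i) \<in> W" "a \<in> W \<Longrightarrow> b \<in> W \<Longrightarrow> (\<lambda>i. a i - b i) \<in> W"
    "a \<in> W \<Longrightarrow> x \<in> A \<Longrightarrow> act (Kmod n c) x a \<in> W"
proof -
  interpret lie_module "Kmod n c" by (rule lie_module_Kmod)
  have s: "submodule W complex_field (Kmod n c)" using assms by (simp add: submod_def)
  note d = submoduleD[OF s]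
  show "W \<subseteq> K_carrier n" "(\<lambda>i. 0) \<in> W" "a \<in> W \<Longrightarrow> b \<in> W \<Longrightarrow> (\<lambda>i. a i + b i) \<in> W"
    and sm: "a \<in> W \<Longrightarrow> (\<lambda>i. r * a i) \<in> W" for a r b
    using d(1-4) by (auto simp: subset_iff)
  show "a \<in> W \<Longrightarrow> b \<in> W \<Longrightarrow> (\<lambda>i. a i - b i) \<in> W"
    using d(3)[of a "\<lambda>i. (- 1) * b i"] sm[of b "- 1"] by simp
  show "a \<in> W \<Longrightarrow> x \<in> A \<Longrightarrow> act (Kmod n c) x a \<in> W" using assms by (simp add: submod_def)
qed

text \<open>The operator fe + h^2/4 + h/2 is the Casimir element up to normalization. Its value on
  L(m) is seen on the highest weight vector: m^2/4 + m/2 = m (m + 2) / 4, here with m = n +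
  k.\<close>

lemma K_casimir:
  assumes "a \<in> K_carrier n"
  shows "K_f n (K_e n a) (k, i) + (K_h n (K_h n a) (k, i) / 4 + K_h n a (k, i) / 2)
    = of_nat ((n + k) * (n + k + 2)) / 4 * a (k, i)"
proof (cases "n + k < i")
  case True
  then show ?thesis using assms by (simp add: K_f_def K_e_def K_h_def K_carrier_def)
next
  case False
  then show ?thesis
    by (cases i) (simp_all add: K_f_def K_e_def K_h_def field_simps)
qed

lemma casimir_inj: "(n + k) * (n + k + 2) = (n + l) * (n + l + 2) \<Longrightarrow> k = (l::nat)"
proof (rule ccontr)
  have mono: "(n + k) * (n + k + 2) < (n + l) * (n + l + 2)" if "k < l" for k l
    using that by (intro mult_strict_mono) auto
  assume "(n + k) * (n + k + 2) = (n + l) * (n + l + 2)" "k \<noteq> l"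
  then show False using mono[of k l] mono[of l k] by linarith
qed

text \<open>The eigenvalues of the Casimir element separate the types \<open>L(n + k)\<close> of the model.\<close>

lemma comp_mem:
  assumes "submod sl2 W (Kmod n c)" "a \<in> W"
  shows "comp k0 a \<in> W"
proof -
  note W = submod_KmodD[OF assms(1)]
  have efh: "\<ee> \<in> sl2" "\<ff> \<in> sl2" "\<hh> \<in> sl2" by (simp_all add: sl2_def \<ee>_def \<ff>_def \<hh>_def)
  define S where "S = (\<lambda>a :: nat \<times> nat \<Rightarrow> complex. {k. k \<noteq> k0 \<and> (\<exists>i. a (k, i) \<noteq> 0)})"
  have fin: "finite (S a)" if "a \<in> W" for a
  proof -
    have "finite {x. a x \<noteq> 0}" using that W(1) by (auto simp: K_carrier_def finsupp_def)
    then have "finite (fst ` {x. a x \<noteq> 0})" by simp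
    then show ?thesis by (rule finite_subset[rotated]) (force simp: S_def)
  qed
  show ?thesis using assms(2)
  proof (induction "card (S a)" arbitrary: a rule: less_induct)
    case less
    show ?case
    proof (cases "S a = {}")
      case True
      then have "comp k0 a = a" by (auto simp: comp_def S_def fun_eq_iff)
      then show ?thesis using less by simp
    next
      case False
      then obtain k1 where k1: "k1 \<in> S a" by auto
      define \<chi> where "\<chi> k = (of_nat ((n + k) * (n + k + 2)) / 4 :: complex)" for k
      have \<chi>: "\<chi> k0 - \<chi> k1 \<noteq> 0"
        using casimir_inj[of n k0 k1] k1 by (auto simp: \<chi>_def S_def simp del: of_nat_mult of_nat_add)
      have aK: "a \<in> K_carrier n" using less(2) W(1) by auto
      \<comment> \<open>Casimir minus its value on level k1: this kills level k1 and multiplies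
        level k0 by the nonzero number \<open>\<chi> k0 - \<chi> k1\<close>, so the number of
        unwanted levels drops and the wanted component is recovered by division.\<close>
      define b where "b = (\<lambda>x. (K_f n (K_e n a) x + ((1 / 4) * K_h n (K_h n a) x + (1 / 2) * K_h n a x)) - \<chi> k1 * a x)"
      have e: "K_e n a \<in> W" and h: "K_h n a \<in> W" using W(6)[OF less(2) efh(1)] W(6)[OF less(2) efh(3)] by simp_all
      have fe: "K_f n (K_e n a) \<in> W" and hh: "K_h n (K_h n a) \<in> W"
        using W(6)[OF e efh(2)] W(6)[OF h efh(3)] by simp_all
      have bW: "b \<in> W" unfolding b_def by (intro W(3-5) fe h hh less(2))
      have b: "b (k, i) = (\<chi> k - \<chi> k1) * a (k, i)" for k i
        using K_casimir[OF aK, of k i] by (simp add: b_def \<chi>_def algebra_simps)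
      have "S b \<subset> S a" using k1 by (auto simp: S_def b)
      then have "card (S b) < card (S a)" using fin[OF less(2)] by (simp add: psubset_card_mono)
      then have "comp k0 b \<in> W" using less(1) bW by blast
      then have "(\<lambda>i. (1 / (\<chi> k0 - \<chi> k1)) * comp k0 b i) \<in> W" by (rule W(4))
      also have "(\<lambda>i. (1 / (\<chi> k0 - \<chi> k1)) * comp k0 b i) = comp k0 a"
        using \<chi> by (auto simp: comp_def b fun_eq_iff)
      finally show ?thesis .
    qed
  qed
qed

lemma K_e_kernel:
  assumes "b \<in> K_carrier n" "K_e n b = (\<lambda>x. 0)"
  shows "b (k, Suc i) = 0"
proof (cases "Suc i \<le> n + k")
  case True
  have "of_nat (Suc i) * (of_nat n + of_nat k - of_nat i) * b (k, Suc i) = 0"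
    using fun_cong[OF assms(2), of "(k, i)"] by (simp add: K_e_def)
  moreover have "of_nat n + of_nat k - of_nat i = (of_nat (n + k - i) :: complex)"
    using True by (simp add: of_nat_diff)
  ultimately have "of_nat (Suc i) * of_nat (n + k - i) * b (k, Suc i) = 0" by (simp only:)
  moreover have "of_nat (Suc i) \<noteq> (0 :: complex)" "of_nat (n + k - i) \<noteq> (0 :: complex)"
    using True by (simp_all add: Suc_le_eq del: of_nat_Suc of_nat_diff)
  ultimately show ?thesis by (simp only: mult_eq_0_iff simp_thms)
next
  case False
  then show ?thesis using assms(1) by (simp add: K_carrier_def)
qed

text \<open>Each application of e lowers by one the bound on the second index i, so the last nonzero
  power of e applied to \<open>a\<close> lies in the kernel of e.\<close>

lemma K_e_descend:
  assumes "submod A W (Kmod n c)" "\<ee> \<in> A" "a \<in> W" "a \<noteq> (\<lambda>x. 0)"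
  obtains b where "b \<in> W" "b \<noteq> (\<lambda>x. 0)" "K_e n b = (\<lambda>x. 0)"
proof -
  note W = submod_KmodD[OF assms(1)]
  have "\<exists>b\<in>W. b \<noteq> (\<lambda>x. 0) \<and> K_e n b = (\<lambda>x. 0)"
    if "a \<in> W" "a \<noteq> (\<lambda>x. 0)" "\<And>k i. N \<le> i \<Longrightarrow> a (k, i) = 0" for N a
    using that
  proof (induction N arbitrary: a)
    case 0
    then show ?case by (auto simp: fun_eq_iff)
  next
    case (Suc N)
    show ?case
    proof (cases "K_e n a = (\<lambda>x. 0)")
      case True
      then show ?thesis using Suc by blast
    next
      case False
      have "K_e n a \<in> W" using W(6)[OF Suc.prems(1) assms(2)] by simp
      moreover have "K_e n a (k, i) = 0" if "N \<le> i" for k i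
        using Suc.prems(3)[of "i + 1" k] that by (simp add: K_e_def)
      ultimately show ?thesis using Suc.IH[of "K_e n a"] False by blast
    qed
  qed
  moreover obtain N where "\<And>k i. N \<le> i \<Longrightarrow> a (k, i) = 0"
  proof -
    have "finite {x. a x \<noteq> 0}" using assms(3) W(1) by (auto simp: K_carrier_def finsupp_def)
    then have "finite (snd ` {x. a x \<noteq> 0})" by simp
    then obtain N where "\<forall>j\<in>snd ` {x. a x \<noteq> 0}. j < N" using finite_nat_set_iff_bounded by blast
    then show ?thesis using that[of N] by (force simp: not_less[symmetric])
  qed
  ultimately show ?thesis using assms(3,4) that by blast
qed

lemma K_generated:
  assumes "submod UNIV W (Kmod n c)" "delta (0, 0) \<in> W"
  shows "W = K_carrier n"
proof
  note W = submod_KmodD[OF assms(1)]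
  show "W \<subseteq> K_carrier n" by (rule W(1))
  have p: "delta (k, 0) \<in> W" for k
  proof (induction k)
    case (Suc k)
    have "K_p n c (delta (k, 0)) \<in> W" using W(6)[OF Suc, of \<pp>] by simp
    moreover have "of_nat n + (1 + of_nat k) \<noteq> (0 :: complex)"
      using of_nat_neq_0[of "n + k", where 'a = complex] by (simp add: add_ac)
    then have "K_p n c (delta (k, 0)) = delta (Suc k, 0)"
      by (auto simp: K_p_def delta_apply fun_eq_iff)
    ultimately show ?case by simp
  qed (rule assms(2))
  have d: "delta (k, i) \<in> W" if "i \<le> n + k" for k i
    using that
  proof (induction i)
    case (Suc i)
    have "K_f n (delta (k, i)) \<in> W" using W(6)[of _ \<ff>] Suc by simp
    moreover have "K_f n (delta (k, i)) = delta (k, Suc i)"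
      using Suc(2) by (auto simp: K_f_def delta_apply fun_eq_iff)
    ultimately show ?case by simp
  qed (rule p)
  show "K_carrier n \<subseteq> W"
  proof
    fix a assume "a \<in> K_carrier n"
    then have "finsupp a" "\<And>k i. a (k, i) \<noteq> 0 \<Longrightarrow> i \<le> n + k"
      by (auto simp: K_carrier_def not_less[symmetric])
    then show "a \<in> W"
    proof (induction a rule: finsupp_induct)
      case (add a r x)
      obtain k i where x: "x = (k, i)" by (cases x)
      have "a \<in> W"
      proof (rule add.IH)
        fix k' i' assume "a (k', i') \<noteq> 0"
        then show "i' \<le> n + k'" using add.prems[of k' i'] add.hyps by (auto simp: delta_apply split: if_splits)
      qed
      moreover have "i \<le> n + k" using add.prems[of k i] add.hyps x by (auto simp: delta_apply)
      ultimately show ?case unfolding x by (intro W(3,4) d)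
    qed (rule W(2))
  qed
qed

text \<open>A nonzero submodule contains a nonzero combination of the highest weight vectors p^k v.
  For c nonzero every \<open>ydown n c (Suc k)\<close> is nonzero, so such a combination can be
  moved down to a multiple of v, which generates the model.\<close>

lemma Kmod_simple:
  assumes "c \<noteq> 0" shows "simple_mod UNIV (Kmod n c)"
  unfolding simple_mod_def
proof (intro conjI allI impI)
  have "delta (0, 0) \<in> K_carrier n" by (rule delta_K_carrier) simp
  then show "carrier (Kmod n c) \<noteq> {\<zero>\<^bsub>Kmod n c\<^esub>}" using delta_nonzero[of "(0, 0) :: nat \<times> nat"] by auto
  fix W assume W': "submod UNIV W (Kmod n c)"
  note W = submod_KmodD[OF W']
  show "W = {\<zero>\<^bsub>Kmod n c\<^esub>} \<or> W = carrier (Kmod n c)"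
  proof (cases "W = {\<lambda>i. 0}")
    case False
    then obtain a where "a \<in> W" "a \<noteq> (\<lambda>i. 0)" using W(2) by auto
    then obtain b where b: "b \<in> W" "b \<noteq> (\<lambda>x. 0)" "K_e n b = (\<lambda>x. 0)"
      using K_e_descend[OF W'] by blast
    have y: "ydown n c (Suc k) \<noteq> 0" for k
    proof -
      have "2 * of_nat n + of_nat (Suc k) + 1 = (of_nat (2 * n + Suc k + 1) :: complex)" by simp
      also have "\<dots> \<noteq> 0" by (simp only: of_nat_eq_0_iff)
      finally show ?thesis using assms by (simp add: ydown_def del: of_nat_Suc)
    qed
    have "delta (0, 0) \<in> W" if "b \<in> W" "b \<noteq> (\<lambda>x. 0)" "\<And>k i. b (k, Suc i) = 0" "\<And>k. N \<le> k \<Longrightarrow> b (k, 0) = 0" for N b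
      using that
    proof (induction N arbitrary: b)
      case 0
      then have "b (k, i) = 0" for k i by (cases i) auto
      then show ?case using 0(2) by (auto simp: fun_eq_iff)
    next
      case (Suc N)
      \<comment> \<open>The operator q (h + 1) - f p. On p^k v, where h + 1 is n + k + 1, the term f
        p^(k+1) v of \<open>q_vk\<close> cancels and \<open>ydown n c k\<close> times p^(k-1) v
        remains: one step down, inside the kernel of e.\<close>
      define b' where "b' = (\<lambda>x. K_q n c (\<lambda>x. K_h n b x + b x) x - K_f n (K_p n c b) x)"
      have hW: "K_h n b \<in> W" and pW: "K_p n c b \<in> W" using W(6)[OF Suc.prems(1), of \<hh>] W(6)[OF Suc.prems(1), of \<pp>] by simp_all
      have "K_q n c (\<lambda>x. K_h n b x + b x) \<in> W" using W(6)[OF W(3)[OF hW Suc.prems(1)], of \<qq>] by simp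
      moreover have "K_f n (K_p n c b) \<in> W" using W(6)[OF pW, of \<ff>] by simp
      ultimately have b'W: "b' \<in> W" unfolding b'_def by (rule W(5))
      have nz: "of_nat n + of_nat k + 2 \<noteq> (0 :: complex)" "of_nat n + (1 + of_nat k) \<noteq> (0 :: complex)" for k
        using of_nat_neq_0[of "n + k + 1", where 'a = complex] of_nat_neq_0[of "n + k", where 'a = complex] by (simp_all add: add_ac)
      have b0: "b' (k, 0) = ydown n c (Suc k) * b (Suc k, 0)" for k
      proof -
        have "b' (k, 0) = ydown n c (Suc k) / (of_nat n + of_nat k + 2) * ((of_nat n + of_nat k + 2) * b (Suc k, 0))"
          by (simp add: b'_def K_q_def K_f_def K_h_def algebra_simps)
        then show ?thesis using nz(1)[of k] by simp
      qed
      have b1: "b' (k, Suc i) = 0" for k i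
      proof (cases i)
        case 0
        have "(of_nat n + of_nat k) * b (k - 1, 0) / (of_nat n + of_nat k) = b (k - 1, 0)" if "k \<noteq> 0"
          using that nz(2)[of "k - 1"] by (cases k) auto
        then show ?thesis
          using 0 Suc.prems(3)
          by (cases k) (simp_all add: b'_def K_q_def K_f_def K_h_def K_p_def algebra_simps)
      next
        case (Suc j)
        then show ?thesis using \<open>\<And>k i. b (k, Suc i) = 0\<close>
          by (simp add: b'_def K_q_def K_f_def K_h_def K_p_def)
      qed
      show ?case
      proof (cases "b' = (\<lambda>x. 0)")
        case True
        \<comment> \<open>If the lowering operator kills b, every level above 0 is absent and b is a
          nonzero multiple of v.\<close>
        have "b (Suc k, 0) = 0" for k using b0[of k] y[of k] True by simp
        then have z: "b (k, i) = 0" if "(k, i) \<noteq> (0, 0)" for k i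
          using that Suc.prems(3) by (cases k; cases i) auto
        have "b (0, 0) \<noteq> 0"
        proof
          assume "b (0, 0) = 0"
          then have "b x = 0" for x using z by (cases x) metis
          then show False using Suc.prems(2) by auto
        qed
        moreover have "(\<lambda>x. (1 / b (0, 0)) * b x) \<in> W" using Suc.prems(1) by (rule W(4))
        moreover have "(1 / b (0, 0)) * b x = delta (0, 0) x" if "b (0, 0) \<noteq> 0" for x
          using z that by (cases x) (auto simp: delta_apply)
        ultimately show ?thesis by (metis (no_types, lifting) ext)
      next
        case False
        then show ?thesis
          using Suc.IH[OF b'W False b1] b0 Suc.prems(4) by simp
      qed
    qed
    moreover obtain N where "\<And>k. N \<le> k \<Longrightarrow> b (k, 0) = 0"
    proof -
      have "finite {x. b x \<noteq> 0}" using b(1) W(1) by (auto simp: K_carrier_def finsupp_def)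
      then have "finite (fst ` {x. b x \<noteq> 0})" by simp
      then obtain N where "\<forall>j\<in>fst ` {x. b x \<noteq> 0}. j < N" using finite_nat_set_iff_bounded by blast
      then show ?thesis using that[of N] by (force simp: not_less[symmetric])
    qed
    ultimately have "delta (0, 0) \<in> W" using b K_e_kernel W(1) by blast
    then show ?thesis using K_generated[OF W'] by simp
  qed simp
qed

section \<open>Finite-dimensional simple modules\<close>

definition L_e :: "nat \<Rightarrow> (nat \<Rightarrow> complex) \<Rightarrow> nat \<Rightarrow> complex"
  where "L_e n v = (\<lambda>i. if i \<le> n then of_nat (i + 1) * (of_nat n - of_nat i) * v (i + 1) else 0)"
definition L_f :: "nat \<Rightarrow> (nat \<Rightarrow> complex) \<Rightarrow> nat \<Rightarrow> complex"
  where "L_f n v = (\<lambda>i. if i \<le> n then if i = 0 then 0 else v (i - 1) else 0)"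

lemma Lmod_simps [simp]:
  "carrier (Lmod n) = {v. \<forall>i>n. v i = 0}" "zero (Lmod n) = (\<lambda>i. 0)"
  "v \<oplus>\<^bsub>Lmod n\<^esub> w = (\<lambda>i. v i + w i)" "r \<odot>\<^bsub>Lmod n\<^esub> v = (\<lambda>i. r * v i)"
  "act (Lmod n) \<ee> = L_e n" "act (Lmod n) \<ff> = L_f n"
  "act (Lmod n) \<pp> = (\<lambda>v i. 0)" "act (Lmod n) \<qq> = (\<lambda>v i. 0)" "act (Lmod n) \<zz> = (\<lambda>v i. 0)"
  by (auto simp: Lmod_def \<ee>_def \<ff>_def \<pp>_def \<qq>_def \<zz>_def L_e_def L_f_def fun_eq_iff)

lemma Lmod_finsupp: "v \<in> carrier (Lmod n) \<Longrightarrow> finsupp v"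
  unfolding finsupp_def by (rule finite_subset[of _ "{..n}"]) (auto simp: not_less[symmetric])

lemma (in mod_hom_loc) inj_nonzero:
  "inj_on \<phi> (carrier M) \<Longrightarrow> v \<in> carrier M \<Longrightarrow> v \<noteq> \<zero>\<^bsub>M\<^esub> \<Longrightarrow> \<phi> v \<noteq> \<zero>\<^bsub>N\<^esub>"
  using M.zero_closed hom_zero by (metis inj_onD)

lemma Lmod_h: "v \<in> carrier (Lmod n) \<Longrightarrow> act (Lmod n) \<hh> v = (\<lambda>i. (of_nat n - 2 * of_nat i) * v i)"
  by (auto simp: Lmod_def \<hh>_def)

lemma sl2_mem [simp]: "\<ee> \<in> sl2" "\<ff> \<in> sl2" "\<hh> \<in> sl2"
  by (simp_all add: sl2_def \<ee>_def \<ff>_def \<hh>_def)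

lemma L_e_kernel:
  assumes "v \<in> carrier (Lmod n)" "L_e n v = (\<lambda>i. 0)"
  shows "v (Suc i) = 0"
proof (cases "Suc i \<le> n")
  case True
  have "of_nat (Suc i) * (of_nat n - of_nat i) * v (Suc i) = 0"
    using fun_cong[OF assms(2), of i] True by (simp add: L_e_def)
  moreover have "of_nat n - of_nat i = (of_nat (n - i) :: complex)"
    using True by (simp add: of_nat_diff)
  ultimately have "of_nat (Suc i) * of_nat (n - i) * v (Suc i) = 0" by (simp only:)
  moreover have "of_nat (Suc i) \<noteq> (0 :: complex)" "of_nat (n - i) \<noteq> (0 :: complex)"
    using True by (simp_all add: Suc_le_eq del: of_nat_Suc of_nat_diff)
  ultimately show ?thesis by (simp only: mult_eq_0_iff simp_thms)
qed (use assms(1) in auto)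

lemma Lmod_simple: "simple_mod sl2 (Lmod n)"
  unfolding simple_mod_def
proof (intro conjI allI impI)
  interpret L: lie_module "Lmod n" by (rule lie_module_Lmod)
  have "delta 0 \<in> carrier (Lmod n)" by (auto simp: delta_apply)
  then show "carrier (Lmod n) \<noteq> {\<zero>\<^bsub>Lmod n\<^esub>}" using delta_nonzero[of "0 :: nat"] by auto
  fix W assume W': "submod sl2 W (Lmod n)"
  then have s: "submodule W complex_field (Lmod n)" by (simp add: submod_def)
  note d = L.submoduleD[OF s]
  have act: "a \<in> W \<Longrightarrow> x \<in> sl2 \<Longrightarrow> act (Lmod n) x a \<in> W" for a x using W' by (simp add: submod_def)
  show "W = {\<zero>\<^bsub>Lmod n\<^esub>} \<or> W = carrier (Lmod n)"
  proof (cases "W = {\<lambda>i. 0}")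
    case False
    then obtain a where a: "a \<in> W" "a \<noteq> (\<lambda>i. 0)" using d(2) by auto
    have "\<exists>b\<in>W. b \<noteq> (\<lambda>x. 0) \<and> L_e n b = (\<lambda>x. 0)"
      if "a \<in> W" "a \<noteq> (\<lambda>x. 0)" "\<And>i. N \<le> i \<Longrightarrow> a i = 0" for N a
      using that
    proof (induction N arbitrary: a)
      case 0
      then show ?case by (auto simp: fun_eq_iff)
    next
      case (Suc N)
      show ?case
      proof (cases "L_e n a = (\<lambda>x. 0)")
        case True
        then show ?thesis using Suc by blast
      next
        case False
        have "L_e n a \<in> W" using act[OF Suc.prems(1), of \<ee>] by simp
        moreover have "L_e n a i = 0" if "N \<le> i" for i
          using Suc.prems(3)[of "i + 1"] that by (simp add: L_e_def)
        ultimately show ?thesis using Suc.IH[of "L_e n a"] False by blast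
      qed
    qed
    moreover have "a i = 0" if "Suc n \<le> i" for i using a(1) d(1) that by auto
    ultimately obtain b where b: "b \<in> W" "b \<noteq> (\<lambda>i. 0)" "L_e n b = (\<lambda>i. 0)" using a by blast
    have bs: "b (Suc i) = 0" for i using L_e_kernel[of b n i] b d(1) by blast
    have b0: "b 0 \<noteq> 0"
    proof
      assume "b 0 = 0"
      then have "b i = 0" for i using bs by (cases i) auto
      then show False using b(2) by auto
    qed
    have "(1 / b 0) \<odot>\<^bsub>Lmod n\<^esub> b \<in> W" using b(1) by (rule d(4))
    moreover have "(1 / b 0) \<odot>\<^bsub>Lmod n\<^esub> b = delta 0"
    proof
      show "((1 / b 0) \<odot>\<^bsub>Lmod n\<^esub> b) i = delta 0 i" for i using bs b0 by (cases i) (auto simp: delta_apply)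
    qed
    ultimately have d0: "delta 0 \<in> W" by simp
    have di: "delta i \<in> W" if "i \<le> n" for i
      using that
    proof (induction i)
      case (Suc i)
      have "L_f n (delta i) \<in> W" using act[of _ \<ff>] Suc by simp
      moreover have "L_f n (delta i) = delta (Suc i)"
        using Suc(2) by (auto simp: L_f_def delta_apply fun_eq_iff)
      ultimately show ?case by simp
    qed (rule d0)
    have "carrier (Lmod n) \<subseteq> W"
    proof
      fix a assume "a \<in> carrier (Lmod n)"
      then have "finsupp a" "\<And>i. a i \<noteq> 0 \<Longrightarrow> i \<le> n" using Lmod_finsupp by (auto simp: not_less[symmetric])
      then show "a \<in> W"
      proof (induction a rule: finsupp_induct)
        case (add a r i)
        have "a \<in> W"
        proof (rule add.IH)
          fix j assume "a j \<noteq> 0"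
          then show "j \<le> n" using add.prems[of j] add.hyps by (auto simp: delta_apply split: if_splits)
        qed
        moreover have "i \<le> n" using add.prems[of i] add.hyps by (auto simp: delta_apply)
        ultimately show ?case using d(3)[of a "\<lambda>j. r * delta i j"] d(4)[of "delta i" r] di by simp
      qed (use d(2) in simp)
    qed
    then show ?thesis using d(1) by auto
  qed simp
qed

lemma Lmod_fin_dim: "fin_dim (Lmod n) (carrier (Lmod n))"
proof -
  interpret L: lie_module "Lmod n" by (rule lie_module_Lmod)
  let ?B = "delta ` {..n}"
  have B: "?B \<subseteq> carrier (Lmod n)" by (auto simp: delta_apply)
  note d = L.submoduleD[OF L.lspan_submodule[OF B]]
  have "carrier (Lmod n) \<subseteq> lspan (Lmod n) ?B"
  proof
    fix a assume "a \<in> carrier (Lmod n)"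
    then have "finsupp a" "\<And>i. a i \<noteq> 0 \<Longrightarrow> i \<le> n" using Lmod_finsupp by (auto simp: not_less[symmetric])
    then show "a \<in> lspan (Lmod n) ?B"
    proof (induction a rule: finsupp_induct)
      case (add a r i)
      have "a \<in> lspan (Lmod n) ?B"
      proof (rule add.IH)
        fix j assume "a j \<noteq> 0"
        then show "j \<le> n" using add.prems[of j] add.hyps by (auto simp: delta_apply split: if_splits)
      qed
      moreover have "i \<le> n" using add.prems[of i] add.hyps by (auto simp: delta_apply)
      then have "delta i \<in> lspan (Lmod n) ?B" using L.lspan_incl[of ?B] by auto
      ultimately show ?case using d(3)[of a "\<lambda>j. r * delta i j"] d(4)[of "delta i" r] by simp
    qed (use d(2) in simp)
  qed
  then have "carrier (Lmod n) = lspan (Lmod n) ?B" using d(1) by blast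
  then show ?thesis unfolding fin_dim_def using B by (intro exI[of _ ?B]) auto
qed

text \<open>For the second claim, q commutes with f and hence kills every f^i x. Since e, f and q
  generate the algebra, compatibility with the trivial action of p and z follows.\<close>

lemma Lmod_hom:
  fixes M :: "(schr, 'm) rep" (structure)
  assumes "lie_module M" "x \<in> carrier M" "act M \<hh> x = of_nat n \<odot> x" "act M \<ee> x = \<zero>"
    and nil: "(act M \<ff> ^^ Suc n) x = \<zero>"
  shows "mod_hom sl2 (Lmod n) M (lc M (\<lambda>i. (act M \<ff> ^^ i) x))"
    and "act M \<qq> x = \<zero> \<Longrightarrow> mod_hom UNIV (Lmod n) M (lc M (\<lambda>i. (act M \<ff> ^^ i) x))"
proof -
  interpret lie_module M by fact
  let ?w = "\<lambda>i. (act M \<ff> ^^ i) x"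
  have w: "?w i \<in> carrier M" for i using assms by simp
  have lin: "lin_op (L_e n)" "lin_op (L_f n)"
    by (auto simp: lin_op_def L_e_def L_f_def fun_eq_iff algebra_simps)
  note fin = Lmod_finsupp
  have fe: "finsupp (L_e n a)" "finsupp (L_f n a)" for a
    by (rule fin[of _ n], simp add: L_e_def L_f_def)+
  have be: "act M \<ee> (?w i) = lc M ?w (L_e n (delta i))" if "i \<le> n" for i
  proof (cases i)
    case 0
    have "L_e n (delta i) = (\<lambda>x. 0)" using 0 by (auto simp: L_e_def delta_def)
    then show ?thesis using 0 assms(4) by simp
  next
    case (Suc j)
    have "L_e n (delta i) = (\<lambda>x. (of_nat (Suc j) * (of_nat n - of_nat j)) * delta j x)"
      using Suc that by (auto simp: L_e_def delta_def)
    then show ?thesis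
      using Suc e_f_pow[OF assms(1-4), of j] by (simp only: lc_smult[OF finsupp_delta w] lc_delta[OF w])
  qed
  have bf: "act M \<ff> (?w i) = lc M ?w (L_f n (delta i))" if "i \<le> n" for i
  proof (cases "i = n")
    case True
    have "L_f n (delta i) = (\<lambda>x. 0)" using True by (auto simp: L_f_def delta_def fun_eq_iff)
    then show ?thesis using nil True by simp
  next
    case False
    have "L_f n (delta i) = delta (Suc i)" using False that by (auto simp: L_f_def delta_def fun_eq_iff)
    then show ?thesis by (simp only: lc_delta[OF w]) simp
  qed
  have r: "a i \<noteq> 0 \<Longrightarrow> i \<le> n" if "a \<in> carrier (Lmod n)" for a i
    using that by (auto simp: not_less[symmetric])
  have he: "act M \<ee> (lc M ?w a) = lc M ?w (L_e n a)" if a: "a \<in> carrier (Lmod n)" for a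
    by (rule lc_hom(1)[where A = "L_e n" and w = ?w])
      (use w lin_opD[OF lin(1)] fe be r[OF a] fin[OF a] in auto)
  have hf: "act M \<ff> (lc M ?w a) = lc M ?w (L_f n a)" if a: "a \<in> carrier (Lmod n)" for a
    by (rule lc_hom(1)[where A = "L_f n" and w = ?w])
      (use w lin_opD[OF lin(2)] fe bf r[OF a] fin[OF a] in auto)
  have ef: "mod_hom {\<ee>, \<ff>} (Lmod n) M (lc M ?w)"
    unfolding mod_hom_def using lc_add[of _ _ ?w] lc_smult[of _ ?w] fin he hf lc_closed[of ?w] w
    by auto
  then show "mod_hom sl2 (Lmod n) M (lc M ?w)"
    by (rule mod_hom_sl2_generators[OF lie_module_Lmod assms(1)])
  assume q: "act M \<qq> x = \<zero>"
  have "bracket \<qq> \<ff> = 0" by (simp add: bracket_schr_def \<qq>_def \<ff>_def zero_schr_def)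
  then have qw: "act M \<qq> (?w i) = \<zero>" for i
    using act_pow_commute[of \<qq> \<ff> x i] assms(2) q by simp
  have "act M \<qq> (lc M ?w a) = \<zero>" if a: "a \<in> carrier (Lmod n)" for a
    using lc_hom(1)[where A = "\<lambda>v i. 0" and w = ?w and x = \<qq> and a = a] w qw fin[OF a] by simp
  then have "mod_hom {\<ee>, \<ff>, \<qq>} (Lmod n) M (lc M ?w)" using ef by (auto simp: mod_hom_def)
  then show "mod_hom UNIV (Lmod n) M (lc M ?w)"
    by (rule mod_hom_generators[OF lie_module_Lmod assms(1)])
qed

text \<open>A highest weight vector spans a copy of L(n), as a nonzero map from a simple module is
  injective. The last claim says that this copy is the least sl2-submodule containing x, which later
  identifies it with a simple summand.\<close>

lemma hw_Lmod:
  fixes M :: "(schr, 'm) rep" (structure)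
  assumes M: "lie_module M" "x \<in> carrier M" "act M \<hh> x = of_nat n \<odot> x" "act M \<ee> x = \<zero>"
    and nil: "(act M \<ff> ^^ Suc n) x = \<zero>" and x: "x \<noteq> \<zero>"
  defines "W \<equiv> lc M (\<lambda>i. (act M \<ff> ^^ i) x) ` carrier (Lmod n)"
  shows "submod sl2 W M" "x \<in> W" "iso_mod sl2 (Lmod n) (restr M W)"
    "act M \<qq> x = \<zero> \<Longrightarrow> W = carrier M \<Longrightarrow> iso_mod UNIV (Lmod n) M"
    "submod sl2 U M \<Longrightarrow> x \<in> U \<Longrightarrow> W \<subseteq> U"
proof -
  interpret lie_module M by fact
  interpret L: lie_module "Lmod n" by (rule lie_module_Lmod)
  let ?w = "\<lambda>i. (act M \<ff> ^^ i) x"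
  let ?\<phi> = "lc M ?w"
  have w: "?w i \<in> carrier M" for i using assms by simp
  note h = Lmod_hom[OF assms(1-5)]
  interpret h: mod_hom_loc "Lmod n" M sl2 ?\<phi>
    using h(1) by (simp add: mod_hom_loc_def mod_hom_loc_axioms_def amodule_any L.amodule_any)
  have d0: "delta 0 \<in> carrier (Lmod n)" by (auto simp: delta_apply)
  have x0: "?\<phi> (delta 0) = x" by (simp only: lc_delta[OF w]) simp
  have inj: "inj_on ?\<phi> (carrier (Lmod n))"
    by (rule h.simple_inj[OF Lmod_simple d0]) (simp add: x0 x)
  show "submod sl2 W M" unfolding W_def by (rule h.image_submod[OF h.M.submod_carrier])
  show "x \<in> W" unfolding W_def using d0 x0 by (metis image_eqI)
  have bij: "bij_betw ?\<phi> (carrier (Lmod n)) W" using inj by (simp add: W_def bij_betw_def)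
  have "mod_hom sl2 (Lmod n) (restr M W) ?\<phi>"
    using h(1) unfolding mod_hom_def W_def by auto
  then show "iso_mod sl2 (Lmod n) (restr M W)" using bij unfolding iso_mod_hom by auto
  show "iso_mod UNIV (Lmod n) M" if "act M \<qq> x = \<zero>" "W = carrier M"
    using h(2)[OF that(1)] bij that(2) unfolding iso_mod_hom by auto
  assume U: "submod sl2 U M" "x \<in> U"
  have "?w i \<in> U" for i
  proof (induction i)
    case (Suc i)
    then show ?case using U(1) by (simp add: submod_def)
  qed (simp add: U(2))
  then show "W \<subseteq> U" unfolding W_def using U(1) lc_submodule[of U _ ?w] by (auto simp: submod_def)
qed

section \<open>Invariants distinguishing the models\<close>

text \<open>The image of the highest weight vector is killed by e, hence sits at index 0, and its
  h-weight is both n and n'.\<close>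

lemma Lmod_iso_eq:
  assumes "iso_mod sl2 (Lmod n) (Lmod n')" shows "n = n'"
proof -
  interpret L: lie_module "Lmod n" by (rule lie_module_Lmod)
  interpret L': lie_module "Lmod n'" by (rule lie_module_Lmod)
  obtain \<phi> where \<phi>: "bij_betw \<phi> (carrier (Lmod n)) (carrier (Lmod n'))" "mod_hom sl2 (Lmod n) (Lmod n') \<phi>"
    using assms by (auto simp: iso_mod_hom)
  interpret h: mod_hom_loc "Lmod n" "Lmod n'" sl2 \<phi>
    using \<phi>(2) by (simp add: mod_hom_loc_def mod_hom_loc_axioms_def L'.amodule_any L.amodule_any)
  have d0: "delta 0 \<in> carrier (Lmod n)" by (auto simp: delta_apply)
  let ?y = "\<phi> (delta 0)"
  have y: "?y \<in> carrier (Lmod n')" using d0 h.hom_closed by blast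
  have "?y \<noteq> (\<lambda>i. 0)"
    using h.inj_nonzero[OF bij_betw_imp_inj_on[OF \<phi>(1)] d0] delta_nonzero[of "0::nat"] by simp
  have "L_e n (delta 0) = (\<lambda>i. 0)" by (auto simp: L_e_def delta_apply)
  then have "L_e n' ?y = (\<lambda>i. 0)" using h.hom_act[OF sl2_mem(1) d0] h.hom_zero by simp
  then have ys: "?y (Suc i) = 0" for i using L_e_kernel y by blast
  have y0: "?y 0 \<noteq> 0"
  proof
    assume "?y 0 = 0"
    then have "?y i = 0" for i using ys by (cases i) auto
    then show False using \<open>?y \<noteq> _\<close> by auto
  qed
  have "act (Lmod n) \<hh> (delta 0) = of_nat n \<odot>\<^bsub>Lmod n\<^esub> delta 0"
    using Lmod_h[OF d0] by (auto simp: delta_apply)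
  then have "act (Lmod n') \<hh> ?y = of_nat n \<odot>\<^bsub>Lmod n'\<^esub> ?y"
    using h.hom_act[OF sl2_mem(3) d0] h.hom_smult[OF d0] by simp
  then have "(\<lambda>i. (of_nat n' - 2 * of_nat i) * ?y i) = (\<lambda>i. of_nat n * ?y i)"
    using Lmod_h[OF y] by simp
  then have "(of_nat n' - 2 * of_nat 0) * ?y 0 = of_nat n * ?y 0" by (rule fun_cong)
  then show ?thesis using y0 by simp
qed

text \<open>The image of v has weight n and is a nonzero combination of highest weight vectors of
  the second model, whose weights are n' + k. Thus n = n' + k for some k; the opposite inequality
  comes from the inverse map.\<close>

lemma Kmod_iso_le:
  assumes "iso_mod UNIV (Kmod n c) (Kmod n' c')" shows "n' \<le> n \<and> c = c'"
proof -
  interpret L: lie_module "Kmod n c" by (rule lie_module_Kmod)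
  interpret L': lie_module "Kmod n' c'" by (rule lie_module_Kmod)
  obtain \<phi> where \<phi>: "bij_betw \<phi> (carrier (Kmod n c)) (carrier (Kmod n' c'))" "mod_hom UNIV (Kmod n c) (Kmod n' c') \<phi>"
    using assms by (auto simp: iso_mod_hom)
  interpret h: mod_hom_loc "Kmod n c" "Kmod n' c'" UNIV \<phi>
    using \<phi>(2) by (simp add: mod_hom_loc_def mod_hom_loc_axioms_def L'.amodule_any L.amodule_any)
  have d0: "delta (0, 0) \<in> carrier (Kmod n c)" using delta_K_carrier by simp
  let ?y = "\<phi> (delta (0, 0))"
  have y: "?y \<in> K_carrier n'" using h.hom_closed[OF d0] by simp
  have ne: "?y \<noteq> (\<lambda>i. 0)"
    using h.inj_nonzero[OF bij_betw_imp_inj_on[OF \<phi>(1)] d0] delta_nonzero[of "(0, 0) :: nat \<times> nat"] by simp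
  have "K_e n (delta (0, 0)) = (\<lambda>i. 0)" by (auto simp: K_e_def delta_apply)
  then have "K_e n' ?y = (\<lambda>i. 0)" using h.hom_act[OF UNIV_I d0, of \<ee>] h.hom_zero by simp
  then have ys: "?y (k, Suc i) = 0" for k i using K_e_kernel y by blast
  obtain k where k: "?y (k, 0) \<noteq> 0"
  proof -
    obtain k i where "?y (k, i) \<noteq> 0" using ne by (auto simp: fun_eq_iff)
    then show ?thesis using ys that by (cases i) auto
  qed
  have "K_h n (delta (0, 0)) = (\<lambda>x. of_nat n * delta (0, 0) x)"
    by (auto simp: K_h_def delta_apply fun_eq_iff)
  then have "K_h n' ?y = (\<lambda>x. of_nat n * ?y x)"
    using h.hom_act[OF UNIV_I d0, of \<hh>] h.hom_smult[OF d0, of "of_nat n"] by simp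
  then have "K_h n' ?y (k, 0) = of_nat n * ?y (k, 0)" by (rule fun_cong)
  then have "(of_nat n' + of_nat k) * ?y (k, 0) = of_nat n * ?y (k, 0)" by (simp add: K_h_def)
  then have "of_nat (n' + k) = (of_nat n :: complex)" using k by simp
  then have "n' + k = n" by (simp only: of_nat_eq_iff)
  moreover have "(\<lambda>x. c' * ?y x) = (\<lambda>x. c * ?y x)"
    using h.hom_act[OF UNIV_I d0, of \<zz>] h.hom_smult[OF d0, of c] by simp
  then have "c' * ?y (k, 0) = c * ?y (k, 0)" by (rule fun_cong)
  ultimately show ?thesis using k by simp
qed

lemma Kmod_iso_eq:
  assumes "iso_mod UNIV (Kmod n c) (Kmod n' c')" shows "n = n' \<and> c = c'"
proof -
  interpret L: lie_module "Kmod n c" by (rule lie_module_Kmod)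
  interpret L': lie_module "Kmod n' c'" by (rule lie_module_Kmod)
  have "iso_mod UNIV (Kmod n' c') (Kmod n c)"
    by (rule iso_mod_sym[OF L.amodule_any L'.amodule_any assms])
  then show ?thesis using Kmod_iso_le[OF assms] Kmod_iso_le[of n' c' n c] by simp
qed

lemma Kmod_not_iso_Lmod:
  assumes "c \<noteq> 0" shows "\<not> iso_mod UNIV (Kmod n c) (Lmod n')"
proof
  interpret L: lie_module "Kmod n c" by (rule lie_module_Kmod)
  interpret L': lie_module "Lmod n'" by (rule lie_module_Lmod)
  assume "iso_mod UNIV (Kmod n c) (Lmod n')"
  then obtain \<phi> where \<phi>: "bij_betw \<phi> (carrier (Kmod n c)) (carrier (Lmod n'))" "mod_hom UNIV (Kmod n c) (Lmod n') \<phi>"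
    by (auto simp: iso_mod_hom)
  interpret h: mod_hom_loc "Kmod n c" "Lmod n'" UNIV \<phi>
    using \<phi>(2) by (simp add: mod_hom_loc_def mod_hom_loc_axioms_def L'.amodule_any L.amodule_any)
  have d0: "delta (0, 0) \<in> carrier (Kmod n c)" using delta_K_carrier by simp
  let ?y = "\<phi> (delta (0, 0))"
  have ne: "?y \<noteq> (\<lambda>i. 0)"
    using h.inj_nonzero[OF bij_betw_imp_inj_on[OF \<phi>(1)] d0] delta_nonzero[of "(0, 0) :: nat \<times> nat"] by simp
  have "(\<lambda>x. 0) = (\<lambda>x. c * ?y x)"
    using h.hom_act[OF UNIV_I d0, of \<zz>] h.hom_smult[OF d0, of c] by simp
  then have "c * ?y x = 0" for x by (metis)
  then show False using ne assms by auto
qed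

section \<open>Modules isomorphic to the model are Harish-Chandra modules\<close>

definition embed :: "nat \<Rightarrow> (nat \<Rightarrow> complex) \<Rightarrow> nat \<times> nat \<Rightarrow> complex"
  where "embed k a = (\<lambda>(l, i). if l = k then a i else 0)"

lemma embed_hom: "mod_hom sl2 (Lmod (n + k)) (Kmod n c) (embed k)"
proof (rule mod_hom_sl2_generators[OF lie_module_Lmod lie_module_Kmod])
  have "embed k a \<in> K_carrier n" if "\<forall>i>n + k. a i = 0" for a
  proof -
    have "{x. embed k a x \<noteq> 0} \<subseteq> {k} \<times> {..n + k}"
      using that by (auto simp: embed_def not_less[symmetric] split: if_splits)
    then have "finsupp (embed k a)" unfolding finsupp_def by (rule finite_subset) simp
    then show ?thesis using that by (auto simp: K_carrier_def embed_def)
  qed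
  moreover have "embed k (L_e (n + k) a) = K_e n (embed k a)" if "\<forall>i>n + k. a i = 0" for a
    using that by (auto simp: embed_def L_e_def K_e_def fun_eq_iff)
  moreover have "embed k (L_f (n + k) a) = K_f n (embed k a)" for a
    by (auto simp: embed_def L_f_def K_f_def fun_eq_iff)
  ultimately show "mod_hom {\<ee>, \<ff>} (Lmod (n + k)) (Kmod n c) (embed k)"
    by (auto simp: mod_hom_def) (auto simp: embed_def fun_eq_iff)
qed

lemma comp_embed: "comp k a = embed k (\<lambda>i. a (k, i))"
  by (auto simp: comp_def embed_def)

lemma K_finsum:
  assumes "finite S" "\<And>k. k \<in> S \<Longrightarrow> g k \<in> K_carrier n"
  shows "finsum (Kmod n c) g S = (\<lambda>x. \<Sum>k\<in>S. g k x)"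
proof -
  interpret lie_module "Kmod n c" by (rule lie_module_Kmod)
  show ?thesis using assms
  proof (induction S rule: finite_induct)
    case (insert k S)
    then show ?case by (simp add: finsum_insert Pi_def)
  qed simp
qed

text \<open>Proved for every isomorphic copy of the model, because the decomposition is a set of
  subspaces of M and is built there directly: the summands are the images of the levels, and the
  projections are \<open>comp k\<close> conjugated by the isomorphism.\<close>

lemma harish_chandra_Kmod_iso:
  fixes M :: "(schr, 'm) rep" (structure)
  assumes "lie_module M" and bij: "bij_betw \<phi> (carrier (Kmod n c)) (carrier M)"
    and hom: "mod_hom UNIV (Kmod n c) M \<phi>"
  shows "harish_chandra M"
proof -
  interpret lie_module M by fact
  interpret K: lie_module "Kmod n c" by (rule lie_module_Kmod)
  interpret \<phi>: mod_hom_loc "Kmod n c" M UNIV \<phi>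
    using hom by (simp add: mod_hom_loc_def mod_hom_loc_axioms_def amodule_any K.amodule_any)
  define \<psi> where "\<psi> = inv_into (carrier (Kmod n c)) \<phi>"
  interpret \<psi>: mod_hom_loc M "Kmod n c" UNIV \<psi>
    using \<phi>.inv_hom[OF bij] unfolding \<psi>_def
    by (simp add: mod_hom_loc_def mod_hom_loc_axioms_def amodule_any K.amodule_any)
  have \<psi>\<phi>: "\<psi> (\<phi> a) = a" if "a \<in> K_carrier n" for a
    using that bij unfolding \<psi>_def by (simp add: bij_betw_def)
  have \<phi>\<psi>: "\<phi> (\<psi> v) = v" if "v \<in> carrier M" for v
    using that bij unfolding \<psi>_def by (simp add: bij_betw_def f_inv_into_f)
  have \<psi>K: "\<psi> v \<in> K_carrier n" if "v \<in> carrier M" for v using \<psi>.hom_closed[OF that] by simp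
  define \<theta> where "\<theta> k = \<phi> \<circ> embed k" for k
  define W where "W k = \<theta> k ` carrier (Lmod (n + k))" for k
  have eK: "embed k a \<in> K_carrier n" if "a \<in> carrier (Lmod (n + k))" for k a
    using that embed_hom[of n k c] by (auto simp: mod_hom_def)
  have \<theta>_hom: "mod_hom sl2 (Lmod (n + k)) M (\<theta> k)" for k
    using embed_hom[of n k c] mod_hom_subset[OF hom, of sl2] unfolding mod_hom_def \<theta>_def
    by (auto simp: Pi_iff)
  have loc: "mod_hom_loc (Lmod (n + k)) M sl2 (\<theta> k)" for k
  proof -
    interpret L: lie_module "Lmod (n + k)" by (rule lie_module_Lmod)
    show ?thesis using \<theta>_hom by (simp add: mod_hom_loc_def mod_hom_loc_axioms_def amodule_any L.amodule_any)
  qed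
  have \<theta>_inj: "inj_on (\<theta> k) (carrier (Lmod (n + k)))" for k
  proof (rule inj_onI)
    fix a b assume ab: "a \<in> carrier (Lmod (n + k))" "b \<in> carrier (Lmod (n + k))" "\<theta> k a = \<theta> k b"
    have "\<psi> (\<theta> k a) = embed k a" "\<psi> (\<theta> k b) = embed k b"
      unfolding \<theta>_def comp_apply by (rule \<psi>\<phi>[OF eK[OF ab(1)]], rule \<psi>\<phi>[OF eK[OF ab(2)]])
    then have "embed k a = embed k b" using ab(3) by (simp only:)
    then have "embed k a (k, i) = embed k b (k, i)" for i by simp
    then show "a = b" by (simp add: embed_def fun_eq_iff)
  qed
  have sub: "submod sl2 (W k) M" for k
  proof -
    interpret mod_hom_loc "Lmod (n + k)" M sl2 "\<theta> k" by (rule loc)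
    show ?thesis unfolding W_def by (rule image_submod[OF M.submod_carrier])
  qed
  have WM: "W k \<subseteq> carrier M" for k using sub[of k] submoduleD(1) by (simp add: submod_def)
  have \<theta>_bij: "bij_betw (\<theta> k) (carrier (Lmod (n + k))) (carrier (restr M (W k)))" for k
    using \<theta>_inj[of k] by (simp add: bij_betw_def W_def)
  have \<theta>_hom': "mod_hom sl2 (Lmod (n + k)) (restr M (W k)) (\<theta> k)" for k
    using \<theta>_hom[of k] unfolding mod_hom_def W_def by auto
  have iso: "iso_mod sl2 (Lmod (n + k)) (restr M (W k))" for k
    using \<theta>_bij \<theta>_hom' unfolding iso_mod_hom by blast
  have simple: "simple_mod sl2 (restr M (W k))" for k
  proof -
    interpret L: lie_module "Lmod (n + k)" by (rule lie_module_Lmod)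
    interpret mod_hom_loc "Lmod (n + k)" "restr M (W k)" sl2 "\<theta> k"
      using \<theta>_hom' amodule_restr[OF sub] by (simp add: mod_hom_loc_def mod_hom_loc_axioms_def L.amodule_any)
    show ?thesis by (rule simple_transport[OF \<theta>_bij Lmod_simple])
  qed
  have fd: "fin_dim M (W k)" for k
  proof -
    interpret mod_hom_loc "Lmod (n + k)" M sl2 "\<theta> k" by (rule loc)
    show ?thesis unfolding W_def by (rule fin_dim_image[OF Lmod_fin_dim])
  qed
  have \<psi>W: "comp l (\<psi> v) = (if l = k then \<psi> v else (\<lambda>x. 0))" if v: "v \<in> W k" for v k l
  proof -
    obtain a where a: "a \<in> carrier (Lmod (n + k))" "v = \<phi> (embed k a)" using v by (auto simp: W_def \<theta>_def)
    then have "\<psi> v = embed k a" using \<psi>\<phi> eK by simp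
    then show ?thesis by (auto simp: comp_def embed_def fun_eq_iff)
  qed
  have cL: "(\<lambda>i. a (k, i)) \<in> carrier (Lmod (n + k))" if "a \<in> K_carrier n" for a k
    using that by (auto simp: K_carrier_def)
  have cK: "comp k a \<in> K_carrier n" if "a \<in> K_carrier n" for a k
    unfolding comp_embed using eK cL that by blast
  have z\<phi>: "\<phi> (\<lambda>i. 0) = \<zero>" using \<phi>.hom_zero by simp
  have zero_iff: "\<phi> a = \<zero> \<longleftrightarrow> a = (\<lambda>x. 0)" if "a \<in> K_carrier n" for a
    using \<psi>\<phi>[OF that] z\<phi> \<psi>.hom_zero by auto
  let ?\<pi> = "\<lambda>k v. \<phi> (comp k (\<psi> v))"
  have fin: "finite {k. comp k a \<noteq> (\<lambda>x. 0)}" if "a \<in> K_carrier n" for a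
  proof -
    have "finite (fst ` {x. a x \<noteq> 0})" using that by (simp add: K_carrier_def finsupp_def)
    then show ?thesis by (rule finite_subset[rotated]) (force simp: comp_def fun_eq_iff split: if_splits)
  qed
  have S: "{k. ?\<pi> k v \<noteq> \<zero>} = {k. comp k (\<psi> v) \<noteq> (\<lambda>x. 0)}" if "v \<in> carrier M" for v
    by (simp only: zero_iff[OF cK[OF \<psi>K[OF that]]])
  have dir: "direct_sum M (range W)"
  proof (rule direct_sum_range[where \<pi> = ?\<pi>])
    show "inj W"
    proof (rule injI)
      fix k l assume kl: "W k = W l"
      have d: "delta 0 \<in> carrier (Lmod (n + k))" by (auto simp: delta_apply)
      have "\<phi> (embed k (delta 0)) \<in> W k"
        unfolding W_def by (rule image_eqI[OF _ d]) (simp add: \<theta>_def)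
      then have "\<phi> (embed k (delta 0)) \<in> W l" by (simp only: kl)
      then have "comp k (embed k (delta 0)) = (if k = l then embed k (delta 0) else (\<lambda>x. 0))"
        using \<psi>W[of _ l k, OF \<open>_ \<in> W l\<close>] by (simp only: \<psi>\<phi>[OF eK[OF d]])
      then have "k \<noteq> l \<Longrightarrow> comp k (embed k (delta 0)) (k, 0) = 0" by simp
      then show "k = l" by (auto simp: comp_def embed_def delta_apply)
    qed
    show "W k \<subseteq> carrier M" for k by (rule WM)
    show "\<zero> \<in> W k" for k using sub[of k] submoduleD(2) by (simp add: submod_def)
    show "?\<pi> k v \<in> W k" if "v \<in> carrier M" for k v
      unfolding W_def by (rule image_eqI[OF _ cL[OF \<psi>K[OF that], of k]]) (simp add: \<theta>_def comp_embed)
    show "?\<pi> k (v \<oplus> w) = ?\<pi> k v \<oplus> ?\<pi> k w" if "v \<in> carrier M" "w \<in> carrier M" for k v w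
    proof -
      have "comp k (\<psi> (v \<oplus> w)) = comp k (\<psi> v) \<oplus>\<^bsub>Kmod n c\<^esub> comp k (\<psi> w)"
        using \<psi>.hom_add[OF that] by (auto simp: comp_def fun_eq_iff)
      then show ?thesis using \<phi>.hom_add cK \<psi>K that by simp
    qed
    show "?\<pi> k v = v" if "v \<in> W k" for k v
      using \<psi>W[OF that, of k] \<phi>\<psi>[of v] WM that by auto
    show "?\<pi> k v = \<zero>" if "v \<in> W l" "k \<noteq> l" for k l v
      using \<psi>W[OF that(1), of k] that(2) z\<phi> by simp
    show "finite {k. ?\<pi> k v \<noteq> \<zero>}" if "v \<in> carrier M" for v using S fin \<psi>K that by simp
    show "v = (\<Oplus>k\<in>{k. ?\<pi> k v \<noteq> \<zero>}. ?\<pi> k v)" if v: "v \<in> carrier M" for v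
    proof -
      let ?S = "{k. comp k (\<psi> v) \<noteq> (\<lambda>x. 0)}"
      have f: "finite ?S" using fin \<psi>K v by simp
      have "(\<Oplus>k\<in>?S. ?\<pi> k v) = \<phi> (finsum (Kmod n c) (\<lambda>k. comp k (\<psi> v)) ?S)"
        using f cK \<psi>K v by (intro \<phi>.hom_finsum[symmetric]) auto
      also have "finsum (Kmod n c) (\<lambda>k. comp k (\<psi> v)) ?S = (\<lambda>x. \<Sum>k\<in>?S. comp k (\<psi> v) x)"
        using f cK \<psi>K v by (intro K_finsum) auto
      also have "\<dots> = \<psi> v"
      proof
        fix x :: "nat \<times> nat"
        obtain l i where x: "x = (l, i)" by (cases x)
        have "(\<Sum>k\<in>?S. comp k (\<psi> v) x) = (\<Sum>k\<in>?S. if k = l then \<psi> v x else 0)"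
          by (rule sum.cong) (auto simp: comp_def x)
        also have "\<dots> = (if l \<in> ?S then \<psi> v x else 0)" using f by (simp add: sum.delta)
        also have "\<dots> = \<psi> v x"
        proof (cases "l \<in> ?S")
          case False
          then have "comp l (\<psi> v) x = 0" by simp
          then show ?thesis using False by (simp add: comp_def x)
        qed simp
        finally show "(\<Sum>k\<in>?S. comp k (\<psi> v) x) = \<psi> v x" .
      qed
      finally show ?thesis using S[OF v] \<phi>\<psi>[OF v] by simp
    qed
  qed
  have "finite {W' \<in> range W. iso_mod sl2 (restr M W') (restr M (W k))}" for k
  proof -
    \<comment> \<open>Level l has type L(n + l), so each type occurs in a single summand.\<close>
    have "W l = W k" if "iso_mod sl2 (restr M (W l)) (restr M (W k))" for l
    proof -
      interpret L: lie_module "Lmod (n + k)" by (rule lie_module_Lmod)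
      have "iso_mod sl2 (restr M (W k)) (Lmod (n + k))"
        by (rule iso_mod_sym[OF L.amodule_any amodule_restr[OF sub] iso])
      then have "iso_mod sl2 (Lmod (n + l)) (Lmod (n + k))"
        by (rule iso_mod_trans[OF iso_mod_trans[OF iso that]])
      then have "n + l = n + k" by (rule Lmod_iso_eq)
      then show ?thesis by simp
    qed
    then have "{W' \<in> range W. iso_mod sl2 (restr M W') (restr M (W k))} \<subseteq> {W k}" by auto
    then show ?thesis by (rule finite_subset) simp
  qed
  then show ?thesis unfolding harish_chandra_def
    using sub simple fd dir by (intro exI[of _ "range W"]) auto
qed

lemma harish_chandra_Lmod: "harish_chandra (Lmod n)"
proof -
  interpret L: lie_module "Lmod n" by (rule lie_module_Lmod)
  have r: "restr (Lmod n) (carrier (Lmod n)) = Lmod n" by (simp add: restr_def)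
  have "direct_sum (Lmod n) {carrier (Lmod n)}"
  proof -
    \<comment> \<open>The decomposition with one summand is obtained as a family indexed by
      \<open>unit\<close>.\<close>
    have "direct_sum (Lmod n) (range (\<lambda>_ :: unit. carrier (Lmod n)))"
    proof (rule L.direct_sum_range[where \<pi> = "\<lambda>_ v. v"])
      show "v = (\<Oplus>\<^bsub>Lmod n\<^esub>i\<in>{i :: unit. v \<noteq> \<zero>\<^bsub>Lmod n\<^esub>}. v)" if "v \<in> carrier (Lmod n)" for v
      proof (cases "v = \<zero>\<^bsub>Lmod n\<^esub>")
        case False
        then have S: "{i :: unit. v \<noteq> \<zero>\<^bsub>Lmod n\<^esub>} = {()}" by auto
        have "(\<Oplus>\<^bsub>Lmod n\<^esub>i\<in>{()}. v) = v"
          using that L.finsum_insert[of "{}" "()" "\<lambda>_. v"] by simp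
        then show ?thesis by (simp only: S)
      qed simp
    qed (auto simp: inj_def)
    then show ?thesis by simp
  qed
  moreover have "submod sl2 (carrier (Lmod n)) (Lmod n)"
    by (rule amodule.submod_carrier[OF L.amodule_any])
  moreover have "simple_mod sl2 (restr (Lmod n) (carrier (Lmod n)))"
    unfolding r by (rule Lmod_simple)
  moreover note Lmod_fin_dim[of n]
  moreover have "finite {W' \<in> {carrier (Lmod n)}. Q W'}" for Q by simp
  ultimately show ?thesis
    unfolding harish_chandra_def by (intro exI[of _ "{carrier (Lmod n)}"] conjI ballI) (simp_all only: singleton_iff)
qed

lemma simple_hc_Lmod: "simple_hc_module (Lmod n)"
proof -
  have "simple_mod UNIV (Lmod n)"
    using Lmod_simple[of n] unfolding simple_mod_def submod_def by blast
  then show ?thesis by (simp add: simple_hc_module_def lie_module_Lmod harish_chandra_Lmod)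
qed

section \<open>Central charge zero\<close>

text \<open>With c = 0 all \<open>ydown\<close> vanish, nothing leads from a higher level down to
  level 0, and the levels from 1 on form a submodule \<open>A\<close>. By simplicity its image is
  zero or everything; the vector p v belongs to this image.\<close>

lemma (in hw_module) charge_zero:
  assumes c: "c = 0" and simple: "simple_mod UNIV M" and nz: "v \<noteq> \<zero>"
  shows "act M \<pp> v = \<zero>"
proof -
  interpret K: lie_module "Kmod n c" by (rule lie_module_Kmod)
  interpret h: mod_hom_loc "Kmod n c" M UNIV \<Psi> by (rule \<Psi>_loc)
  define A where "A = {a \<in> K_carrier n. \<forall>i. a (0, i) = 0}"
  have y: "ydown n c k = 0" for k by (simp add: ydown_def c)
  have "submod UNIV A (Kmod n c)"
  proof (rule submod_generators[OF lie_module_Kmod])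
    show "submodule A complex_field (Kmod n c)"
      unfolding K.submodule_iff by (auto simp: A_def K_carrier_def)
    fix x w assume x: "x \<in> {\<ee>, \<ff>, \<qq>}" and w: "w \<in> A"
    have "act (Kmod n c) x w \<in> carrier (Kmod n c)" using w by (intro K.act_closed') (simp add: A_def)
    then show "act (Kmod n c) x w \<in> A"
      using x w by (auto simp: A_def K_e_def K_f_def K_q_def y)
  qed
  then have "\<Psi> ` A = {\<zero>} \<or> \<Psi> ` A = carrier M"
    using h.image_submod simple unfolding simple_mod_def by blast
  \<comment> \<open>Otherwise v is the image of some b in \<open>A\<close>, so the kernel contains
    \<open>delta (0, 0)\<close> minus b. The kernel contains the level 0 component of this
    difference, which is \<open>delta (0, 0)\<close>, and v would be zero.\<close>
  moreover have "\<Psi> ` A \<noteq> carrier M"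
  proof
    assume "\<Psi> ` A = carrier M"
    then obtain b where b: "b \<in> A" "\<Psi> b = v" using v by (metis imageE)
    let ?Z = "{a \<in> carrier (Kmod n c). \<Psi> a = \<zero>}"
    have Z: "submod sl2 ?Z (Kmod n c)" using h.kernel_submod by (simp add: submod_def)
    have d: "delta (0, 0) \<in> carrier (Kmod n c)" using delta_K_carrier by simp
    have bK: "b \<in> carrier (Kmod n c)" using b by (simp add: A_def)
    have m: "delta (0, 0) \<ominus>\<^bsub>Kmod n c\<^esub> b \<in> carrier (Kmod n c)" by (intro K.minus_closed d bK)
    have "\<Psi> (delta (0, 0) \<ominus>\<^bsub>Kmod n c\<^esub> b) = \<zero>"
      using b(2) d bK by (simp add: h.hom_minus u_00 minus_smult smult_collect1)
    then have "comp 0 (delta (0, 0) \<ominus>\<^bsub>Kmod n c\<^esub> b) \<in> ?Z" using comp_mem[OF Z] m by blast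
    moreover have "comp 0 (delta (0, 0) \<ominus>\<^bsub>Kmod n c\<^esub> b) = delta (0, 0)"
      using b(1) d bK K_minus[of "delta (0, 0)" n b c] by (auto simp: comp_def A_def delta_apply fun_eq_iff)
    ultimately show False using nz by (simp add: u_00)
  qed
  moreover have "delta (1, 0) \<in> A" by (simp add: A_def delta_K_carrier delta_apply)
  ultimately have "\<Psi> (delta (1, 0)) = \<zero>" by blast
  then show ?thesis by (simp add: u_def vk_def)
qed

section \<open>Finite-dimensional linear algebra\<close>

text \<open>More than \<open>card B\<close> vectors in a space of dimension at most
  \<open>card B\<close> are dependent. Dependence is a notion for sets, so two equal vectors among
  the \<open>A j\<close> are treated first: their difference is already a relation.\<close>

lemma homogeneous_system:
  fixes A :: "nat \<Rightarrow> 'b \<Rightarrow> complex"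
  assumes "finite B" "\<And>j b. b \<notin> B \<Longrightarrow> A j b = 0"
  obtains c N where "\<exists>j\<le>N. c j \<noteq> (0 :: complex)" "\<And>b. (\<Sum>j\<le>N. c j * A j b) = 0"
proof (cases "inj_on A {..card B}")
  case False
  then obtain j k where jk: "j \<le> card B" "k \<le> card B" "j \<noteq> k" "A j = A k" by (auto simp: inj_on_def)
  let ?c = "\<lambda>i. if i = j then 1 else if i = k then - 1 else (0 :: complex)"
  have "(\<Sum>i\<le>card B. ?c i * A i b) = 0" for b
  proof -
    have "(\<Sum>i\<le>card B. ?c i * A i b) = (\<Sum>i\<in>{j, k}. ?c i * A i b)"
      using jk by (intro sum.mono_neutral_right) auto
    then show ?thesis using jk by simp
  qed
  then show ?thesis using jk by (intro that[of "card B" ?c]) auto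
next
  case True
  interpret V: vector_space "\<lambda>c (f :: 'b \<Rightarrow> complex) x. c * f x"
    by unfold_locales (auto simp: algebra_simps)
  let ?S = "A ` {..card B}" and ?T = "delta ` B"
  have "A j \<in> V.span ?T" for j
  proof -
    have e: "A j = (\<Sum>b\<in>B. (\<lambda>x. A j b * delta b x))"
    proof
      fix x
      have "(\<Sum>b\<in>B. (\<lambda>x. A j b * delta b x)) x = (\<Sum>b\<in>B. A j b * delta b x)"
        by (induction B rule: infinite_finite_induct) auto
      also have "\<dots> = (\<Sum>b\<in>B. if b = x then A j x else 0)"
        by (rule sum.cong) (auto simp: delta_apply)
      also have "\<dots> = A j x" using assms by (auto simp: sum.delta)
      finally show "A j x = (\<Sum>b\<in>B. (\<lambda>x. A j b * delta b x)) x" by simp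
    qed
    have "(\<Sum>b\<in>B. (\<lambda>x. A j b * delta b x)) \<in> V.span ?T"
      by (rule V.span_sum, rule V.span_scale, rule V.span_base) simp
    then show ?thesis by (subst e)
  qed
  then have sub: "?S \<subseteq> V.span ?T" by auto
  have "card ?S = Suc (card B)" using True by (simp add: card_image)
  moreover have "card ?T \<le> card B" by (rule card_image_le[OF assms(1)])
  ultimately have "\<not> V.independent ?S"
    using V.independent_span_bound[of ?T ?S] sub assms(1) by fastforce
  then obtain u where u: "\<exists>v\<in>?S. u v \<noteq> 0" "(\<Sum>v\<in>?S. (\<lambda>x. u v * v x)) = 0"
    using V.dependent_finite[of ?S] by auto
  have "(\<Sum>j\<le>card B. u (A j) * A j b) = 0" for b
  proof -
    have "(\<Sum>v\<in>S. (\<lambda>x. u v * v x)) b = (\<Sum>v\<in>S. u v * v b)" for S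
      by (induction S rule: infinite_finite_induct) auto
    from this[of ?S] have "(\<Sum>v\<in>?S. u v * v b) = 0" using u(2) by simp
    then show ?thesis using sum.reindex[OF True, of "\<lambda>v. u v * v b"] by simp
  qed
  then show ?thesis using u(1) by (intro that[of "card B" "\<lambda>j. u (A j)"]) auto
qed

lemma (in cmodule) linear_dependence:
  assumes "finite B" "B \<subseteq> carrier M" "\<And>j :: nat. x j \<in> lspan M B"
  obtains c N where "\<exists>j\<le>N. c j \<noteq> 0" "(\<Oplus>j\<in>{..N}. c j \<odot> x j) = \<zero>"
proof -
  \<comment> \<open>The spanning vectors index themselves; extension by zero outside
    \<open>B\<close> turns them into a total family, as \<open>lc\<close> requires.\<close>
  define w where "w b = (if b \<in> B then b else \<zero>)" for b
  have w: "w b \<in> carrier M" for b using assms(2) by (auto simp: w_def)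
  have "B \<subseteq> range w" by (force simp: w_def)
  then have xj: "x j \<in> lspan M (range w)" for j using lspan_mono assms(3) by blast
  have "\<exists>a. finsupp a \<and> x j = lc M w a" for j
    by (rule lspan_lc[where w = w and v = "x j", OF w xj]) blast
  then obtain a where a: "\<And>j. finsupp (a j)" "\<And>j. x j = lc M w (a j)" by metis
  \<comment> \<open>Coefficients outside \<open>B\<close> multiply the zero vector and may be
    dropped, which leaves finitely many equations.\<close>
  define A where "A j b = (if b \<in> B then a j b else 0)" for j b
  have A: "x j = (\<Oplus>b\<in>B. A j b \<odot> w b)" for j
  proof -
    have "x j = (\<Oplus>b\<in>{b. a j b \<noteq> 0} \<union> B. a j b \<odot> w b)"
      unfolding a(2) by (rule lc_eq) (use a(1) assms(1) w in \<open>auto simp: finsupp_def\<close>)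
    also have "\<dots> = (\<Oplus>b\<in>B. a j b \<odot> w b)"
      by (rule finsum_superset[symmetric]) (use a(1) assms(1,2) w in \<open>auto simp: finsupp_def w_def\<close>)
    also have "\<dots> = (\<Oplus>b\<in>B. A j b \<odot> w b)"
      by (rule finsum_cong') (use w in \<open>auto simp: A_def\<close>)
    finally show ?thesis .
  qed
  obtain c N where c: "\<exists>j\<le>N. c j \<noteq> 0" "\<And>b. (\<Sum>j\<le>N. c j * A j b) = 0"
    by (rule homogeneous_system[of B A]) (use assms(1) in \<open>simp_all add: A_def\<close>)
  have fs: "finsupp (A j)" for j
    unfolding finsupp_def by (rule finite_subset[OF _ assms(1)]) (auto simp: A_def)
  have xA: "x j = lc M w (A j)" for j
    unfolding A by (rule lc_eq[symmetric, OF assms(1)]) (use w in \<open>auto simp: A_def split: if_splits\<close>)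
  have "finsupp (\<lambda>b. \<Sum>j\<in>J. c j * A j b) \<and> lc M w (\<lambda>b. \<Sum>j\<in>J. c j * A j b) = (\<Oplus>j\<in>J. c j \<odot> x j)" if "finite J" for J
    using that
  proof (induction J rule: finite_induct)
    case (insert j J)
    have "lc M w (\<lambda>b. c j * A j b + (\<Sum>j\<in>J. c j * A j b)) = c j \<odot> x j \<oplus> (\<Oplus>j\<in>J. c j \<odot> x j)"
      using insert fs w by (subst lc_add) (auto simp: lc_smult xA)
    then show ?case using insert fs w by (simp add: finsum_insert xA Pi_def)
  qed simp
  from this[of "{..N}"] have "(\<Oplus>j\<in>{..N}. c j \<odot> x j) = \<zero>" using c(2) by simp
  then show ?thesis using c(1) that by blast
qed

section \<open>Eigenvectors of an endomorphism\<close>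

locale endo = cmodule M for M :: "('g, 'm) rep" (structure) +
  fixes T
  assumes T_closed [simp, intro]: "v \<in> carrier M \<Longrightarrow> T v \<in> carrier M"
    and T_add: "v \<in> carrier M \<Longrightarrow> w \<in> carrier M \<Longrightarrow> T (v \<oplus> w) = T v \<oplus> T w"
    and T_smult: "v \<in> carrier M \<Longrightarrow> T (c \<odot> v) = c \<odot> T v"
begin

lemma T_zero [simp]: "T \<zero> = \<zero>"
  using T_smult[of \<zero> 0] by simp

lemma T_pow_closed [simp, intro]: "v \<in> carrier M \<Longrightarrow> (T ^^ j) v \<in> carrier M"
  by (induction j) auto

lemma T_finsum: "finite I \<Longrightarrow> (\<And>i. i \<in> I \<Longrightarrow> g i \<in> carrier M) \<Longrightarrow> T (finsum M g I) = finsum M (\<lambda>i. T (g i)) I"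
  by (rule finsum_hom) (auto simp: T_add)

text \<open>Applying T minus \<open>\<mu> k\<close> to the relation removes the k-th vector and
  multiplies each other one by a nonzero difference of eigenvalues.\<close>

lemma eigenvectors_independent:
  assumes "finite I" "inj_on \<mu> I" "\<And>i. i \<in> I \<Longrightarrow> x i \<in> carrier M"
    "\<And>i. i \<in> I \<Longrightarrow> T (x i) = \<mu> i \<odot> x i" "finsum M x I = \<zero>" "i \<in> I"
  shows "x i = \<zero>"
  using assms
proof (induction I arbitrary: x i rule: finite_induct)
  case (insert k I)
  have xc: "x i \<in> carrier M" if "i \<in> insert k I" for i using insert.prems(2) that .
  let ?s = "finsum M x I"
  have s: "?s \<in> carrier M" using xc by (intro finsum_closed) auto
  have sum: "x k \<oplus> ?s = \<zero>" using insert xc by (simp add: finsum_insert Pi_def)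
  have "T (x k) \<oplus> T ?s = \<zero>" using sum xc s T_add[of "x k" ?s] by simp
  moreover have "T (x k) = \<mu> k \<odot> x k" using insert.prems(3) by simp
  moreover have "\<mu> k \<odot> x k \<oplus> \<mu> k \<odot> ?s = \<zero>" using sum xc s smult_add_right[of "x k" ?s "\<mu> k"] by simp
  ultimately have "T ?s = \<mu> k \<odot> ?s" using xc s by (metis T_closed insertI1 smult_closed_c a_comm minus_equality)
  moreover have "T ?s = (\<Oplus>i\<in>I. \<mu> i \<odot> x i)"
    using insert.hyps xc insert.prems(3) by (subst T_finsum) (auto intro!: finsum_cong')
  moreover have "(- \<mu> k) \<odot> ?s = (\<Oplus>i\<in>I. (- \<mu> k) \<odot> x i)"
    using insert.hyps xc by (intro finsum_smult) auto
  moreover have "(\<Oplus>i\<in>I. \<mu> i \<odot> x i \<oplus> (- \<mu> k) \<odot> x i) = (\<Oplus>i\<in>I. \<mu> i \<odot> x i) \<oplus> (\<Oplus>i\<in>I. (- \<mu> k) \<odot> x i)"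
    using xc by (intro finsum_addf) auto
  moreover have "(\<Oplus>i\<in>I. \<mu> i \<odot> x i \<oplus> (- \<mu> k) \<odot> x i) = (\<Oplus>i\<in>I. (\<mu> i - \<mu> k) \<odot> x i)"
    using xc by (intro finsum_cong') (auto simp: smult_collect)
  ultimately have "(\<Oplus>i\<in>I. (\<mu> i - \<mu> k) \<odot> x i) = \<mu> k \<odot> ?s \<oplus> (- \<mu> k) \<odot> ?s" by simp
  also have "\<dots> = \<zero>" using s by (simp add: smult_collect)
  finally have z: "(\<Oplus>i\<in>I. (\<mu> i - \<mu> k) \<odot> x i) = \<zero>" .
  have xI: "x i = \<zero>" if i: "i \<in> I" for i
  proof -
    have "(\<mu> i - \<mu> k) \<odot> x i = \<zero>"
    proof (rule insert.IH[OF _ _ _ z i])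
      show "inj_on \<mu> I" using insert.prems(1) by simp
      show "(\<mu> i - \<mu> k) \<odot> x i \<in> carrier M" if "i \<in> I" for i using xc that by simp
      show "T ((\<mu> i - \<mu> k) \<odot> x i) = \<mu> i \<odot> ((\<mu> i - \<mu> k) \<odot> x i)" if "i \<in> I" for i
        using xc that insert.prems(3)[of i] by (simp add: T_smult smult_smult mult.commute)
    qed
    moreover have "\<mu> i \<noteq> \<mu> k" using insert.prems(1) insert.hyps i by (auto simp: inj_on_def)
    ultimately show ?thesis using smult_eq_0 xc i by (metis insertI2 right_minus_eq)
  qed
  have "?s = \<zero>" using xI finsum_cong'[of I I "\<lambda>_. \<zero>" x] by (simp add: finsum_zero)
  then have "x k = \<zero>" using sum xc by simp
  then show ?case using xI insert.prems(5) by auto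
qed simp

text \<open>This is p(T) x.\<close>

definition pact :: "complex poly \<Rightarrow> 'm \<Rightarrow> 'm"
  where "pact p x = (\<Oplus>j\<in>{..degree p}. poly.coeff p j \<odot> (T ^^ j) x)"

lemma pact_eq:
  assumes "x \<in> carrier M" "Polynomial.degree p \<le> N"
  shows "pact p x = (\<Oplus>j\<in>{..N}. poly.coeff p j \<odot> (T ^^ j) x)"
  unfolding pact_def using assms by (intro finsum_superset) (auto simp: coeff_eq_0)

lemma pact_closed [simp, intro]: "x \<in> carrier M \<Longrightarrow> pact p x \<in> carrier M"
  unfolding pact_def by (intro finsum_closed) auto

lemma pact_linear_factor:
  assumes x: "x \<in> carrier M"
  shows "pact ([:- \<mu>, 1:] * r) x = T (pact r x) \<oplus> (- \<mu>) \<odot> pact r x"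
proof -
  let ?N = "Polynomial.degree r" and ?q = "[:- \<mu>, 1:] * r"
  have deg: "Polynomial.degree ?q \<le> Suc ?N" using degree_mult_le[of "[:- \<mu>, 1:]" r] by simp
  let ?g = "\<lambda>j. (if j = 0 then 0 else poly.coeff r (j - 1)) \<odot> (T ^^ j) x"
  let ?h = "\<lambda>j. (- \<mu> * poly.coeff r j) \<odot> (T ^^ j) x"
  have co: "poly.coeff ?q j = (if j = 0 then 0 else poly.coeff r (j - 1)) + (- \<mu> * poly.coeff r j)" for j
    by (cases j) (auto simp: coeff_pCons)
  have "pact ?q x = (\<Oplus>j\<in>{..Suc ?N}. ?g j \<oplus> ?h j)"
    unfolding pact_eq[OF x deg]
  proof (rule finsum_cong'[OF refl])
    show "(\<lambda>j. ?g j \<oplus> ?h j) \<in> {..Suc ?N} \<rightarrow> carrier M" using x by auto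
    show "poly.coeff ?q j \<odot> (T ^^ j) x = ?g j \<oplus> ?h j" for j
      by (simp only: co smult_add_left[OF T_pow_closed[OF x]])
  qed
  also have "\<dots> = (\<Oplus>j\<in>{..Suc ?N}. ?g j) \<oplus> (\<Oplus>j\<in>{..Suc ?N}. ?h j)"
    using x by (intro finsum_addf) auto
  also have "(\<Oplus>j\<in>{..Suc ?N}. ?h j) = (- \<mu>) \<odot> pact r x"
  proof -
    have "(- \<mu>) \<odot> pact r x = (\<Oplus>j\<in>{..Suc ?N}. (- \<mu>) \<odot> (poly.coeff r j \<odot> (T ^^ j) x))"
      unfolding pact_eq[OF x le_SucI[OF order_refl]] by (rule finsum_smult) (use x in auto)
    also have "\<dots> = (\<Oplus>j\<in>{..Suc ?N}. ?h j)"
      using x by (intro finsum_cong') (auto simp: smult_smult)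
    finally show ?thesis by simp
  qed
  also have "(\<Oplus>j\<in>{..Suc ?N}. ?g j) = T (pact r x)"
  proof -
    have "(\<Oplus>j\<in>{..Suc ?N}. ?g j) = (\<Oplus>j\<in>Suc ` {..?N}. ?g j)"
    proof (rule finsum_superset[symmetric])
      show "?g i = \<zero>" if "i \<in> {..Suc ?N} - Suc ` {..?N}" for i
        using that x by (cases i) auto
    qed (use x in auto)
    also have "\<dots> = (\<Oplus>j\<in>{..?N}. ?g (Suc j))"
      using x by (intro finsum_reindex) auto
    also have "\<dots> = (\<Oplus>j\<in>{..?N}. T (poly.coeff r j \<odot> (T ^^ j) x))"
      using x by (intro finsum_cong') (auto simp: T_smult)
    also have "\<dots> = T (pact r x)" unfolding pact_def using x by (intro T_finsum[symmetric]) auto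
    finally show ?thesis .
  qed
  finally show ?thesis .
qed

text \<open>Some nonzero polynomial p satisfies p(T) x = 0 because the powers of T on x stay in a
  finite-dimensional space. Splitting off linear factors one at a time, the last nonzero value r(T)
  x is an eigenvector; being a combination of the T^j x, it lies in \<open>H\<close>.\<close>

lemma eigenvector_exists:
  assumes "finite B" "B \<subseteq> carrier M" "\<And>j. (T ^^ j) x \<in> lspan M B" "x \<noteq> \<zero>" "x \<in> carrier M"
    and H: "submodule H complex_field M" "\<And>j. (T ^^ j) x \<in> H"
  obtains y \<mu> where "y \<in> H" "y \<noteq> \<zero>" "T y = \<mu> \<odot> y"
proof -
  note x = assms(5)
  obtain c N where c: "\<exists>j\<le>N. c j \<noteq> 0" "(\<Oplus>j\<in>{..N}. c j \<odot> (T ^^ j) x) = \<zero>"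
    by (rule linear_dependence[OF assms(1,2), of "\<lambda>j. (T ^^ j) x", OF assms(3)])
  define p where "p = (\<Sum>j\<le>N. Polynomial.monom (c j) j)"
  have co: "poly.coeff p j = (if j \<le> N then c j else 0)" for j
    unfolding p_def by (simp add: coeff_sum sum.delta)
  have deg: "Polynomial.degree p \<le> N" by (rule degree_le) (simp add: co)
  have "p \<noteq> 0" using c(1) co by (metis coeff_0)
  moreover have "pact p x = \<zero>"
    unfolding pact_eq[OF x deg] c(2)[symmetric] using x by (intro finsum_cong') (auto simp: co)
  ultimately have "\<exists>y \<mu>. y \<in> H \<and> y \<noteq> \<zero> \<and> T y = \<mu> \<odot> y"
  proof (induction "Polynomial.degree p" arbitrary: p rule: less_induct)
    case less
    show ?case
    proof (cases "Polynomial.degree p = 0")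
      case True
      then obtain a where a: "p = [:a:]" by (metis degree_eq_zeroE)
      then have "a \<odot> x = \<zero>" using less.prems(2) x by (simp add: pact_def finsum_insert)
      then show ?thesis using less.prems(1) a assms(4) smult_eq_0 x by fastforce
    next
      case False
      then obtain \<mu> where "poly p \<mu> = 0"
        using fundamental_theorem_of_algebra[of p] by (auto simp: constant_degree)
      then obtain r where r: "p = [:- \<mu>, 1:] * r" by (auto simp: poly_eq_0_iff_dvd)
      then have r0: "r \<noteq> 0" using less.prems(1) by auto
      have "Polynomial.degree p = Suc (Polynomial.degree r)" unfolding r using r0 by (subst degree_mult_eq) auto
      then have dr: "Polynomial.degree r < Polynomial.degree p" by simp
      show ?thesis
      proof (cases "pact r x = \<zero>")
        case True
        then show ?thesis using less.hyps[OF dr r0] by simp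
      next
        case F: False
        have "T (pact r x) \<oplus> (- \<mu>) \<odot> pact r x = \<zero>"
          using pact_linear_factor[OF x, of \<mu> r] less.prems(2) r by simp
        then have "T (pact r x) = \<mu> \<odot> pact r x"
        proof -
          assume a: "T (pact r x) \<oplus> (- \<mu>) \<odot> pact r x = \<zero>"
          have "T (pact r x) = T (pact r x) \<oplus> ((- \<mu>) \<odot> pact r x \<oplus> \<mu> \<odot> pact r x)"
            using x by (simp add: smult_collect)
          also have "\<dots> = \<mu> \<odot> pact r x" using x a by (simp add: a_assoc[symmetric])
          finally show ?thesis .
        qed
        moreover have "pact r x \<in> H"
          unfolding pact_def using H submoduleD(4)[OF H(1)] by (intro submodule_finsum) auto
        ultimately show ?thesis using F by blast
      qed
    qed
  qed
  then show ?thesis using that by blast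
qed

end

section \<open>Simple Harish-Chandra modules\<close>

lemma iso_LmodI:
  assumes "lie_module M" "submod sl2 W M" "iso_mod sl2 (Lmod n) (restr M W)"
  shows "iso_mod sl2 (restr M W) (Lmod n)"
  by (rule iso_mod_sym[OF lie_module.amodule_any[OF lie_module_Lmod] lie_module.amodule_restr[OF assms(1,2)] assms(3)])

locale simple_hc = lie_module V for V :: "(schr, 'v) rep" (structure) +
  assumes simple: "simple_mod UNIV V" and hc: "harish_chandra V"
begin

definition summands :: "'v set set" where
  "summands = (SOME \<W>. (\<forall>W\<in>\<W>. submod sl2 W V \<and> simple_mod sl2 (restr V W) \<and> fin_dim V W) \<and>
    direct_sum V \<W> \<and> (\<forall>W\<in>\<W>. finite {W'\<in>\<W>. iso_mod sl2 (restr V W') (restr V W)}))"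

lemma summands:
  "W \<in> summands \<Longrightarrow> submod sl2 W V" "W \<in> summands \<Longrightarrow> simple_mod sl2 (restr V W)"
  "W \<in> summands \<Longrightarrow> fin_dim V W" "direct_sum V summands"
  "W \<in> summands \<Longrightarrow> finite {W'\<in>summands. iso_mod sl2 (restr V W') (restr V W)}"
  using someI_ex[OF hc[unfolded harish_chandra_def]] unfolding summands_def[symmetric] by blast+

definition gens :: "'v set \<Rightarrow> 'v set" where
  "gens W = (SOME B. finite B \<and> B \<subseteq> carrier V \<and> W = lspan V B)"

lemma gens:
  assumes "W \<in> summands"
  shows "finite (gens W)" "gens W \<subseteq> carrier V" "lspan V (gens W) = W"
  using someI_ex[OF summands(3)[OF assms, unfolded fin_dim_def]] unfolding gens_def by auto

lemma summand_closed: "W \<in> summands \<Longrightarrow> x \<in> W \<Longrightarrow> x \<in> carrier V"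
  using summands(1) submoduleD(1) unfolding submod_def by blast

lemma components:
  assumes "v \<in> carrier V"
  obtains w where "\<And>W. W \<in> summands \<Longrightarrow> w W \<in> W" "\<And>W. W \<notin> summands \<Longrightarrow> w W = \<zero>"
    "finite {W. w W \<noteq> \<zero>}" "v = finsum V w {W. w W \<noteq> \<zero>}" "\<And>W. w W \<in> carrier V"
proof -
  from summands(4) assms obtain w where w: "\<forall>W\<in>summands. w W \<in> W" "\<forall>W. W \<notin> summands \<longrightarrow> w W = \<zero>"
    "finite {W. w W \<noteq> \<zero>}" "v = finsum V w {W. w W \<noteq> \<zero>}"
    unfolding direct_sum_def by blast
  moreover have "w W \<in> carrier V" for W
    using w(1,2) summand_closed by (cases "W \<in> summands") auto
  ultimately show ?thesis using that by blast
qed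

lemma zero_components:
  assumes "\<And>W. W \<in> summands \<Longrightarrow> w W \<in> W" "\<And>W. W \<notin> summands \<Longrightarrow> w W = \<zero>"
    "finite {W. w W \<noteq> \<zero>}" "finsum V w {W. w W \<noteq> \<zero>} = \<zero>"
  shows "w W = \<zero>"
proof -
  define Q where "Q w \<longleftrightarrow> (\<forall>W\<in>summands. w W \<in> W) \<and> (\<forall>W. W \<notin> summands \<longrightarrow> w W = \<zero>) \<and>
    finite {W. w W \<noteq> \<zero>} \<and> \<zero> = finsum V w {W. w W \<noteq> \<zero>}" for w
  have 1: "\<exists>!w. Q w" using summands(4) zero_closed unfolding direct_sum_def Q_def by (rule bspec)
  have 2: "Q w" unfolding Q_def
  proof (intro conjI ballI allI impI)
    show "\<zero> = finsum V w {W. w W \<noteq> \<zero>}" by (rule assms(4)[symmetric])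
  qed (fact assms)+
  have 3: "Q (\<lambda>_. \<zero>)" unfolding Q_def
  proof (intro conjI ballI allI impI)
    show "\<zero> \<in> W" if "W \<in> summands" for W
      using summands(1)[OF that] submoduleD(2)[of W] by (simp add: submod_def)
    have e: "{W :: 'v set. \<zero> \<noteq> \<zero>} = {}" by simp
    show "finite {W :: 'v set. \<zero> \<noteq> \<zero>}" unfolding e by (rule finite.emptyI)
    show "\<zero> = finsum V (\<lambda>_. \<zero>) {W :: 'v set. \<zero> \<noteq> \<zero>}" unfolding e by (rule finsum_empty[symmetric])
  qed (rule refl)
  have "w = (\<lambda>_. \<zero>)" using 1 2 3 by blast
  then show ?thesis by simp
qed

text \<open>Applying T to the components of v decomposes T v = 0, and the decomposition of zero is
  unique.\<close>

lemma kernel_components: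
  assumes T: "endo V T" and TW: "\<And>W x. W \<in> summands \<Longrightarrow> x \<in> W \<Longrightarrow> T x \<in> W"
    and w: "\<And>W. W \<in> summands \<Longrightarrow> w W \<in> W" "\<And>W. W \<notin> summands \<Longrightarrow> w W = \<zero>"
    "finite {W. w W \<noteq> \<zero>}" "v = finsum V w {W. w W \<noteq> \<zero>}" "\<And>W. w W \<in> carrier V"
    and z: "T v = \<zero>"
  shows "T (w W) = \<zero>"
proof -
  interpret T: endo V T by fact
  have sub: "{W. T (w W) \<noteq> \<zero>} \<subseteq> {W. w W \<noteq> \<zero>}" by auto
  have "finsum V (\<lambda>W. T (w W)) {W. T (w W) \<noteq> \<zero>} = finsum V (\<lambda>W. T (w W)) {W. w W \<noteq> \<zero>}"
    by (rule finsum_superset[OF w(3) sub]) (use w(5) in auto)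
  also have "\<dots> = T v" unfolding w(4) by (rule T.T_finsum[symmetric, OF w(3,5)])
  finally have 0: "finsum V (\<lambda>W. T (w W)) {W. T (w W) \<noteq> \<zero>} = \<zero>" unfolding z .
  show ?thesis
  proof (rule zero_components[where w = "\<lambda>W. T (w W)", OF _ _ finite_subset[OF sub w(3)] 0])
    show "T (w W) \<in> W" if "W \<in> summands" for W by (rule TW[OF that w(1)[OF that]])
    show "T (w W) = \<zero>" if "W \<notin> summands" for W using w(2)[OF that] by simp
  qed
qed

lemma span_gens:
  assumes "finite A" "A \<subseteq> summands"
  defines "B \<equiv> (\<Union>W\<in>A. gens W)"
  shows "finite B" "B \<subseteq> carrier V" "W \<in> A \<Longrightarrow> W \<subseteq> lspan V B"
    "x \<in> sl2 \<Longrightarrow> y \<in> lspan V B \<Longrightarrow> act V x y \<in> lspan V B"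
proof -
  show "finite B" using assms gens(1) by auto
  show Bc: "B \<subseteq> carrier V" using assms gens(2) by auto
  show WB: "W \<subseteq> lspan V B" if "W \<in> A" for W
  proof -
    have "lspan V (gens W) \<subseteq> lspan V B" using that by (intro lspan_mono) (auto simp: B_def)
    then show ?thesis using gens(3) that assms(2) by auto
  qed
  show "act V x y \<in> lspan V B" if "x \<in> sl2" "y \<in> lspan V B"
  proof (rule lspan_act_closed[OF Bc _ that(2)])
    fix b assume "b \<in> B"
    then obtain W where W: "W \<in> A" "b \<in> gens W" by (auto simp: B_def)
    then have "b \<in> W" using lspan_incl[of "gens W"] gens(3)[of W] assms(2) by auto
    then have "act V x b \<in> W" using summands(1)[of W] W(1) assms(2) that(1) by (auto simp: submod_def)
    then show "act V x b \<in> lspan V B" using WB[OF W(1)] by auto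
  qed
qed

lemma locally_finite:
  assumes "v \<in> carrier V"
  obtains B where "finite B" "B \<subseteq> carrier V" "v \<in> lspan V B"
    "\<And>x y. x \<in> sl2 \<Longrightarrow> y \<in> lspan V B \<Longrightarrow> act V x y \<in> lspan V B"
proof -
  obtain w where w: "\<And>W. W \<in> summands \<Longrightarrow> w W \<in> W" "\<And>W. W \<notin> summands \<Longrightarrow> w W = \<zero>"
    "finite {W. w W \<noteq> \<zero>}" "v = finsum V w {W. w W \<noteq> \<zero>}" "\<And>W. w W \<in> carrier V"
    by (rule components[OF assms]) blast
  let ?A = "{W. w W \<noteq> \<zero>}"
  have A: "?A \<subseteq> summands" using w(2) by auto
  let ?B = "\<Union>W\<in>?A. gens W"
  note B = span_gens[OF w(3) A]
  have "v \<in> lspan V ?B"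
    unfolding w(4) using w(1) A B(3) by (intro submodule_finsum lspan_submodule[OF B(2)]) blast
  then show ?thesis using B(1,2,4) that[of ?B] by blast
qed

lemma act_endo: "endo V (act V x)"
  by unfold_locales (auto simp: act_add_right act_smult_right)

text \<open>The vectors x^j y lie in a finite-dimensional space, hence satisfy a nontrivial
  relation, but they belong to distinct eigenvalues of h. So each term of the relation vanishes, in
  particular one with nonzero coefficient.\<close>

lemma pow_nilpotent:
  assumes x: "x \<in> {\<ee>, \<ff>}" and y: "y \<in> carrier V" "act V \<hh> y = \<mu> \<odot> y"
  obtains j where "(act V x ^^ j) y = \<zero>"
proof -
  interpret h: endo V "act V \<hh>" by (rule act_endo)
  obtain B where B: "finite B" "B \<subseteq> carrier V" "y \<in> lspan V B"
    "\<And>x y. x \<in> sl2 \<Longrightarrow> y \<in> lspan V B \<Longrightarrow> act V x y \<in> lspan V B"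
    by (rule locally_finite[OF y(1)]) blast
  have "(act V x ^^ j) y \<in> lspan V B" for j
    using x B(3,4) by (induction j) auto
  then obtain c N where c: "\<exists>j\<le>N. c j \<noteq> 0" "(\<Oplus>j\<in>{..N}. c j \<odot> (act V x ^^ j) y) = \<zero>"
    by (rule linear_dependence[OF B(1,2), of "\<lambda>j. (act V x ^^ j) y"])
  define s :: complex where "s = (if x = \<ee> then 2 else - 2)"
  have s: "act V \<hh> ((act V x ^^ j) y) = (\<mu> + s * of_nat j) \<odot> (act V x ^^ j) y" for j
    using x weight_e[OF lie_module_axioms y] weight_f[OF lie_module_axioms y] by (auto simp: s_def)
  from c(1) obtain j where j: "j \<le> N" "c j \<noteq> 0" by blast
  have "c j \<odot> (act V x ^^ j) y = \<zero>"
  proof (rule h.eigenvectors_independent[where I = "{..N}" and \<mu> = "\<lambda>j. \<mu> + s * of_nat j", OF _ _ _ _ c(2)])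
    show "inj_on (\<lambda>j. \<mu> + s * of_nat j) {..N}" by (auto simp: inj_on_def s_def)
    show "act V \<hh> (c i \<odot> (act V x ^^ i) y) = (\<mu> + s * of_nat i) \<odot> (c i \<odot> (act V x ^^ i) y)" for i
      using y(1) by (simp add: act_smult_right s smult_smult mult.commute)
  qed (use y(1) j in auto)
  then show ?thesis using smult_eq_0 j(2) y(1) that by blast
qed

lemma hw_type:
  assumes x: "x \<in> carrier V" "act V \<hh> x = \<mu> \<odot> x" "act V \<ee> x = \<zero>" "x \<noteq> \<zero>"
  obtains m where "\<mu> = of_nat m" "(act V \<ff> ^^ Suc m) x = \<zero>" "has_type V m"
proof -
  obtain j where "(act V \<ff> ^^ j) x = \<zero>" using pow_nilpotent[of \<ff> x \<mu>] x by blast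
  then obtain m where m: "\<mu> = of_nat m" "(act V \<ff> ^^ Suc m) x = \<zero>"
    using highest_weight_nat[OF lie_module_axioms x(1-3) _ x(4)] by blast
  note h = hw_Lmod[OF lie_module_axioms x(1) x(2)[unfolded m(1)] x(3) m(2) x(4)]
  have "has_type V m" unfolding has_type_def
    using h(1) iso_LmodI[OF lie_module_axioms h(1,3)] by blast
  then show ?thesis using m that by blast
qed

lemma type_hw:
  assumes "has_type V n"
  obtains v where "v \<in> carrier V" "v \<noteq> \<zero>" "act V \<hh> v = of_nat n \<odot> v" "act V \<ee> v = \<zero>"
proof -
  obtain W where W: "submod sl2 W V" "iso_mod sl2 (restr V W) (Lmod n)" using assms by (auto simp: has_type_def)
  interpret L: lie_module "Lmod n" by (rule lie_module_Lmod)
  have Wr: "amodule (restr V W) sl2" by (rule amodule_restr[OF W(1)])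
  have "iso_mod sl2 (Lmod n) (restr V W)" by (rule iso_mod_sym[OF Wr L.amodule_any W(2)])
  then obtain \<phi> where \<phi>: "bij_betw \<phi> (carrier (Lmod n)) (carrier (restr V W))" "mod_hom sl2 (Lmod n) (restr V W) \<phi>"
    by (auto simp: iso_mod_hom)
  interpret h: mod_hom_loc "Lmod n" "restr V W" sl2 \<phi>
    using \<phi>(2) Wr by (simp add: mod_hom_loc_def mod_hom_loc_axioms_def L.amodule_any)
  have d0: "delta 0 \<in> carrier (Lmod n)" by (auto simp: delta_apply)
  let ?v = "\<phi> (delta 0)"
  have "?v \<in> W" using h.hom_closed[OF d0] by simp
  then have 1: "?v \<in> carrier V" using W(1) submoduleD(1) by (auto simp: submod_def)
  have 2: "?v \<noteq> \<zero>"
    using h.inj_nonzero[OF bij_betw_imp_inj_on[OF \<phi>(1)] d0] delta_nonzero[of "0 :: nat"] by simp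
  have "act (Lmod n) \<hh> (delta 0) = of_nat n \<odot>\<^bsub>Lmod n\<^esub> delta 0"
    using Lmod_h[OF d0] by (auto simp: delta_apply)
  then have 3: "act V \<hh> ?v = of_nat n \<odot> ?v"
    using h.hom_act[OF sl2_mem(3) d0] h.hom_smult[OF d0] by simp
  have "L_e n (delta 0) = (\<lambda>i. 0)" by (auto simp: L_e_def delta_apply)
  then have "act V \<ee> ?v = \<zero>" using h.hom_act[OF sl2_mem(1) d0] h.hom_zero by simp
  then show ?thesis using 1 2 3 that by blast
qed

text \<open>Local finiteness gives an eigenvector of h; the last nonzero power of e applied to it is
  a highest weight vector.\<close>

lemma type_exists: "\<exists>n. has_type V n"
proof -
  obtain x where x: "x \<in> carrier V" "x \<noteq> \<zero>" using simple zero_closed unfolding simple_mod_def by blast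
  obtain B where B: "finite B" "B \<subseteq> carrier V" "x \<in> lspan V B"
    "\<And>x y. x \<in> sl2 \<Longrightarrow> y \<in> lspan V B \<Longrightarrow> act V x y \<in> lspan V B"
    by (rule locally_finite[OF x(1)]) blast
  interpret h: endo V "act V \<hh>" by (rule act_endo)
  have hx: "(act V \<hh> ^^ j) x \<in> lspan V B" for j
    using B(3,4) by (induction j) auto
  obtain y \<mu> where y: "y \<in> carrier V" "y \<noteq> \<zero>" "act V \<hh> y = \<mu> \<odot> y"
    by (rule h.eigenvector_exists[OF B(1,2) hx x(2,1) carrier_is_submodule]) (use x in auto)
  obtain j where j: "(act V \<ee> ^^ j) y = \<zero>" using pow_nilpotent[of \<ee> y \<mu>] y by blast
  define l where "l = (LEAST j. (act V \<ee> ^^ j) y = \<zero>)"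
  have l: "(act V \<ee> ^^ l) y = \<zero>" unfolding l_def using j by (rule LeastI)
  then obtain m where m: "l = Suc m" using y(2) by (cases l) auto
  have "(act V \<ee> ^^ m) y \<noteq> \<zero>" using not_less_Least[of m "\<lambda>j. (act V \<ee> ^^ j) y = \<zero>"] m l_def by simp
  moreover have "act V \<ee> ((act V \<ee> ^^ m) y) = \<zero>" using l m by simp
  ultimately show ?thesis
    using hw_type[OF act_pow_closed[OF y(1)] weight_e[OF lie_module_axioms y(1,3)]] by blast
qed

lemma minimal_hw_module:
  assumes min: "minimal_type V n" and c: "central_charge V c"
  obtains v where "hw_module V v n c" "v \<noteq> \<zero>"
proof -
  have "has_type V n" using min by (simp add: minimal_type_def)
  then obtain v where v: "v \<in> carrier V" "v \<noteq> \<zero>" "act V \<hh> v = of_nat n \<odot> v" "act V \<ee> v = \<zero>"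
    by (rule type_hw)
  have eq: "act V \<ee> (act V \<qq> v) = act V \<pp> v"
    using act_swap[of v \<ee> \<qq>] v by (simp add: schr_relations)
  have ep: "act V \<ee> (act V \<pp> v) = \<zero>"
    using act_swap[of v \<ee> \<pp>] v by (simp add: schr_relations)
  have hp: "act V \<hh> (act V \<pp> v) = (of_nat n + 1) \<odot> act V \<pp> v"
    using weight_p[OF lie_module_axioms v(1,3), of 1] by simp
  have efp: "act V \<ee> (act V \<ff> (act V \<pp> v)) = (of_nat n + 1) \<odot> act V \<pp> v"
    using e_f_pow[OF lie_module_axioms _ hp ep, of 0] v(1) by simp
  have hq: "act V \<hh> (act V \<qq> v) = (of_nat n - 1) \<odot> act V \<qq> v"
  proof -
    have "act V \<hh> (act V \<qq> v) = of_nat n \<odot> act V \<qq> v \<oplus> (- 1) \<odot> act V \<qq> v"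
      using act_swap[of v \<hh> \<qq>] v by (simp add: schr_relations act_uminus_left act_smult_right)
    also have "\<dots> = (of_nat n + - 1) \<odot> act V \<qq> v" by (rule smult_collect) (use v in simp)
    finally show ?thesis by simp
  qed
  have hfp: "act V \<hh> (act V \<ff> (act V \<pp> v)) = (of_nat n - 1) \<odot> act V \<ff> (act V \<pp> v)"
    using weight_f[OF lie_module_axioms _ hp, of 1] v(1) by (simp add: algebra_simps)
  \<comment> \<open>Up to a factor, the component of q v of type L(n - 1): in e y the two terms both
    become (n + 1) p v and cancel.\<close>
  define y where "y = (of_nat n + 1) \<odot> act V \<qq> v \<oplus> (- 1) \<odot> act V \<ff> (act V \<pp> v)"
  have yc: "y \<in> carrier V" using v(1) by (simp add: y_def)
  have "act V \<ee> y = (of_nat n + 1) \<odot> act V \<pp> v \<oplus> (- 1) \<odot> ((of_nat n + 1) \<odot> act V \<pp> v)"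
    using v(1) by (simp add: y_def act_add_right act_smult_right eq efp)
  also have "\<dots> = \<zero>" using v(1) by (simp add: smult_smult smult_collect)
  finally have ye: "act V \<ee> y = \<zero>" .
  have yh: "act V \<hh> y = (of_nat n - 1) \<odot> y"
    using v(1) by (simp add: y_def act_add_right act_smult_right hq hfp smult_add_right smult_smult mult.commute)
  have "y = \<zero>"
  proof (rule ccontr)
    assume "y \<noteq> \<zero>"
    \<comment> \<open>A nonzero y would be a highest weight vector of weight n - 1. For n > 0 this
      contradicts minimality; for n = 0 the weight - 1 is not a natural number.\<close>
    then obtain m where m: "of_nat n - 1 = (of_nat m :: complex)" "has_type V m"
      using hw_type[OF yc yh ye] by blast
    then have "of_nat n = (of_nat (Suc m) :: complex)" by (simp add: algebra_simps)
    then have "n = Suc m" by (simp only: of_nat_eq_iff)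
    then show False using min m(2) by (auto simp: minimal_type_def)
  qed
  then have q: "(of_nat n + 1) \<odot> act V \<qq> v = act V \<ff> (act V \<pp> v)"
    using v(1) minus_equality[of "(of_nat n + 1) \<odot> act V \<qq> v" "(- 1) \<odot> act V \<ff> (act V \<pp> v)"]
    unfolding y_def by (simp add: uminus_smult smult_smult)
  have "hw_module V v n c"
  proof unfold_locales
    fix k
    let ?x = "(act V \<pp> ^^ k) v"
    have xh: "act V \<hh> ?x = (of_nat n + of_nat k) \<odot> ?x" by (rule weight_p[OF lie_module_axioms v(1,3)])
    have xe: "act V \<ee> ?x = \<zero>"
      using act_pow_commute[of \<ee> \<pp> v k] v by (simp add: schr_relations)
    \<comment> \<open>A nonzero p^k v is itself a highest weight vector, of weight n + k, so
      \<open>hw_type\<close> bounds its powers of f.\<close>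
    show "(act V \<ff> ^^ Suc (n + k)) ?x = \<zero>"
    proof (cases "?x = \<zero>")
      case False
      obtain m where m: "of_nat n + of_nat k = (of_nat m :: complex)" "(act V \<ff> ^^ Suc m) ?x = \<zero>"
        using hw_type[OF _ xh xe False] v(1) by blast
      then have "of_nat (n + k) = (of_nat m :: complex)" by simp
      then have "n + k = m" by (simp only: of_nat_eq_iff)
      then show ?thesis using m(2) by simp
    qed (simp only: act_pow_zero)
  qed (use v q c in \<open>auto simp: central_charge_def\<close>)
  then show ?thesis using v(2) that by blast
qed

lemma iso_Kmod:
  assumes "minimal_type V n" "central_charge V c" "c \<noteq> 0"
  shows "iso_mod UNIV (Kmod n c) V"
proof -
  obtain v where v: "hw_module V v n c" "v \<noteq> \<zero>" by (rule minimal_hw_module[OF assms(1,2)])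
  note v0 = v(2)
  interpret hw_module V v n c by (rule v(1))
  interpret h: mod_hom_loc "Kmod n c" V UNIV \<Psi> by (rule \<Psi>_loc)
  have d: "delta (0, 0) \<in> carrier (Kmod n c)" using delta_K_carrier by simp
  have nz: "\<Psi> (delta (0, 0)) \<noteq> \<zero>" using v0 by (simp add: u_00)
  have "bij_betw \<Psi> (carrier (Kmod n c)) (carrier V)"
    unfolding bij_betw_def
    using h.simple_inj[OF Kmod_simple[OF assms(3)] d nz] h.simple_surj[OF simple d nz] by blast
  then show ?thesis using \<Psi>_hom unfolding iso_mod_hom by blast
qed

lemma iso_Lmod:
  assumes "minimal_type V n" "central_charge V 0"
  shows "iso_mod UNIV (Lmod n) V"
proof -
  obtain v where v: "hw_module V v n 0" "v \<noteq> \<zero>" by (rule minimal_hw_module[OF assms])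
  interpret hw: hw_module V v n 0 by (rule v(1))
  have p: "act V \<pp> v = \<zero>" by (rule hw.charge_zero[OF refl simple v(2)])
  have q: "act V \<qq> v = \<zero>" by (rule hw.q_v_zero[OF p])
  have nil: "(act V \<ff> ^^ Suc n) v = \<zero>" using hw.nil[of 0] by simp
  note h = Lmod_hom(2)[OF lie_module_axioms hw.v hw.h_v hw.e_v nil q]
  note hw' = hw_Lmod[OF lie_module_axioms hw.v hw.h_v hw.e_v nil v(2)]
  interpret L: lie_module "Lmod n" by (rule lie_module_Lmod)
  interpret h: mod_hom_loc "Lmod n" V UNIV "lc V (\<lambda>i. (act V \<ff> ^^ i) v)"
    using h by (simp add: mod_hom_loc_def mod_hom_loc_axioms_def L.amodule_any amodule_any)
  have "lc V (\<lambda>i. (act V \<ff> ^^ i) v) ` carrier (Lmod n) = carrier V"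
    using h.image_submod[OF amodule.submod_carrier[OF L.amodule_any]] simple hw'(2) v(2) unfolding simple_mod_def by blast
  then show ?thesis by (rule hw'(4)[OF q])
qed

lemma minimal_type_exists: "\<exists>n. minimal_type V n"
  using type_exists LeastI_ex[of "has_type V"] Least_le[of "has_type V"] unfolding minimal_type_def by blast

text \<open>Here finite multiplicity enters. The highest weight vectors of a fixed weight n lie in
  the sum of the finitely many summands of type L(n), and z preserves them as it commutes with e and
  h. So z has an eigenvector, and its eigenspace is a nonzero submodule of a simple module.\<close>

lemma central_charge_exists: "\<exists>c. central_charge V c"
proof -
  obtain n where "has_type V n" using type_exists by blast
  then obtain v where v: "v \<in> carrier V" "v \<noteq> \<zero>" "act V \<hh> v = of_nat n \<odot> v" "act V \<ee> v = \<zero>"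
    by (rule type_hw)
  define A where "A = {W \<in> summands. iso_mod sl2 (Lmod n) (restr V W)}"
  have finA: "finite A"
  proof (cases "A = {}")
    case False
    then obtain W0 where W0: "W0 \<in> summands" "iso_mod sl2 (Lmod n) (restr V W0)" by (auto simp: A_def)
    have "A \<subseteq> {W'\<in>summands. iso_mod sl2 (restr V W') (restr V W0)}"
      using iso_LmodI[OF lie_module_axioms summands(1)] iso_mod_trans[OF _ W0(2)] by (auto simp: A_def)
    then show ?thesis using summands(5)[OF W0(1)] by (rule finite_subset)
  qed simp
  have AS: "A \<subseteq> summands" by (auto simp: A_def)
  let ?B = "\<Union>W\<in>A. gens W"
  note B = span_gens[OF finA AS]
  \<comment> \<open>The nonzero components of such an x are highest weight vectors of weight n
    again, and each generates its simple summand, which is therefore a copy of L(n) and belongs to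
    \<open>A\<close>.\<close>
  have N: "x \<in> lspan V ?B" if x: "x \<in> carrier V" "act V \<hh> x = of_nat n \<odot> x" "act V \<ee> x = \<zero>" for x
  proof -
    obtain w where w: "\<And>W. W \<in> summands \<Longrightarrow> w W \<in> W" "\<And>W. W \<notin> summands \<Longrightarrow> w W = \<zero>"
      "finite {W. w W \<noteq> \<zero>}" "x = finsum V w {W. w W \<noteq> \<zero>}" "\<And>W. w W \<in> carrier V"
      by (rule components[OF x(1)]) blast
    have inv: "act V y u \<in> W" if "W \<in> summands" "u \<in> W" "y \<in> sl2" for W u y
      using summands(1)[OF that(1)] that by (simp add: submod_def)
    have e0: "act V \<ee> (w W) = \<zero>" for W
      by (rule kernel_components[OF act_endo _ w x(3)]) (use inv in auto)
    \<comment> \<open>Being of weight n is expressed as lying in the kernel of h - n, so that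
      \<open>kernel_components\<close> applies to it as it does to e.\<close>
    let ?T = "\<lambda>y. act V \<hh> y \<oplus> (- of_nat n) \<odot> y"
    have T: "endo V ?T"
      by unfold_locales (auto simp: act_add_right act_smult_right smult_add_right smult_smult mult.commute a_ac)
    have "?T (w W) = \<zero>" for W
    proof (rule kernel_components[OF T _ w])
      show "?T u \<in> W" if "W \<in> summands" "u \<in> W" for W u
        using summands(1)[OF that(1)] inv[OF that, of \<hh>] that(2) submoduleD(3,4)[of W] by (simp add: submod_def)
      show "?T x = \<zero>" using x by (simp add: smult_collect)
    qed
    then have h0: "act V \<hh> (w W) = of_nat n \<odot> w W" for W
      using minus_equality[of "act V \<hh> (w W)" "(- of_nat n) \<odot> w W"] w(5)[of W]
      by (simp add: uminus_smult smult_smult)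
    have "W \<in> A" if W: "w W \<noteq> \<zero>" for W
    proof -
      have WS: "W \<in> summands" using w(2) W by blast
      obtain m where m: "of_nat n = (of_nat m :: complex)" "(act V \<ff> ^^ Suc m) (w W) = \<zero>"
        using hw_type[OF w(5) h0 e0 W] by blast
      then have "m = n" by simp
      note h = hw_Lmod[OF lie_module_axioms w(5) h0 e0 m(2)[unfolded this] W]
      let ?U = "lc V (\<lambda>i. (act V \<ff> ^^ i) (w W)) ` carrier (Lmod n)"
      have "?U \<subseteq> W" by (rule h(5)[OF summands(1)[OF WS] w(1)[OF WS]])
      then have "submod sl2 ?U (restr V W)" using submod_restr[OF summands(1)[OF WS]] h(1) by blast
      moreover have "?U \<noteq> {\<zero>}" using h(2) W by blast
      ultimately have "?U = W" using summands(2)[OF WS] unfolding simple_mod_def by auto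
      then show ?thesis using h(3) WS by (simp add: A_def)
    qed
    then have "w W \<in> lspan V ?B" if "w W \<noteq> \<zero>" for W
      using B(3) w(1) AS that by blast
    then show ?thesis unfolding w(4) by (intro submodule_finsum lspan_submodule[OF B(2)]) auto
  qed
  have br: "bracket x \<zz> = 0" for x by (simp add: bracket_schr_def \<zz>_def zero_schr_def)
  have zx: "act V x (act V \<zz> u) = act V \<zz> (act V x u)" if "u \<in> carrier V" for x u
    using act_swap[OF that, of x \<zz>] br[of x] that by simp
  have "(act V \<zz> ^^ j) v \<in> carrier V \<and> act V \<hh> ((act V \<zz> ^^ j) v) = of_nat n \<odot> (act V \<zz> ^^ j) v
      \<and> act V \<ee> ((act V \<zz> ^^ j) v) = \<zero>" for j
    using v by (induction j) (auto simp: zx act_smult_right)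
  then have zj: "(act V \<zz> ^^ j) v \<in> lspan V ?B" "(act V \<zz> ^^ j) v \<in> carrier V" for j using N by auto
  interpret z: endo V "act V \<zz>" by (rule act_endo)
  obtain y c where y: "y \<in> carrier V" "y \<noteq> \<zero>" "act V \<zz> y = c \<odot> y"
    by (rule z.eigenvector_exists[OF B(1,2) zj(1) v(2,1) carrier_is_submodule zj(2)])
  let ?E = "{u \<in> carrier V. act V \<zz> u = c \<odot> u}"
  have "submodule ?E complex_field V"
    unfolding submodule_iff by (auto simp: act_add_right act_smult_right smult_add_right smult_smult mult.commute)
  then have "submod UNIV ?E V"
    by (auto simp: submod_def zx[symmetric] act_smult_right)
  then have "?E = carrier V" using simple y unfolding simple_mod_def by blast
  then show ?thesis unfolding central_charge_def by blast
qed

end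

section \<open>Modules over enveloping algebras\<close>

text \<open>Left modules over a ring that need not be commutative, with a type as the ring of
  scalars: this covers modules over enveloping algebras and the tensor products formed from
  them.\<close>

locale left_mod = abelian_group N for N :: "('r::ring_1, 'm) module" (structure) +
  assumes s_closed [simp, intro]: "x \<in> carrier N \<Longrightarrow> r \<odot> x \<in> carrier N"
    and s_add_left: "x \<in> carrier N \<Longrightarrow> (r + s) \<odot> x = r \<odot> x \<oplus> s \<odot> x"
    and s_add_right: "x \<in> carrier N \<Longrightarrow> y \<in> carrier N \<Longrightarrow> r \<odot> (x \<oplus> y) = r \<odot> x \<oplus> r \<odot> y"
    and s_mult: "x \<in> carrier N \<Longrightarrow> (r * s) \<odot> x = r \<odot> (s \<odot> x)"
    and s_one [simp]: "x \<in> carrier N \<Longrightarrow> 1 \<odot> x = x"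
begin

lemma s_zero_left [simp]: "x \<in> carrier N \<Longrightarrow> 0 \<odot> x = \<zero>"
  using s_add_left[of x 0 0] by (metis add_0 s_closed add.r_cancel_one')

lemma s_zero_right [simp]: "r \<odot> \<zero> = \<zero>"
  using s_add_right[of \<zero> \<zero> r] by (metis zero_closed l_zero s_closed add.r_cancel_one')

lemma s_diff_left: "x \<in> carrier N \<Longrightarrow> (r - s) \<odot> x = r \<odot> x \<ominus> s \<odot> x"
proof -
  assume x: "x \<in> carrier N"
  have "r \<odot> x = (r - s) \<odot> x \<oplus> s \<odot> x" using x by (simp add: s_add_left[symmetric])
  then show ?thesis using x by (simp add: a_minus_def a_assoc r_neg)
qed

end

lemma uea_const_add: "uea_const (c + d) = uea_const c + (uea_const d :: 'g::lie_algebra uea)"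
  by (simp add: uea_const_def plus_uea.abs_eq single_add)

lemma lie_module_of_left_mod:
  assumes "left_mod N" shows "lie_module (rep_of_uea_module N)"
proof -
  interpret left_mod N by fact
  have ab: "abelian_group (rep_of_uea_module N)"
  proof (rule abelian_groupI)
    show "\<exists>y\<in>carrier (rep_of_uea_module N). y \<oplus>\<^bsub>rep_of_uea_module N\<^esub> x = \<zero>\<^bsub>rep_of_uea_module N\<^esub>"
      if "x \<in> carrier (rep_of_uea_module N)" for x
      using that by (intro bexI[of _ "\<ominus>\<^bsub>N\<^esub> x"]) (auto simp: rep_of_uea_module_def l_neg)
  qed (auto simp: rep_of_uea_module_def a_ac)
  interpret R: abelian_group "rep_of_uea_module N" by (rule ab)
  have minus: "x \<ominus>\<^bsub>rep_of_uea_module N\<^esub> y = x \<ominus>\<^bsub>N\<^esub> y" if "x \<in> carrier N" "y \<in> carrier N" for x y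
  proof -
    have "\<ominus>\<^bsub>rep_of_uea_module N\<^esub> y = \<ominus>\<^bsub>N\<^esub> y"
      by (rule R.minus_equality) (use that in \<open>auto simp: rep_of_uea_module_def l_neg\<close>)
    then show ?thesis by (simp add: a_minus_def) (simp add: rep_of_uea_module_def)
  qed
  have comm: "uea_of x \<odot>\<^bsub>N\<^esub> (uea_const c \<odot>\<^bsub>N\<^esub> v) = uea_const c \<odot>\<^bsub>N\<^esub> (uea_of x \<odot>\<^bsub>N\<^esub> v)"
    if "v \<in> carrier N" for c x v
    by (simp only: s_mult[OF that, symmetric] uea_const_commute[of c "uea_of x"])
  show ?thesis
  proof (intro lie_module.intro moduleI lie_module_axioms.intro ab cring_from_type_algebra)
    fix x y v assume "v \<in> carrier (rep_of_uea_module N)"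
    then have v: "v \<in> carrier N" by (simp add: rep_of_uea_module_def)
    show "act (rep_of_uea_module N) (bracket x y) v
      = act (rep_of_uea_module N) x (act (rep_of_uea_module N) y v)
        \<ominus>\<^bsub>rep_of_uea_module N\<^esub> act (rep_of_uea_module N) y (act (rep_of_uea_module N) x v)"
      using v by (subst minus) (auto simp: rep_of_uea_module_def uea_of_bracket s_diff_left s_mult)
  qed (auto simp: rep_of_uea_module_def uea_const_add uea_const_mult uea_const_1 uea_of_add uea_of_lscale
      s_add_left s_add_right s_mult comm)
qed

section \<open>Words acting on a Lie algebra module, and the passage to the enveloping
  algebra\<close>

definition word_act :: "('g, 'm) rep \<Rightarrow> 'm \<Rightarrow> 'g word \<Rightarrow> 'm"
  where "word_act M v w = foldr (act M) (letters w) v"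

definition word_eval :: "('g, 'm) rep \<Rightarrow> ('g word \<Rightarrow>\<^sub>0 complex) \<Rightarrow> 'm \<Rightarrow> 'm"
  where "word_eval M a v = lc M (word_act M v) (Poly_Mapping.lookup a)"

context lie_module
begin

lemma word_act_closed [simp, intro]: "v \<in> carrier M \<Longrightarrow> word_act M v w \<in> carrier M"
proof -
  assume v: "v \<in> carrier M"
  have "foldr (act M) xs v \<in> carrier M" for xs using v by (induction xs) auto
  then show ?thesis by (simp add: word_act_def)
qed

lemma word_act_plus: "word_act M v (w + w') = word_act M (word_act M v w') w"
  by (simp add: word_act_def plus_word_def)

lemma word_act_add: "v \<in> carrier M \<Longrightarrow> v' \<in> carrier M \<Longrightarrow>
    word_act M (v \<oplus> v') w = word_act M v w \<oplus> word_act M v' w"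
  and word_act_smult: "v \<in> carrier M \<Longrightarrow> word_act M (c \<odot> v) w = c \<odot> word_act M v w"
proof -
  have cl: "foldr (act M) xs v \<in> carrier M" if "v \<in> carrier M" for xs v using that by (induction xs) auto
  have "foldr (act M) xs (v \<oplus> v') = foldr (act M) xs v \<oplus> foldr (act M) xs v'"
    if "v \<in> carrier M" "v' \<in> carrier M" for xs
    by (induction xs) (simp_all add: act_add_right cl that)
  then show "v \<in> carrier M \<Longrightarrow> v' \<in> carrier M \<Longrightarrow> word_act M (v \<oplus> v') w = word_act M v w \<oplus> word_act M v' w"
    by (simp add: word_act_def)
  have "foldr (act M) xs (c \<odot> v) = c \<odot> foldr (act M) xs v" if "v \<in> carrier M" for xs
    by (induction xs) (simp_all add: act_smult_right cl that)
  then show "v \<in> carrier M \<Longrightarrow> word_act M (c \<odot> v) w = c \<odot> word_act M v w"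
    by (simp add: word_act_def)
qed

lemma finsupp_lookup [simp]: "finsupp (Poly_Mapping.lookup a)"
  by (simp add: finsupp_def)

lemma word_eval_closed [simp, intro]: "v \<in> carrier M \<Longrightarrow> word_eval M a v \<in> carrier M"
  unfolding word_eval_def by (rule lc_closed) simp

lemma word_eval_add: "v \<in> carrier M \<Longrightarrow> word_eval M (a + b) v = word_eval M a v \<oplus> word_eval M b v"
  unfolding word_eval_def by (simp add: lookup_add lc_add[symmetric] plus_poly_mapping.rep_eq)

lemma word_eval_0 [simp]: "word_eval M 0 v = \<zero>"
  by (simp add: word_eval_def lookup_zero zero_poly_mapping.rep_eq)

lemma word_eval_single: "v \<in> carrier M \<Longrightarrow> word_eval M (Poly_Mapping.single w c) v = c \<odot> word_act M v w"
proof -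
  assume v: "v \<in> carrier M"
  have "Poly_Mapping.lookup (Poly_Mapping.single w c) = (\<lambda>i. c * delta w i)"
    by (auto simp: lookup_single when_def delta_apply fun_eq_iff)
  then show ?thesis unfolding word_eval_def using v by (simp add: lc_smult)
qed

lemma word_eval_add_right:
  assumes "v \<in> carrier M" "v' \<in> carrier M"
  shows "word_eval M a (v \<oplus> v') = word_eval M a v \<oplus> word_eval M a v'"
proof (induction a rule: poly_mapping_sum_induct)
  case (add a b)
  then show ?case using assms by (simp add: word_eval_add a_ac)
qed (use assms in \<open>simp_all add: word_eval_single word_act_add smult_add_right\<close>)

lemma word_eval_smult_right:
  assumes "v \<in> carrier M"
  shows "word_eval M a (c \<odot> v) = c \<odot> word_eval M a v"
proof (induction a rule: poly_mapping_sum_induct)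
  case (add a b)
  then show ?case using assms by (simp add: word_eval_add smult_add_right)
qed (use assms in \<open>simp_all add: word_eval_single word_act_smult smult_smult mult.commute\<close>)

lemma word_eval_mult:
  assumes "v \<in> carrier M"
  shows "word_eval M (a * b) v = word_eval M a (word_eval M b v)"
proof (induction a rule: poly_mapping_sum_induct)
  case (single k c)
  show ?case
  proof (induction b rule: poly_mapping_sum_induct)
    case (single l d)
    show ?case using assms
      by (simp add: mult_single word_eval_single word_eval_smult_right word_act_plus smult_smult mult.commute)
  next
    case (add a b)
    then show ?case using assms by (simp add: distrib_left word_eval_add word_eval_add_right)
  qed (use assms word_eval_add_right[of \<zero> \<zero>] word_eval_smult_right[of \<zero> _ 0] in simp)
next
  case (add a b)
  then show ?case using assms by (simp add: distrib_right word_eval_add)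
qed (use assms in simp)

lemma word_eval_diff: "v \<in> carrier M \<Longrightarrow> word_eval M (a - b) v = word_eval M a v \<ominus> word_eval M b v"
proof -
  assume v: "v \<in> carrier M"
  have "word_eval M a v = word_eval M (a - b) v \<oplus> word_eval M b v"
    using word_eval_add[OF v, of "a - b" b] by simp
  then show ?thesis using v by (simp add: a_minus_def a_assoc r_neg)
qed

lemma word_eval_letter: "v \<in> carrier M \<Longrightarrow> word_eval M (letter x) v = act M x v"
  by (simp add: word_eval_single word_act_def)

lemma word_eval_const: "v \<in> carrier M \<Longrightarrow> word_eval M (const c) v = c \<odot> v"
  by (simp add: word_eval_single word_act_def zero_word_def)

lemma diff_self: "v \<in> carrier M \<Longrightarrow> v \<ominus> v = \<zero>"
  by (simp add: a_minus_def r_neg)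

lemma word_eval_relator:
  assumes "r \<in> uea_relators" "v \<in> carrier M"
  shows "word_eval M r v = \<zero>"
  using assms(1) unfolding uea_relators_def
proof (elim UnE CollectE exE conjE)
  fix x y assume "r = letter (x + y) - letter x - letter y"
  then show ?thesis using assms(2)
    by (simp add: word_eval_diff word_eval_letter act_add_left minus_smult smult_collect smult_collect1
        a_assoc a_comm[of _ "act M y v"])
next
  fix c x assume "r = letter (lscale c x) - const c * letter x"
  then show ?thesis using assms(2)
    by (simp only: word_eval_diff word_eval_mult word_eval_const word_eval_letter act_closed act_lscale)
      (simp add: diff_self)
next
  fix x y assume "r = letter x * letter y - letter y * letter x - letter (bracket x y)"
  then show ?thesis using assms(2)
    by (simp only: word_eval_diff word_eval_mult word_eval_letter act_closed act_bracket) (simp add: diff_self)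
qed

lemma word_eval_ideal:
  assumes "a \<in> uea_ideal" "v \<in> carrier M" shows "word_eval M a v = \<zero>"
  using assms(1) unfolding uea_ideal_def
proof (induction rule: group_closure.induct)
  case (base s)
  then consider "s = 0" | a r b where "s = a * r * b" "r \<in> uea_relators" by auto
  then show ?case
  proof cases
    case 2
    then show ?thesis
      using assms(2) word_eval_smult_right[of \<zero> a 0] by (simp add: word_eval_mult word_eval_relator)
  qed simp
next
  case (diff s t)
  then show ?case using assms(2) by (simp add: word_eval_diff diff_self)
qed

text \<open>The scalar multiplication of \<open>uea_module\<close> is computed from the arbitrary
  representative \<open>rep_uea u\<close>. As the ideal acts by zero, any convenient representative
  may replace it.\<close>

lemma word_eval_rep:
  assumes "abs_uea a = u" "v \<in> carrier M"
  shows "word_eval M (rep_uea u) v = word_eval M a v"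
proof -
  have "abs_uea (rep_uea u) = abs_uea a" using assms(1) by (simp add: Quotient3_abs_rep[OF Quotient3_uea])
  then have "uea_rel (rep_uea u) a"
    using Quotient3_rel[OF Quotient3_uea] equivp_reflp[OF uea_rel_equivp] by metis
  then have "word_eval M (rep_uea u - a) v = \<zero>"
    using word_eval_ideal assms(2) by (simp add: uea_rel_def)
  then have "word_eval M (rep_uea u) v \<ominus> word_eval M a v = \<zero>" using assms(2) by (simp add: word_eval_diff)
  then show ?thesis
    using assms(2) minus_equality[of "word_eval M (rep_uea u) v" "\<ominus> word_eval M a v"] by (simp add: a_minus_def)
qed

lemma uea_smult: "u \<odot>\<^bsub>uea_module M\<^esub> v = word_eval M (rep_uea u) v"
  by (simp add: uea_module_def word_eval_def lc_def word_act_def keys.rep_eq)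

lemma uea_simps [simp]:
  "carrier (uea_module M) = carrier M" "zero (uea_module M) = \<zero>" "add (uea_module M) = add M"
  by (simp_all add: uea_module_def)

lemma abs_rep: "abs_uea (rep_uea u) = u"
  by (rule Quotient3_abs_rep[OF Quotient3_uea])

lemma uea_smult_of: "v \<in> carrier M \<Longrightarrow> uea_of x \<odot>\<^bsub>uea_module M\<^esub> v = act M x v"
  unfolding uea_smult by (subst word_eval_rep[OF uea_of.abs_eq[symmetric]]) (simp_all add: word_eval_letter)

lemma uea_smult_const: "v \<in> carrier M \<Longrightarrow> uea_const c \<odot>\<^bsub>uea_module M\<^esub> v = c \<odot> v"
  unfolding uea_smult by (subst word_eval_rep[OF uea_const.abs_eq[symmetric]]) (simp_all add: word_eval_const)

lemma left_mod_uea_module: "left_mod (uea_module M)"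
proof -
  have "abelian_group (uea_module M)"
  proof (rule abelian_groupI)
    show "\<exists>y\<in>carrier (uea_module M). y \<oplus>\<^bsub>uea_module M\<^esub> x = \<zero>\<^bsub>uea_module M\<^esub>"
      if "x \<in> carrier (uea_module M)" for x
      using that by (intro bexI[of _ "\<ominus> x"]) (auto simp: l_neg)
  qed (auto simp: a_ac)
  then interpret U: abelian_group "uea_module M" .
  show ?thesis
  proof
    fix x y r s
    assume "x \<in> carrier (uea_module M)"
    then have x: "x \<in> carrier M" by simp
    show "r \<odot>\<^bsub>uea_module M\<^esub> x \<in> carrier (uea_module M)" using x by (simp add: uea_smult)
    have "abs_uea (rep_uea r + rep_uea s) = r + s" "abs_uea (rep_uea r * rep_uea s) = r * s"
      by (simp_all add: plus_uea.abs_eq[symmetric] times_uea.abs_eq[symmetric] abs_rep)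
    from this[THEN word_eval_rep, OF x]
    show "(r + s) \<odot>\<^bsub>uea_module M\<^esub> x = r \<odot>\<^bsub>uea_module M\<^esub> x \<oplus>\<^bsub>uea_module M\<^esub> s \<odot>\<^bsub>uea_module M\<^esub> x"
      "(r * s) \<odot>\<^bsub>uea_module M\<^esub> x = r \<odot>\<^bsub>uea_module M\<^esub> (s \<odot>\<^bsub>uea_module M\<^esub> x)"
      using x by (simp_all add: uea_smult word_eval_add word_eval_mult)
    show "1 \<odot>\<^bsub>uea_module M\<^esub> x = x"
      using uea_smult_const[OF x, of 1] x by (simp add: uea_const_1)
    assume "y \<in> carrier (uea_module M)"
    then show "r \<odot>\<^bsub>uea_module M\<^esub> (x \<oplus>\<^bsub>uea_module M\<^esub> y) = r \<odot>\<^bsub>uea_module M\<^esub> x \<oplus>\<^bsub>uea_module M\<^esub> r \<odot>\<^bsub>uea_module M\<^esub> y"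
      using x by (simp add: uea_smult word_eval_add_right)
  qed
qed

end

text \<open>The scalar is expressed through \<open>rep_uea u\<close>, as in the definition of
  \<open>uea_map\<close>. \<open>uea_eigenvector\<close> produces literally the same scalar for a
  module on which the small Lie algebra acts by the character \<open>\<chi>\<close>; this agreement
  is what makes maps out of the tensor product balanced.\<close>

lemma (in lie_module) uea_map_eigenvector:
  fixes \<phi> :: "'h::lie_algebra \<Rightarrow> 'g"
  assumes v: "v \<in> carrier M" and \<chi>: "\<And>x. act M (\<phi> x) v = \<chi> x \<odot> v"
  shows "uea_map \<phi> u \<odot>\<^bsub>uea_module M\<^esub> v
    = (\<Sum>w\<in>Poly_Mapping.keys (rep_uea u). Poly_Mapping.lookup (rep_uea u) w * prod_list (map \<chi> (letters w))) \<odot> v"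
proof -
  interpret U: left_mod "uea_module M" by (rule left_mod_uea_module)
  have p: "prod_list (map (\<lambda>x. uea_of (\<phi> x)) xs) \<odot>\<^bsub>uea_module M\<^esub> v = prod_list (map \<chi> xs) \<odot> v" for xs
  proof (induction xs)
    case Nil
    then show ?case using v U.s_one by simp
  next
    case (Cons x xs)
    then show ?case using v U.s_mult by (simp add: uea_smult_of act_smult_right \<chi> smult_smult mult.commute)
  qed
  have "(\<Sum>w\<in>A. uea_const (c w) * prod_list (map (uea_of \<circ> \<phi>) (letters w))) \<odot>\<^bsub>uea_module M\<^esub> v
     = (\<Sum>w\<in>A. c w * prod_list (map \<chi> (letters w))) \<odot> v" if "finite A" for A and c :: "'h word \<Rightarrow> complex"
    using that
  proof (induction A rule: finite_induct)
    case empty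
    then show ?case using v U.s_zero_left by simp
  next
    case (insert w A)
    then show ?case using v U.s_add_left U.s_mult
      by (simp add: comp_def p uea_smult_const smult_smult smult_add_left)
  qed
  then show ?thesis by (simp add: uea_map_def)
qed

section \<open>Tensor products\<close>

definition frag_lin :: "('a \<Rightarrow> complex) \<Rightarrow> ('a \<Rightarrow>\<^sub>0 int) \<Rightarrow> complex"
  where "frag_lin g t = (\<Sum>p\<in>Poly_Mapping.keys t. of_int (Poly_Mapping.lookup t p) * g p)"

lemma frag_lin_eq:
  "finite A \<Longrightarrow> Poly_Mapping.keys t \<subseteq> A \<Longrightarrow> frag_lin g t = (\<Sum>p\<in>A. of_int (Poly_Mapping.lookup t p) * g p)"
  unfolding frag_lin_def by (rule sum.mono_neutral_left) (auto simp: in_keys_iff)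

lemma frag_lin_of [simp]: "frag_lin g (frag_of x) = g x"
  by (subst frag_lin_eq[of "{x}"]) (auto simp: keys_frag_of)

lemma frag_lin_0 [simp]: "frag_lin g 0 = 0"
  by (simp add: frag_lin_def)

lemma frag_lin_diff: "frag_lin g (s - t) = frag_lin g s - frag_lin g t"
proof -
  let ?A = "Poly_Mapping.keys s \<union> Poly_Mapping.keys t"
  have "Poly_Mapping.keys (s - t) \<subseteq> ?A" by (rule keys_diff)
  then show ?thesis
    by (simp add: frag_lin_eq[of ?A] lookup_minus sum_subtractf[symmetric] left_diff_distrib)
qed

lemma frag_lin_add: "frag_lin g (s + t) = frag_lin g s + frag_lin g t"
  using frag_lin_diff[of g "s + t" t] by simp

locale tensor_prod = M: left_mod M for M :: "('r::ring_1, 'm) module" +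
  fixes nl :: "'s::ring_1 \<Rightarrow> 'n::ab_group_add \<Rightarrow> 'n" and nr :: "'n \<Rightarrow> 'r \<Rightarrow> 'n"
  assumes nl_add: "nl s (x + y) = nl s x + nl s y"
    and nl_add_left: "nl (s + s') x = nl s x + nl s' x"
    and nl_mult: "nl (s * s') x = nl s (nl s' x)"
    and nl_one: "nl 1 x = x"
    and nl_nr: "nl s (nr x r) = nr (nl s x) r"
begin

definition "K = group_closure (tensor_relators nr M)"
definition "T = tensor nl nr M"
definition "cs t = t +o K"
definition "pure x v = cs (frag_of (x, v))"
definition "F s = frag_extend (\<lambda>(x, v). frag_of (nl s x, v))"

lemma K_0: "0 \<in> K" and K_diff: "a \<in> K \<Longrightarrow> b \<in> K \<Longrightarrow> a - b \<in> K"
  by (simp_all add: K_def group_closure.diff)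

lemma K_neg: "a \<in> K \<Longrightarrow> - a \<in> K" using K_diff[OF K_0, of a] by simp

lemma K_add: "a \<in> K \<Longrightarrow> b \<in> K \<Longrightarrow> a + b \<in> K" using K_diff[OF _ K_neg, of a b] by simp

lemma cs_eq: "cs t = cs t' \<longleftrightarrow> t - t' \<in> K"
proof
  assume "cs t = cs t'"
  then have "t \<in> cs t'" unfolding cs_def elt_set_plus_def using K_0 by force
  then obtain k where "t = t' + k" "k \<in> K" by (auto simp: cs_def elt_set_plus_def)
  then show "t - t' \<in> K" by simp
next
  assume k: "t - t' \<in> K"
  have "a \<in> cs t'" if "a \<in> cs t" "t - t' \<in> K" for a t t'
  proof -
    obtain k where "k \<in> K" "a = t + k" using \<open>a \<in> cs t\<close> by (auto simp: cs_def elt_set_plus_def)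
    then have "a = t' + ((t - t') + k)" "(t - t') + k \<in> K" using that(2) by (simp_all add: K_add)
    then show ?thesis unfolding cs_def elt_set_plus_def by blast
  qed
  moreover have "t' - t \<in> K" using K_neg[OF k] by simp
  ultimately show "cs t = cs t'" using k by blast
qed

lemma cs_add: "cs t + cs t' = cs (t + t')"
proof -
  have "a \<in> cs (t + t')" if "a \<in> cs t + cs t'" for a
  proof -
    obtain k k' where "k \<in> K" "k' \<in> K" "a = (t + k) + (t' + k')"
      using \<open>a \<in> cs t + cs t'\<close> by (auto simp: cs_def elt_set_plus_def set_plus_def)
    then show ?thesis unfolding cs_def elt_set_plus_def
      by (intro CollectI bexI[of _ "k + k'"]) (auto simp: K_add)
  qed
  moreover have "a \<in> cs t + cs t'" if "a \<in> cs (t + t')" for a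
  proof -
    obtain k where k: "k \<in> K" "a = t + (t' + k)"
      using \<open>a \<in> cs (t + t')\<close> by (auto simp: cs_def elt_set_plus_def add.assoc)
    have "t \<in> cs t" "t' + k \<in> cs t'" using K_0 k by (force simp: cs_def elt_set_plus_def)+
    then show ?thesis unfolding k(2) by (rule set_plus_intro)
  qed
  ultimately show ?thesis by blast
qed

lemma cs_0: "cs 0 = K" by (auto simp: cs_def elt_set_plus_def)

lemma F_add: "F s (a + b) = F s a + F s b" and F_diff: "F s (a - b) = F s a - F s b"
  and F_of [simp]: "F s (frag_of (x, v)) = frag_of (nl s x, v)" and F_0 [simp]: "F s 0 = 0"
  by (simp_all add: F_def frag_extend_add frag_extend_diff)

lemma K_base: "a \<in> tensor_relators nr M \<Longrightarrow> a \<in> K"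
  unfolding K_def by (rule group_closure.base) simp

lemma rel1: "v \<in> carrier M \<Longrightarrow> frag_of (x + y, v) - frag_of (x, v) - frag_of (y, v) \<in> K"
  and rel2: "v \<in> carrier M \<Longrightarrow> w \<in> carrier M \<Longrightarrow> frag_of (x, v \<oplus>\<^bsub>M\<^esub> w) - frag_of (x, v) - frag_of (x, w) \<in> K"
  and rel3: "v \<in> carrier M \<Longrightarrow> frag_of (nr x r, v) - frag_of (x, r \<odot>\<^bsub>M\<^esub> v) \<in> K"
  by (rule K_base, unfold tensor_relators_def, blast)+

text \<open>The left action is additive and commutes with the right one, so it sends relators to
  relators.\<close>

lemma F_K: "a \<in> K \<Longrightarrow> F s a \<in> K"
  unfolding K_def
proof (induction rule: group_closure.induct)
  case (base a)
  then consider "a = 0" | "a \<in> tensor_relators nr M" by auto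
  then show ?case unfolding K_def[symmetric]
  proof cases
    case 2
    then show "F s a \<in> K"
      unfolding tensor_relators_def
      by (elim UnE CollectE exE conjE) (auto simp: F_diff nl_add nl_nr intro: rel1 rel2 rel3)
  qed (simp add: K_0)
next
  case (diff a b)
  then show ?case by (simp add: F_diff group_closure.diff)
qed

lemma T_simps: "carrier T = {cs t | t. Poly_Mapping.keys t \<subseteq> UNIV \<times> carrier M}" "zero T = K"
  "A \<oplus>\<^bsub>T\<^esub> B = A + B" "s \<odot>\<^bsub>T\<^esub> A = F s ` A + K"
  by (simp_all add: T_def tensor_def Let_def K_def cs_def F_def)

lemma T_smult: "s \<odot>\<^bsub>T\<^esub> cs t = cs (F s t)"
proof -
  have "a \<in> cs (F s t)" if "a \<in> F s ` cs t + K" for a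
  proof -
    obtain k k' where "k \<in> K" "k' \<in> K" "a = F s (t + k) + k'"
      using \<open>a \<in> F s ` cs t + K\<close> by (auto simp: cs_def elt_set_plus_def set_plus_def)
    then show ?thesis unfolding cs_def elt_set_plus_def
      by (intro CollectI bexI[of _ "F s k + k'"]) (auto simp: F_add F_K K_add)
  qed
  moreover have "a \<in> F s ` cs t + K" if "a \<in> cs (F s t)" for a
  proof -
    obtain k where k: "k \<in> K" "a = F s t + k" using \<open>a \<in> cs (F s t)\<close> by (auto simp: cs_def elt_set_plus_def)
    have "t \<in> cs t" using K_0 by (force simp: cs_def elt_set_plus_def)
    then show ?thesis unfolding k(2) by (intro set_plus_intro imageI k(1))
  qed
  ultimately show ?thesis unfolding T_simps by blast
qed

lemma keys_F: "Poly_Mapping.keys t \<subseteq> UNIV \<times> carrier M \<Longrightarrow> Poly_Mapping.keys (F s t) \<subseteq> UNIV \<times> carrier M"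
  unfolding F_def by (rule order_trans[OF keys_frag_extend]) (auto split: if_splits)

lemma cs_closed: "Poly_Mapping.keys t \<subseteq> UNIV \<times> carrier M \<Longrightarrow> cs t \<in> carrier T"
  unfolding T_simps by blast

lemma T_cases:
  assumes "A \<in> carrier T" obtains t where "A = cs t" "Poly_Mapping.keys t \<subseteq> UNIV \<times> carrier M"
  using assms unfolding T_simps by blast

lemma pure_closed [simp, intro]: "v \<in> carrier M \<Longrightarrow> pure x v \<in> carrier T"
  unfolding pure_def by (rule cs_closed) simp

lemma T_cs_induct:
  assumes "Poly_Mapping.keys t \<subseteq> UNIV \<times> carrier M"
    and "P 0" "\<And>x v. v \<in> carrier M \<Longrightarrow> P (frag_of (x, v))" "\<And>a b. P a \<Longrightarrow> P b \<Longrightarrow> P (a - b)"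
  shows "P t"
  by (rule frag_induction[OF assms(1)]) (use assms(2-4) in auto)

lemma abelian_T: "abelian_group T"
proof (rule abelian_groupI)
  show "x \<oplus>\<^bsub>T\<^esub> y \<in> carrier T" if "x \<in> carrier T" "y \<in> carrier T" for x y
  proof -
    obtain s where s: "x = cs s" "Poly_Mapping.keys s \<subseteq> UNIV \<times> carrier M" using \<open>x \<in> carrier T\<close> by (rule T_cases)
    obtain t where t: "y = cs t" "Poly_Mapping.keys t \<subseteq> UNIV \<times> carrier M" using \<open>y \<in> carrier T\<close> by (rule T_cases)
    have "Poly_Mapping.keys (s + t) \<subseteq> UNIV \<times> carrier M" using s(2) t(2) keys_add[of s t] by blast
    then show ?thesis unfolding T_simps(3) s(1) t(1) cs_add by (rule cs_closed)
  qed
  show "\<zero>\<^bsub>T\<^esub> \<in> carrier T" using cs_closed[of 0] by (simp add: T_simps(2) cs_0)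
  show "\<zero>\<^bsub>T\<^esub> \<oplus>\<^bsub>T\<^esub> x = x" if "x \<in> carrier T" for x
    using that by (elim T_cases) (simp add: T_simps(2,3) cs_0[symmetric] cs_add)
  show "\<exists>y\<in>carrier T. y \<oplus>\<^bsub>T\<^esub> x = \<zero>\<^bsub>T\<^esub>" if x: "x \<in> carrier T" for x
  proof -
    obtain t where t: "x = cs t" "Poly_Mapping.keys t \<subseteq> UNIV \<times> carrier M" using x by (rule T_cases)
    have "Poly_Mapping.keys (- t) \<subseteq> UNIV \<times> carrier M" using t(2) by simp
    then have "cs (- t) \<in> carrier T" by (rule cs_closed)
    then show ?thesis using t(1)
      by (intro bexI[of _ "cs (- t)"]) (auto simp: T_simps(2,3) cs_0[symmetric] cs_add)
  qed
qed (auto simp: T_simps(3) add_ac)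

sublocale T: abelian_group T by (rule abelian_T)

lemma pure_add_left: "v \<in> carrier M \<Longrightarrow> pure (x + y) v = pure x v \<oplus>\<^bsub>T\<^esub> pure y v"
  unfolding pure_def T_simps cs_add cs_eq using rel1[of v x y] by (simp add: algebra_simps)

lemma pure_add_right: "v \<in> carrier M \<Longrightarrow> w \<in> carrier M \<Longrightarrow> pure x (v \<oplus>\<^bsub>M\<^esub> w) = pure x v \<oplus>\<^bsub>T\<^esub> pure x w"
  unfolding pure_def T_simps cs_add cs_eq using rel2[of v w x] by (simp add: algebra_simps)

lemma pure_balanced: "v \<in> carrier M \<Longrightarrow> pure (nr x r) v = pure x (r \<odot>\<^bsub>M\<^esub> v)"
  unfolding pure_def cs_eq by (rule rel3)

lemma smult_pure: "s \<odot>\<^bsub>T\<^esub> pure x v = pure (nl s x) v"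
  unfolding pure_def T_smult by simp

lemma pure_0_left: "v \<in> carrier M \<Longrightarrow> pure 0 v = \<zero>\<^bsub>T\<^esub>"
  using pure_add_left[of v 0 0] by (metis add_0 pure_closed T.add.r_cancel_one')

text \<open>Sums of pure tensors exhaust the tensor product since the negative of a pure tensor is
  the pure tensor of \<open>- x\<close> and \<open>v\<close>. The induction for the free abelian
  group proceeds by differences, hence the invariant includes \<open>- t\<close> along with
  \<open>t\<close>.\<close>

lemma T_induct [consumes 1, case_names zero pure add]:
  assumes A: "A \<in> carrier T" and 0: "P \<zero>\<^bsub>T\<^esub>" and pure: "\<And>x v. v \<in> carrier M \<Longrightarrow> P (pure x v)"
    and add: "\<And>A B. A \<in> carrier T \<Longrightarrow> B \<in> carrier T \<Longrightarrow> P A \<Longrightarrow> P B \<Longrightarrow> P (A \<oplus>\<^bsub>T\<^esub> B)"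
  shows "P A"
proof -
  obtain t where t: "A = cs t" "Poly_Mapping.keys t \<subseteq> UNIV \<times> carrier M" using A by (rule T_cases)
  let ?Q = "\<lambda>t. cs t \<in> carrier T \<and> cs (- t) \<in> carrier T \<and> P (cs t) \<and> P (cs (- t))"
  have "?Q t"
  proof (rule T_cs_induct[OF t(2)])
    show "?Q 0" using 0 T.zero_closed by (simp add: cs_0 T_simps(2)[symmetric])
    show "?Q (frag_of (x, v))" if v: "v \<in> carrier M" for x v
    proof -
      have "pure (- x) v \<oplus>\<^bsub>T\<^esub> pure x v = \<zero>\<^bsub>T\<^esub>"
        using pure_add_left[OF v, of "- x" x] pure_0_left[OF v] by simp
      then have "cs (frag_of (- x, v) + frag_of (x, v)) = cs 0"
        by (simp add: pure_def T_simps(2,3) cs_add cs_0)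
      then have "frag_of (- x, v) + frag_of (x, v) \<in> K" by (simp add: cs_eq)
      then have "- frag_of (x, v) - frag_of (- x, v) \<in> K" using K_neg by (metis minus_add_distrib diff_conv_add_uminus add.commute)
      then have "cs (- frag_of (x, v)) = pure (- x) v"
        unfolding pure_def cs_eq .
      then show ?thesis using pure[OF v] pure_closed[OF v] by (simp add: pure_def[symmetric])
    qed
    show "?Q (a - b)" if "?Q a" "?Q b" for a b
    proof -
      have "cs (a - b) = cs a \<oplus>\<^bsub>T\<^esub> cs (- b)" "cs (- (a - b)) = cs b \<oplus>\<^bsub>T\<^esub> cs (- a)"
        by (simp_all add: T_simps(3) cs_add)
      then show ?thesis using that add T.a_closed by simp
    qed
  qed
  then show ?thesis using t(1) by simp
qed

lemma T_s_closed: "A \<in> carrier T \<Longrightarrow> s \<odot>\<^bsub>T\<^esub> A \<in> carrier T"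
  by (elim T_cases) (auto simp: T_smult intro!: cs_closed keys_F)

lemma T_s_add_right: "A \<in> carrier T \<Longrightarrow> B \<in> carrier T \<Longrightarrow> s \<odot>\<^bsub>T\<^esub> (A \<oplus>\<^bsub>T\<^esub> B) = s \<odot>\<^bsub>T\<^esub> A \<oplus>\<^bsub>T\<^esub> s \<odot>\<^bsub>T\<^esub> B"
  by (elim T_cases) (simp add: T_simps(3) cs_add T_smult F_add)

lemma left_mod_T: "left_mod T"
proof (intro left_mod.intro left_mod_axioms.intro abelian_T T_s_closed T_s_add_right)
  have s0: "s \<odot>\<^bsub>T\<^esub> \<zero>\<^bsub>T\<^esub> = \<zero>\<^bsub>T\<^esub>" for s by (simp add: T_simps(2) cs_0[symmetric] T_smult)
  show "(r + s) \<odot>\<^bsub>T\<^esub> A = r \<odot>\<^bsub>T\<^esub> A \<oplus>\<^bsub>T\<^esub> s \<odot>\<^bsub>T\<^esub> A" if "A \<in> carrier T" for A r s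
    using that
  proof (induction A rule: T_induct)
    case (add A B)
    then show ?case by (simp add: T_s_add_right T_s_closed T.a_ac)
  qed (simp_all add: s0 smult_pure nl_add_left pure_add_left)
  show "(r * s) \<odot>\<^bsub>T\<^esub> A = r \<odot>\<^bsub>T\<^esub> (s \<odot>\<^bsub>T\<^esub> A)" if "A \<in> carrier T" for A r s
    using that
  proof (induction A rule: T_induct)
    case (add A B)
    then show ?case by (simp add: T_s_add_right T_s_closed)
  qed (simp_all add: s0 smult_pure nl_mult)
  show "1 \<odot>\<^bsub>T\<^esub> A = A" if "A \<in> carrier T" for A
    using that
  proof (induction A rule: T_induct)
    case (add A B)
    then show ?case by (simp add: T_s_add_right)
  qed (simp_all add: s0 smult_pure nl_one)
qed

text \<open>The universal property with values in coordinate functions: the extension of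
  \<open>g\<close> to the free abelian group vanishes on the relators, so its value at any
  representative of a coset serves as the value of \<open>h\<close>.\<close>

lemma universal_map:
  fixes g :: "'n \<Rightarrow> 'm \<Rightarrow> 'i \<Rightarrow> complex"
  assumes "\<And>x y v i. v \<in> carrier M \<Longrightarrow> g (x + y) v i = g x v i + g y v i"
    "\<And>x v w i. v \<in> carrier M \<Longrightarrow> w \<in> carrier M \<Longrightarrow> g x (v \<oplus>\<^bsub>M\<^esub> w) i = g x v i + g x w i"
    "\<And>x r v i. v \<in> carrier M \<Longrightarrow> g (nr x r) v i = g x (r \<odot>\<^bsub>M\<^esub> v) i"
  obtains h where "\<And>x v. h (pure x v) = g x v"
    "\<And>A B. A \<in> carrier T \<Longrightarrow> B \<in> carrier T \<Longrightarrow> h (A \<oplus>\<^bsub>T\<^esub> B) = (\<lambda>i. h A i + h B i)"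
proof -
  define G where "G t i = frag_lin (\<lambda>(x, v). g x v i) t" for t i
  have GK: "G a i = 0" if "a \<in> K" for a i
    using that unfolding K_def
  proof (induction rule: group_closure.induct)
    case (base a)
    then consider "a = 0" | "a \<in> tensor_relators nr M" by auto
    then show ?case
    proof cases
      case 2
      then show ?thesis unfolding tensor_relators_def
        by (elim UnE CollectE exE conjE) (auto simp: G_def frag_lin_diff assms)
    qed (simp add: G_def)
  qed (simp add: G_def frag_lin_diff)
  define h where "h A = G (SOME t. A = cs t)" for A
  have h: "h (cs t) = G t" for t
  proof -
    have "cs t = cs (SOME t'. cs t = cs t')" by (rule someI) simp
    then have "t - (SOME t'. cs t = cs t') \<in> K" by (simp only: cs_eq)
    then have "G (t - (SOME t'. cs t = cs t')) i = 0" for i by (rule GK)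
    then show ?thesis by (auto simp: h_def G_def frag_lin_diff fun_eq_iff)
  qed
  show ?thesis
  proof (rule that[of h])
    show "h (pure x v) = g x v" for x v by (simp add: pure_def h) (simp add: G_def fun_eq_iff)
    show "h (A \<oplus>\<^bsub>T\<^esub> B) = (\<lambda>i. h A i + h B i)" if AB: "A \<in> carrier T" "B \<in> carrier T" for A B
    proof -
      obtain s where "A = cs s" using AB(1) by (rule T_cases)
      moreover obtain t where "B = cs t" using AB(2) by (rule T_cases)
      ultimately show ?thesis by (simp add: T_simps(3) cs_add h) (simp add: G_def frag_lin_add fun_eq_iff)
    qed
  qed
qed

end

text \<open>Turning a module over the enveloping algebra into a representation and back changes
  nothing. This is needed because the Verma module is stored as a representation and enters the
  second tensor product as \<open>uea_module\<close> of it.\<close>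

lemma uea_rep_smult:
  assumes "left_mod N" "x \<in> carrier N"
  shows "u \<odot>\<^bsub>uea_module (rep_of_uea_module N)\<^esub> x = u \<odot>\<^bsub>N\<^esub> x"
proof -
  interpret N: left_mod N by fact
  interpret L: lie_module "rep_of_uea_module N" by (rule lie_module_of_left_mod[OF assms(1)])
  interpret U: left_mod "uea_module (rep_of_uea_module N)" by (rule L.left_mod_uea_module)
  have c [simp]: "carrier (rep_of_uea_module N) = carrier N" "add (rep_of_uea_module N) = add N"
    by (simp_all add: rep_of_uea_module_def)
  show ?thesis using assms(2)
  proof (induction u arbitrary: x rule: uea_induct)
    case (const r)
    then show ?case using L.uea_smult_const[of x r] by (simp add: rep_of_uea_module_def)
  next
    case (of y)
    then show ?case using L.uea_smult_of[of x y] by (simp add: rep_of_uea_module_def)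
  next
    case (add u v)
    then show ?case using U.s_add_left[of x u v] by (simp add: N.s_add_left)
  next
    case (mult u v)
    then show ?case using U.s_mult[of x u v] by (simp add: N.s_mult)
  qed
qed

lemma (in lie_module) uea_eigenvector:
  assumes v: "v \<in> carrier M" and \<chi>: "\<And>x. act M x v = \<chi> x \<odot> v"
  shows "u \<odot>\<^bsub>uea_module M\<^esub> v
    = (\<Sum>w\<in>Poly_Mapping.keys (rep_uea u). Poly_Mapping.lookup (rep_uea u) w * prod_list (map \<chi> (letters w))) \<odot> v"
proof -
  have f: "foldr (act M) xs v = prod_list (map \<chi> xs) \<odot> v" for xs
    using v by (induction xs) (simp_all add: act_smult_right \<chi> smult_smult mult.commute)
  have "(\<Oplus>w\<in>A. a w \<odot> word_act M v w) = (\<Sum>w\<in>A. a w * prod_list (map \<chi> (letters w))) \<odot> v"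
    if "finite A" for A and a :: "'g word \<Rightarrow> complex"
    using that
  proof (induction A rule: finite_induct)
    case (insert w A)
    then show ?case using v
      by (simp add: finsum_insert Pi_def smult_add_left word_act_def f smult_smult)
  qed (use v in simp)
  from this[of "Poly_Mapping.keys (rep_uea u)" "Poly_Mapping.lookup (rep_uea u)"]
  show ?thesis unfolding uea_smult word_eval_def lc_def by (simp add: keys.rep_eq)
qed

text \<open>The homomorphism \<open>uea_map \<phi>\<close> is evaluated on generators through the action of the smaller
  Lie algebra on the enveloping algebra by left multiplication.\<close>

lemma
  fixes \<phi> :: "'h::lie_algebra \<Rightarrow> 'g::lie_algebra"
  assumes "\<And>x y. \<phi> (x + y) = \<phi> x + \<phi> y" "\<And>c x. \<phi> (lscale c x) = lscale c (\<phi> x)"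
    "\<And>x y. \<phi> (bracket x y) = bracket (\<phi> x) (\<phi> y)"
  shows uea_map_of: "uea_map \<phi> (uea_of x) = uea_of (\<phi> x)"
    and uea_map_const: "uea_map \<phi> (uea_const c) = uea_const c"
proof -
  define R :: "('h, 'g uea) rep" where "R = \<lparr>carrier = UNIV, monoid.mult = undefined, one = undefined,
    zero = 0, add = (+), module.smult = (\<lambda>c v. uea_const c * v), act = (\<lambda>x v. uea_of (\<phi> x) * v)\<rparr>"
  have ab: "abelian_group R"
  proof (rule abelian_groupI)
    show "\<exists>y\<in>carrier R. y \<oplus>\<^bsub>R\<^esub> x = \<zero>\<^bsub>R\<^esub>" for x
      by (intro bexI[of _ "- x"]) (auto simp: R_def)
  qed (auto simp: R_def add_ac)
  interpret Ra: abelian_group R by (rule ab)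
  have minus: "x \<ominus>\<^bsub>R\<^esub> y = x - y" for x y
  proof -
    have "\<ominus>\<^bsub>R\<^esub> y = - y" by (rule Ra.minus_equality) (auto simp: R_def)
    then show ?thesis by (simp add: a_minus_def) (simp add: R_def)
  qed
  have "lie_module R"
  proof (intro lie_module.intro moduleI lie_module_axioms.intro ab cring_from_type_algebra)
    show "act R (bracket x y) v = act R x (act R y v) \<ominus>\<^bsub>R\<^esub> act R y (act R x v)" for x y v
      unfolding minus by (simp add: R_def assms uea_of_bracket algebra_simps)
    show "act R x (c \<odot>\<^bsub>R\<^esub> v) = c \<odot>\<^bsub>R\<^esub> act R x v" for x c v
      using uea_const_commute[of c "uea_of (\<phi> x)"] by (simp add: R_def mult.assoc[symmetric])
  qed (auto simp: R_def assms uea_const_add uea_const_mult uea_const_1 uea_of_add uea_of_lscale algebra_simps)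
  then interpret R: lie_module R .
  have Rs: "r \<odot>\<^bsub>R\<^esub> v = uea_const r * v" "v \<oplus>\<^bsub>R\<^esub> w = v + w" for r v w by (simp_all add: R_def)
  have f: "foldr (act R) xs v = prod_list (map (uea_of \<circ> \<phi>) xs) * v" for xs v
    by (induction xs) (simp_all add: R_def mult.assoc)
  have "(\<Oplus>\<^bsub>R\<^esub>w\<in>A. a w \<odot>\<^bsub>R\<^esub> foldr (act R) (letters w) 1)
      = (\<Sum>w\<in>A. uea_const (a w) * prod_list (map (uea_of \<circ> \<phi>) (letters w)))"
    if "finite A" for A and a :: "'h word \<Rightarrow> complex"
    using that
  proof (induction A rule: finite_induct)
    case empty
    show ?case by simp (simp add: R_def)
  next
    case (insert w A)
    have "finsum R (\<lambda>w. a w \<odot>\<^bsub>R\<^esub> foldr (act R) (letters w) 1) (insert w A)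
      = a w \<odot>\<^bsub>R\<^esub> foldr (act R) (letters w) 1 \<oplus>\<^bsub>R\<^esub> finsum R (\<lambda>w. a w \<odot>\<^bsub>R\<^esub> foldr (act R) (letters w) 1) A"
      using insert by (intro Ra.finsum_insert) (auto simp: R_def)
    also have "\<dots> = uea_const (a w) * prod_list (map (uea_of \<circ> \<phi>) (letters w))
        + (\<Sum>w\<in>A. uea_const (a w) * prod_list (map (uea_of \<circ> \<phi>) (letters w)))"
      unfolding insert(3) unfolding f by (simp only: Rs mult_1_right)
    finally show ?case by (simp only: sum.insert[OF insert(1,2)])
  qed
  then have m: "u \<odot>\<^bsub>uea_module R\<^esub> 1 = uea_map \<phi> u" for u
    by (simp add: uea_module_def uea_map_def)
  have 1: "1 \<in> carrier R" by (simp add: R_def)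
  show "uea_map \<phi> (uea_of x) = uea_of (\<phi> x)" using R.uea_smult_of[OF 1, of x] m by (simp add: R_def)
  show "uea_map \<phi> (uea_const c) = uea_const c" using R.uea_smult_const[OF 1, of c] m by (simp add: R_def)
qed

section \<open>The localized Verma module\<close>

text \<open>The coordinate \<open>(i, b)\<close> belongs to \<open>f\<^sup>i q\<^sup>b v\<close>, where \<open>v\<close> is the highest weight vector; negative
  \<open>i\<close> occur after localization.\<close>

definition V_e :: "complex \<Rightarrow> complex \<Rightarrow> (int \<times> nat \<Rightarrow> complex) \<Rightarrow> int \<times> nat \<Rightarrow> complex" where
  "V_e l c a = (\<lambda>(i, b). of_int (i + 1) * (l - of_nat b - of_int i) * a (i + 1, b)
     + c * of_nat (b + 2) * of_nat (b + 1) / 2 * a (i, b + 2))"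
definition V_h :: "complex \<Rightarrow> (int \<times> nat \<Rightarrow> complex) \<Rightarrow> int \<times> nat \<Rightarrow> complex" where
  "V_h l a = (\<lambda>(i, b). (l - 2 * of_int i - of_nat b) * a (i, b))"
definition V_f :: "(int \<times> nat \<Rightarrow> complex) \<Rightarrow> int \<times> nat \<Rightarrow> complex" where
  "V_f a = (\<lambda>(i, b). a (i - 1, b))"
definition V_p :: "complex \<Rightarrow> (int \<times> nat \<Rightarrow> complex) \<Rightarrow> int \<times> nat \<Rightarrow> complex" where
  "V_p c a = (\<lambda>(i, b). of_nat (b + 1) * c * a (i, b + 1)
     - (if b = 0 then 0 else of_int (i + 1) * a (i + 1, b - 1)))"
definition V_q :: "(int \<times> nat \<Rightarrow> complex) \<Rightarrow> int \<times> nat \<Rightarrow> complex" where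
  "V_q a = (\<lambda>(i, b). if b = 0 then 0 else a (i, b - 1))"

lemma V_lin: "lin_op (V_e l c)" "lin_op (V_h l)" "lin_op V_f" "lin_op (V_p c)" "lin_op V_q"
  by (auto simp: lin_op_def V_e_def V_h_def V_f_def V_p_def V_q_def fun_eq_iff algebra_simps add_divide_distrib)

lemma V_e_double:
  "V_e l (2 * d) a (i, b) = of_int (i + 1) * (l - of_nat b - of_int i) * a (i + 1, b)
     + d * of_nat (b + 2) * of_nat (b + 1) * a (i, b + 2)"
  by (simp add: V_e_def)

lemma V_comm:
  "V_e l c (V_f v) i - V_f (V_e l c v) i = V_h l v i"
  "V_h l (V_e l c v) i - V_e l c (V_h l v) i = 2 * V_e l c v i"
  "V_h l (V_f v) i - V_f (V_h l v) i = - 2 * V_f v i"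
  "V_e l c (V_p c v) i - V_p c (V_e l c v) i = 0"
  "V_h l (V_p c v) i - V_p c (V_h l v) i = V_p c v i"
  "V_f (V_p c v) i - V_p c (V_f v) i = V_q v i"
  "V_e l c (V_q v) i - V_q (V_e l c v) i = V_p c v i"
  "V_h l (V_q v) i - V_q (V_h l v) i = - V_q v i"
  "V_f (V_q v) i - V_q (V_f v) i = 0"
  "V_p c (V_q v) i - V_q (V_p c v) i = c * v i"
proof -
  obtain j b where i: "i = (j, b)" by (cases i)
  \<comment> \<open>Halving c beforehand removes the only division, so that the identities become
    polynomial.\<close>
  define d where "d = c / 2"
  have c: "c = 2 * d" by (simp add: d_def)
  note defs = V_e_double V_h_def V_f_def V_p_def V_q_def
  show "V_e l c (V_f v) i - V_f (V_e l c v) i = V_h l v i"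
    unfolding i c
    by (cases b) ((simp_all add: defs)?, (simp_all add: algebra_simps)?)
  show "V_h l (V_e l c v) i - V_e l c (V_h l v) i = 2 * V_e l c v i"
    unfolding i c
    by (cases b) ((simp_all add: defs)?, (simp_all add: algebra_simps)?)
  show "V_h l (V_f v) i - V_f (V_h l v) i = - 2 * V_f v i"
    unfolding i c
    by (cases b) ((simp_all add: defs)?, (simp_all add: algebra_simps)?)
  show "V_e l c (V_p c v) i - V_p c (V_e l c v) i = 0"
    unfolding i c
    by (cases b) ((simp_all add: defs)?, (simp_all add: algebra_simps)?)
  show "V_h l (V_p c v) i - V_p c (V_h l v) i = V_p c v i"
    unfolding i c
    by (cases b) ((simp_all add: defs)?, (simp_all add: algebra_simps)?)
  show "V_f (V_p c v) i - V_p c (V_f v) i = V_q v i"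
    unfolding i c
    by (cases b) ((simp_all add: defs)?, (simp_all add: algebra_simps)?)
  show "V_e l c (V_q v) i - V_q (V_e l c v) i = V_p c v i"
    unfolding i c
    by (cases b) ((simp_all add: defs)?, (simp_all add: algebra_simps)?)
  show "V_h l (V_q v) i - V_q (V_h l v) i = - V_q v i"
    unfolding i c
    by (cases b) ((simp_all add: defs)?, (simp_all add: algebra_simps)?)
  show "V_f (V_q v) i - V_q (V_f v) i = 0"
    unfolding i c
    by (cases b) ((simp_all add: defs)?, (simp_all add: algebra_simps)?)
  show "V_p c (V_q v) i - V_q (V_p c v) i = c * v i"
    unfolding i c
    by (cases b) ((simp_all add: defs)?, (simp_all add: algebra_simps)?)
qed

definition Vmod :: "complex \<Rightarrow> complex \<Rightarrow> (schr, int \<times> nat \<Rightarrow> complex) rep"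
  where "Vmod l c = fun_rep UNIV (schr_act (V_e l c) (V_h l) V_f (V_p c) V_q c)"

lemma lie_module_Vmod: "lie_module (Vmod l c)"
  unfolding Vmod_def by (rule lie_module_operators[OF _ _ _ V_lin]) (simp_all add: V_comm)

definition U_act :: "complex \<Rightarrow> complex \<Rightarrow> schr uea \<Rightarrow> (int \<times> nat \<Rightarrow> complex) \<Rightarrow> int \<times> nat \<Rightarrow> complex"
  where "U_act l c u a = u \<odot>\<^bsub>uea_module (Vmod l c)\<^esub> a"

lemma Vmod_simps [simp]:
  "carrier (Vmod l c) = UNIV" "zero (Vmod l c) = (\<lambda>i. 0)"
  "v \<oplus>\<^bsub>Vmod l c\<^esub> w = (\<lambda>i. v i + w i)" "r \<odot>\<^bsub>Vmod l c\<^esub> v = (\<lambda>i. r * v i)"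
  "act (Vmod l c) x = schr_act (V_e l c) (V_h l) V_f (V_p c) V_q c x"
  by (simp_all add: Vmod_def)

lemma U_act_simps:
  "U_act l c (u + u') a = (\<lambda>i. U_act l c u a i + U_act l c u' a i)"
  "U_act l c (u * u') a = U_act l c u (U_act l c u' a)"
  "U_act l c 1 a = a"
  "U_act l c u (\<lambda>i. a i + a' i) = (\<lambda>i. U_act l c u a i + U_act l c u a' i)"
  "U_act l c (uea_const r) a = (\<lambda>i. r * a i)"
  "U_act l c (uea_of x) a = schr_act (V_e l c) (V_h l) V_f (V_p c) V_q c x a"
proof -
  interpret L: lie_module "Vmod l c" by (rule lie_module_Vmod)
  interpret U: left_mod "uea_module (Vmod l c)" by (rule L.left_mod_uea_module)
  show "U_act l c (u + u') a = (\<lambda>i. U_act l c u a i + U_act l c u' a i)"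
    "U_act l c (u * u') a = U_act l c u (U_act l c u' a)"
    "U_act l c 1 a = a"
    "U_act l c u (\<lambda>i. a i + a' i) = (\<lambda>i. U_act l c u a i + U_act l c u a' i)"
    using U.s_add_left[of a u u'] U.s_mult[of a u u'] U.s_one[of a] U.s_add_right[of a a' u]
    by (simp_all add: U_act_def)
  show "U_act l c (uea_const r) a = (\<lambda>i. r * a i)"
    "U_act l c (uea_of x) a = schr_act (V_e l c) (V_h l) V_f (V_p c) V_q c x a"
    using L.uea_smult_const[of a r] L.uea_smult_of[of a x] by (simp_all add: U_act_def)
qed

lemma U_act_smult: "U_act l c u (\<lambda>i. r * a i) = (\<lambda>i. r * U_act l c u a i)"
  using U_act_simps(2)[of l c u "uea_const r" a] U_act_simps(2)[of l c "uea_const r" u a]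
  by (simp add: U_act_simps(5) uea_const_commute)

lemma U_act_f_pow: "U_act l c (uea_of \<ff> ^ k) a = (\<lambda>(i, b). a (i - int k, b))"
proof (induction k)
  case 0
  then show ?case by (simp add: U_act_simps)
next
  case (Suc k)
  then show ?case by (auto simp: U_act_simps V_f_def fun_eq_iff algebra_simps)
qed

section \<open>The action of the localization: f is an invertible shift\<close>

definition f_inv :: "nat \<Rightarrow> (int \<times> nat \<Rightarrow> complex) \<Rightarrow> int \<times> nat \<Rightarrow> complex"
  where "f_inv k a = (\<lambda>(i, b). a (i + int k, b))"

definition loc_act :: "complex \<Rightarrow> complex \<Rightarrow> uloc \<Rightarrow> (int \<times> nat \<Rightarrow> complex) \<Rightarrow> int \<times> nat \<Rightarrow> complex"
  where "loc_act l c x a = f_inv (fst (rep_uloc x)) (U_act l c (snd (rep_uloc x)) a)"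

text \<open>Equivalent fractions agree after multiplication by powers of f, and these act as
  invertible shifts of the first index.\<close>

lemma loc_act_abs: "loc_act l c (abs_uloc (k, u)) a = f_inv k (U_act l c u a)"
proof -
  obtain k' u' where r: "rep_uloc (abs_uloc (k, u)) = (k', u')" by (cases "rep_uloc (abs_uloc (k, u))")
  have "frac_rel (uea_of \<ff>) (k', u') (k, u)"
    using uloc.abs_eq_iff[of "(k', u')" "(k, u)"] Quotient3_abs_rep[OF Quotient3_uloc, of "abs_uloc (k, u)"] r by simp
  then obtain m where "uea_of \<ff> ^ (m + k) * u' = uea_of \<ff> ^ (m + k') * u" by (auto simp: frac_rel_def)
  then have "U_act l c (uea_of \<ff> ^ (m + k) * u') a = U_act l c (uea_of \<ff> ^ (m + k') * u) a" by simp
  then have *: "U_act l c u' a (i - int (m + k), b) = U_act l c u a (i - int (m + k'), b)" for i b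
    unfolding U_act_simps(2) U_act_f_pow by (auto simp: fun_eq_iff)
  have "U_act l c u' a (i + int k', b) = U_act l c u a (i + int k, b)" for i b
    using *[of "i + int m + int k + int k'" b] by (simp add: algebra_simps)
  then show ?thesis by (simp add: loc_act_def r f_inv_def)
qed

lemma uloc_cases: obtains k u where "x = abs_uloc (k, u)"
  using uloc.abs_induct[of "\<lambda>x. \<exists>k u. x = abs_uloc (k, u)" x] by auto

lemma loc_act_add: "loc_act l c (x + y) a = (\<lambda>i. loc_act l c x a i + loc_act l c y a i)"
proof -
  obtain k u where x: "x = abs_uloc (k, u)" by (rule uloc_cases)
  obtain m v where y: "y = abs_uloc (m, v)" by (rule uloc_cases)
  have "x + y = abs_uloc (k + m, uea_of \<ff> ^ m * u + uea_of \<ff> ^ k * v)"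
    unfolding x y plus_uloc.abs_eq frac_add_def by simp
  then show ?thesis
    unfolding x y by (auto simp: loc_act_abs f_inv_def U_act_simps U_act_f_pow fun_eq_iff algebra_simps)
qed

lemma loc_act_add_right: "loc_act l c x (\<lambda>i. a i + a' i) = (\<lambda>i. loc_act l c x a i + loc_act l c x a' i)"
  by (auto simp: loc_act_def f_inv_def U_act_simps)

lemma uloc_mult_right: "abs_uloc (k, u) * uloc_of v = abs_uloc (k, u * v)"
  using uea_F.frac_mult_rel[of 0 u u 0 k v] by (simp add: uloc_of.abs_eq times_uloc.abs_eq uloc.abs_eq_iff)

lemma loc_act_mult_right: "loc_act l c (x * uloc_of v) a = loc_act l c x (U_act l c v a)"
proof -
  obtain k u where x: "x = abs_uloc (k, u)" by (rule uloc_cases)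
  show ?thesis unfolding x uloc_mult_right loc_act_abs U_act_simps(2) ..
qed

lemma loc_act_of: "loc_act l c (uloc_of u) a = U_act l c u a"
  by (simp add: uloc_of.abs_eq loc_act_abs f_inv_def)

text \<open>The Ore condition f^j v = u' f^k turns v f^(-k) w into f^(-j) u' w. Both sides agree
  after applying f^j, which is an injective shift.\<close>

lemma loc_act_mult_left: "loc_act l c (uloc_of v * x) a = U_act l c v (loc_act l c x a)"
proof -
  obtain k w where x: "x = abs_uloc (k, w)" by (rule uloc_cases)
  obtain j u' where ore: "uea_of \<ff> ^ j * v = u' * uea_of \<ff> ^ k" using uea_F.ore by blast
  have "uloc_of v * x = abs_uloc (j, u' * w)"
    using uea_F.frac_mult_rel[OF ore, of 0 w] unfolding x by (simp add: uloc_of.abs_eq times_uloc.abs_eq uloc.abs_eq_iff)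
  then have 1: "loc_act l c (uloc_of v * x) a = f_inv j (U_act l c u' (U_act l c w a))"
    by (simp add: loc_act_abs U_act_simps)
  let ?d = "f_inv k (U_act l c w a)"
  have "U_act l c (uea_of \<ff> ^ k) ?d = U_act l c w a" by (auto simp: U_act_f_pow f_inv_def fun_eq_iff)
  then have "U_act l c (uea_of \<ff> ^ j) (U_act l c v ?d) = U_act l c u' (U_act l c w a)"
    using U_act_simps(2)[of l c "uea_of \<ff> ^ j" v ?d] U_act_simps(2)[of l c u' "uea_of \<ff> ^ k" ?d] ore by simp
  moreover have "f_inv j (U_act l c (uea_of \<ff> ^ j) b) = b" for b by (auto simp: U_act_f_pow f_inv_def fun_eq_iff)
  ultimately show ?thesis unfolding 1 by (simp add: x loc_act_abs) metis
qed

section \<open>The quotient by the Verma module\<close>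

text \<open>Here \<open>(k, b)\<close> belongs to the class of \<open>f\<^sup>-\<^sup>k\<^sup>-\<^sup>1 q\<^sup>b v\<close>.\<close>

definition tr :: "(int \<times> nat \<Rightarrow> complex) \<Rightarrow> nat \<times> nat \<Rightarrow> complex"
  where "tr a = (\<lambda>(k, b). a (- int k - 1, b))"

definition T_e :: "complex \<Rightarrow> complex \<Rightarrow> (nat \<times> nat \<Rightarrow> complex) \<Rightarrow> nat \<times> nat \<Rightarrow> complex" where
  "T_e l c a = (\<lambda>(k, b). (if k = 0 then 0 else - of_nat k * (l - of_nat b + of_nat k + 1) * a (k - 1, b))
     + c * of_nat (b + 2) * of_nat (b + 1) / 2 * a (k, b + 2))"
definition T_h :: "complex \<Rightarrow> (nat \<times> nat \<Rightarrow> complex) \<Rightarrow> nat \<times> nat \<Rightarrow> complex" where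
  "T_h l a = (\<lambda>(k, b). (l + 2 * of_nat k + 2 - of_nat b) * a (k, b))"
definition T_f :: "(nat \<times> nat \<Rightarrow> complex) \<Rightarrow> nat \<times> nat \<Rightarrow> complex" where
  "T_f a = (\<lambda>(k, b). a (k + 1, b))"
definition T_p :: "complex \<Rightarrow> (nat \<times> nat \<Rightarrow> complex) \<Rightarrow> nat \<times> nat \<Rightarrow> complex" where
  "T_p c a = (\<lambda>(k, b). of_nat (b + 1) * c * a (k, b + 1)
     + (if b = 0 \<or> k = 0 then 0 else of_nat k * a (k - 1, b - 1)))"
definition T_q :: "(nat \<times> nat \<Rightarrow> complex) \<Rightarrow> nat \<times> nat \<Rightarrow> complex" where
  "T_q a = (\<lambda>(k, b). if b = 0 then 0 else a (k, b - 1))"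

lemma T_lin: "lin_op (T_e l c)" "lin_op (T_h l)" "lin_op T_f" "lin_op (T_p c)" "lin_op T_q"
  by (auto simp: lin_op_def T_e_def T_h_def T_f_def T_p_def T_q_def fun_eq_iff algebra_simps add_divide_distrib)

text \<open>The operators descend to the quotient by the coordinates i >= 0. Only at i = - 1 do the
  formulas for e and p read the coordinate i + 1 = 0 of the divided part, and there the factor i + 1
  is zero; this is the case k = 0 in \<open>T_e\<close> and \<open>T_p\<close>.\<close>

lemma tr_V:
  "tr (V_e l c a) = T_e l c (tr a)" "tr (V_h l a) = T_h l (tr a)" "tr (V_f a) = T_f (tr a)"
  "tr (V_p c a) = T_p c (tr a)" "tr (V_q a) = T_q (tr a)"
proof -
  show "tr (V_e l c a) = T_e l c (tr a)"
  proof
    fix x :: "nat \<times> nat"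
    obtain k b where x: "x = (k, b)" by (cases x)
    show "tr (V_e l c a) x = T_e l c (tr a) x"
    proof (cases k)
      case (Suc n)
      have idx: "- int (Suc n) - 1 + 1 = - int (Suc n - 1) - 1" by simp
      have co: "of_int (- int (Suc n - 1) - 1) * (l - of_nat b - of_int (- int (Suc n) - 1))
          = - of_nat (Suc n) * (l - of_nat b + of_nat (Suc n) + 1)"
        by (simp add: algebra_simps)
      show ?thesis unfolding x tr_def V_e_def T_e_def prod.case Suc idx co by simp
    qed (simp add: x tr_def V_e_def T_e_def)
  qed
  show "tr (V_p c a) = T_p c (tr a)"
  proof
    fix x :: "nat \<times> nat"
    obtain k b where x: "x = (k, b)" by (cases x)
    show "tr (V_p c a) x = T_p c (tr a) x"
    proof (cases k)
      case (Suc n)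
      have idx: "- int (Suc n) - 1 + 1 = - int (Suc n - 1) - 1" by simp
      have co: "of_int (- int (Suc n - 1) - 1) = (- of_nat (Suc n) :: complex)" by simp
      show ?thesis unfolding x tr_def V_p_def T_p_def prod.case Suc idx co by (simp add: algebra_simps)
    qed (simp add: x tr_def V_p_def T_p_def)
  qed
qed (auto simp: tr_def V_h_def T_h_def V_f_def T_f_def V_q_def T_q_def fun_eq_iff algebra_simps)

text \<open>A section of \<open>tr\<close>. Every function on the quotient is thus of the form
  \<open>tr a\<close>, and its commutation relations are inherited from
  \<open>V_comm\<close>.\<close>

definition ext :: "(nat \<times> nat \<Rightarrow> complex) \<Rightarrow> int \<times> nat \<Rightarrow> complex"
  where "ext a = (\<lambda>(i, b). if i < 0 then a (nat (- i - 1), b) else 0)"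

lemma tr_ext: "tr (ext a) = a"
  by (auto simp: tr_def ext_def fun_eq_iff)

definition Tmod :: "complex \<Rightarrow> complex \<Rightarrow> (schr, nat \<times> nat \<Rightarrow> complex) rep"
  where "Tmod l c = fun_rep {a. finsupp a} (schr_act (T_e l c) (T_h l) T_f (T_p c) T_q c)"

lemma tr_schr_act:
  "tr (schr_act (V_e l c) (V_h l) V_f (V_p c) V_q c x a) = schr_act (T_e l c) (T_h l) T_f (T_p c) T_q c x (tr a)"
proof -
  have "tr (schr_act (V_e l c) (V_h l) V_f (V_p c) V_q c x a) = (\<lambda>i. ce x * tr (V_e l c a) i
     + (ch x * tr (V_h l a) i + (cf x * tr (V_f a) i
     + (cp x * tr (V_p c a) i + (cq x * tr (V_q a) i + cz x * (c * tr a i))))))"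
    by (auto simp: schr_act_def tr_def)
  then show ?thesis by (simp add: tr_V schr_act_def)
qed

lemma T_finsupp:
  assumes "finsupp v" "T \<in> {T_e l c, T_h l, T_f, T_p c, T_q}"
  shows "finsupp (T v)"
proof (rule finsupp_images[OF assms(1)])
  let ?G = "{\<lambda>(k, i). (k + 1, i), id, \<lambda>(k, i). (k, i - 2), \<lambda>(k, i). (k - 1, i),
    \<lambda>(k, i). (k, i - 1), \<lambda>(k, i). (k + 1, i + 1), \<lambda>(k, i). (k, i + 1)} :: (nat \<times> nat \<Rightarrow> nat \<times> nat) set"
  show "finite ?G" by simp
  fix x assume x: "T v x \<noteq> 0"
  obtain k i where ki: "x = (k, i)" by (cases x)
  have "v (k, i + 2) \<noteq> 0 \<or> v (k, i) \<noteq> 0 \<or> k \<noteq> 0 \<and> v (k - 1, i) \<noteq> 0 \<or> v (k + 1, i) \<noteq> 0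
    \<or> v (k, i + 1) \<noteq> 0 \<or> k \<noteq> 0 \<and> i \<noteq> 0 \<and> v (k - 1, i - 1) \<noteq> 0 \<or> i \<noteq> 0 \<and> v (k, i - 1) \<noteq> 0"
  proof (rule ccontr)
    assume "\<not> ?thesis"
    then have z: "v (k, i + 2) = 0" "v (k, i) = 0" "k \<noteq> 0 \<Longrightarrow> v (k - 1, i) = 0"
      "v (k + 1, i) = 0" "v (k, i + 1) = 0"
      "k \<noteq> 0 \<Longrightarrow> i \<noteq> 0 \<Longrightarrow> v (k - 1, i - 1) = 0" "i \<noteq> 0 \<Longrightarrow> v (k, i - 1) = 0"
      by blast+
    have "T_e l c v (k, i) = 0" "T_h l v (k, i) = 0" "T_f v (k, i) = 0" "T_p c v (k, i) = 0"
      "T_q v (k, i) = 0"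
      using z by (simp_all add: T_e_def T_h_def T_f_def T_p_def T_q_def)
    then have "T v (k, i) = 0" using assms(2) by auto
    then show False using x ki by simp
  qed
  then show "\<exists>g\<in>?G. \<exists>y. v y \<noteq> 0 \<and> x = g y"
    unfolding ki
    apply (elim disjE)
    subgoal by (rule bexI[of _ "\<lambda>(k, i). (k, i - 2)"], rule exI[of _ "(k, i + 2)"]) auto
    subgoal by (rule bexI[of _ id], rule exI[of _ "(k, i)"]) auto
    subgoal by (rule bexI[of _ "\<lambda>(k, i). (k + 1, i)"], rule exI[of _ "(k - 1, i)"]) auto
    subgoal by (rule bexI[of _ "\<lambda>(k, i). (k - 1, i)"], rule exI[of _ "(k + 1, i)"]) auto
    subgoal by (rule bexI[of _ "\<lambda>(k, i). (k, i - 1)"], rule exI[of _ "(k, i + 1)"]) auto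
    subgoal by (rule bexI[of _ "\<lambda>(k, i). (k + 1, i + 1)"], rule exI[of _ "(k - 1, i - 1)"]) auto
    subgoal by (rule bexI[of _ "\<lambda>(k, i). (k, i + 1)"], rule exI[of _ "(k, i - 1)"]) auto
    done
qed

lemma lie_module_Tmod: "lie_module (Tmod l c)"
  unfolding Tmod_def
proof (rule lie_module_operators[OF _ _ _ T_lin])
  show "T v \<in> {a. finsupp a}" if "T \<in> {T_e l c, T_h l, T_f, T_p c, T_q}" "v \<in> {a. finsupp a}" for T v
    using T_finsupp that by blast
  fix v :: "nat \<times> nat \<Rightarrow> complex" and i :: "nat \<times> nat"
  obtain k b where i: "i = (k, b)" by (cases i)
  obtain a where v: "v = tr a" using tr_ext[of v] by metis
  have e: "tr x (k, b) = x (- int k - 1, b)" for x by (simp add: tr_def)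
  show "T_e l c (T_f v) i - T_f (T_e l c v) i = T_h l v i"
    unfolding i v by (simp only: tr_V[symmetric] e V_comm)
  show "T_h l (T_e l c v) i - T_e l c (T_h l v) i = 2 * T_e l c v i"
    unfolding i v by (simp only: tr_V[symmetric] e V_comm)
  show "T_h l (T_f v) i - T_f (T_h l v) i = - 2 * T_f v i"
    unfolding i v by (simp only: tr_V[symmetric] e V_comm)
  show "T_e l c (T_p c v) i - T_p c (T_e l c v) i = 0"
    unfolding i v by (simp only: tr_V[symmetric] e V_comm)
  show "T_h l (T_p c v) i - T_p c (T_h l v) i = T_p c v i"
    unfolding i v by (simp only: tr_V[symmetric] e V_comm)
  show "T_f (T_p c v) i - T_p c (T_f v) i = T_q v i"
    unfolding i v by (simp only: tr_V[symmetric] e V_comm)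
  show "T_e l c (T_q v) i - T_q (T_e l c v) i = T_p c v i"
    unfolding i v by (simp only: tr_V[symmetric] e V_comm)
  show "T_h l (T_q v) i - T_q (T_h l v) i = - T_q v i"
    unfolding i v by (simp only: tr_V[symmetric] e V_comm)
  show "T_f (T_q v) i - T_q (T_f v) i = 0"
    unfolding i v by (simp only: tr_V[symmetric] e V_comm)
  show "T_p c (T_q v) i - T_q (T_p c v) i = c * v i"
    unfolding i v by (simp only: tr_V[symmetric] e V_comm)
qed auto

text \<open>The functions supported on i >= 0 are stable under the enveloping algebra; the image of
  the Verma module will be found among them.\<close>

lemma tr_U_act_zero:
  assumes "tr a = (\<lambda>i. 0)" shows "tr (U_act l c u a) = (\<lambda>i. 0)"
  using assms
proof (induction u arbitrary: a rule: uea_induct)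
  case (const r)
  then show ?case by (auto simp: U_act_simps tr_def fun_eq_iff)
next
  case (of x)
  have "schr_act (T_e l c) (T_h l) T_f (T_p c) T_q c x (\<lambda>i. 0) = (\<lambda>i. 0)"
    by (auto simp: schr_act_def T_e_def T_h_def T_f_def T_p_def T_q_def)
  then show ?case using of by (simp add: U_act_simps tr_schr_act)
next
  case (add u v)
  then show ?case by (auto simp: U_act_simps tr_def fun_eq_iff)
next
  case (mult u v)
  then show ?case by (simp add: U_act_simps)
qed

section \<open>The module \<open>S\<^sub>f \<otimes> \<Delta>\<close>\<close>

text \<open>The spanning half of a PBW statement. On the q^b v, h and z act by scalars, and p and e
  are treated by recursion on b; a second recursion, on i, takes e through the powers of f.\<close>

lemma highest_weight_span:
  fixes M :: "(schr, 'm) rep" (structure)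
  assumes "lie_module M" and v: "v \<in> carrier M" "act M \<ee> v = \<zero>" "act M \<pp> v = \<zero>"
    "act M \<hh> v = l \<odot> v" "act M \<zz> v = c \<odot> v"
  shows "submod UNIV (lspan M (range (\<lambda>(i, b). (act M \<ff> ^^ i) ((act M \<qq> ^^ b) v)))) M"
proof -
  interpret lie_module M by fact
  define w where "w = (\<lambda>(i, b). (act M \<ff> ^^ i) ((act M \<qq> ^^ b) v))"
  have wc: "w x \<in> carrier M" for x using v(1) by (cases x) (simp add: w_def)
  then have rc: "range w \<subseteq> carrier M" by auto
  let ?S = "lspan M (range w)"
  note d = submoduleD[OF lspan_submodule[OF rc]]
  have wS: "w x \<in> ?S" for x using lspan_incl[of "range w"] by auto
  have f: "act M \<ff> s \<in> ?S" if "s \<in> ?S" for s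
  proof (rule lspan_act_closed[OF rc _ that])
    fix b assume "b \<in> range w"
    then obtain i j where "b = w (i, j)" by auto
    then have "act M \<ff> b = w (Suc i, j)" by (simp add: w_def)
    then show "act M \<ff> b \<in> ?S" using wS by simp
  qed
  have br: "bracket \<qq> \<ff> = 0" "bracket \<zz> x = 0" for x
    by (simp_all add: bracket_schr_def \<qq>_def \<ff>_def \<zz>_def zero_schr_def)
  have q: "act M \<qq> s \<in> ?S" if "s \<in> ?S" for s
  proof (rule lspan_act_closed[OF rc _ that])
    fix b assume "b \<in> range w"
    then obtain i j where "b = w (i, j)" by auto
    then have "act M \<qq> b = w (i, Suc j)" using act_pow_commute[OF br(1), of "(act M \<qq> ^^ j) v" i] v(1)
      by (simp add: w_def)
    then show "act M \<qq> b \<in> ?S" using wS by simp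
  qed
  have y: "(act M \<qq> ^^ b) v \<in> carrier M" for b using v(1) by simp
  have yS: "(act M \<qq> ^^ b) v \<in> ?S" for b using wS[of "(0, b)"] by (simp add: w_def)
  have z: "act M \<zz> ((act M \<qq> ^^ b) v) = c \<odot> (act M \<qq> ^^ b) v" for b
    using act_pow_commute[OF br(2)[of \<qq>] v(1), of b] v by (simp add: act_pow_smult)
  have h: "act M \<hh> ((act M \<qq> ^^ b) v) = (l - of_nat b) \<odot> (act M \<qq> ^^ b) v" for b
  proof (induction b)
    case (Suc b)
    let ?y = "(act M \<qq> ^^ b) v"
    have "act M \<hh> (act M \<qq> ?y) = act M \<qq> (act M \<hh> ?y) \<oplus> (- 1) \<odot> act M \<qq> ?y"
      using act_swap[OF y, of \<hh> \<qq>] y by (simp add: schr_relations act_uminus_left)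
    then show ?case using y by (simp add: Suc act_smult_right smult_collect algebra_simps)
  qed (simp add: v)
  have p0: "act M \<pp> ((act M \<qq> ^^ b) v) \<in> ?S" for b
  proof (induction b)
    case (Suc b)
    let ?y = "(act M \<qq> ^^ b) v"
    have "act M \<pp> (act M \<qq> ?y) = act M \<qq> (act M \<pp> ?y) \<oplus> c \<odot> ?y"
      using act_swap[OF y, of \<pp> \<qq>] by (simp add: schr_relations z)
    then show ?case using d(3)[OF q[OF Suc] d(4)[OF yS[of b], of c]] by simp
  qed (simp add: v d(2))
  have e0: "act M \<ee> ((act M \<qq> ^^ b) v) \<in> ?S" for b
  proof (induction b)
    case (Suc b)
    let ?y = "(act M \<qq> ^^ b) v"
    have "act M \<ee> (act M \<qq> ?y) = act M \<qq> (act M \<ee> ?y) \<oplus> act M \<pp> ?y"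
      using act_swap[OF y, of \<ee> \<qq>] by (simp add: schr_relations)
    then show ?case using d(3)[OF q[OF Suc] p0[of b]] by simp
  qed (simp add: v d(2))
  have e1: "act M \<ee> (w (i, b)) \<in> ?S" for i b
  proof (induction i)
    case 0
    then show ?case using e0[of b] by (simp add: w_def)
  next
    case (Suc i)
    have "act M \<ee> (act M \<ff> (w (i, b))) = act M \<ff> (act M \<ee> (w (i, b))) \<oplus> act M \<hh> (w (i, b))"
      using act_swap[OF wc, of \<ee> \<ff>] by (simp add: schr_relations)
    moreover have "act M \<hh> (w (i, b)) = (l - of_nat b - 2 * of_nat i) \<odot> w (i, b)"
      using weight_f[OF lie_module_axioms y h, of i b] by (simp add: w_def)
    ultimately have "act M \<ee> (act M \<ff> (w (i, b))) \<in> ?S" using d(3)[OF f[OF Suc] d(4)[OF wS]] by simp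
    then show ?case by (simp add: w_def)
  qed
  have e: "act M \<ee> s \<in> ?S" if "s \<in> ?S" for s
  proof (rule lspan_act_closed[OF rc _ that])
    show "act M \<ee> b \<in> ?S" if "b \<in> range w" for b using that e1 by auto
  qed
  have "submod UNIV ?S M"
    by (rule submod_generators[OF lie_module_axioms lspan_submodule[OF rc]]) (use e f q in auto)
  then show ?thesis by (simp add: w_def)
qed

section \<open>The Verma module, its tensor product with S_f, and their maps to coordinates\<close>

locale verma_data =
  fixes l c :: complex
begin

definition chi :: "borel \<Rightarrow> complex" where "chi x = ch (Rep_borel x) * l + cz (Rep_borel x) * c"

definition chi_U :: "borel uea \<Rightarrow> complex" where
  "chi_U b = (\<Sum>w\<in>Poly_Mapping.keys (rep_uea b). Poly_Mapping.lookup (rep_uea b) w * prod_list (map chi (letters w)))"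

sublocale B: lie_module "borel_character l c" by (rule lie_module_borel_character)

lemma B_smult: "b \<odot>\<^bsub>uea_module (borel_character l c)\<^esub> a = chi_U b * a"
  unfolding chi_U_def by (subst B.uea_eigenvector[of a chi]) (simp_all add: borel_character_def chi_def)

lemma B_carrier [simp]: "carrier (borel_character l c) = UNIV" "add (borel_character l c) = (+)"
  by (simp_all add: borel_character_def)

sublocale D1: tensor_prod "uea_module (borel_character l c)" "(*) :: schr uea \<Rightarrow> schr uea \<Rightarrow> schr uea"
    "\<lambda>u b. u * uea_map Rep_borel b"
  by (intro tensor_prod.intro B.left_mod_uea_module tensor_prod_axioms.intro) (simp_all add: algebra_simps)

lemma verma_eq: "verma l c = rep_of_uea_module D1.T"
  by (simp add: verma_def D1.T_def)

sublocale Vm: lie_module "verma l c"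
  unfolding verma_eq by (rule lie_module_of_left_mod[OF D1.left_mod_T])

lemma verma_simps: "carrier (verma l c) = carrier D1.T" "x \<oplus>\<^bsub>verma l c\<^esub> y = x \<oplus>\<^bsub>D1.T\<^esub> y"
  "r \<odot>\<^bsub>verma l c\<^esub> x = uea_const r \<odot>\<^bsub>D1.T\<^esub> x" "act (verma l c) g x = uea_of g \<odot>\<^bsub>D1.T\<^esub> x"
  "\<zero>\<^bsub>verma l c\<^esub> = \<zero>\<^bsub>D1.T\<^esub>"
  by (simp_all add: verma_eq rep_of_uea_module_def)

lemma verma_smult: "x \<in> carrier D1.T \<Longrightarrow> u \<odot>\<^bsub>uea_module (verma l c)\<^esub> x = u \<odot>\<^bsub>D1.T\<^esub> x"
  unfolding verma_eq by (rule uea_rep_smult[OF D1.left_mod_T])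

lemma sf_abs:
  "sf_left u (abs_sf y) = abs_sf (uloc_of u * y)" "sf_right (abs_sf y) u = abs_sf (y * uloc_of u)"
  "abs_sf y + abs_sf y' = abs_sf (y + y')"
  by (simp_all add: sf_left.abs_eq sf_right.abs_eq plus_sf.abs_eq)

lemma sf_cases: obtains y where "x = abs_sf y"
  using sf.abs_induct[of "\<lambda>x. \<exists>y. x = abs_sf y" x] by auto

sublocale D2: tensor_prod "uea_module (verma l c)" sf_left sf_right
proof (intro tensor_prod.intro Vm.left_mod_uea_module tensor_prod_axioms.intro)
  fix s s' r :: "schr uea" and x y :: sf
  obtain x' where x: "x = abs_sf x'" by (rule sf_cases)
  obtain y' where y: "y = abs_sf y'" by (rule sf_cases)
  show "sf_left s (x + y) = sf_left s x + sf_left s y" "sf_left (s + s') x = sf_left s x + sf_left s' x"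
    "sf_left (s * s') x = sf_left s (sf_left s' x)" "sf_left 1 x = x"
    "sf_left s (sf_right x r) = sf_right (sf_left s x) r"
    unfolding x y by (simp_all add: sf_abs uloc_of_hom distrib_left distrib_right mult.assoc)
qed

definition "T2 = rep_of_uea_module D2.T"

lemma lie_module_T2: "lie_module T2"
  unfolding T2_def by (rule lie_module_of_left_mod[OF D2.left_mod_T])

lemma T2_simps: "carrier T2 = carrier D2.T" "x \<oplus>\<^bsub>T2\<^esub> y = x \<oplus>\<^bsub>D2.T\<^esub> y"
  "r \<odot>\<^bsub>T2\<^esub> x = uea_const r \<odot>\<^bsub>D2.T\<^esub> x" "act T2 g x = uea_of g \<odot>\<^bsub>D2.T\<^esub> x" "\<zero>\<^bsub>T2\<^esub> = \<zero>\<^bsub>D2.T\<^esub>"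
  by (simp_all add: T2_def rep_of_uea_module_def)

definition one :: "int \<times> nat \<Rightarrow> complex" where "one = delta (0, 0)"

lemma one_act: "schr_act (V_e l c) (V_h l) V_f (V_p c) V_q c (Rep_borel y) one = (\<lambda>i. chi y * one i)"
proof -
  have e: "complex_of_int a + 1 = 0" if "a + 1 = 0" for a
    using arg_cong[OF that, of complex_of_int] by simp
  have z: "V_e l c one = (\<lambda>i. 0)" "V_p c one = (\<lambda>i. 0)" "V_h l one = (\<lambda>i. l * one i)"
    by (auto simp: V_e_def V_p_def V_h_def one_def delta_apply fun_eq_iff e)
  show ?thesis using Rep_borel[of y]
    by (auto simp: schr_act_def z chi_def algebra_simps)
qed

text \<open>The function \<open>one\<close> plays the highest weight vector. The scalar
  \<open>chi_U b\<close> is the one by which \<open>b\<close> acts on the one-dimensional module, so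
  sending u and a to \<open>a\<close> times the action of \<open>u\<close> on \<open>one\<close> is
  balanced.\<close>

lemma U_act_borel: "U_act l c (uea_map Rep_borel b) one = (\<lambda>i. chi_U b * one i)"
proof -
  interpret L: lie_module "Vmod l c" by (rule lie_module_Vmod)
  have "uea_map Rep_borel b \<odot>\<^bsub>uea_module (Vmod l c)\<^esub> one
    = (\<Sum>w\<in>Poly_Mapping.keys (rep_uea b). Poly_Mapping.lookup (rep_uea b) w * prod_list (map chi (letters w))) \<odot>\<^bsub>Vmod l c\<^esub> one"
    by (rule L.uea_map_eigenvector) (simp_all add: one_act)
  then show ?thesis by (simp add: U_act_def chi_U_def)
qed

text \<open>The properties supplied by the universal map are collected in a predicate, so that one
  such map can be fixed by choice; \<open>is_\<Phi>\<close> does the same for the second tensor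
  product.\<close>

definition "is_\<theta> \<theta> \<longleftrightarrow> (\<forall>u a. \<theta> (D1.pure u a) = (\<lambda>i. a * U_act l c u one i)) \<and>
    (\<forall>A\<in>carrier D1.T. \<forall>B\<in>carrier D1.T. \<theta> (A \<oplus>\<^bsub>D1.T\<^esub> B) = (\<lambda>i. \<theta> A i + \<theta> B i))"

definition "\<theta> = (SOME \<theta>. is_\<theta> \<theta>)"

lemma \<theta>: "\<theta> (D1.pure u a) = (\<lambda>i. a * U_act l c u one i)"
  "A \<in> carrier D1.T \<Longrightarrow> B \<in> carrier D1.T \<Longrightarrow> \<theta> (A \<oplus>\<^bsub>D1.T\<^esub> B) = (\<lambda>i. \<theta> A i + \<theta> B i)"
proof -
  obtain h where "\<And>u a. h (D1.pure u a) = (\<lambda>i. a * U_act l c u one i)"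
    "\<And>A B. A \<in> carrier D1.T \<Longrightarrow> B \<in> carrier D1.T \<Longrightarrow> h (A \<oplus>\<^bsub>D1.T\<^esub> B) = (\<lambda>i. h A i + h B i)"
  proof (rule D1.universal_map[of "\<lambda>u a i. a * U_act l c u one i"])
    show "v * U_act l c (x * uea_map Rep_borel r) one i = (r \<odot>\<^bsub>uea_module (borel_character l c)\<^esub> v) * U_act l c x one i"
      for x r v i
      by (simp add: B_smult U_act_simps(2) U_act_borel U_act_smult)
  qed (auto simp: U_act_simps algebra_simps)
  then have "is_\<theta> h" by (simp add: is_\<theta>_def)
  then have "is_\<theta> \<theta>" unfolding \<theta>_def by (rule someI[where P = is_\<theta>])
  then show "\<theta> (D1.pure u a) = (\<lambda>i. a * U_act l c u one i)"
    "A \<in> carrier D1.T \<Longrightarrow> B \<in> carrier D1.T \<Longrightarrow> \<theta> (A \<oplus>\<^bsub>D1.T\<^esub> B) = (\<lambda>i. \<theta> A i + \<theta> B i)"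
    by (auto simp: is_\<theta>_def)
qed

lemma \<theta>_zero: "\<theta> \<zero>\<^bsub>D1.T\<^esub> = (\<lambda>i. 0)"
  using \<theta>(2)[OF D1.T.zero_closed D1.T.zero_closed] by (auto simp: fun_eq_iff)

interpretation D1m: left_mod D1.T by (rule D1.left_mod_T)
interpretation D2m: left_mod D2.T by (rule D2.left_mod_T)

lemma \<theta>_U: "A \<in> carrier D1.T \<Longrightarrow> \<theta> (u \<odot>\<^bsub>D1.T\<^esub> A) = U_act l c u (\<theta> A)"
proof (induction A rule: D1.T_induct)
  case zero
  then show ?case using U_act_smult[of l c u 0 "\<lambda>i. 0"] by (simp add: \<theta>_zero D1m.s_zero_right)
next
  case (pure x v)
  then show ?case by (simp add: D1.smult_pure \<theta> U_act_simps U_act_smult)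
next
  case (add A B)
  then show ?case by (simp add: D1m.s_add_right \<theta> D1m.s_closed U_act_simps)
qed

text \<open>The Verma module lands on i >= 0, because \<open>one\<close> does and this region is
  stable. Hence its elements disappear under \<open>tr\<close>.\<close>

lemma tr_\<theta>: "A \<in> carrier D1.T \<Longrightarrow> tr (\<theta> A) = (\<lambda>i. 0)"
proof (induction A rule: D1.T_induct)
  case zero
  then show ?case by (simp add: \<theta>_zero tr_def)
next
  case (pure x v)
  have "tr one = (\<lambda>i. 0)" by (auto simp: tr_def one_def delta_apply)
  then have "tr (U_act l c x one) = (\<lambda>i. 0)" by (rule tr_U_act_zero)
  then show ?case by (auto simp: \<theta> tr_def fun_eq_iff)
next
  case (add A B)
  then show ?case by (auto simp: \<theta> tr_def fun_eq_iff)
qed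

definition g2 :: "sf \<Rightarrow> _ \<Rightarrow> nat \<times> nat \<Rightarrow> complex"
  where "g2 x d = tr (loc_act l c (rep_sf x) (\<theta> d))"

text \<open>Two representatives of an element of S_f differ by an element of the enveloping algebra,
  which keeps the image of the Verma module on i >= 0 and so contributes nothing after
  \<open>tr\<close>.\<close>

lemma g2_abs: "d \<in> carrier D1.T \<Longrightarrow> g2 (abs_sf y) d = tr (loc_act l c y (\<theta> d))"
proof -
  assume d: "d \<in> carrier D1.T"
  have "uloc_mod (rep_sf (abs_sf y)) y"
    using sf.abs_eq_iff[of "rep_sf (abs_sf y)" y] Quotient3_abs_rep[OF Quotient3_sf, of "abs_sf y"] by simp
  then obtain u where "rep_sf (abs_sf y) - y = uloc_of u" by (auto simp: uloc_mod_def)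
  then have "rep_sf (abs_sf y) = y + uloc_of u" by (simp add: algebra_simps)
  then have "loc_act l c (rep_sf (abs_sf y)) (\<theta> d) = (\<lambda>i. loc_act l c y (\<theta> d) i + U_act l c u (\<theta> d) i)"
    by (simp add: loc_act_add loc_act_of)
  moreover have "tr (U_act l c u (\<theta> d)) = (\<lambda>i. 0)" using tr_U_act_zero[OF tr_\<theta>[OF d]] .
  ultimately show ?thesis by (auto simp: g2_def tr_def fun_eq_iff)
qed

definition "is_\<Phi> \<Phi> \<longleftrightarrow> (\<forall>x d. \<Phi> (D2.pure x d) = g2 x d) \<and>
    (\<forall>A\<in>carrier D2.T. \<forall>B\<in>carrier D2.T. \<Phi> (A \<oplus>\<^bsub>D2.T\<^esub> B) = (\<lambda>i. \<Phi> A i + \<Phi> B i))"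

definition "\<Phi> = (SOME \<Phi>. is_\<Phi> \<Phi>)"

lemma \<Phi>: "\<Phi> (D2.pure x d) = g2 x d"
  "A \<in> carrier D2.T \<Longrightarrow> B \<in> carrier D2.T \<Longrightarrow> \<Phi> (A \<oplus>\<^bsub>D2.T\<^esub> B) = (\<lambda>i. \<Phi> A i + \<Phi> B i)"
proof -
  obtain h where "\<And>x d. h (D2.pure x d) = g2 x d"
    "\<And>A B. A \<in> carrier D2.T \<Longrightarrow> B \<in> carrier D2.T \<Longrightarrow> h (A \<oplus>\<^bsub>D2.T\<^esub> B) = (\<lambda>i. h A i + h B i)"
  proof (rule D2.universal_map[of g2])
    fix x y r v w i
    assume "v \<in> carrier (uea_module (verma l c))"
    then have v: "v \<in> carrier D1.T" by (simp add: verma_simps)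
    obtain x' where x: "x = abs_sf x'" by (rule sf_cases)
    obtain y' where y: "y = abs_sf y'" by (rule sf_cases)
    show "g2 (x + y) v i = g2 x v i + g2 y v i"
      unfolding x y by (auto simp: sf_abs g2_abs[OF v] loc_act_add tr_def split: prod.split)
    show "g2 (sf_right x r) v i = g2 x (r \<odot>\<^bsub>uea_module (verma l c)\<^esub> v) i"
      unfolding x using v
      by (simp add: sf_abs g2_abs D1m.s_closed verma_smult loc_act_mult_right \<theta>_U)
    assume "w \<in> carrier (uea_module (verma l c))"
    then have w: "w \<in> carrier D1.T" by (simp add: verma_simps)
    show "g2 x (v \<oplus>\<^bsub>uea_module (verma l c)\<^esub> w) i = g2 x v i + g2 x w i"
      using v w by (auto simp: g2_def verma_simps \<theta> loc_act_add_right tr_def split: prod.split)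
  qed blast
  then have "is_\<Phi> h" by (simp add: is_\<Phi>_def)
  then have "is_\<Phi> \<Phi>" unfolding \<Phi>_def by (rule someI[where P = is_\<Phi>])
  then show "\<Phi> (D2.pure x d) = g2 x d"
    "A \<in> carrier D2.T \<Longrightarrow> B \<in> carrier D2.T \<Longrightarrow> \<Phi> (A \<oplus>\<^bsub>D2.T\<^esub> B) = (\<lambda>i. \<Phi> A i + \<Phi> B i)"
    by (auto simp: is_\<Phi>_def)
qed

lemma \<Phi>_zero: "\<Phi> \<zero>\<^bsub>D2.T\<^esub> = (\<lambda>i. 0)"
  using \<Phi>(2)[OF D2.T.zero_closed D2.T.zero_closed] by (auto simp: fun_eq_iff)

lemma \<Phi>_act: "A \<in> carrier D2.T \<Longrightarrow> \<Phi> (uea_of x \<odot>\<^bsub>D2.T\<^esub> A) = schr_act (T_e l c) (T_h l) T_f (T_p c) T_q c x (\<Phi> A)"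
proof (induction A rule: D2.T_induct)
  case zero
  have "schr_act (T_e l c) (T_h l) T_f (T_p c) T_q c x (\<lambda>i. 0) = (\<lambda>i. 0)"
    by (auto simp: schr_act_def T_e_def T_h_def T_f_def T_p_def T_q_def)
  then show ?case by (simp add: \<Phi>_zero D2m.s_zero_right)
next
  case (pure y v)
  then have v: "v \<in> carrier D1.T" by (simp add: verma_simps)
  obtain y' where y: "y = abs_sf y'" by (rule sf_cases)
  show ?case unfolding y
    by (simp add: D2.smult_pure \<Phi> sf_abs g2_abs[OF v] loc_act_mult_left U_act_simps tr_schr_act)
next
  case (add A B)
  then show ?case
    using lin_opD(1)[OF lin_op_schr_act[OF T_lin]] by (simp add: D2m.s_add_right \<Phi> D2m.s_closed)
qed

lemma \<Phi>_const: "A \<in> carrier D2.T \<Longrightarrow> \<Phi> (uea_const r \<odot>\<^bsub>D2.T\<^esub> A) = (\<lambda>i. r * \<Phi> A i)"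
proof (induction A rule: D2.T_induct)
  case zero
  then show ?case by (simp add: \<Phi>_zero D2m.s_zero_right)
next
  case (pure y v)
  then have v: "v \<in> carrier D1.T" by (simp add: verma_simps)
  obtain y' where y: "y = abs_sf y'" by (rule sf_cases)
  show ?case unfolding y
    by (auto simp: D2.smult_pure \<Phi> sf_abs g2_abs[OF v] loc_act_mult_left U_act_simps tr_def)
next
  case (add A B)
  then show ?case by (simp add: D2m.s_add_right \<Phi> D2m.s_closed algebra_simps)
qed

definition "v0 = D1.pure 1 1"

lemma v0_closed: "v0 \<in> carrier D1.T"
  unfolding v0_def by (rule D1.pure_closed) simp

lemma Rep_borel_hom: "Rep_borel (x + y) = Rep_borel x + Rep_borel y"
  "Rep_borel (lscale r x) = lscale r (Rep_borel x)"
  "Rep_borel (bracket x y) = bracket (Rep_borel x) (Rep_borel y)"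
  by (simp_all add: plus_borel.rep_eq lscale_borel.rep_eq bracket_borel.rep_eq)

lemma pure_1: "D1.pure 1 a = uea_const a \<odot>\<^bsub>D1.T\<^esub> v0"
proof -
  have "uea_const a \<odot>\<^bsub>D1.T\<^esub> v0 = D1.pure (1 * uea_map Rep_borel (uea_const a)) 1"
    unfolding v0_def D1.smult_pure uea_map_const[OF Rep_borel_hom] by simp
  also have "\<dots> = D1.pure 1 (uea_const a \<odot>\<^bsub>uea_module (borel_character l c)\<^esub> 1)"
    by (rule D1.pure_balanced) simp
  also have "uea_const a \<odot>\<^bsub>uea_module (borel_character l c)\<^esub> 1 = a"
    using B.uea_smult_const[of 1 a] by (simp add: borel_character_def)
  finally show ?thesis by simp
qed

lemma v0_act: "act (verma l c) (Rep_borel y) v0 = chi y \<odot>\<^bsub>verma l c\<^esub> v0"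
proof -
  have "act (verma l c) (Rep_borel y) v0 = D1.pure (1 * uea_map Rep_borel (uea_of y)) 1"
    unfolding verma_simps v0_def D1.smult_pure uea_map_of[OF Rep_borel_hom] by simp
  also have "\<dots> = D1.pure 1 (uea_of y \<odot>\<^bsub>uea_module (borel_character l c)\<^esub> 1)"
    by (rule D1.pure_balanced) simp
  also have "uea_of y \<odot>\<^bsub>uea_module (borel_character l c)\<^esub> 1 = chi y"
    using B.uea_smult_of[of 1 y] by (simp add: borel_character_def chi_def)
  finally show ?thesis by (simp add: pure_1 verma_simps)
qed

definition w :: "nat \<times> nat \<Rightarrow> _" where
  "w = (\<lambda>(i, b). (act (verma l c) \<ff> ^^ i) ((act (verma l c) \<qq> ^^ b) v0))"

lemma w_closed: "w x \<in> carrier (verma l c)"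
  using v0_closed by (cases x) (simp add: w_def verma_simps(1)[symmetric])

lemma verma_span: "carrier (verma l c) = lspan (verma l c) (range w)"
proof -
  have v0: "v0 \<in> carrier (verma l c)" using v0_closed by (simp add: verma_simps)
  have r: "act (verma l c) x v0 = (ch x * l + cz x * c) \<odot>\<^bsub>verma l c\<^esub> v0" if "cf x = 0" "cq x = 0" for x
    using v0_act[of "Abs_borel x"] that by (simp add: Abs_borel_inverse chi_def)
  have W: "submod UNIV (lspan (verma l c) (range w)) (verma l c)"
    unfolding w_def
    by (rule highest_weight_span[OF Vm.lie_module_axioms v0, of l c])
      (use r[of \<ee>] r[of \<pp>] r[of \<hh>] r[of \<zz>] v0 in \<open>simp_all add: \<ee>_def \<hh>_def \<pp>_def \<zz>_def\<close>)
  let ?W = "lspan (verma l c) (range w)"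
  have rc: "range w \<subseteq> carrier (verma l c)" using w_closed by auto
  note d = Vm.submoduleD[OF Vm.lspan_submodule[OF rc]]
  have cl: "u \<odot>\<^bsub>D1.T\<^esub> x \<in> ?W" if "x \<in> ?W" for u x
    using that
  proof (induction u arbitrary: x rule: uea_induct)
    case (const r)
    then show ?case using d(4)[of x r] by (simp add: verma_simps)
  next
    case (of y)
    then show ?case using W by (simp add: submod_def verma_simps)
  next
    case (add u v)
    have "x \<in> carrier D1.T" using d(1) add(3) by (auto simp: verma_simps)
    then show ?case using d(3)[OF add(1)[OF add(3)] add(2)[OF add(3)]] by (simp add: D1m.s_add_left verma_simps)
  next
    case (mult u v)
    have "x \<in> carrier D1.T" using d(1) mult(3) by (auto simp: verma_simps)
    then show ?case using mult by (simp add: D1m.s_mult)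
  qed
  have v0W: "v0 \<in> ?W" using Vm.lspan_incl[of "range w"] by (auto simp: w_def image_iff intro!: subsetD[OF Vm.lspan_incl] exI[of _ "0::nat"])
  have "A \<in> ?W" if "A \<in> carrier D1.T" for A
    using that
  proof (induction A rule: D1.T_induct)
    case zero
    then show ?case using d(2) by (simp add: verma_simps)
  next
    case (pure u a)
    have "D1.pure u a = u \<odot>\<^bsub>D1.T\<^esub> D1.pure 1 a" by (simp add: D1.smult_pure)
    then show ?case using cl[OF cl[OF v0W]] by (simp add: pure_1)
  next
    case (add A B)
    then show ?case using d(3) by (simp add: verma_simps)
  qed
  then show ?thesis using d(1) by (auto simp: verma_simps)
qed

definition fi :: "nat \<Rightarrow> sf" where "fi k = abs_sf (abs_uloc (k, 1))"

lemma fi_right: "sf_right (fi k) u = abs_sf (abs_uloc (k, u))"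
  unfolding fi_def sf_abs uloc_mult_right by simp

text \<open>For k <= i the product f^(-k) f^i lies in the enveloping algebra, which is zero in
  S_f.\<close>

lemma fi_f_pow: "sf_right (fi k) (uea_of \<ff> ^ i) = (if k \<le> i then 0 else fi (k - i))"
proof (cases "k \<le> i")
  case True
  have "abs_uloc (k, uea_of \<ff> ^ i) = uloc_of (uea_of \<ff> ^ (i - k))"
    unfolding uloc_of.abs_eq uloc.abs_eq_iff frac_rel_def
    using True by (intro exI[of _ 0]) (simp add: power_add[symmetric])
  moreover have "abs_sf (uloc_of u) = 0" for u
    unfolding zero_sf_def sf.abs_eq_iff uloc_mod_def by simp
  ultimately show ?thesis using True by (simp add: fi_right)
next
  case False
  have "abs_uloc (k, uea_of \<ff> ^ i) = abs_uloc (k - i, 1)"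
    unfolding uloc.abs_eq_iff frac_rel_def
    using False by (intro exI[of _ 0]) (simp add: power_add[symmetric])
  then show ?thesis unfolding fi_right using False by (simp add: fi_def)
qed

lemma fi_const: "sf_right (fi k) (uea_const r) = sf_left (uea_const r) (fi k)"
proof -
  have "uloc_of (uea_const r) * abs_uloc (k, 1) = abs_uloc (k, uea_const r)"
    using uea_F.frac_mult_rel[of k "uea_const r" "uea_const r" k 0 1]
    by (simp add: uloc_of.abs_eq times_uloc.abs_eq uloc.abs_eq_iff uea_const_commute)
  then show ?thesis by (simp only: fi_right) (simp add: fi_def sf_abs)
qed

definition \<tau> :: "nat \<times> nat \<Rightarrow> _" where "\<tau> = (\<lambda>(k, b). D2.pure (fi (Suc k)) (w (0, b)))"

lemma \<tau>_closed: "\<tau> x \<in> carrier T2"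
  using w_closed by (cases x) (auto simp: \<tau>_def T2_simps)

text \<open>A pure tensor of f^(-k) u and y equals that of f^(-k) and u y. As u y is a combination
  of vectors f^i q^b v, the power f^i can be moved to the left factor, where it either cancels
  against f^(-k) or gives zero.\<close>

lemma T2_span: "carrier T2 = lspan T2 (range \<tau>)"
proof -
  interpret T2: lie_module T2 by (rule lie_module_T2)
  have rc: "range \<tau> \<subseteq> carrier T2" using \<tau>_closed by auto
  let ?S = "lspan T2 (range \<tau>)"
  note d = T2.submoduleD[OF T2.lspan_submodule[OF rc]]
  \<comment> \<open>All exponents k are quantified here at once, since moving f^i across the tensor
    sign changes the exponent.\<close>
  let ?G = "{x \<in> carrier (verma l c). \<forall>k. D2.pure (fi k) x \<in> ?S}"
  have "submodule ?G complex_field (verma l c)"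
    unfolding Vm.submodule_iff
  proof (intro conjI ballI allI)
    show "\<zero>\<^bsub>verma l c\<^esub> \<in> ?G"
    proof -
      have "D2.pure (fi k) (0 \<odot>\<^bsub>uea_module (verma l c)\<^esub> v0) = D2.pure (sf_right (fi k) 0) v0" for k
        using v0_closed by (intro D2.pure_balanced[symmetric]) (simp add: verma_simps)
      moreover have "sf_right (fi k) 0 = 0" for k
        using fi_const[of k 0] unfolding fi_right zero_sf_def sf.abs_eq_iff uloc_mod_def
        by (auto simp: uloc_of.abs_eq zero_uloc.abs_eq uloc.abs_eq_iff frac_rel_def minus_uloc_def uminus_uloc.abs_eq plus_uloc.abs_eq frac_add_def intro!: range_eqI[of _ _ 0])
      moreover have "0 \<odot>\<^bsub>uea_module (verma l c)\<^esub> v0 = \<zero>\<^bsub>verma l c\<^esub>"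
        using v0_closed by (simp add: verma_smult D1m.s_zero_left verma_simps)
      ultimately have "D2.pure (fi k) \<zero>\<^bsub>verma l c\<^esub> = \<zero>\<^bsub>D2.T\<^esub>" for k
        using D2.pure_0_left[of v0] v0_closed by (simp add: verma_simps)
      then show ?thesis using d(2) by (simp add: T2_simps)
    qed
    show "x \<oplus>\<^bsub>verma l c\<^esub> y \<in> ?G" if "x \<in> ?G" "y \<in> ?G" for x y
      using that D2.pure_add_right[of x y] d(3) by (simp add: T2_simps)
    show "r \<odot>\<^bsub>verma l c\<^esub> x \<in> ?G" if x: "x \<in> ?G" for r x
    proof -
      have xc: "x \<in> carrier D1.T" using x by (simp add: verma_simps)
      have "D2.pure (fi k) (r \<odot>\<^bsub>verma l c\<^esub> x) = r \<odot>\<^bsub>T2\<^esub> D2.pure (fi k) x" for k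
      proof -
        have "D2.pure (fi k) (r \<odot>\<^bsub>verma l c\<^esub> x) = D2.pure (sf_right (fi k) (uea_const r)) x"
          using D2.pure_balanced[of x "fi k" "uea_const r"] xc by (simp add: verma_smult verma_simps)
        then show ?thesis by (simp add: fi_const T2_simps D2.smult_pure)
      qed
      then show ?thesis using x d(4) by auto
    qed
  qed auto
  moreover have "range w \<subseteq> ?G"
  proof
    fix x assume "x \<in> range w"
    then obtain i b where x: "x = w (i, b)" by auto
    have wb: "w (0, b) \<in> carrier D1.T" using w_closed[of "(0, b)"] by (simp add: verma_simps)
    have "w (i, b) = uea_of \<ff> ^ i \<odot>\<^bsub>uea_module (verma l c)\<^esub> w (0, b)"
    proof (induction i)
      case 0
      then show ?case using wb by (simp add: verma_smult)
    next
      case (Suc i)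
      have "w (Suc i, b) = uea_of \<ff> \<odot>\<^bsub>D1.T\<^esub> w (i, b)" by (simp add: w_def verma_simps)
      then show ?case using Suc wb by (simp add: verma_smult D1m.s_mult)
    qed
    then have "D2.pure (fi k) x = D2.pure (if k \<le> i then 0 else fi (k - i)) (w (0, b))" for k
      using D2.pure_balanced[of "w (0, b)" "fi k" "uea_of \<ff> ^ i"] wb x by (simp add: verma_simps fi_f_pow)
    moreover have "D2.pure (fi (k - i)) (w (0, b)) \<in> ?S" if "\<not> k \<le> i" for k
    proof -
      have "k - i = Suc (k - i - 1)" using that by simp
      then have "fi (k - i) = fi (Suc (k - i - 1))" by (rule arg_cong)
      then have "D2.pure (fi (k - i)) (w (0, b)) = \<tau> (k - i - 1, b)" by (simp add: \<tau>_def)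
      then show ?thesis using T2.lspan_incl[of "range \<tau>"] by auto
    qed
    moreover have "D2.pure 0 (w (0, b)) \<in> ?S"
      using D2.pure_0_left[of "w (0, b)"] wb d(2) by (simp add: verma_simps T2_simps)
    ultimately show "x \<in> ?G" using w_closed x by simp
  qed
  ultimately have "lspan (verma l c) (range w) \<subseteq> ?G" by (rule Vm.lspan_least)
  then have G: "D2.pure (fi k) x \<in> ?S" if "x \<in> carrier (verma l c)" for k x
    using verma_span that by blast
  have "A \<in> ?S" if "A \<in> carrier D2.T" for A
    using that
  proof (induction A rule: D2.T_induct)
    case zero
    then show ?case using d(2) by (simp add: T2_simps)
  next
    case (pure x y)
    obtain x' where x': "x = abs_sf x'" by (rule sf_cases)
    obtain k u where "x' = abs_uloc (k, u)" by (rule uloc_cases)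
    then have "x = sf_right (fi k) u" by (simp add: fi_right x')
    then have "D2.pure x y = D2.pure (fi k) (u \<odot>\<^bsub>uea_module (verma l c)\<^esub> y)"
      using D2.pure_balanced[OF pure] by simp
    moreover have "u \<odot>\<^bsub>uea_module (verma l c)\<^esub> y \<in> carrier (verma l c)"
      using pure by (simp add: verma_simps verma_smult D1m.s_closed)
    ultimately show ?case using G by simp
  next
    case (add A B)
    then show ?case using d(3) by (simp add: T2_simps)
  qed
  then show ?thesis using d(1) by (auto simp: T2_simps)
qed

text \<open>The independence half of the basis statement: the spanning vectors have distinct unit
  functions as coordinates.\<close>

lemma \<Phi>_\<tau>: "\<Phi> (\<tau> x) = delta x"
proof -
  obtain k b where x: "x = (k, b)" by (cases x)
  have wb: "w (0, b) \<in> carrier D1.T" for b using w_closed[of "(0, b)"] by (simp add: verma_simps)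
  have "\<theta> (w (0, b)) = delta (0, b)" for b
  proof (induction b)
    case 0
    then show ?case by (simp add: w_def v0_def \<theta> U_act_simps one_def)
  next
    case (Suc b)
    have "w (0, Suc b) = uea_of \<qq> \<odot>\<^bsub>D1.T\<^esub> w (0, b)" by (simp add: w_def verma_simps)
    then have "\<theta> (w (0, Suc b)) = V_q (delta (0, b))" using \<theta>_U[OF wb] Suc by (simp add: U_act_simps)
    also have "\<dots> = delta (0, Suc b)" by (auto simp: V_q_def delta_apply fun_eq_iff)
    finally show ?case .
  qed
  then have "\<Phi> (\<tau> x) = tr (f_inv (Suc k) (delta (0, b)))"
    by (simp add: x \<tau>_def \<Phi> fi_def g2_abs[OF wb] loc_act_abs U_act_simps)
  also have "\<dots> = delta (k, b)" by (auto simp: tr_def f_inv_def delta_apply fun_eq_iff)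
  finally show ?thesis using x by simp
qed

text \<open>Every element is a combination of the \<open>\<tau> x\<close>, and \<Phi> returns its
  coefficients; so \<Phi> is inverse to forming combinations.\<close>

lemma T2_iso: "bij_betw \<Phi> (carrier T2) (carrier (Tmod l c))" "mod_hom UNIV T2 (Tmod l c) \<Phi>"
proof -
  interpret T2: lie_module T2 by (rule lie_module_T2)
  interpret Tm: lie_module "Tmod l c" by (rule lie_module_Tmod)
  have Tm: "carrier (Tmod l c) = {a. finsupp a}" by (simp add: Tmod_def)
  have add: "\<Phi> (A \<oplus>\<^bsub>T2\<^esub> B) = (\<lambda>i. \<Phi> A i + \<Phi> B i)" if "A \<in> carrier T2" "B \<in> carrier T2" for A B
    using \<Phi>(2) that by (simp add: T2_simps)
  have sm: "\<Phi> (r \<odot>\<^bsub>T2\<^esub> A) = (\<lambda>i. r * \<Phi> A i)" if "A \<in> carrier T2" for A r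
    using \<Phi>_const that by (simp add: T2_simps)
  have lc: "\<Phi> (lc T2 \<tau> a) = a" if "finsupp a" for a
    using that
  proof (induction a rule: finsupp_induct)
    case zero
    then show ?case using \<Phi>_zero by (simp add: T2_simps)
  next
    case (add a r i)
    have "lc T2 \<tau> (\<lambda>j. a j + r * delta i j) = lc T2 \<tau> a \<oplus>\<^bsub>T2\<^esub> r \<odot>\<^bsub>T2\<^esub> \<tau> i"
      using add.hyps \<tau>_closed by (subst T2.lc_add) (auto simp: T2.lc_smult)
    moreover have "\<Phi> (lc T2 \<tau> a \<oplus>\<^bsub>T2\<^esub> r \<odot>\<^bsub>T2\<^esub> \<tau> i) = (\<lambda>j. \<Phi> (lc T2 \<tau> a) j + \<Phi> (r \<odot>\<^bsub>T2\<^esub> \<tau> i) j)"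
      by (rule \<open>\<And>A B. A \<in> carrier T2 \<Longrightarrow> B \<in> carrier T2 \<Longrightarrow> \<Phi> (A \<oplus>\<^bsub>T2\<^esub> B) = (\<lambda>i. \<Phi> A i + \<Phi> B i)\<close>)
        (use \<tau>_closed in auto)
    ultimately show ?case using add.IH by (simp add: sm[OF \<tau>_closed] \<Phi>_\<tau>)
  qed
  have rep: "\<exists>a. finsupp a \<and> A = lc T2 \<tau> a" if "A \<in> carrier T2" for A
    by (rule T2.lspan_lc[where w = \<tau> and v = A, OF \<tau>_closed that[unfolded T2_span]]) blast
  have cl: "\<Phi> A \<in> carrier (Tmod l c)" if "A \<in> carrier T2" for A
    using rep[OF that] lc by (auto simp: Tm)
  show "mod_hom UNIV T2 (Tmod l c) \<Phi>"
    unfolding mod_hom_def using cl add sm \<Phi>_act by (auto simp: Tmod_def T2_simps)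
  have "inj_on \<Phi> (carrier T2)" using rep lc by (intro inj_onI) metis
  moreover have "\<Phi> ` carrier T2 = carrier (Tmod l c)"
  proof
    show "carrier (Tmod l c) \<subseteq> \<Phi> ` carrier T2"
    proof
      fix a assume "a \<in> carrier (Tmod l c)"
      then have "a = \<Phi> (lc T2 \<tau> a)" using lc by (simp add: Tm)
      moreover have "lc T2 \<tau> a \<in> carrier T2" using \<tau>_closed by auto
      ultimately show "a \<in> \<Phi> ` carrier T2" by blast
    qed
  qed (use cl in auto)
  ultimately show "bij_betw \<Phi> (carrier T2) (carrier (Tmod l c))" by (simp add: bij_betw_def)
qed

end

section \<open>The completion functor\<close>

definition e_finite :: "(schr, 'm) rep \<Rightarrow> 'm set"
  where "e_finite M = {m \<in> carrier M. fin_dim M (lspan M (range (\<lambda>k. (act M \<ee> ^^ k) m)))}"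

lemma EA_e_finite: "EA M = restr (rep_of_uea_module (tensor sf_left sf_right (uea_module M)))
    (e_finite (rep_of_uea_module (tensor sf_left sf_right (uea_module M))))"
  by (simp add: EA_def Let_def e_finite_def)

lemma (in mod_hom_loc) fin_dim_orbit:
  assumes "x \<in> A" "m \<in> carrier M" "fin_dim M (lspan M (range (\<lambda>k. (act M x ^^ k) m)))"
  shows "fin_dim N (lspan N (range (\<lambda>k. (act N x ^^ k) (\<phi> m))))"
proof -
  have c: "range (\<lambda>k. (act M x ^^ k) m) \<subseteq> carrier M" using hom_pow[OF assms(1,2)] by auto
  have "\<phi> ` range (\<lambda>k. (act M x ^^ k) m) = range (\<lambda>k. (act N x ^^ k) (\<phi> m))"
    using hom_pow[OF assms(1,2)] by (auto simp: image_image)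
  then show ?thesis using fin_dim_image[OF assms(3)] lspan_image[OF c] by simp
qed

lemma e_finite_transport:
  assumes "lie_module M" "lie_module N" and bij: "bij_betw \<phi> (carrier M) (carrier N)"
    and hom: "mod_hom UNIV M N \<phi>"
  shows "\<phi> ` e_finite M = e_finite N"
proof -
  interpret M: lie_module M by fact
  interpret N: lie_module N by fact
  interpret \<phi>: mod_hom_loc M N UNIV \<phi>
    using hom by (simp add: mod_hom_loc_def mod_hom_loc_axioms_def M.amodule_any N.amodule_any)
  define \<psi> where "\<psi> = inv_into (carrier M) \<phi>"
  interpret \<psi>: mod_hom_loc N M UNIV \<psi>
    using \<phi>.inv_hom[OF bij] unfolding \<psi>_def
    by (simp add: mod_hom_loc_def mod_hom_loc_axioms_def M.amodule_any N.amodule_any)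
  have \<phi>\<psi>: "\<phi> (\<psi> v) = v" if "v \<in> carrier N" for v
    using that bij unfolding \<psi>_def by (simp add: bij_betw_def f_inv_into_f)
  show ?thesis
  proof
    show "\<phi> ` e_finite M \<subseteq> e_finite N" using \<phi>.fin_dim_orbit by (auto simp: e_finite_def)
    show "e_finite N \<subseteq> \<phi> ` e_finite M"
    proof
      fix x assume x: "x \<in> e_finite N"
      then have "\<psi> x \<in> e_finite M" using \<psi>.fin_dim_orbit by (auto simp: e_finite_def)
      moreover have "x = \<phi> (\<psi> x)" using \<phi>\<psi> x by (simp add: e_finite_def)
      ultimately show "x \<in> \<phi> ` e_finite M" by blast
    qed
  qed
qed

section \<open>Local finiteness of e and f on the coordinate module\<close>

lemma Tmod_simps [simp]:
  "carrier (Tmod l c) = {a. finsupp a}" "zero (Tmod l c) = (\<lambda>i. 0)"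
  "v \<oplus>\<^bsub>Tmod l c\<^esub> w = (\<lambda>i. v i + w i)" "r \<odot>\<^bsub>Tmod l c\<^esub> v = (\<lambda>i. r * v i)"
  "act (Tmod l c) \<ee> = T_e l c" "act (Tmod l c) \<hh> = T_h l" "act (Tmod l c) \<ff> = T_f"
  "act (Tmod l c) \<pp> = T_p c" "act (Tmod l c) \<qq> = T_q" "act (Tmod l c) \<zz> = (\<lambda>v i. c * v i)"
  by (simp_all add: Tmod_def)

lemma Tmod_finsum:
  assumes "finite S" "\<And>k. k \<in> S \<Longrightarrow> finsupp (g k)"
  shows "finsum (Tmod l c) g S = (\<lambda>x. \<Sum>k\<in>S. g k x)"
proof -
  interpret lie_module "Tmod l c" by (rule lie_module_Tmod)
  show ?thesis using assms
  proof (induction S rule: finite_induct)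
    case (insert k S)
    then show ?case by (simp add: finsum_insert Pi_def)
  qed simp
qed

lemma Tmod_lc:
  assumes "finsupp a" "\<And>i. finsupp (w i)"
  shows "lc (Tmod l c) w a x = (\<Sum>i\<in>{i. a i \<noteq> 0}. a i * w i x)"
  unfolding lc_def by (subst Tmod_finsum) (use assms in \<open>auto simp: finsupp_def[symmetric]\<close>)

lemma T_f_pow: "(T_f ^^ d) a = (\<lambda>(k, b). a (k + d, b))"
  by (induction d) (auto simp: T_f_def fun_eq_iff)

lemma T_f_nilpotent:
  assumes "finsupp a" obtains d where "(T_f ^^ d) a = (\<lambda>x. 0)"
proof -
  have "finite (fst ` {x. a x \<noteq> 0})" using assms by (simp add: finsupp_def)
  then obtain N where "\<forall>j\<in>fst ` {x. a x \<noteq> 0}. j < N" using finite_nat_set_iff_bounded by blast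
  then have "a (k + N, b) = 0" for k b by force
  then have "(T_f ^^ N) a = (\<lambda>x. 0)" by (simp add: T_f_pow fun_eq_iff)
  then show ?thesis by (rule that)
qed

lemma T_e_T_f: "T_e l c (T_f a) x = T_f (T_e l c a) x + T_h l a x"
proof -
  obtain k b where x: "x = (k, b)" by (cases x)
  show ?thesis by (simp add: x T_e_def T_f_def T_h_def algebra_simps)
qed

text \<open>The formula e f^(d+1) y = (d + 1) f^d (h - d) y holds as soon as f e y = 0, since e y
  enters only through f^(d+1) e y. It is written at a coordinate because y need not be a weight
  vector.\<close>

lemma T_e_T_f_pow:
  assumes "T_f (T_e l c y) = (\<lambda>x. 0)"
  shows "T_e l c ((T_f ^^ Suc d) y) (k, b)
    = of_nat (Suc d) * (l + 2 * of_nat (k + d) + 2 - of_nat b - of_nat d) * y (k + d, b)"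
proof (induction d arbitrary: k)
  case 0
  then show ?case by (simp add: T_e_T_f assms) (simp add: T_h_def)
next
  case (Suc d)
  have "T_e l c ((T_f ^^ Suc (Suc d)) y) (k, b)
    = T_e l c ((T_f ^^ Suc d) y) (k + 1, b) + T_h l ((T_f ^^ Suc d) y) (k, b)"
    using T_e_T_f[of l c "(T_f ^^ Suc d) y" "(k, b)"] by (simp add: T_f_def)
  also have "T_e l c ((T_f ^^ Suc d) y) (k + 1, b)
    = of_nat (Suc d) * (l + 2 * of_nat (k + 1 + d) + 2 - of_nat b - of_nat d) * y (k + 1 + d, b)"
    by (rule Suc)
  also have "T_h l ((T_f ^^ Suc d) y) (k, b) = (l + 2 * of_nat k + 2 - of_nat b) * y (k + Suc d, b)"
    unfolding T_f_pow by (simp add: T_h_def)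
  also have "of_nat (Suc d) * (l + 2 * of_nat (k + 1 + d) + 2 - of_nat b - of_nat d) * y (k + 1 + d, b)
      + (l + 2 * of_nat k + 2 - of_nat b) * y (k + Suc d, b)
    = of_nat (Suc (Suc d)) * (l + 2 * of_nat (k + Suc d) + 2 - of_nat b - of_nat (Suc d)) * y (k + Suc d, b)"
    by (simp add: algebra_simps)
  finally show ?case .
qed

text \<open>Finitely many generators bound the weights in the span of the orbit from above, while
  each application of e raises all weights by 2, so a high power of e gives zero. Conversely, if a
  power of e kills \<open>a\<close>, finitely many vectors span the orbit.\<close>

lemma e_finite_Tmod: "e_finite (Tmod l c) = {a. finsupp a \<and> (\<exists>k. (T_e l c ^^ k) a = (\<lambda>x. 0))}"
proof -
  interpret lie_module "Tmod l c" by (rule lie_module_Tmod)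
  have pc: "finsupp ((T_e l c ^^ k) a)" if "finsupp a" for k a
    using act_pow_closed[of a k \<ee>] that by simp
  have "fin_dim (Tmod l c) (lspan (Tmod l c) (range (\<lambda>k. (T_e l c ^^ k) a)))"
    if a: "finsupp a" and k: "(T_e l c ^^ k) a = (\<lambda>x. 0)" for a k
  proof -
    let ?B = "(\<lambda>j. (T_e l c ^^ j) a) ` {..<k}"
    have B: "?B \<subseteq> carrier (Tmod l c)" using pc[OF a] by auto
    have "(T_e l c ^^ j) a \<in> lspan (Tmod l c) ?B" for j
    proof (cases "j < k")
      case True
      then show ?thesis using lspan_incl[of ?B] by auto
    next
      case False
      then obtain d where "j = d + k" using le_iff_add[of k j] by (auto simp: add.commute)
      then have "(T_e l c ^^ j) a = (\<lambda>x. 0)" using k act_pow_zero[of d \<ee>] by (simp add: funpow_add)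
      then show ?thesis using submoduleD(2)[OF lspan_submodule[OF B]] by simp
    qed
    then have "lspan (Tmod l c) (range (\<lambda>k. (T_e l c ^^ k) a)) \<subseteq> lspan (Tmod l c) ?B"
      by (intro lspan_least lspan_submodule[OF B]) auto
    moreover have "lspan (Tmod l c) ?B \<subseteq> lspan (Tmod l c) (range (\<lambda>k. (T_e l c ^^ k) a))"
      by (rule lspan_mono) auto
    ultimately have "lspan (Tmod l c) (range (\<lambda>k. (T_e l c ^^ k) a)) = lspan (Tmod l c) ?B" by blast
    then show ?thesis unfolding fin_dim_def using B by (intro exI[of _ ?B]) auto
  qed
  moreover have "\<exists>k. (T_e l c ^^ k) a = (\<lambda>x. 0)"
    if a: "finsupp a" and fd: "fin_dim (Tmod l c) (lspan (Tmod l c) (range (\<lambda>k. (T_e l c ^^ k) a)))" for a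
  proof -
    \<comment> \<open>The h-weight of a coordinate up to the constant l + 2.\<close>
    let ?wt = "\<lambda>x :: nat \<times> nat. 2 * int (fst x) - int (snd x)"
    have bnd: "\<exists>M. \<forall>x. a x \<noteq> 0 \<longrightarrow> \<bar>?wt x\<bar> \<le> M" if "finsupp a" for a :: "nat \<times> nat \<Rightarrow> complex"
    proof -
      have "finite ((\<lambda>x. \<bar>?wt x\<bar>) ` {x. a x \<noteq> 0})" using that by (simp add: finsupp_def)
      then have "\<forall>y\<in>(\<lambda>x. \<bar>?wt x\<bar>) ` {x. a x \<noteq> 0}. y \<le> Max (insert 0 ((\<lambda>x. \<bar>?wt x\<bar>) ` {x. a x \<noteq> 0}))" by simp
      then show ?thesis by blast
    qed
    obtain B where B: "finite B" "B \<subseteq> carrier (Tmod l c)"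
      "lspan (Tmod l c) (range (\<lambda>k. (T_e l c ^^ k) a)) = lspan (Tmod l c) B"
      using fd by (auto simp: fin_dim_def)
    have "\<exists>M. \<forall>x. b x \<noteq> 0 \<longrightarrow> \<bar>?wt x\<bar> \<le> M" if "b \<in> B" for b using bnd B(2) that by auto
    then obtain Mb where Mb: "\<And>b x. b \<in> B \<Longrightarrow> b x \<noteq> 0 \<Longrightarrow> \<bar>?wt x\<bar> \<le> Mb b" by metis
    let ?M = "Max (insert 0 (Mb ` B))"
    let ?H = "{y. finsupp y \<and> (\<forall>x. y x \<noteq> 0 \<longrightarrow> ?wt x \<le> ?M)}"
    have "submodule ?H complex_field (Tmod l c)"
      unfolding submodule_iff
    proof (intro conjI ballI allI)
      show "u \<oplus>\<^bsub>Tmod l c\<^esub> v \<in> ?H" if "u \<in> ?H" "v \<in> ?H" for u v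
      proof -
        have "?wt x \<le> ?M" if x: "u x + v x \<noteq> 0" for x
        proof -
          have "u x \<noteq> 0 \<or> v x \<noteq> 0" using x by auto
          then show ?thesis using \<open>u \<in> ?H\<close> \<open>v \<in> ?H\<close> by blast
        qed
        moreover have "finsupp (\<lambda>x. u x + v x)" using that by (intro finsupp_add) auto
        ultimately show ?thesis by (simp only: Tmod_simps mem_Collect_eq) blast
      qed
    qed auto
    moreover have "B \<subseteq> ?H"
    proof
      fix b assume b: "b \<in> B"
      have "Mb b \<le> ?M" using B(1) b by (intro Max_ge) auto
      then have "?wt x \<le> ?M" if "b x \<noteq> 0" for x using Mb[OF b that] by linarith
      then show "b \<in> ?H" using B(2) b by auto
    qed
    ultimately have "lspan (Tmod l c) B \<subseteq> ?H" by (rule lspan_least)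
    then have up: "?wt x \<le> ?M" if "(T_e l c ^^ k) a x \<noteq> 0" for k x
      using lspan_incl[of "range (\<lambda>k. (T_e l c ^^ k) a)"] B(3) that by blast
    obtain M0 where M0: "\<And>x. a x \<noteq> 0 \<Longrightarrow> \<bar>?wt x\<bar> \<le> M0" using bnd[OF a] by blast
    have low: "- M0 + 2 * int k \<le> ?wt x" if "(T_e l c ^^ k) a x \<noteq> 0" for k x
      using that
    proof (induction k arbitrary: x)
      case 0
      then show ?case using M0[of x] by simp
    next
      case (Suc k)
      obtain i b where x: "x = (i, b)" by (cases x)
      have step: "i \<noteq> 0 \<and> w (i - 1, b) \<noteq> 0 \<or> w (i, b + 2) \<noteq> 0" if "T_e l c w (i, b) \<noteq> 0" for w
        using that by (auto simp: T_e_def split: if_splits)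
      have "i \<noteq> 0 \<and> (T_e l c ^^ k) a (i - 1, b) \<noteq> 0 \<or> (T_e l c ^^ k) a (i, b + 2) \<noteq> 0"
        using Suc.prems by (intro step) (simp add: x)
      then show ?case using Suc.IH[of "(i - 1, b)"] Suc.IH[of "(i, b + 2)"] by (auto simp: x)
    qed
    define k where "k = nat (?M + M0 + 1)"
    have "(T_e l c ^^ k) a x = 0" for x
    proof (rule ccontr)
      assume "(T_e l c ^^ k) a x \<noteq> 0"
      from up[OF this] low[OF this] have "- M0 + 2 * int k \<le> ?M" by linarith
      moreover have "int k \<ge> ?M + M0 + 1" "int k \<ge> 0" by (simp_all add: k_def)
      ultimately show False by linarith
    qed
    then show ?thesis by blast
  qed
  ultimately show ?thesis by (auto simp: e_finite_def)
qed

text \<open>In both cases of interest the kernel of \<open>e\<close> is determined by the coordinates at the sites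
  \<open>s j\<close>, one for each weight \<open>n + j\<close>: the equation \<open>e x = 0\<close> propagates values along
  \<open>(k, b), (k + 1, b + 2), \<dots>\<close>, and a chain starting off the sites never terminates.\<close>

locale Tmod_hw = hw_module "Tmod (of_int L) c" v n c for L :: int and c v n +
  fixes s :: "nat \<Rightarrow> nat \<times> nat"
  assumes c: "c \<noteq> 0" and v_nz: "v \<noteq> (\<lambda>x. 0)"
    and s_weight: "L + 2 + 2 * int (fst (s j)) - int (snd (s j)) = int n + int j"
    and s_cover: "\<epsilon> \<le> 1 \<Longrightarrow> 0 \<le> L + int k + 2 - int \<epsilon> \<Longrightarrow> \<exists>j. s j = (k, \<epsilon>)"
begin

abbreviation "wt x \<equiv> L + 2 + 2 * int (fst x) - int (snd x)"

sublocale K: lie_module "Kmod n c" by (rule lie_module_Kmod)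
sublocale h: mod_hom_loc "Kmod n c" "Tmod (of_int L) c" UNIV \<Psi> by (rule \<Psi>_loc)

lemma e_rec: "T_e (of_int L) c x = (\<lambda>x. 0) \<Longrightarrow>
   c * of_nat (b + 2) * of_nat (b + 1) / 2 * x (k, b + 2)
   = (if k = 0 then 0 else of_nat k * of_int (L - int b + int k + 1) * x (k - 1, b))"
  by (drule fun_cong[of _ _ "(k, b)"]) (auto simp: T_e_def algebra_simps split: if_splits)

lemma b_nz: "c * of_nat (b + 2) * of_nat (b + 1) / 2 \<noteq> 0"
proof -
  have "of_nat (b + 2) \<noteq> (0 :: complex)" "of_nat (b + 1) \<noteq> (0 :: complex)"
    by (simp_all only: of_nat_eq_0_iff)
  then show ?thesis using c by (simp del: of_nat_add)
qed

text \<open>An element of the kernel of e is determined by its values at second index 0 and 1,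
  because \<open>e_rec\<close> yields the value at b + 2 from the one at b. The starting values that
  are not sites must vanish by finiteness of the support.\<close>

lemma kernel_sites:
  assumes x: "finsupp x" "T_e (of_int L) c x = (\<lambda>x. 0)" and z: "\<And>j. x (s j) = 0"
  shows "x = (\<lambda>x. 0)"
proof -
  have start: "x (k, \<epsilon>) = 0" if \<epsilon>: "\<epsilon> \<le> 1" for k \<epsilon>
  proof (cases "0 \<le> L + int k + 2 - int \<epsilon>")
    case True
    then show ?thesis using s_cover[OF \<epsilon>] z by metis
  next
    case False
    show ?thesis
    proof (rule ccontr)
      assume nz: "x (k, \<epsilon>) \<noteq> 0"
      \<comment> \<open>By \<open>e_rec\<close> the step from j to j + 1 multiplies by a nonzero
        number times L + k + 2 - \<epsilon> - j. A chain ends only where this factor is zero, which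
        cannot happen when L + k + 2 - \<epsilon> is negative.\<close>
      have chain: "x (k + j, 2 * j + \<epsilon>) \<noteq> 0" for j
      proof (induction j)
        case (Suc j)
        let ?k = "k + Suc j" and ?b = "2 * j + \<epsilon>"
        have "of_nat ?k * of_int (L - int ?b + int ?k + 1) * x (?k - 1, ?b) \<noteq> 0"
        proof -
          have "of_nat ?k \<noteq> (0 :: complex)" by (simp only: of_nat_eq_0_iff)
          moreover have "of_int (L - int ?b + int ?k + 1) \<noteq> (0 :: complex)"
            using False by (simp only: of_int_eq_0_iff)
          moreover have "x (?k - 1, ?b) \<noteq> 0" using Suc by simp
          ultimately show ?thesis by (simp only: mult_eq_0_iff simp_thms)
        qed
        then have "x (?k, ?b + 2) \<noteq> 0" using e_rec[OF x(2), of ?b ?k] by auto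
        moreover have "?b + 2 = 2 * Suc j + \<epsilon>" by simp
        ultimately show ?case by simp
      qed (use nz in simp)
      have "inj (\<lambda>j :: nat. (k + j, 2 * j + \<epsilon>))" by (auto simp: inj_def)
      then have "infinite (range (\<lambda>j :: nat. (k + j, 2 * j + \<epsilon>)))" by (rule range_inj_infinite)
      moreover have "range (\<lambda>j :: nat. (k + j, 2 * j + \<epsilon>)) \<subseteq> {y. x y \<noteq> 0}" using chain by auto
      ultimately show False using x(1) finite_subset unfolding finsupp_def by blast
    qed
  qed
  have "x (k, b) = 0" for k b
  proof (induction b arbitrary: k rule: less_induct)
    case (less b)
    show ?case
    proof (cases "b \<le> 1")
      case True
      then show ?thesis by (rule start)
    next
      case False
      define b' where "b' = b - 2"
      have b: "b = b' + 2" using False by (simp add: b'_def)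
      have "x (k - 1, b') = 0" using less[of b'] b by simp
      then have "c * of_nat (b' + 2) * of_nat (b' + 1) / 2 * x (k, b' + 2) = 0"
        using e_rec[OF x(2), of b' k] by simp
      then have "x (k, b' + 2) = 0" using b_nz[of b'] mult_eq_0_iff by blast
      then show ?thesis by (simp only: b)
    qed
  qed
  then show ?thesis by (auto simp: fun_eq_iff)
qed

lemma \<Psi>_inj: "inj_on \<Psi> (K_carrier n)"
  using h.simple_inj[OF Kmod_simple[OF c], of "delta (0, 0)"] delta_K_carrier[of 0 n 0] v_nz
  by (simp add: u_00)

lemma u_finsupp [simp]: "finsupp (u x)"
  using u_closed[of x] by simp

lemma \<Psi>_eval: "finsupp a \<Longrightarrow> \<Psi> a x = (\<Sum>i\<in>{i. a i \<noteq> 0}. a i * u i x)"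
  unfolding \<Psi>_def by (rule Tmod_lc) simp_all

lemma u_weight:
  assumes "i \<le> n + k" "u (k, i) x \<noteq> 0" shows "wt x = int (n + k) - 2 * int i"
proof -
  have "T_h (of_int L) (u (k, i)) = (\<lambda>x. (of_nat (n + k) - 2 * of_nat i) * u (k, i) x)"
    using weight_f[OF lie_module_axioms vk_closed h_vk, of i k] by (simp add: u_def)
  then have "T_h (of_int L) (u (k, i)) x = (of_nat (n + k) - 2 * of_nat i) * u (k, i) x" by (rule fun_cong)
  moreover have "T_h (of_int L) (u (k, i)) x = of_int (wt x) * u (k, i) x"
    by (cases x) (simp add: T_h_def algebra_simps)
  ultimately have "of_int (wt x) = (of_nat (n + k) - 2 * of_nat i :: complex)" using assms(2) by simp
  then have "of_int (wt x) = (of_int (int (n + k) - 2 * int i) :: complex)" by simp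
  then show ?thesis by (simp only: of_int_eq_iff)
qed

text \<open>By weights, p^k v vanishes at every site other than \<open>s k\<close>, and there it is
  nonzero, as otherwise \<open>kernel_sites\<close> would make it zero. So the values of x at the
  sites are matched by a unique combination of these vectors.\<close>

lemma kernel_image:
  assumes x: "finsupp x" "T_e (of_int L) c x = (\<lambda>x. 0)"
  shows "x \<in> \<Psi> ` K_carrier n"
proof -
  have uk: "u (k, 0) (s j) = 0" if "j \<noteq> k" for j k
    using u_weight[of 0 k "s j"] s_weight[of j] that by fastforce
  have nz: "u (k, 0) (s k) \<noteq> 0" for k
  proof
    assume z: "u (k, 0) (s k) = 0"
    have s0: "u (k, 0) (s j) = 0" for j using z uk by (cases "j = k") auto
    have "T_e (of_int L) c (u (k, 0)) = (\<lambda>x. 0)" using e_vk[of k] by (simp add: u_def)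
    then have "u (k, 0) = (\<lambda>x. 0)" by (rule kernel_sites[OF u_finsupp _ s0])
    then have "\<Psi> (delta (k, 0)) = \<Psi> (\<lambda>x. 0)" using h.hom_zero by simp
    then have "delta (k, 0 :: nat) = (\<lambda>x. 0)"
      using inj_onD[OF \<Psi>_inj, of "delta (k, 0)" "\<lambda>x. 0"] delta_K_carrier[of 0 n k] K.zero_closed by auto
    then show False by (rule notE[OF delta_nonzero])
  qed
  have inj_s: "inj s" using s_weight by (intro injI) (metis add_left_cancel of_nat_eq_iff)
  \<comment> \<open>The coefficient of p^k v is the ratio of the two values at the site
    \<open>s k\<close>.\<close>
  define a where "a = (\<lambda>(k, i). if i = (0 :: nat) then x (s k) / u (k, 0) (s k) else 0)"
  have "finite (s -` {y. x y \<noteq> 0})" using x(1) inj_s by (intro finite_vimageI) (auto simp: finsupp_def)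
  then have fin: "finite {k. x (s k) \<noteq> 0}" by (simp add: vimage_def)
  have supp: "{i. a i \<noteq> 0} = (\<lambda>k. (k, 0)) ` {k. x (s k) \<noteq> 0}"
    using nz by (auto simp: a_def split: if_splits)
  have fa: "finsupp a" unfolding finsupp_def supp using fin by simp
  have aK: "a \<in> K_carrier n" using fa by (auto simp: K_carrier_def a_def)
  have "K_e n a = (\<lambda>x. 0)" by (auto simp: K_e_def a_def)
  then have ea: "T_e (of_int L) c (\<Psi> a) = (\<lambda>x. 0)"
    using h.hom_act[of \<ee> a] aK h.hom_zero by simp
  have ev: "\<Psi> a (s j) = x (s j)" for j
  proof -
    have "\<Psi> a (s j) = (\<Sum>k\<in>{k. x (s k) \<noteq> 0}. a (k, 0) * u (k, 0) (s j))"
      unfolding \<Psi>_eval[OF fa] supp by (subst sum.reindex) (auto simp: inj_on_def)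
    also have "\<dots> = (\<Sum>k\<in>{k. x (s k) \<noteq> 0}. if k = j then x (s j) else 0)"
      using uk nz by (intro sum.cong) (auto simp: a_def)
    also have "\<dots> = x (s j)" using fin by (simp add: sum.delta)
    finally show ?thesis .
  qed
  have \<Psi>f: "finsupp (\<Psi> a)" using h.hom_closed[of a] aK by simp
  have "(\<lambda>y. x y + (- 1) * \<Psi> a y) = (\<lambda>y. 0)"
  proof (rule kernel_sites)
    show "finsupp (\<lambda>y. x y + (- 1) * \<Psi> a y)" using x(1) \<Psi>f by (intro finsupp_add finsupp_mult)
    show "T_e (of_int L) c (\<lambda>y. x y + (- 1) * \<Psi> a y) = (\<lambda>y. 0)"
      unfolding lin_opD[OF T_lin(1)] x(2) ea by simp
  qed (simp add: ev)
  then have "x = \<Psi> a" by (simp add: fun_eq_iff)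
  then show ?thesis using aK by blast
qed

text \<open>Modulo the image, e y consists of lowest weight vectors of the model, as e reaches
  everything else there. These have weight at most 0 and are killed by f, so e y comes from the part
  of y of negative weight. On that part e f^(r+1) = (r + 1) f^r (h - r) with h - r invertible, which
  contradicts the nilpotency of f unless the part is zero.\<close>

lemma image_descend:
  assumes y: "finsupp y" and e: "T_e (of_int L) c y \<in> \<Psi> ` K_carrier n"
  shows "y \<in> \<Psi> ` K_carrier n"
proof -
  have sub: "submodule (\<Psi> ` carrier (Kmod n c)) complex_field (Tmod (of_int L) c)"
    by (rule h.image_submodule[OF K.carrier_is_submodule])
  note d = submoduleD[OF sub]
  obtain a where a: "a \<in> K_carrier n" "T_e (of_int L) c y = \<Psi> a" using e by blast
  \<comment> \<open>A preimage under e as far as one exists: e sends f^i p^k v to i (n + k + 1 - i)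
    f^(i-1) p^k v, so every coordinate except i = n + k is reached.\<close>
  define b where "b = (\<lambda>(k, i). if i \<noteq> 0 \<and> i \<le> n + k then a (k, i - 1) / (of_nat i * of_nat (n + k + 1 - i)) else 0)"
  have "finsupp b"
  proof (rule finsupp_images[of a "{\<lambda>(k, i). (k, i + 1)}"])
    show "\<exists>g\<in>{\<lambda>(k, i). (k, i + 1)}. \<exists>y. a y \<noteq> 0 \<and> x = g y" if "b x \<noteq> 0" for x
    proof -
      obtain k i where x: "x = (k, i)" by (cases x)
      then have "i \<noteq> 0" "a (k, i - 1) \<noteq> 0" using that by (auto simp: b_def split: if_splits)
      then show ?thesis by (intro bexI[of _ "\<lambda>(k, i). (k, i + 1)"] exI[of _ "(k, i - 1)"]) (auto simp: x)
    qed
  qed (use a in \<open>auto simp: K_carrier_def\<close>)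
  then have bK: "b \<in> K_carrier n" by (auto simp: K_carrier_def b_def)
  define a' where "a' = (\<lambda>x. a x + (- 1) * K_e n b x)"
  have eb: "K_e n b (k, i) = (if i < n + k then a (k, i) else 0)" for k i
  proof (cases "i < n + k")
    case True
    have "of_nat (i + 1) * (of_nat n + of_nat k - of_nat i) = (of_nat (i + 1) * of_nat (n + k + 1 - (i + 1)) :: complex)"
      using True by (simp add: of_nat_diff)
    moreover have "of_nat (i + 1) * of_nat (n + k + 1 - (i + 1)) \<noteq> (0 :: complex)"
      using True by (simp del: of_nat_add of_nat_Suc of_nat_diff)
    ultimately show ?thesis using True by (simp only: K_e_def prod.case b_def) simp
  next
    case False
    then show ?thesis by (auto simp: K_e_def b_def)
  qed
  have a': "a' (k, i) = (if i = n + k then a (k, i) else 0)" for k i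
    using a(1) by (auto simp: a'_def eb K_carrier_def)
  have ebK: "K_e n b \<in> K_carrier n" using K.act_closed'[of b \<ee>] bK by simp
  have fa': "finsupp a'"
    unfolding a'_def using a(1) ebK by (intro finsupp_add finsupp_mult) (auto simp: K_carrier_def)
  then have a'K: "a' \<in> K_carrier n" using a' by (auto simp: K_carrier_def)
  have \<Psi>b: "finsupp (\<Psi> b)" "\<Psi> b \<in> \<Psi> ` K_carrier n" using h.hom_closed[of b] bK by auto
  define y' where "y' = (\<lambda>x. y x + (- 1) * \<Psi> b x)"
  have y'f: "finsupp y'" unfolding y'_def using y \<Psi>b by (intro finsupp_add finsupp_mult)
  have ey': "T_e (of_int L) c y' = \<Psi> a'"
  proof -
    have "T_e (of_int L) c y' = (\<lambda>x. \<Psi> a x + (- 1) * \<Psi> (K_e n b) x)"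
      unfolding y'_def lin_opD[OF T_lin(1)] a(2) using h.hom_act[of \<ee> b] bK by simp
    also have "\<dots> = \<Psi> (\<lambda>x. a x + (- 1) * K_e n b x)"
      using h.hom_add[of a "\<lambda>x. (- 1) * K_e n b x"] h.hom_smult[of "K_e n b" "- 1"] a(1) ebK K.smult_closed_c[of "K_e n b" "- 1"]
      by simp
    finally show ?thesis by (simp add: a'_def)
  qed
  have neg: "wt x \<le> 0" if "\<Psi> a' x \<noteq> 0" for x
  proof -
    have "\<exists>p. a' p \<noteq> 0 \<and> u p x \<noteq> 0"
      using that unfolding \<Psi>_eval[OF fa'] by (metis (mono_tags, lifting) mult_zero_right mem_Collect_eq sum.neutral)
    then obtain k i where "a' (k, i) \<noteq> 0" "u (k, i) x \<noteq> 0" by auto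
    then show ?thesis using u_weight[of i k x] a' by (auto split: if_splits)
  qed
  \<comment> \<open>Since e raises weights by 2 and e y' has weights at most 0, discarding the
    nonnegative weights of y' does not change its image under e.\<close>
  define y2 where "y2 = (\<lambda>x. if wt x \<le> - 1 then y' x else 0)"
  have y2f: "finsupp y2"
    using y'f unfolding finsupp_def by (rule finite_subset[rotated]) (auto simp: y2_def)
  have ey2: "T_e (of_int L) c y2 = T_e (of_int L) c y'"
  proof
    fix x :: "nat \<times> nat"
    obtain k b where x: "x = (k, b)" by (cases x)
    show "T_e (of_int L) c y2 x = T_e (of_int L) c y' x"
    proof (cases "wt x \<le> 1")
      case True
      then have "k \<noteq> 0 \<Longrightarrow> y2 (k - 1, b) = y' (k - 1, b)" "y2 (k, b + 2) = y' (k, b + 2)"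
        by (auto simp: y2_def x)
      then show ?thesis by (simp add: x T_e_def)
    next
      case False
      then have "k \<noteq> 0 \<Longrightarrow> y2 (k - 1, b) = 0" "y2 (k, b + 2) = 0" by (auto simp: y2_def x)
      then have "T_e (of_int L) c y2 x = 0" by (simp add: x T_e_def)
      moreover have "T_e (of_int L) c y' x = 0" using neg[of x] False unfolding ey' by linarith
      ultimately show ?thesis by simp
    qed
  qed
  have "K_f n a' = (\<lambda>x. 0)" by (auto simp: K_f_def a' fun_eq_iff)
  then have fe: "T_f (T_e (of_int L) c y2) = (\<lambda>x. 0)"
    unfolding ey2 ey' using h.hom_act[of \<ff> a'] a'K h.hom_zero by simp
  have y2_0: "y2 = (\<lambda>x. 0)"
  proof (rule ccontr)
    assume ne: "y2 \<noteq> (\<lambda>x. 0)"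
    obtain j where j: "(T_f ^^ j) y2 = (\<lambda>x. 0)" by (rule T_f_nilpotent[OF y2f])
    define m where "m = (LEAST j. (T_f ^^ j) y2 = (\<lambda>x. 0))"
    have m: "(T_f ^^ m) y2 = (\<lambda>x. 0)" unfolding m_def using j by (rule LeastI)
    then obtain r where r: "m = Suc r" using ne by (cases m) auto
    have nz: "(T_f ^^ r) y2 \<noteq> (\<lambda>x. 0)" using not_less_Least[of r "\<lambda>j. (T_f ^^ j) y2 = (\<lambda>x. 0)"] r m_def by simp
    have "y2 (k + r, b) = 0" for k b
    proof (rule ccontr)
      assume z: "y2 (k + r, b) \<noteq> 0"
      then have w: "wt (k + r, b) \<le> - 1" by (simp add: y2_def split: if_splits)
      have "T_e (of_int L) c ((T_f ^^ Suc r) y2) (k, b) = 0"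
        using m r lin_opD(2)[OF T_lin(1)[of "of_int L" c], of 0 "\<lambda>x. 0"] by (simp del: funpow.simps)
      then have "of_nat (Suc r) * (of_int L + 2 * of_nat (k + r) + 2 - of_nat b - of_nat r) * y2 (k + r, b) = 0"
        unfolding T_e_T_f_pow[OF fe] .
      moreover have "of_int L + 2 * of_nat (k + r) + 2 - of_nat b - of_nat r = (of_int (wt (k + r, b) - int r) :: complex)"
        by simp
      moreover have "(of_int (wt (k + r, b) - int r) :: complex) \<noteq> 0"
        using w by (simp only: of_int_eq_0_iff)
      moreover have "of_nat (Suc r) \<noteq> (0 :: complex)" by (simp only: of_nat_eq_0_iff)
      ultimately show False using z by (metis mult_eq_0_iff)
    qed
    then show False using nz by (auto simp: T_f_pow fun_eq_iff)
  qed
  have "T_e (of_int L) c y' = (\<lambda>x. 0)"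
    using ey2 y2_0 lin_opD(2)[OF T_lin(1)[of "of_int L" c], of 0 "\<lambda>x. 0"] by simp
  then have "y' \<in> \<Psi> ` K_carrier n" using kernel_image y'f by blast
  then have "y' \<oplus>\<^bsub>Tmod (of_int L) c\<^esub> \<Psi> b \<in> \<Psi> ` K_carrier n" using d(3) \<Psi>b(2) by simp
  also have "y' \<oplus>\<^bsub>Tmod (of_int L) c\<^esub> \<Psi> b = y" by (simp add: y'_def)
  finally show ?thesis .
qed

text \<open>In the model e lowers the second index and is locally nilpotent. The other inclusion is
  an induction on the power of e that kills a vector, each step being
  \<open>image_descend\<close>.\<close>

lemma image_e_finite: "\<Psi> ` K_carrier n = e_finite (Tmod (of_int L) c)"
proof
  have nil: "(K_e n ^^ N) a = (\<lambda>x. 0)" if "\<And>k i. N \<le> i \<Longrightarrow> a (k, i) = 0" for N a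
    using that
  proof (induction N arbitrary: a)
    case 0
    then show ?case by (auto simp: fun_eq_iff)
  next
    case (Suc N)
    have "(K_e n ^^ N) (K_e n a) = (\<lambda>x. 0)"
      by (rule Suc.IH) (use Suc.prems in \<open>simp add: K_e_def\<close>)
    then show ?case by (simp add: funpow_swap1)
  qed
  show "\<Psi> ` K_carrier n \<subseteq> e_finite (Tmod (of_int L) c)"
  proof
    fix x assume "x \<in> \<Psi> ` K_carrier n"
    then obtain a where a: "a \<in> K_carrier n" "x = \<Psi> a" by blast
    have "finite (snd ` {x. a x \<noteq> 0})" using a(1) by (simp add: K_carrier_def finsupp_def)
    then obtain N where "\<forall>j\<in>snd ` {x. a x \<noteq> 0}. j < N" using finite_nat_set_iff_bounded by blast
    then have "(K_e n ^^ N) a = (\<lambda>x. 0)" by (intro nil) (force simp: not_less[symmetric])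
    then have "(T_e (of_int L) c ^^ N) x = (\<lambda>x. 0)"
      using h.hom_pow[of \<ee> a N] a h.hom_zero by simp
    moreover have "finsupp x" using h.hom_closed[of a] a by simp
    ultimately show "x \<in> e_finite (Tmod (of_int L) c)" unfolding e_finite_Tmod by blast
  qed
  show "e_finite (Tmod (of_int L) c) \<subseteq> \<Psi> ` K_carrier n"
  proof
    fix x assume "x \<in> e_finite (Tmod (of_int L) c)"
    then obtain k where "finsupp x" "(T_e (of_int L) c ^^ k) x = (\<lambda>x. 0)" unfolding e_finite_Tmod by blast
    then show "x \<in> \<Psi> ` K_carrier n"
    proof (induction k arbitrary: x)
      case 0
      then have "x = \<Psi> (\<lambda>x. 0)" using h.hom_zero by simp
      then show ?case using K.zero_closed by simp
    next
      case (Suc k)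
      have "finsupp (T_e (of_int L) c x)" using T_finsupp[OF Suc.prems(1), of "T_e (of_int L) c"] by blast
      then have "T_e (of_int L) c x \<in> \<Psi> ` K_carrier n"
        using Suc.prems(2) by (intro Suc.IH) (simp_all add: funpow_swap1)
      then show ?case using image_descend Suc.prems(1) by blast
    qed
  qed
qed

lemma EA_iso: "lie_module (EA (verma (of_int L) c))" "iso_mod UNIV (Kmod n c) (EA (verma (of_int L) c))"
proof -
  interpret vd: verma_data "of_int L" c .
  interpret T2: lie_module vd.T2 by (rule vd.lie_module_T2)
  interpret \<Phi>: mod_hom_loc vd.T2 "Tmod (of_int L) c" UNIV vd.\<Phi>
    using vd.T2_iso(2) by (simp add: mod_hom_loc_def mod_hom_loc_axioms_def T2.amodule_any amodule_any)
  define \<psi> where "\<psi> = inv_into (carrier vd.T2) vd.\<Phi>"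
  have \<psi>b: "bij_betw \<psi> (carrier (Tmod (of_int L) c)) (carrier vd.T2)" and \<psi>h: "mod_hom UNIV (Tmod (of_int L) c) vd.T2 \<psi>"
    using \<Phi>.inv_hom[OF vd.T2_iso(1)] by (simp_all add: \<psi>_def)
  interpret \<psi>: mod_hom_loc "Tmod (of_int L) c" vd.T2 UNIV \<psi>
    using \<psi>h by (simp add: mod_hom_loc_def mod_hom_loc_axioms_def T2.amodule_any amodule_any)
  have EA: "EA (verma (of_int L) c) = restr vd.T2 (e_finite vd.T2)"
    by (simp add: EA_e_finite vd.T2_def vd.D2.T_def)
  have ef: "e_finite vd.T2 = \<psi> ` \<Psi> ` K_carrier n"
    using e_finite_transport[OF lie_module_axioms vd.lie_module_T2 \<psi>b \<psi>h] by (simp add: image_e_finite)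
  have "submod UNIV (\<Psi> ` carrier (Kmod n c)) (Tmod (of_int L) c)"
    by (rule h.image_submod[OF K.submod_carrier])
  then have "submod UNIV (\<psi> ` \<Psi> ` K_carrier n) vd.T2" using \<psi>.image_submod by simp
  then show "lie_module (EA (verma (of_int L) c))"
    unfolding EA ef by (rule T2.lie_module_restr)
  have img: "\<Psi> ` K_carrier n \<subseteq> carrier (Tmod (of_int L) c)" using h.hom_closed by auto
  have "inj_on (\<psi> \<circ> \<Psi>) (K_carrier n)"
    using \<Psi>_inj \<psi>b img by (intro comp_inj_on) (auto simp: bij_betw_def intro: inj_on_subset)
  then have bij: "bij_betw (\<psi> \<circ> \<Psi>) (carrier (Kmod n c)) (carrier (restr vd.T2 (e_finite vd.T2)))"
    by (simp add: bij_betw_def ef image_comp)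
  have "mod_hom UNIV (Kmod n c) (restr vd.T2 (e_finite vd.T2)) (\<psi> \<circ> \<Psi>)"
    unfolding mod_hom_def
  proof (intro conjI ballI allI)
    show "\<psi> \<circ> \<Psi> \<in> carrier (Kmod n c) \<rightarrow> carrier (restr vd.T2 (e_finite vd.T2))"
      by (auto simp: ef)
  qed (use h.hom_closed h.hom_add h.hom_smult h.hom_act \<psi>.hom_add \<psi>.hom_smult \<psi>.hom_act in auto)
  then show "iso_mod UNIV (Kmod n c) (EA (verma (of_int L) c))"
    unfolding EA iso_mod_hom using bij by blast
qed

end

section \<open>The highest weight vectors for the two Verma parameters\<close>

lemma Tmod_hw_moduleI:
  assumes v: "finsupp v" "T_e l c v = (\<lambda>x. 0)" "T_h l v = (\<lambda>x. of_nat n * v x)"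
    and q: "(\<lambda>x. (of_nat n + 1) * T_q v x) = T_f (T_p c v)"
  shows "hw_module (Tmod l c) v n c"
proof -
  interpret lie_module "Tmod l c" by (rule lie_module_Tmod)
  show ?thesis
  proof unfold_locales
    fix k
    let ?x = "(act (Tmod l c) \<pp> ^^ k) v"
    have xc: "?x \<in> carrier (Tmod l c)" using act_pow_closed[of v k \<pp>] v(1) by simp
    have xh: "act (Tmod l c) \<hh> ?x = (of_nat n + of_nat k) \<odot>\<^bsub>Tmod l c\<^esub> ?x"
      by (rule weight_p[OF lie_module_axioms]) (use v in simp_all)
    have xe: "act (Tmod l c) \<ee> ?x = \<zero>\<^bsub>Tmod l c\<^esub>"
      using act_pow_commute[of \<ee> \<pp> v k] act_pow_zero[of k \<pp>] v by (simp add: schr_relations)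
    show "(act (Tmod l c) \<ff> ^^ Suc (n + k)) ?x = \<zero>\<^bsub>Tmod l c\<^esub>"
    proof (cases "?x = \<zero>\<^bsub>Tmod l c\<^esub>")
      case False
      \<comment> \<open>On S_f tensored with the Verma module f lowers the pole order, hence is
        locally nilpotent; this is what yields the vanishing of f^(n+k+1) p^k v.\<close>
      obtain j where "(T_f ^^ j) ?x = (\<lambda>x. 0)" using T_f_nilpotent xc by (metis Tmod_simps(1) mem_Collect_eq)
      then have "(act (Tmod l c) \<ff> ^^ j) ?x = \<zero>\<^bsub>Tmod l c\<^esub>" by simp
      then obtain m where m: "of_nat n + of_nat k = (of_nat m :: complex)" "(act (Tmod l c) \<ff> ^^ Suc m) ?x = \<zero>\<^bsub>Tmod l c\<^esub>"
        using highest_weight_nat[OF lie_module_axioms xc xh xe _ False] by blast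
      then have "of_nat (n + k) = (of_nat m :: complex)" by simp
      then have "n + k = m" by (simp only: of_nat_eq_iff)
      then show ?thesis using m(2) by simp
    qed (simp only: act_pow_zero)
  qed (use v q in auto)
qed

text \<open>For l = n - 1 the vectors f^(-k-1) q^(2k+1) v all have weight n. The recursion is the
  condition that e kills their combination; the factor n - k stops it after k = n.\<close>

fun v_coeff :: "nat \<Rightarrow> complex \<Rightarrow> nat \<Rightarrow> complex" where
  "v_coeff n c 0 = 1"
| "v_coeff n c (Suc k) = (of_nat n - of_nat k) / (c * of_nat (2 * k + 3)) * v_coeff n c k"

lemma v_coeff_0: "n < k \<Longrightarrow> v_coeff n c k = 0"
proof (induction k)
  case (Suc k)
  then show ?case by (cases "n = k") auto
qed simp

text \<open>With L = n - 1 one has L + k + 2 - \<epsilon> = n + 1 + k - \<epsilon> >= 0 for both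
  values of \<epsilon>, so all coordinates with second index 0 or 1 are sites, (k, 1) of weight n +
  2k and (k, 0) of weight n + 2k + 1.\<close>

lemma Tmod_hw_nonneg:
  assumes "c \<noteq> 0"
  shows "Tmod_hw (int n - 1) c (\<lambda>(k, b). if b = 2 * k + 1 then v_coeff n c k else 0) n
    (\<lambda>j. if even j then (j div 2, 1) else (j div 2, 0))"
proof -
  let ?v = "\<lambda>(k, b). if b = 2 * k + 1 then v_coeff n c k else 0"
  let ?l = "of_int (int n - 1) :: complex"
  have rec: "c * of_nat (2 * k + 3) * v_coeff n c (Suc k) = (of_nat n - of_nat k) * v_coeff n c k" for k
  proof -
    have "of_nat (2 * k + 3) \<noteq> (0 :: complex)" by (simp only: of_nat_eq_0_iff)
    then show ?thesis using assms by (simp del: of_nat_add of_nat_mult)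
  qed
  have fin: "finsupp ?v"
  proof -
    have "{x. ?v x \<noteq> 0} \<subseteq> (\<lambda>k. (k, 2 * k + 1)) ` {..n}"
      using v_coeff_0[of n _ c] by (auto simp: image_iff not_less[symmetric] split: if_splits)
    then show ?thesis unfolding finsupp_def by (rule finite_subset) simp
  qed
  have e: "T_e ?l c ?v = (\<lambda>x. 0)"
  proof
    fix x :: "nat \<times> nat"
    obtain k b where x: "x = (k, b)" by (cases x)
    show "T_e ?l c ?v x = 0"
    proof (cases "b + 1 = 2 * k")
      case False
      then show ?thesis by (cases k) (auto simp: x T_e_def)
    next
      case True
      then obtain r where r: "k = Suc r" "b = 2 * r + 1" by (cases k) auto
      have "T_e ?l c ?v x = - of_nat (Suc r) * (of_nat n - of_nat r) * v_coeff n c r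
          + of_nat (Suc r) * (c * of_nat (2 * r + 3) * v_coeff n c (Suc r))"
        by (simp add: x r T_e_def algebra_simps del: v_coeff.simps)
      also have "\<dots> = 0"
        unfolding rec by (simp only: mult_minus_left mult.assoc add.left_inverse)
      finally show ?thesis .
    qed
  qed
  have h: "T_h ?l ?v = (\<lambda>x. of_nat n * ?v x)" by (auto simp: T_h_def fun_eq_iff)
  have q: "(\<lambda>x. (of_nat n + 1) * T_q ?v x) = T_f (T_p c ?v)"
  proof
    fix x :: "nat \<times> nat"
    obtain k b where x: "x = (k, b)" by (cases x)
    show "(of_nat n + 1) * T_q ?v x = T_f (T_p c ?v) x"
    proof (cases "b = 2 * k + 2")
      case False
      then show ?thesis by (cases b) (auto simp: x T_q_def T_f_def T_p_def)
    next
      case True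
      have "T_f (T_p c ?v) x = c * of_nat (2 * k + 3) * v_coeff n c (Suc k) + of_nat (Suc k) * v_coeff n c k"
        using True by (simp add: x T_f_def T_p_def algebra_simps del: v_coeff.simps)
      also have "\<dots> = (of_nat n + 1) * v_coeff n c k" unfolding rec by (simp add: algebra_simps)
      finally show ?thesis using True by (simp add: x T_q_def)
    qed
  qed
  interpret hw_module "Tmod ?l c" ?v n c by (rule Tmod_hw_moduleI[OF fin e h q])
  show ?thesis
  proof
    show "?v \<noteq> (\<lambda>x. 0)" by (auto dest!: fun_cong[of _ _ "(0, 1)"])
    show "int n - 1 + 2 + 2 * int (fst (if even j then (j div 2, 1) else (j div 2, 0)))
        - int (snd (if even j then (j div 2, 1 :: nat) else (j div 2, 0))) = int n + int j" for j
      by (cases "even j") (auto elim!: evenE oddE)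
    show "\<exists>j. (if even j then (j div 2, 1) else (j div 2, 0)) = (k, \<epsilon>)" if "\<epsilon> \<le> 1" for k \<epsilon> :: nat
      using that by (intro exI[of _ "if \<epsilon> = 1 then 2 * k else 2 * k + 1"]) auto
  qed (rule assms)
qed

text \<open>For l = - n - 2 the single vector f^(-n-1) v already has weight n and is killed by e.
  The condition L + k + 2 - \<epsilon> >= 0 becomes k >= n + \<epsilon>, so the sites begin at (n,
  0) and (n + 1, 1).\<close>

lemma Tmod_hw_nonpos:
  assumes "c \<noteq> 0"
  shows "Tmod_hw (- int n - 2) c (delta (n, 0)) n
    (\<lambda>j. if even j then (n + j div 2, 0) else (n + j div 2 + 1, 1))"
proof -
  let ?l = "of_int (- int n - 2) :: complex"
  have e: "T_e ?l c (delta (n, 0)) = (\<lambda>x. 0)"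
  proof
    fix x :: "nat \<times> nat"
    obtain k b where x: "x = (k, b)" by (cases x)
    show "T_e ?l c (delta (n, 0)) x = 0" by (cases k) (auto simp: x T_e_def delta_apply)
  qed
  have h: "T_h ?l (delta (n, 0)) = (\<lambda>x. of_nat n * delta (n, 0) x)"
    by (auto simp: T_h_def delta_apply fun_eq_iff)
  have q: "(\<lambda>x. (of_nat n + 1) * T_q (delta (n, 0)) x) = T_f (T_p c (delta (n, 0)))"
    by (auto simp: T_q_def T_f_def T_p_def delta_apply fun_eq_iff)
  interpret hw_module "Tmod ?l c" "delta (n, 0)" n c by (rule Tmod_hw_moduleI[OF finsupp_delta e h q])
  show ?thesis
  proof
    show "delta (n, 0) \<noteq> (\<lambda>x. 0)" by (rule delta_nonzero)
    show "- int n - 2 + 2 + 2 * int (fst (if even j then (n + j div 2, 0) else (n + j div 2 + 1, 1)))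
        - int (snd (if even j then (n + j div 2, 0 :: nat) else (n + j div 2 + 1, 1))) = int n + int j" for j
      by (cases "even j") (auto elim!: evenE oddE)
    show "\<exists>j. (if even j then (n + j div 2, 0) else (n + j div 2 + 1, 1)) = (k, \<epsilon>)"
      if "\<epsilon> \<le> 1" "0 \<le> - int n - 2 + int k + 2 - int \<epsilon>" for k \<epsilon> :: nat
    proof (cases "\<epsilon> = 0")
      case True
      then show ?thesis using that by (intro exI[of _ "2 * (k - n)"]) auto
    next
      case False
      then have "\<epsilon> = 1" "n + 1 \<le> k" using that by auto
      then show ?thesis by (intro exI[of _ "2 * (k - n - 1) + 1"]) auto
    qed
  qed (rule assms)
qed

section \<open>Both families as copies of the model, and the classification\<close>

lemma V_nonneg_iso:
  assumes "c \<noteq> 0"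
  shows "lie_module (V_nonneg (int n) c)" "iso_mod UNIV (Kmod n c) (V_nonneg (int n) c)"
proof -
  interpret Tmod_hw "int n - 1" c "\<lambda>(k, b). if b = 2 * k + 1 then v_coeff n c k else 0" n
    "\<lambda>j. if even j then (j div 2, 1) else (j div 2, 0)" by (rule Tmod_hw_nonneg[OF assms])
  show "lie_module (V_nonneg (int n) c)" "iso_mod UNIV (Kmod n c) (V_nonneg (int n) c)"
    using EA_iso by (simp_all add: V_nonneg_def)
qed

lemma V_nonpos_iso:
  assumes "c \<noteq> 0"
  shows "lie_module (V_nonpos (- int n) c)" "iso_mod UNIV (Kmod n c) (V_nonpos (- int n) c)"
proof -
  interpret Tmod_hw "- int n - 2" c "delta (n, 0)" n
    "\<lambda>j. if even j then (n + j div 2, 0) else (n + j div 2 + 1, 1)" by (rule Tmod_hw_nonpos[OF assms])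
  show "lie_module (V_nonpos (- int n) c)" "iso_mod UNIV (Kmod n c) (V_nonpos (- int n) c)"
    using EA_iso by (simp_all add: V_nonpos_def)
qed

lemma iso_mod_UNIV_sym:
  "lie_module M \<Longrightarrow> lie_module N \<Longrightarrow> iso_mod UNIV M N \<Longrightarrow> iso_mod UNIV N M"
  by (rule iso_mod_sym[OF lie_module.amodule_any lie_module.amodule_any])

lemma simple_hc_V_nonneg:
  assumes "c \<noteq> 0" shows "simple_hc_module (V_nonneg (int n) c)"
proof -
  note V = V_nonneg_iso[OF assms, of n]
  obtain \<phi> where \<phi>: "bij_betw \<phi> (carrier (Kmod n c)) (carrier (V_nonneg (int n) c))"
    "mod_hom UNIV (Kmod n c) (V_nonneg (int n) c) \<phi>"
    using V(2) by (auto simp only: iso_mod_hom)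
  interpret mod_hom_loc "Kmod n c" "V_nonneg (int n) c" UNIV \<phi>
    using \<phi>(2) lie_module.amodule_any[OF V(1)] lie_module.amodule_any[OF lie_module_Kmod]
    by (simp only: mod_hom_loc_def mod_hom_loc_axioms_def)
  show ?thesis unfolding simple_hc_module_def
    using V(1) simple_transport[OF \<phi>(1) Kmod_simple[OF assms]] harish_chandra_Kmod_iso[OF V(1) \<phi>] by blast
qed

lemma simple_hcI: "simple_hc_module V \<Longrightarrow> simple_hc V"
  by (simp add: simple_hc_module_def simple_hc_def simple_hc_axioms_def)

theorem theorem53:
  shows "(\<forall>(V :: (schr, 'v) rep) n c.
            simple_hc_module V \<and> central_charge V c \<and> minimal_type V n \<longrightarrow>
              (c \<noteq> 0 \<longrightarrow> iso_mod UNIV V (V_nonneg (int n) c) \<and>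
                           iso_mod UNIV (V_nonneg (int n) c) (V_nonpos (- int n) c)) \<and>
              (c = 0 \<longrightarrow> iso_mod UNIV V (Lmod n)))
       \<and> (\<forall>n c. c \<noteq> 0 \<longrightarrow> simple_hc_module (V_nonneg (int n) c))
       \<and> (\<forall>n. simple_hc_module (Lmod n))
       \<and> (\<forall>(V :: (schr, 'v) rep). simple_hc_module V \<longrightarrow>
            (\<exists>n c. c \<noteq> 0 \<and> iso_mod UNIV V (V_nonneg (int n) c)) \<or>
            (\<exists>n. iso_mod UNIV V (Lmod n)))
       \<and> (\<forall>n c n' c'. c \<noteq> 0 \<and> c' \<noteq> 0 \<and>
            iso_mod UNIV (V_nonneg (int n) c) (V_nonneg (int n') c') \<longrightarrow> n = n' \<and> c = c')
       \<and> (\<forall>n n'. iso_mod UNIV (Lmod n) (Lmod n') \<longrightarrow> n = n')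
       \<and> (\<forall>n c n'. c \<noteq> 0 \<longrightarrow> \<not> iso_mod UNIV (V_nonneg (int n) c) (Lmod n'))"
proof -
  have charged: "iso_mod UNIV V (V_nonneg (int n) c)"
    if "simple_hc_module V" "central_charge V c" "minimal_type V n" "c \<noteq> 0" for V :: "(schr, 'v) rep" and n c
  proof -
    interpret simple_hc V by (rule simple_hcI[OF that(1)])
    have "iso_mod UNIV V (Kmod n c)"
      by (rule iso_mod_UNIV_sym[OF lie_module_Kmod lie_module_axioms iso_Kmod[OF that(3,2,4)]])
    then show ?thesis by (rule iso_mod_trans[OF _ V_nonneg_iso(2)[OF that(4)]])
  qed
  have uncharged: "iso_mod UNIV V (Lmod n)"
    if "simple_hc_module V" "central_charge V 0" "minimal_type V n" for V :: "(schr, 'v) rep" and n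
  proof -
    interpret simple_hc V by (rule simple_hcI[OF that(1)])
    show ?thesis by (rule iso_mod_UNIV_sym[OF lie_module_Lmod lie_module_axioms iso_Lmod[OF that(3,2)]])
  qed
  have K: "iso_mod UNIV (V_nonneg (int n) c) (Kmod n c)" if "c \<noteq> 0" for n c
    by (rule iso_mod_UNIV_sym[OF lie_module_Kmod V_nonneg_iso[OF that]])
  have signs: "iso_mod UNIV (V_nonneg (int n) c) (V_nonpos (- int n) c)" if "c \<noteq> 0" for n c
    by (rule iso_mod_trans[OF K[OF that] V_nonpos_iso(2)[OF that]])
  have complete: "(\<exists>n c. c \<noteq> 0 \<and> iso_mod UNIV V (V_nonneg (int n) c)) \<or> (\<exists>n. iso_mod UNIV V (Lmod n))"
    if V: "simple_hc_module V" for V :: "(schr, 'v) rep"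
  proof -
    interpret simple_hc V by (rule simple_hcI[OF V])
    obtain n where n: "minimal_type V n" using minimal_type_exists by blast
    obtain c where c: "central_charge V c" using central_charge_exists by blast
    show ?thesis using charged[OF V c n] uncharged[OF V _ n] c by (cases "c = 0") auto
  qed
  have distinct: "n = n' \<and> c = c'"
    if "c \<noteq> 0" "c' \<noteq> 0" "iso_mod UNIV (V_nonneg (int n) c) (V_nonneg (int n') c')" for n n' c c'
    by (rule Kmod_iso_eq[OF iso_mod_trans[OF V_nonneg_iso(2)[OF that(1)] iso_mod_trans[OF that(3) K[OF that(2)]]]])
  have Ldistinct: "n = n'" if "iso_mod UNIV (Lmod n) (Lmod n')" for n n'
    using that Lmod_iso_eq by (auto simp only: iso_mod_hom intro: mod_hom_subset[OF _ subset_UNIV])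
  have mixed: "\<not> iso_mod UNIV (V_nonneg (int n) c) (Lmod n')" if "c \<noteq> 0" for n c n'
    using Kmod_not_iso_Lmod[OF that] iso_mod_trans[OF V_nonneg_iso(2)[OF that]] by blast
  show ?thesis
    using charged uncharged signs simple_hc_V_nonneg simple_hc_Lmod complete distinct Ldistinct mixed
    by blast
qed

end
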